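(* Let $p\in(0,1)$, let $f_\rho,f_\pi$ satisfy the density assumption with exponent $p$ (see context), let $T$ be the Knothe–Rosenblatt transport pushing forward $\rho$ to $\pi$, let $(c_j)_{j\in\mathbb{N}}\in\ell^1(\mathbb{N})$ be a sequence of positive numbers, and equip $U$ with the metric $d(x,y)=\sum_jc_j|x_j-y_j|$. Let $\Phi:U\to Y$, $\Phi(y)=\sum_{j\in\mathbb{N}}y_j\psi_{\pi,j}$. Then there exist $\alpha>0$, $C>0$ and, for every $\varepsilon>0$ and $k\in\mathbb{N}$, polynomials $p_{\varepsilon,k}\in\mathbb{P}_{\Lambda_{\varepsilon,k}}$ (with $\Lambda_{\varepsilon,k}$, $N_\varepsilon$ determined by $\alpha$ as in the context) such that for every $\varepsilon>0$ the associated rational map $\tilde T_\varepsilon=(\tilde T_{\varepsilon,k})_k$ (see context) is a monotone triangular bijection $U\to U$, $N_\varepsilon<\infty$, $$\sum_{k}\|T_k-\tilde T_{\varepsilon,k}\|_{L^\infty(U_k)}\le CN_\varepsilon^{-\frac1p+1},\qquad\sum_{k}\|\partial_kT_k-\partial_k\tilde T_{\varepsilon,k}\|_{L^\infty(U_k)}\le CN_\varepsilon^{-\frac1p+1},$$ and for every $q\in[1,\infty)$ and every $\varepsilon>0$ $$W_q\big((\tilde T_\varepsilon)_\sharp\rho,\pi\big)\le CN_\varepsilon^{-\frac1p+1},$$ and for the pushforward measures on the Banach space $Y$ $$W_q\big((\Phi\circ\tilde T_\varepsilon)_\sharp\rho,\Phi_\sharp\pi\big)\le CN_\varepsilon^{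-\frac1p+1}.$$
   Context: Notation. $\mathbb{N}=\{1,2,\dots\}$, $\mathbb{N}_0=\{0,1,\dots\}$, $U_k=[-1,1]^k$, $U=[-1,1]^{\mathbb{N}}$ with the product topology (which $d$ induces). $\lambda$ is Lebesgue measure on $[-1,1]$, $\mu=\bigotimes_{j\in\mathbb{N}}\frac\lambda2$ on $U$ (and $\mu=\bigotimes_{j=1}^k\frac\lambda2$ on $U_k$). $y_{[k]}=(y_1,\dots,y_k)$. $F_\sharp\nu$ is the pushforward. A map $T=(T_k)_k:U\to U$ is triangular if $T_k$ depends only on $x_1,\dots,x_k$, and monotone if $x_k\mapsto T_k(x_1,\dots,x_k)$ is monotonically increasing for all $k$ and all $x_1,\dots,x_{k-1}$. $W_q(\nu,\eta)=\inf_\gamma(\int d(x,y)^q\,d\gamma(x,y))^{1/q}$, the infimum over couplings $\gamma$ of $\nu$ and $\eta$; on $U$ it is taken with respect to the metric $d$, and for measures on $Y$ with respect to the norm distance of $Y$ (all such measures here are supported on the compact set $\Phi(U)\subseteq Y$). Density assumption with exponent $p\in(0,1)$: there are real Banach spaces $X,Y$ with complexifications $X_{\mathbb{C}},Y_{\mathbb{C}}$ and constants $0<M\le L<\infty$, and for each $( *,Z)\in\{(\rho,X),(\pi,Y)\}$ a sequence $(\psi_{*,j})_{j\in\mathbb{N}}\subseteq Z$, an open set $O_*\subseteq Z_{\mathbb{C}}$ and a (complex) differentiable function $\mathfrak{f}_*:O_*\to\mathbb{C}$ such that: (a) $\sum_j\|\psi_{*,j}\|_Z^p<\infty$; (b)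 $\sum_jy_j\psi_{*,j}\in O_*$ for all $y\in U$; (c) $\mathfrak{f}_*(\sum_jy_j\psi_{*,j})\in\mathbb{R}$ for all $y\in U$; (d) $M\le|\mathfrak{f}_*(\psi)|\le L$ for all $\psi\in O_*$; and $f_*(y)=\mathfrak{f}_*(\sum_jy_j\psi_{*,j})$ is positive on $U$ with $\int_Uf_*\,d\mu=1$. The measures $\rho,\pi$ on $U$ have $\mu$-densities $f_\rho,f_\pi$. Knothe–Rosenblatt transport. For $*\in\{\rho,\pi\}$ set $\hat f_{*,0}=1$, $\hat f_{*,k}(y_{[k]})=\int_Uf_*(y_{[k]},t)\,d\mu(t)$, $f_{*,k}(y_{[k]})=\hat f_{*,k}(y_{[k]})/\hat f_{*,k-1}(y_{[k-1]})$. Let $\rho_1,\pi_1$ be the measures on $U_1$ with $\mu$-densities $\hat f_{\rho,1},\hat f_{\pi,1}$, and $\rho_{k+1}^{y_{[k]}},\pi_{k+1}^{y_{[k]}}$ those with $\mu$-densities $f_{\rho,k+1}(y_{[k]},\cdot),f_{\pi,k+1}(y_{[k]},\cdot)$. $T_1$ is the unique monotonically increasing map $U_1\to U_1$ with $(T_1)_\sharp\rho_1=\pi_1$, and inductively, with $T_{[k]}=(T_j)_{j=1}^k$, $T_{k+1}(y_{[k]},\cdot):U_1\to U_1$ is the unique monotonically increasing map with $(T_{k+1}(y_{[k]},\cdot))_\sharp\rho_{k+1}^{y_{[k]}}=\pi_{k+1}^{T_{[k]}(y_{[k]})}$. $T=(T_k)_{k\in\mathbb{N}}$. Ansatz spaces.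 $b_j=\max\{\|\psi_{\rho,j}\|_X,\|\psi_{\pi,j}\|_Y\}$; given $\alpha>0$, $\varrho_j=1+\alpha/b_j$; for $\nu\in\mathbb{N}_0^k$, $\gamma(\varrho,\nu)=\varrho_k^{-\max\{1,\nu_k\}}\prod_{j=1}^{k-1}\varrho_j^{-\nu_j}$; $\Lambda_{\varepsilon,k}=\{\nu\in\mathbb{N}_0^k:\gamma(\varrho,\nu)\ge\varepsilon\}$, $N_\varepsilon=\sum_k|\Lambda_{\varepsilon,k}|$; $\mathbb{P}_\Lambda=\mathrm{span}\{y^\nu:\nu\in\Lambda\}$, $\mathbb{P}_\emptyset=\{0\}$. Conventions: if $b_j=0$ then $\varrho_j=\infty$, $\infty^{-m}=0$ for $m\ge1$, $\infty^0=1$; if $N_\varepsilon=0$, $CN_\varepsilon^{-1/p+1}$ is read as $+\infty$. The rational map associated with $(p_{\varepsilon,k})_k$ has components $$\tilde T_{\varepsilon,k}(y)=-1+2\,\frac{\int_{-1}^{y_k}(p_{\varepsilon,k}(y_{[k-1]},t)+1)^2\,d\mu(t)}{\int_{-1}^1(p_{\varepsilon,k}(y_{[k-1]},t)+1)^2\,d\mu(t)},\qquad y\in U_k.$$ *)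

theory Defs
  imports "HOL-Probability.Probability"
begin

text \<open>
  Coordinates are numbered from 0: coordinate \<open>j\<close> of the mathematical text is \<open>y (j - 1)\<close> here.
  A function of \<open>y\<^sub>0, \<dots>, y\<^sub>k\<close> only is rendered as a function on \<open>nat \<Rightarrow> real\<close> that looks at no
  other coordinate, so that it can be evaluated both on sequences and on the points of a
  finite-dimensional cube, which are extensional functions.  Component maps \<open>T k\<close> take the
  component index first; the map on \<open>U\<close> with these components is \<open>\<lambda>y k. T k y\<close>.
\<close>

section \<open>The cube and its measures\<close>

definition cube :: "(nat \<Rightarrow> real) set" where
  "cube = {y. \<forall>j. y j \<in> {-1..1}}"

definition mu1 :: "real measure" where
  "mu1 = scale_measure (1 / 2) (restrict_space lborel {-1..1})"

definition mu_fin :: "nat \<Rightarrow> (nat \<Rightarrow> real) measure" where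
  "mu_fin n = (\<Pi>\<^sub>M j\<in>{..<n}. mu1)"

definition mu :: "(nat \<Rightarrow> real) measure" where
  "mu = (\<Pi>\<^sub>M j\<in>UNIV. mu1)"

lemma space_mu1: "space mu1 = {-1..1}"
  by (simp add: mu1_def space_scale_measure space_restrict_space)

lemma space_mu: "space mu = cube"
  by (auto simp: mu_def space_PiM space_mu1 cube_def PiE_UNIV_domain)

section \<open>Complexification and the density assumption\<close>

text \<open>
  The complexification of a real normed space \<open>Z\<close> is \<open>Z \<times> Z\<close> with \<open>(x, y)\<close> standing for
  \<open>x + \<i> y\<close>.  Openness and differentiability only depend on the norm up to equivalence, and by
  \<open>complexification_norm_equiv\<close> every norm of a complexification is equivalent to the product
  norm, so the latter may be used although it is not homogeneous over the complex numbers.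
\<close>

definition cscale :: "complex \<Rightarrow> 'a::real_vector \<times> 'a \<Rightarrow> 'a \<times> 'a" where
  "cscale c z = (Re c *\<^sub>R fst z - Im c *\<^sub>R snd z, Im c *\<^sub>R fst z + Re c *\<^sub>R snd z)"

lemma complexification_norm_equiv:
  fixes N :: "'a::real_normed_vector \<times> 'a \<Rightarrow> real"
  assumes extends: "\<And>x. N (x, 0) = norm x"
    and triangle: "\<And>z w. N (z + w) \<le> N z + N w"
    and homogeneous: "\<And>c z. N (cscale c z) = cmod c * N z"
    and conjugation: "\<And>x y. N (x, - y) = N (x, y)"
  shows "N z \<le> 2 * norm z" and "norm z \<le> 2 * N z"
proof -
  obtain x y where z: "z = (x, y)" by fastforce
  have im: "N (0, v) = norm v" for v
    using homogeneous[of \<i> "(v, 0)"] by (simp add: cscale_def extends)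
  have neg: "N (- u, v) = N (u, v)" for u v
    using homogeneous[of "-1" "(- u, v)"] by (simp add: cscale_def conjugation)
  have "N (x, y) \<le> norm x + norm y"
    using triangle[of "(x, 0)" "(0, y)"] by (simp add: extends im)
  then show "N z \<le> 2 * norm z"
    using norm_fst_le[of x y] norm_snd_le[of y x] by (simp add: z)
  have "norm (x + x) \<le> 2 * N (x, y)"
    using triangle[of "(x, y)" "(x, - y)"] by (simp add: extends conjugation)
  moreover have "norm (y + y) \<le> 2 * N (x, y)"
    using triangle[of "(x, y)" "(- x, y)"] by (simp add: im neg)
  moreover have "norm (v + v) = 2 * norm v" for v :: 'a
    by (simp flip: scaleR_2)
  ultimately show "norm z \<le> 2 * N z"
    using norm_Pair_le[of x y] by (simp add: z)
qed

definition complex_differentiable_on ::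
    "('a::real_normed_vector \<times> 'a \<Rightarrow> complex) \<Rightarrow> ('a \<times> 'a) set \<Rightarrow> bool" where
  "complex_differentiable_on F S \<longleftrightarrow>
     (\<forall>z\<in>S. \<exists>D. (F has_derivative D) (at z) \<and> (\<forall>c v. D (cscale c v) = c * D v))"

definition expansion :: "(nat \<Rightarrow> 'a::banach) \<Rightarrow> (nat \<Rightarrow> real) \<Rightarrow> 'a" where
  "expansion \<psi> y = (\<Sum>j. y j *\<^sub>R \<psi> j)"

definition induced_density ::
    "(nat \<Rightarrow> 'a::banach) \<Rightarrow> ('a \<times> 'a \<Rightarrow> complex) \<Rightarrow> (nat \<Rightarrow> real) \<Rightarrow> real" where
  "induced_density \<psi> F y = Re (F (expansion \<psi> y, 0))"

definition density_assumption ::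
    "real \<Rightarrow> real \<Rightarrow> real \<Rightarrow> (nat \<Rightarrow> 'a::banach) \<Rightarrow> ('a \<times> 'a) set \<Rightarrow> ('a \<times> 'a \<Rightarrow> complex) \<Rightarrow> bool"
  where
  "density_assumption p M L \<psi> S F \<longleftrightarrow>
     open S \<and> complex_differentiable_on F S \<and>
     summable (\<lambda>j. norm (\<psi> j) powr p) \<and>
     (\<forall>y\<in>cube. (expansion \<psi> y, 0) \<in> S) \<and>
     (\<forall>y\<in>cube. F (expansion \<psi> y, 0) \<in> \<real>) \<and>
     (\<forall>z\<in>S. M \<le> cmod (F z) \<and> cmod (F z) \<le> L) \<and>
     (\<forall>y\<in>cube. 0 < induced_density \<psi> F y) \<and>
     (\<integral>y. induced_density \<psi> F y \<partial>mu) = 1"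

section \<open>The Knothe--Rosenblatt transport\<close>

definition append_seq :: "nat \<Rightarrow> (nat \<Rightarrow> real) \<Rightarrow> (nat \<Rightarrow> real) \<Rightarrow> nat \<Rightarrow> real" where
  "append_seq n y t = (\<lambda>j. if j < n then y j else t (j - n))"

text \<open>Here \<open>n\<close> is the number of leading coordinates, as in the mathematical text.\<close>

definition marginal :: "((nat \<Rightarrow> real) \<Rightarrow> real) \<Rightarrow> nat \<Rightarrow> (nat \<Rightarrow> real) \<Rightarrow> real" where
  "marginal f n y = (if n = 0 then 1 else (\<integral>t. f (append_seq n y t) \<partial>mu))"

definition conditional :: "((nat \<Rightarrow> real) \<Rightarrow> real) \<Rightarrow> nat \<Rightarrow> (nat \<Rightarrow> real) \<Rightarrow> real" where
  "conditional f n y = marginal f n y / marginal f (n - 1) y"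

text \<open>The law of coordinate \<open>k\<close> given the coordinates \<open>y\<^sub>0, \<dots>, y\<^bsub>k-1\<^esub>\<close>.\<close>

definition conditional_measure ::
    "((nat \<Rightarrow> real) \<Rightarrow> real) \<Rightarrow> nat \<Rightarrow> (nat \<Rightarrow> real) \<Rightarrow> real measure" where
  "conditional_measure f k y = density mu1 (\<lambda>t. ennreal (conditional f (Suc k) (y(k := t))))"

definition increasing_transport :: "real measure \<Rightarrow> real measure \<Rightarrow> real \<Rightarrow> real" where
  "increasing_transport A B =
     (THE h. h \<in> {-1..1} \<rightarrow>\<^sub>E {-1..1} \<and> mono_on {-1..1} h \<and> distr A mu1 h = B)"

fun KR :: "((nat \<Rightarrow> real) \<Rightarrow> real) \<Rightarrow> ((nat \<Rightarrow> real) \<Rightarrow> real) \<Rightarrow> nat \<Rightarrow> (nat \<Rightarrow> real) \<Rightarrow> real" where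
  "KR f g k y =
     increasing_transport (conditional_measure f k y)
       (conditional_measure g k (\<lambda>j. if j < k then KR f g j y else 0)) (y k)"

declare KR.simps [simp del]

definition triangular :: "((nat \<Rightarrow> real) \<Rightarrow> (nat \<Rightarrow> real)) \<Rightarrow> bool" where
  "triangular T \<longleftrightarrow> (\<forall>k. \<forall>x\<in>cube. \<forall>y\<in>cube. (\<forall>j\<le>k. x j = y j) \<longrightarrow> T x k = T y k)"

definition componentwise_increasing :: "((nat \<Rightarrow> real) \<Rightarrow> (nat \<Rightarrow> real)) \<Rightarrow> bool" where
  "componentwise_increasing T \<longleftrightarrow> (\<forall>k. \<forall>x\<in>cube. mono_on {-1..1} (\<lambda>t. T (x(k := t)) k))"

section \<open>Ansatz spaces and rational maps\<close>

text \<open>If \<open>b j = 0\<close>, then \<open>weight \<alpha> b j = \<infinity>\<close>, by division in \<^typ>\<open>ennreal\<close> (for \<open>\<alpha> > 0\<close>).\<close>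

definition weight :: "real \<Rightarrow> (nat \<Rightarrow> real) \<Rightarrow> nat \<Rightarrow> ennreal" where
  "weight \<alpha> b j = 1 + ennreal \<alpha> / ennreal (b j)"

definition gamma_weight :: "(nat \<Rightarrow> ennreal) \<Rightarrow> nat \<Rightarrow> (nat \<Rightarrow> nat) \<Rightarrow> ennreal" where
  "gamma_weight w k \<nu> = inverse (w k ^ max 1 (\<nu> k)) * (\<Prod>j<k. inverse (w j ^ \<nu> j))"

definition Lambda :: "(nat \<Rightarrow> ennreal) \<Rightarrow> real \<Rightarrow> nat \<Rightarrow> (nat \<Rightarrow> nat) set" where
  "Lambda w \<epsilon> k = {\<nu> \<in> {..k} \<rightarrow>\<^sub>E UNIV. gamma_weight w k \<nu> \<ge> ennreal \<epsilon>}"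

definition N_dim :: "(nat \<Rightarrow> ennreal) \<Rightarrow> real \<Rightarrow> ennreal" where
  "N_dim w \<epsilon> = (\<Sum>k. emeasure (count_space UNIV) (Lambda w \<epsilon> k))"

definition poly_space :: "nat \<Rightarrow> (nat \<Rightarrow> nat) set \<Rightarrow> ((nat \<Rightarrow> real) \<Rightarrow> real) set" where
  "poly_space k \<Lambda> =
     {q. \<exists>S a. finite S \<and> S \<subseteq> \<Lambda> \<and> q = (\<lambda>y. \<Sum>\<nu>\<in>S. a \<nu> * (\<Prod>j\<le>k. y j ^ \<nu> j))}"

definition rational_component ::
    "((nat \<Rightarrow> real) \<Rightarrow> real) \<Rightarrow> nat \<Rightarrow> (nat \<Rightarrow> real) \<Rightarrow> real" where
  "rational_component q k y =
     - 1 + 2 * ((LINT t:{-1..y k}|mu1. (q (y(k := t)) + 1)\<^sup>2) /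
                (LINT t:{-1..1}|mu1. (q (y(k := t)) + 1)\<^sup>2))"

section \<open>Norms and Wasserstein distances\<close>

definition Linf_norm :: "nat \<Rightarrow> ((nat \<Rightarrow> real) \<Rightarrow> real) \<Rightarrow> ennreal" where
  "Linf_norm n g = esssup (mu_fin n) (\<lambda>y. ennreal \<bar>g y\<bar>)"

text \<open>Partial derivative in coordinate \<open>k\<close>, one-sided on the faces of the cube.\<close>

definition partial :: "nat \<Rightarrow> ((nat \<Rightarrow> real) \<Rightarrow> real) \<Rightarrow> (nat \<Rightarrow> real) \<Rightarrow> real" where
  "partial k g y = vector_derivative (\<lambda>t. g (y(k := t))) (at (y k) within {-1..1})"

definition weighted_dist :: "(nat \<Rightarrow> real) \<Rightarrow> (nat \<Rightarrow> real) \<Rightarrow> (nat \<Rightarrow> real) \<Rightarrow> real" where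
  "weighted_dist c x y = (\<Sum>j. c j * \<bar>x j - y j\<bar>)"

text \<open>
  Couplings are Borel measures on the product space.  In a non-separable space the Borel sets of
  the product can be more than the product sigma-algebra, and only the former makes every
  continuous metric measurable.
\<close>

definition couplings ::
    "'a::topological_space measure \<Rightarrow> 'a measure \<Rightarrow> ('a \<times> 'a) measure set" where
  "couplings A B =
     {G. sets G = sets (restrict_space borel (space A \<times> space B)) \<and>
         distr G A fst = A \<and> distr G B snd = B}"

definition ennreal_powr :: "ennreal \<Rightarrow> real \<Rightarrow> ennreal" where
  "ennreal_powr x s = (if x = \<infinity> then \<infinity> else ennreal (enn2real x powr s))"

definition wasserstein ::
    "('a::topological_space \<Rightarrow> 'a \<Rightarrow> real) \<Rightarrow> real \<Rightarrow> 'a measure \<Rightarrow> 'a measure \<Rightarrow> ennreal" where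
  "wasserstein d q A B =
     (INF G\<in>couplings A B. ennreal_powr (\<integral>\<^sup>+z. ennreal (d (fst z) (snd z) powr q) \<partial>G) (1 / q))"

definition rate_bound :: "real \<Rightarrow> real \<Rightarrow> ennreal \<Rightarrow> ennreal" where
  "rate_bound C p N = (if N = 0 then \<infinity> else ennreal (C * enn2real N powr (- (1 / p) + 1)))"

end

(*
  The conditional densities extend to functions of complex variables, holomorphic on the set of z with
  sum_j b_j |z_j - y_j| <= delta for some y in the cube.  Solving F_pi(T_k) = F_rho(z_k) for the complexified conditional
  distribution functions extends the Knothe-Rosenblatt map to such a set, and the k-th partial derivative of T_k is
  R_k^2 with R_k holomorphic and |R_k - 1| <= C b_k (1 + |z_k - y_k|).  Hence the tensor Chebyshev coefficients of
  R_k - 1 decay like products of powers of the weights, and with N_eps = O(eps^(-p)) the truncation to Lambda_(eps,k)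
  has error O(eps^(1-p) b_k^p), which is summable over k.  Squaring and normalising the truncated expansion gives
  the rational maps, and T transports rho to pi, so the law of (T'(y), T(y)) under rho is a coupling that
  bounds the Wasserstein distances by the sup norm errors.
*)

theory Submission
  imports Defs "HOL-Complex_Analysis.Complex_Analysis"
begin

section \<open>Holomorphy along curves in weighted neighbourhoods of the cube\<close>

text \<open>The obstacle is that a differentiable density on a Banach space comes with no product
  domain of fixed radii. Around the compact image of the cube there is only a tube of some width, so
  the displacements of all coordinates, weighted by \<open>b\<close>, share one budget \<delta>.
  This is why the domains are the sets \<open>nbhd\<close> and not polydiscs, why the transport has
  to map a thin tube into such a tube uniformly in the number of variables, and why the ellipses
  behind a Chebyshev coefficient are chosen for each multi-index separately, which leads to
  multinomial sums. The factor \<open>b k\<close> in all component estimates has a simple origin: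
  the marginal in k coordinates is the average over coordinate k of the next marginal, so their
  quotient differs from 1 only by a variation in that single coordinate. Approximating the root of
  the derivative makes monotonicity automatic; all that is asked of a polynomial is that its sum
  with 1 stays away from 0. This can fail for large \<epsilon>, where the zero polynomial, whose
  rational map is the identity, already has an admissible error.\<close>

definition near :: "(nat \<Rightarrow> real) \<Rightarrow> nat \<Rightarrow> real \<Rightarrow> (nat \<Rightarrow> real) \<Rightarrow> (nat \<Rightarrow> complex) \<Rightarrow> bool" where
  "near b n \<delta> y z \<longleftrightarrow> (\<Sum>j<n. b j * cmod (z j - of_real (y j))) \<le> \<delta>"

definition nbhd :: "(nat \<Rightarrow> real) \<Rightarrow> nat \<Rightarrow> real \<Rightarrow> (nat \<Rightarrow> complex) set" where
  "nbhd b n \<delta> = {z. \<exists>y\<in>cube. near b n \<delta> y z}"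

text \<open>Holomorphy in several variables is expressed by composition with holomorphic curves.  This needs no
  theory of functions of several variables and is trivially stable under composition.\<close>

definition curve_hol :: "(nat \<Rightarrow> real) \<Rightarrow> nat \<Rightarrow> real \<Rightarrow> ((nat \<Rightarrow> complex) \<Rightarrow> complex) \<Rightarrow> bool" where
  "curve_hol b n \<delta> g \<longleftrightarrow> (\<forall>S \<zeta>. open S \<longrightarrow> (\<forall>j<n. (\<lambda>s. \<zeta> s j) holomorphic_on S) \<longrightarrow>
     (\<forall>s\<in>S. \<zeta> s \<in> nbhd b n \<delta>) \<longrightarrow> (\<lambda>s. g (\<zeta> s)) holomorphic_on S)"

lemma curve_holD:
  assumes "curve_hol b n \<delta> g" "open S" "\<And>j. j < n \<Longrightarrow> (\<lambda>s. \<zeta> s j) holomorphic_on S"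
    "\<And>s. s \<in> S \<Longrightarrow> \<zeta> s \<in> nbhd b n \<delta>"
  shows "(\<lambda>s. g (\<zeta> s)) holomorphic_on S"
  using assms unfolding curve_hol_def by blast

lemma curve_holI:
  assumes "\<And>S \<zeta>. open S \<Longrightarrow> (\<And>j. j < n \<Longrightarrow> (\<lambda>s. \<zeta> s j) holomorphic_on S) \<Longrightarrow>
     (\<And>s. s \<in> S \<Longrightarrow> \<zeta> s \<in> nbhd b n \<delta>) \<Longrightarrow> (\<lambda>s. g (\<zeta> s)) holomorphic_on S"
  shows "curve_hol b n \<delta> g"
  using assms unfolding curve_hol_def by blast

text \<open>Cauchy's inequality on discs of radius \<open>R / 4\<close> around points of the half
  disc, which stay inside \<open>ball s0 R\<close>, bounds the derivative by
  \<open>4 * B / R\<close>; the half disc is convex.\<close>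

lemma holomorphic_diff_bound:
  assumes "\<phi> holomorphic_on ball s0 R" "\<And>s. s \<in> ball s0 R \<Longrightarrow> cmod (\<phi> s) \<le> B"
    "cmod (x - s0) \<le> R / 2" "0 < R"
  shows "cmod (\<phi> x - \<phi> s0) \<le> 4 * B / R * cmod (x - s0)"
proof -
  have d: "cmod (deriv \<phi> \<xi>) \<le> 4 * B / R" if "\<xi> \<in> cball s0 (R / 2)" for \<xi>
  proof -
    have sub: "cball \<xi> (R / 4) \<subseteq> ball s0 R"
    proof
      fix v assume v: "v \<in> cball \<xi> (R / 4)"
      have "dist s0 v \<le> dist s0 \<xi> + dist \<xi> v" by (rule dist_triangle)
      then show "v \<in> ball s0 R" using v that \<open>0 < R\<close> by simp
    qed
    have "cmod ((deriv ^^ 1) \<phi> \<xi>) \<le> fact 1 * B / (R / 4) ^ 1"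
    proof (rule Cauchy_inequality)
      show "\<phi> holomorphic_on ball \<xi> (R / 4)"
        using assms(1) by (rule holomorphic_on_subset) (use sub ball_subset_cball in blast)
      show "continuous_on (cball \<xi> (R / 4)) \<phi>"
        using assms(1) holomorphic_on_imp_continuous_on holomorphic_on_subset sub by blast
      show "0 < R / 4" using assms by simp
      show "cmod (\<phi> x) \<le> B" if "cmod (\<xi> - x) = R / 4" for x
        using that sub by (intro assms(2)) (auto simp: dist_norm)
    qed
    then show ?thesis by (simp add: field_simps)
  qed
  show ?thesis
  proof (rule field_differentiable_bound)
    show "convex (cball s0 (R / 2))" by simp
    show "(\<phi> has_field_derivative deriv \<phi> z) (at z within cball s0 (R / 2))"
      if "z \<in> cball s0 (R / 2)" for z
    proof -
      have "z \<in> ball s0 R" using that \<open>0 < R\<close> by simp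
      then show ?thesis
        using assms(1) holomorphic_derivI open_ball by blast
    qed
    show "x \<in> cball s0 (R / 2)" "s0 \<in> cball s0 (R / 2)"
      using assms by (auto simp: dist_norm norm_minus_commute)
  qed (use d in auto)
qed

text \<open>The uniform bound on the values already dominates the difference quotients, by the
  constant \<open>4 * B / R\<close> of \<open>holomorphic_diff_bound\<close>. The limit is taken
  along sequences because dominated convergence is used.\<close>

lemma holomorphic_on_integral:
  fixes g :: "complex \<Rightarrow> 'a \<Rightarrow> complex"
  assumes fin: "finite_measure M" and S: "open S"
    and hol: "\<And>t. t \<in> space M \<Longrightarrow> (\<lambda>s. g s t) holomorphic_on S"
    and meas: "\<And>s. s \<in> S \<Longrightarrow> g s \<in> borel_measurable M"
    and bd: "\<And>s t. s \<in> S \<Longrightarrow> t \<in> space M \<Longrightarrow> cmod (g s t) \<le> B"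
  shows "(\<lambda>s. \<integral>t. g s t \<partial>M) holomorphic_on S"
proof -
  interpret finite_measure M by fact
  have int: "integrable M (g s)" if "s \<in> S" for s
    using bd that meas by (intro integrable_const_bound[where B = B]) auto
  have "(\<lambda>s. \<integral>t. g s t \<partial>M) field_differentiable at s0" if "s0 \<in> S" for s0
  proof -
    obtain R where R: "R > 0" "ball s0 R \<subseteq> S" using openE[OF S \<open>s0 \<in> S\<close>] by blast
    define D where "D t = deriv (\<lambda>s. g s t) s0" for t
    have der: "((\<lambda>s. g s t) has_field_derivative D t) (at s0)" if "t \<in> space M" for t
      unfolding D_def by (rule holomorphic_derivI[OF hol[OF that] S \<open>s0 \<in> S\<close>])
    have "((\<lambda>h. ((\<integral>t. g (s0 + h) t \<partial>M) - (\<integral>t. g s0 t \<partial>M)) / h) \<longlongrightarrow> (\<integral>t. D t \<partial>M)) (at 0)"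
      unfolding tendsto_at_iff_sequentially
    proof (intro allI impI)
      fix X :: "nat \<Rightarrow> complex" assume X0: "\<forall>i. X i \<in> UNIV - {0}" and X: "X \<longlonglongrightarrow> 0"
      have lim: "(\<lambda>i. (g (s0 + X i) t - g s0 t) / X i) \<longlonglongrightarrow> D t" if "t \<in> space M" for t
        using der[OF that] X0 X unfolding DERIV_def tendsto_at_iff_sequentially
        by (auto simp: comp_def)
      obtain N where N: "\<And>i. i \<ge> N \<Longrightarrow> cmod (X i) < R / 2"
        using LIMSEQ_D[OF X, of "R / 2"] R by auto
      have inS: "s0 + X i \<in> S" if "i \<ge> N" for i
        using N[OF that] R by (intro subsetD[OF R(2)]) (auto simp: dist_norm)
      have "(\<lambda>i. \<integral>t. (g (s0 + X (i + N)) t - g s0 t) / X (i + N) \<partial>M) \<longlonglongrightarrow> (\<integral>t. D t \<partial>M)"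
      proof (rule integral_dominated_convergence[where w = "\<lambda>_. 4 * B / R"])
        show m: "(\<lambda>t. (g (s0 + X (i + N)) t - g s0 t) / X (i + N)) \<in> borel_measurable M" for i
          using meas[OF inS[of "i + N"]] meas[OF that] by auto
        show l: "AE t in M. (\<lambda>i. (g (s0 + X (i + N)) t - g s0 t) / X (i + N)) \<longlonglongrightarrow> D t"
          by (rule AE_I2) (use LIMSEQ_ignore_initial_segment[OF lim, of _ N] in simp)
        show "D \<in> borel_measurable M"
          by (rule borel_measurable_LIMSEQ_metric[where f = "\<lambda>i t. (g (s0 + X (i + N)) t - g s0 t) / X (i + N)", OF m])
            (use LIMSEQ_ignore_initial_segment[OF lim, of _ N] in simp)
        show "AE t in M. norm ((g (s0 + X (i + N)) t - g s0 t) / X (i + N)) \<le> 4 * B / R" for i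
        proof (rule AE_I2)
          fix t assume t: "t \<in> space M"
          have "cmod (g (s0 + X (i + N)) t - g s0 t) \<le> 4 * B / R * cmod (s0 + X (i + N) - s0)"
            using N[of "i + N"] R bd[OF _ t]
            by (intro holomorphic_diff_bound holomorphic_on_subset[OF hol[OF t]]) auto
          then show "norm ((g (s0 + X (i + N)) t - g s0 t) / X (i + N)) \<le> 4 * B / R"
            using X0 by (simp add: norm_divide pos_divide_le_eq)
        qed
      qed auto
      moreover have "(\<integral>t. (g (s0 + X (i + N)) t - g s0 t) / X (i + N) \<partial>M) =
          ((\<integral>t. g (s0 + X (i + N)) t \<partial>M) - (\<integral>t. g s0 t \<partial>M)) / X (i + N)" for i
        using int[OF inS[of "i + N"]] int[OF that] by simp
      ultimately have "(\<lambda>i. ((\<integral>t. g (s0 + X (i + N)) t \<partial>M) - (\<integral>t. g s0 t \<partial>M)) / X (i + N))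
          \<longlonglongrightarrow> (\<integral>t. D t \<partial>M)" by (simp only:)
      then show "((\<lambda>h. ((\<integral>t. g (s0 + h) t \<partial>M) - (\<integral>t. g s0 t \<partial>M)) / h) \<circ> X) \<longlonglongrightarrow> (\<integral>t. D t \<partial>M)"
        unfolding comp_def by (rule LIMSEQ_offset)
    qed
    then show ?thesis unfolding field_differentiable_def DERIV_def by blast
  qed
  then show ?thesis using S by (simp add: holomorphic_on_open field_differentiable_def)
qed

section \<open>The weighted distance and its tubes around the cube\<close>

locale weights =
  fixes b :: "nat \<Rightarrow> real"
  assumes b_nonneg: "\<And>j. 0 \<le> b j" and b_summable: "summable b"
begin

definition sdist :: "nat \<Rightarrow> (nat \<Rightarrow> complex) \<Rightarrow> (nat \<Rightarrow> complex) \<Rightarrow> real" where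
  "sdist n z z' = (\<Sum>j<n. b j * cmod (z j - z' j))"

lemma sdist_nonneg: "0 \<le> sdist n z z'"
  unfolding sdist_def by (intro sum_nonneg mult_nonneg_nonneg b_nonneg) auto

lemma sdist_triangle: "sdist n x z \<le> sdist n x y + sdist n y z"
proof -
  have "cmod (x j - z j) \<le> cmod (x j - y j) + cmod (y j - z j)" for j
    using norm_triangle_ineq[of "x j - y j" "y j - z j"] by simp
  then have "b j * cmod (x j - z j) \<le> b j * cmod (x j - y j) + b j * cmod (y j - z j)" for j
    using b_nonneg[of j] by (metis distrib_left mult_left_mono)
  then show ?thesis unfolding sdist_def sum.distrib[symmetric] by (intro sum_mono)
qed

lemma sdist_refl [simp]: "sdist n x x = 0"
  unfolding sdist_def by simp

lemma sdist_Suc: "sdist (Suc n) x y = sdist n x y + b n * cmod (x n - y n)"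
  unfolding sdist_def by simp

lemma sdist_cong: "(\<And>j. j < n \<Longrightarrow> x j = x' j) \<Longrightarrow> (\<And>j. j < n \<Longrightarrow> y j = y' j) \<Longrightarrow> sdist n x y = sdist n x' y'"
  unfolding sdist_def by (intro sum.cong) auto

lemma near_sdist: "near b n \<delta> y z \<longleftrightarrow> sdist n z (complex_of_real \<circ> y) \<le> \<delta>"
  unfolding near_def sdist_def by simp

lemma nbhd_sdist: "nbhd b n \<delta> = {z. \<exists>y\<in>cube. sdist n z (complex_of_real \<circ> y) \<le> \<delta>}"
  unfolding nbhd_def near_sdist ..

lemma nbhd_mono: "\<delta> \<le> \<delta>' \<Longrightarrow> nbhd b n \<delta> \<subseteq> nbhd b n \<delta>'"
  unfolding nbhd_sdist using order_trans by blast

lemma nbhd_add: "z \<in> nbhd b n \<delta> \<Longrightarrow> sdist n z' z \<le> e \<Longrightarrow> z' \<in> nbhd b n (\<delta> + e)"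
proof -
  assume z: "z \<in> nbhd b n \<delta>" and e: "sdist n z' z \<le> e"
  then obtain y where "y \<in> cube" "sdist n z (complex_of_real \<circ> y) \<le> \<delta>" by (auto simp: nbhd_sdist)
  moreover have "sdist n z' (complex_of_real \<circ> y) \<le> sdist n z' z + sdist n z (complex_of_real \<circ> y)" by (rule sdist_triangle)
  ultimately show ?thesis using e unfolding nbhd_sdist by (auto intro!: bexI[of _ y])
qed

lemma cube_in_nbhd: "y \<in> cube \<Longrightarrow> 0 \<le> \<delta> \<Longrightarrow> complex_of_real \<circ> y \<in> nbhd b n \<delta>"
  unfolding nbhd_sdist by (auto intro!: bexI[of _ y])

lemma sdist_less_Suc: "n \<le> m \<Longrightarrow> sdist n z z' \<le> sdist m z z'"
  unfolding sdist_def by (intro sum_mono2 mult_nonneg_nonneg b_nonneg) auto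

lemma nbhd_drop: "n \<le> m \<Longrightarrow> nbhd b m \<delta> \<subseteq> nbhd b n \<delta>"
  unfolding nbhd_sdist using sdist_less_Suc order_trans by blast

lemma nbhd_cong: "(\<And>j. j < n \<Longrightarrow> z j = z' j) \<Longrightarrow> z \<in> nbhd b n \<delta> \<longleftrightarrow> z' \<in> nbhd b n \<delta>"
proof -
  assume "\<And>j. j < n \<Longrightarrow> z j = z' j"
  then have "sdist n z x = sdist n z' x" for x by (intro sdist_cong) auto
  then show ?thesis by (simp add: nbhd_sdist)
qed

text \<open>A real value for the new coordinate costs nothing, because the centre of the tube can be
  given the same value.\<close>

lemma nbhd_Suc_real:
  assumes "z \<in> nbhd b k \<delta>" "x \<in> {-1..1}"
  shows "z(k := of_real x) \<in> nbhd b (Suc k) \<delta>"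
proof -
  obtain y where y: "y \<in> cube" "sdist k z (complex_of_real \<circ> y) \<le> \<delta>" using assms nbhd_sdist by auto
  have "sdist (Suc k) (z(k := of_real x)) (complex_of_real \<circ> y(k := x)) = sdist k z (complex_of_real \<circ> y)"
    unfolding sdist_Suc by (simp) (rule sdist_cong, auto)
  moreover have "y(k := x) \<in> cube" using y assms by (auto simp: cube_def)
  ultimately show ?thesis unfolding nbhd_sdist using y by force
qed

lemma curve_hol_mono: "curve_hol b n \<delta> g \<Longrightarrow> \<delta>' \<le> \<delta> \<Longrightarrow> n \<le> m \<Longrightarrow> curve_hol b m \<delta>' g"
  unfolding curve_hol_def using nbhd_mono[of \<delta>' \<delta> n] nbhd_drop[of n m \<delta>'] by (meson order_less_le_trans subsetD)

text \<open>Along the complex line through z and z' the parameter may run over a disc of radius R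
  with \<open>R * sdist n z' z \<le> \<delta> / 2\<close> before the tube is left. Cauchy's estimate
  on this disc is a Lipschitz bound in \<open>sdist\<close> whose constant does not depend on
  n.\<close>

lemma curve_hol_lipschitz:
  assumes g: "curve_hol b n \<delta> g" and bd: "\<And>z. z \<in> nbhd b n \<delta> \<Longrightarrow> cmod (g z) \<le> B"
    and z: "z \<in> nbhd b n (\<delta> / 2)" and z': "z' \<in> nbhd b n \<delta>" and \<delta>: "0 < \<delta>"
  shows "cmod (g z' - g z) \<le> 8 * B / \<delta> * sdist n z' z"
proof -
  have "z \<in> nbhd b n \<delta>" using z nbhd_mono[of "\<delta> / 2" \<delta>] \<delta> by auto
  then have B: "cmod (g z' - g z) \<le> 2 * B" "0 \<le> B"
    using bd[OF z'] bd[of z] norm_triangle_ineq4[of "g z'" "g z"] norm_ge_zero[of "g z"] by linarith+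
  have main: "cmod (g z' - g z) \<le> 4 * B / R" if R: "R > 0" "R * sdist n z' z \<le> \<delta> / 2" for R
  proof (cases "R < 2")
    case True
    \<comment> \<open>The parameter 1 is not in the half disc here, but the trivial bound is already
      good enough.\<close>
    then have "2 * B \<le> 4 * B / R" using B R by (simp add: field_simps mult_left_mono)
    then show ?thesis using B by linarith
  next
    case False
    define \<zeta> where "\<zeta> s = (\<lambda>j. z j + s * (z' j - z j))" for s
    have sd: "sdist n (\<zeta> s) z = cmod s * sdist n z' z" for s
      unfolding sdist_def \<zeta>_def sum_distrib_left by (intro sum.cong) (auto simp: norm_mult)
    have "(\<lambda>s. g (\<zeta> s)) holomorphic_on ball 0 R"
    proof (rule curve_holD[OF g open_ball])
      show "\<zeta> s \<in> nbhd b n \<delta>" if "s \<in> ball 0 R" for s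
      proof -
        have "sdist n (\<zeta> s) z = cmod s * sdist n z' z"
          by (rule sd)
        also have "\<dots> \<le> \<delta> / 2"
          using that R sdist_nonneg[of n z' z] by (smt (verit) mem_ball_0 mult_right_mono)
        finally show ?thesis using nbhd_add[OF z, of "\<zeta> s" "\<delta> / 2"] by simp
      qed
    qed (auto simp: \<zeta>_def intro!: holomorphic_intros)
    moreover have "cmod (g (\<zeta> s)) \<le> B" if "s \<in> ball 0 R" for s
    proof -
      have "sdist n (\<zeta> s) z = cmod s * sdist n z' z"
        by (rule sd)
      also have "\<dots> \<le> \<delta> / 2"
        using that R sdist_nonneg[of n z' z] by (smt (verit) mem_ball_0 mult_right_mono)
      finally show ?thesis using nbhd_add[OF z, of "\<zeta> s" "\<delta> / 2"] by (simp add: bd)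
    qed
    ultimately have "cmod (g (\<zeta> 1) - g (\<zeta> 0)) \<le> 4 * B / R * cmod (1 - 0)"
      using False by (intro holomorphic_diff_bound) auto
    then show ?thesis by (simp add: \<zeta>_def)
  qed
  show ?thesis
  proof (cases "sdist n z' z = 0")
    case True
    \<comment> \<open>Distinct points have \<open>sdist\<close> zero if they differ only where
      weights vanish or beyond n. Every R is then admissible, and a large one makes the difference
      smaller than e.\<close>
    have "cmod (g z' - g z) \<le> e" if "e > 0" for e
    proof -
      have "cmod (g z' - g z) \<le> 4 * B / (4 * (B + 1) / e)" by (rule main) (use True that B \<delta> in auto)
      also have "\<dots> \<le> e" using that B by (simp add: field_simps)
      finally show ?thesis .
    qed
    then have "cmod (g z' - g z) \<le> 0" by (meson dense_ge)
    then show ?thesis by (simp add: True)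
  next
    case False
    then have "sdist n z' z > 0" using sdist_nonneg[of n z' z] by simp
    then show ?thesis using main[of "\<delta> / (2 * sdist n z' z)"] \<delta> by (simp add: field_simps)
  qed
qed

text \<open>The curve that is z at the parameter 0 and z' elsewhere has constant, hence holomorphic,
  coordinates below n. Its composition with g is therefore continuous at 0, which forces equal
  values: holomorphy along curves already contains independence of the remaining
  coordinates.\<close>

lemma curve_hol_cong:
  assumes g: "curve_hol b n \<delta> g" and "z \<in> nbhd b n \<delta>" "\<And>j. j < n \<Longrightarrow> z j = z' j"
  shows "g z = g z'"
proof -
  define \<zeta> where "\<zeta> s = (if s = (0::complex) then z else z')" for s
  have z': "z' \<in> nbhd b n \<delta>" using assms nbhd_cong by blast
  have "(\<lambda>s. g (\<zeta> s)) holomorphic_on UNIV"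
  proof (rule curve_holD[OF g])
    fix j assume "j < n"
    then have "(\<lambda>s. \<zeta> s j) = (\<lambda>_. z j)" using assms by (auto simp: \<zeta>_def)
    then show "(\<lambda>s. \<zeta> s j) holomorphic_on UNIV" by simp
  qed (use assms z' in \<open>auto simp: \<zeta>_def\<close>)
  then have "isCont (\<lambda>s. g (\<zeta> s)) 0"
    using holomorphic_on_imp_continuous_on continuous_on_eq_continuous_at by blast
  then have "((\<lambda>s. g (\<zeta> s)) \<longlongrightarrow> g z) (at 0)" by (simp add: isCont_def \<zeta>_def)
  moreover have "((\<lambda>s. g (\<zeta> s)) \<longlongrightarrow> g z') (at 0)"
    by (rule tendsto_eventually) (auto simp: \<zeta>_def eventually_at_filter)
  ultimately show ?thesis using tendsto_unique[OF at_neq_bot] by blast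
qed

end

section \<open>Complexified conditional distribution functions\<close>

lemma prob_space_mu1: "prob_space mu1"
proof
  have "emeasure mu1 (space mu1) = ennreal (1/2) * emeasure (restrict_space lborel {-1..1::real}) {-1..1}"
    by (simp add: mu1_def space_scale_measure space_restrict_space divide_ennreal_def)
  also have "\<dots> = ennreal (1/2) * ennreal 2"
    by (subst emeasure_restrict_space) (auto simp: divide_ennreal_def)
  also have "\<dots> = 1" by (subst ennreal_mult[symmetric]) simp_all
  finally show "emeasure mu1 (space mu1) = 1" .
qed

lemma finite_measure_mu1: "finite_measure mu1"
  using prob_space_mu1 by (rule prob_space.finite_measure)

lemma sets_mu1: "sets mu1 = sets (restrict_space borel {-1..1})"
  by (simp add: mu1_def sets_restrict_space)

lemma measurable_mu1_continuous:
  fixes f :: "real \<Rightarrow> 'b::topological_space"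
  assumes "continuous_on {-1..1} f" shows "f \<in> borel_measurable mu1"
  using borel_measurable_continuous_on_restrict[OF assms] measurable_cong_sets[OF sets_mu1 refl] by blast

lemma mu1_density: "mu1 = density (restrict_space lborel {-1..1}) (\<lambda>_. ennreal (1/2))"
  by (rule measure_eqI) (simp_all add: mu1_def emeasure_density_const divide_ennreal_def sets_restrict_space)

lemma integral_mu1_Icc:
  fixes f :: "real \<Rightarrow> 'b::euclidean_space"
  assumes "continuous_on {-1..1} f" "-1 \<le> a" "c \<le> 1"
  shows "(LINT t:{a..c}|mu1. f t) = (1/2) *\<^sub>R integral {a..c} f"
proof -
  have sub: "{a..c} \<subseteq> {-1..1}" using assms by auto
  have m: "f \<in> borel_measurable (restrict_space lborel {-1..1})"
    using borel_measurable_continuous_on_restrict[OF assms(1)] by (simp add: measurable_lborel2 sets_restrict_space cong: measurable_cong_sets)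
  have "(LINT t:{a..c}|mu1. f t) = (\<integral>t. (1/2) *\<^sub>R (indicator {a..c} t *\<^sub>R f t) \<partial>restrict_space lborel {-1..1})"
    unfolding set_lebesgue_integral_def mu1_density
    by (subst integral_density) (use m in \<open>auto simp: measurable_restrict_space1 intro!: borel_measurable_scaleR\<close>)
  also have "\<dots> = (1/2) *\<^sub>R (\<integral>t. indicator {-1..1} t *\<^sub>R (indicator {a..c} t *\<^sub>R f t) \<partial>lborel)"
    by (subst integral_restrict_space) (simp_all flip: integral_scaleR_right add: mult.commute)
  also have "(\<lambda>t. indicator {-1..1} t *\<^sub>R (indicator {a..c} t *\<^sub>R f t)) = (\<lambda>t. indicator {a..c} t *\<^sub>R f t)"
    using sub by (auto simp: indicator_def)
  also have "(\<integral>t. indicator {a..c} t *\<^sub>R f t \<partial>lborel) = integral {a..c} f"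
    using set_borel_integral_eq_integral(2)[OF borel_integrable_atLeastAtMost'[of a c f]] continuous_on_subset[OF assms(1) sub]
    by (simp add: set_lebesgue_integral_def)
  finally show ?thesis .
qed

lemma integral_mu1:
  fixes f :: "real \<Rightarrow> 'b::euclidean_space"
  assumes "continuous_on {-1..1} f"
  shows "(\<integral>t. f t \<partial>mu1) = (1/2) *\<^sub>R integral {-1..1} f"
proof -
  have "(\<integral>t. f t \<partial>mu1) = (LINT t:{-1..1}|mu1. f t)"
    unfolding set_lebesgue_integral_def by (rule Bochner_Integration.integral_cong) (auto simp: space_mu1)
  then show ?thesis using integral_mu1_Icc[OF assms, of "-1" 1] by simp
qed

text \<open>\<open>\<phi> k\<close> stands for the conditional density of coordinate \<open>k\<close>, extended to complex arguments.  The factor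
  \<open>b k\<close> in \<open>\<phi>_one\<close> is what eventually makes all component errors summable in \<open>k\<close>.\<close>

locale density_family = weights +
  fixes \<phi> :: "nat \<Rightarrow> (nat \<Rightarrow> complex) \<Rightarrow> complex" and \<delta> m K A :: real
  assumes \<delta>_pos: "0 < \<delta>" and m_pos: "0 < m" and A_nonneg: "0 \<le> A"
    and \<phi>_hol: "\<And>k. curve_hol b (Suc k) \<delta> (\<phi> k)"
    and \<phi>_le: "\<And>k z. z \<in> nbhd b (Suc k) \<delta> \<Longrightarrow> cmod (\<phi> k z) \<le> K"
    and \<phi>_ge: "\<And>k z. z \<in> nbhd b (Suc k) \<delta> \<Longrightarrow> m \<le> Re (\<phi> k z)"
    and \<phi>_one: "\<And>k y z. y \<in> cube \<Longrightarrow> near b (Suc k) \<delta> y z \<Longrightarrow>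
        cmod (\<phi> k z - 1) \<le> A * b k * (1 + cmod (z k - of_real (y k)))"
    and \<phi>_real: "\<And>k y. y \<in> cube \<Longrightarrow> \<phi> k (complex_of_real \<circ> y) \<in> \<real>"
    and \<phi>_norm: "\<And>k y. y \<in> cube \<Longrightarrow> (\<integral>t. \<phi> k (complex_of_real \<circ> y(k := t)) \<partial>mu1) = 1"
begin

lemma m_le_K: "m \<le> K"
proof -
  have z: "complex_of_real \<circ> (\<lambda>_. 0) \<in> nbhd b (Suc 0) \<delta>"
    using cube_in_nbhd[of "\<lambda>_. 0"] \<delta>_pos by (auto simp: cube_def)
  show ?thesis using \<phi>_le[OF z] \<phi>_ge[OF z] complex_Re_le_cmod[of "\<phi> 0 (complex_of_real \<circ> (\<lambda>_. 0))"] by linarith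
qed

text \<open>The budget \<delta> is halved: one half for the first k coordinates, the other for
  coordinate k. If \<open>b k = 0\<close>, the strip is the whole plane.\<close>

definition strip :: "nat \<Rightarrow> complex set" where
  "strip k = {w. \<exists>x\<in>{-1..1}. b k * cmod (w - of_real x) < \<delta> / 2}"

lemma open_strip: "open (strip k)"
proof -
  have "strip k = (\<Union>x\<in>{-1..1}. {w. b k * cmod (w - of_real x) < \<delta> / 2})" by (auto simp: strip_def)
  also have "open \<dots>" by (intro open_UN ballI open_Collect_less continuous_intros)
  finally show ?thesis .
qed

lemma convex_strip: "convex (strip k)"
proof (rule convexI)
  fix w w' :: complex and u v :: real
  assume w: "w \<in> strip k" "w' \<in> strip k" and uv: "0 \<le> u" "0 \<le> v" "u + v = 1"
  obtain x x' where x: "x \<in> {-1..1}" "b k * cmod (w - of_real x) < \<delta> / 2"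
    and x': "x' \<in> {-1..1}" "b k * cmod (w' - of_real x') < \<delta> / 2" using w by (auto simp: strip_def)
  have "u *\<^sub>R x + v *\<^sub>R x' \<in> {-1..1}" using x x' uv by (intro convexD) auto
  then have 1: "u * x + v * x' \<in> {-1..1}" by simp
  have "(u *\<^sub>R w + v *\<^sub>R w') - of_real (u * x + v * x') = u *\<^sub>R (w - of_real x) + v *\<^sub>R (w' - of_real x')"
    by (simp add: scaleR_conv_of_real algebra_simps)
  then have "cmod ((u *\<^sub>R w + v *\<^sub>R w') - of_real (u * x + v * x')) \<le> u * cmod (w - of_real x) + v * cmod (w' - of_real x')"
    using norm_triangle_ineq[of "u *\<^sub>R (w - of_real x)" "v *\<^sub>R (w' - of_real x')"] uv by simp
  then have "b k * cmod ((u *\<^sub>R w + v *\<^sub>R w') - of_real (u * x + v * x')) \<le>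
     b k * (u * cmod (w - of_real x) + v * cmod (w' - of_real x'))"
    using b_nonneg by (rule mult_left_mono)
  also have "\<dots> = u * (b k * cmod (w - of_real x)) + v * (b k * cmod (w' - of_real x'))"
    by (simp add: algebra_simps)
  also have "\<dots> < \<delta> / 2" using x(2) x'(2) uv by (rule convex_bound_lt)
  finally show "u *\<^sub>R w + v *\<^sub>R w' \<in> strip k" using 1 unfolding strip_def by blast
qed

lemma real_in_strip: "x \<in> {-1..1} \<Longrightarrow> of_real x \<in> strip k"
  using \<delta>_pos by (auto simp: strip_def intro!: bexI[of _ x])

lemma m1_in_strip: "-1 \<in> strip k"
  using real_in_strip[of "-1"] by simp

lemma strip_nbhd:
  assumes "u \<in> nbhd b k (\<delta> / 2)" "w \<in> strip k"
  shows "u(k := w) \<in> nbhd b (Suc k) \<delta>"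
proof -
  obtain x where x: "x \<in> {-1..1}" "b k * cmod (w - of_real x) < \<delta> / 2" using assms by (auto simp: strip_def)
  have *: "sdist (Suc k) (u(k := w)) (u(k := of_real x)) = b k * cmod (w - of_real x)"
    unfolding sdist_Suc by (simp add: sdist_def)
  have "u(k := w) \<in> nbhd b (Suc k) (\<delta> / 2 + \<delta> / 2)"
    by (rule nbhd_add[OF nbhd_Suc_real[OF assms(1) x(1)]]) (use x(2) * in simp)
  then show ?thesis by simp
qed

lemma \<phi>_hol_strip:
  assumes "u \<in> nbhd b k (\<delta> / 2)"
  shows "(\<lambda>w. \<phi> k (u(k := w))) holomorphic_on strip k"
proof (rule curve_holD[OF \<phi>_hol open_strip])
  show "(\<lambda>w. (u(k := w)) j) holomorphic_on strip k" if "j < Suc k" for j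
    by (cases "j = k") (auto intro: holomorphic_intros)
qed (rule strip_nbhd[OF assms])

text \<open>\<open>cdf k u\<close> is half the integral of \<open>\<phi> k\<close> from \<open>-1\<close> to \<open>w\<close>, parametrised along the segment by \<open>mid w\<close>.\<close>

definition mid :: "complex \<Rightarrow> real \<Rightarrow> complex" where
  "mid w t = -1 + (of_real t + 1) / 2 * (w + 1)"

lemma mid_strip:
  assumes "w \<in> strip k" "t \<in> {-1..1}" shows "mid w t \<in> strip k"
proof -
  have "(1 - (t + 1) / 2) *\<^sub>R (-1) + ((t + 1) / 2) *\<^sub>R w \<in> strip k"
    using assms m1_in_strip by (intro convexD[OF convex_strip]) auto
  also have "(1 - (t + 1) / 2) *\<^sub>R (-1) + ((t + 1) / 2) *\<^sub>R w = mid w t"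
    by (simp add: mid_def scaleR_conv_of_real field_simps)
  finally show ?thesis .
qed

definition cdf :: "nat \<Rightarrow> (nat \<Rightarrow> complex) \<Rightarrow> complex \<Rightarrow> complex" where
  "cdf k u w = (w + 1) / 2 * (\<integral>t. \<phi> k (u(k := mid w t)) \<partial>mu1)"

lemma measurable_\<phi>_mid:
  assumes "u \<in> nbhd b k (\<delta> / 2)" "w \<in> strip k"
  shows "(\<lambda>t. \<phi> k (u(k := mid w t))) \<in> borel_measurable mu1"
proof (rule measurable_mu1_continuous)
  have "continuous_on (strip k) (\<lambda>w. \<phi> k (u(k := w)))"
    using \<phi>_hol_strip[OF assms(1)] by (rule holomorphic_on_imp_continuous_on)
  then show "continuous_on {-1..1} (\<lambda>t. \<phi> k (u(k := mid w t)))"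
    by (rule continuous_on_compose2[where f = "mid w"])
      (use mid_strip[OF assms(2)] in \<open>auto simp: mid_def intro!: continuous_intros\<close>)
qed

lemma cdf_hol:
  assumes S: "open S" and u: "\<And>j. j < k \<Longrightarrow> (\<lambda>s. u s j) holomorphic_on S"
    "\<And>s. s \<in> S \<Longrightarrow> u s \<in> nbhd b k (\<delta> / 2)"
    and w: "w holomorphic_on S" "\<And>s. s \<in> S \<Longrightarrow> w s \<in> strip k"
  shows "(\<lambda>s. cdf k (u s) (w s)) holomorphic_on S"
proof -
  have "(\<lambda>s. \<integral>t. \<phi> k ((u s)(k := mid (w s) t)) \<partial>mu1) holomorphic_on S"
  proof (rule holomorphic_on_integral[OF finite_measure_mu1 S])
    fix t assume "t \<in> space mu1"
    then have t: "t \<in> {-1..1}" by (simp add: space_mu1)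
    show "(\<lambda>s. \<phi> k ((u s)(k := mid (w s) t))) holomorphic_on S"
    proof (rule curve_holD[OF \<phi>_hol S])
      show "(\<lambda>s. ((u s)(k := mid (w s) t)) j) holomorphic_on S" if "j < Suc k" for j
        using that u(1)[of j] w(1) by (cases "j = k") (auto simp: mid_def intro!: holomorphic_intros)
      show "(u s)(k := mid (w s) t) \<in> nbhd b (Suc k) \<delta>" if "s \<in> S" for s
        using strip_nbhd[OF u(2) mid_strip[OF w(2) t]] that by blast
    qed
  next
    fix s t assume "s \<in> S" "t \<in> space mu1"
    then show "cmod (\<phi> k ((u s)(k := mid (w s) t))) \<le> K"
      using u w by (intro \<phi>_le strip_nbhd mid_strip) (auto simp: space_mu1)
  qed (use measurable_\<phi>_mid u w in blast)
  then show ?thesis unfolding cdf_def using w by (intro holomorphic_intros) auto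
qed

text \<open>\<open>cdf\<close> is a parameter integral because that form is holomorphic in all
  arguments at once; the primitive supplies the derivative in w.\<close>

lemma cdf_primitive:
  assumes u: "u \<in> nbhd b k (\<delta> / 2)"
  obtains \<Psi> where "\<And>w. w \<in> strip k \<Longrightarrow> (\<Psi> has_field_derivative \<phi> k (u(k := w))) (at w)"
    "\<And>w. w \<in> strip k \<Longrightarrow> cdf k u w = (\<Psi> w - \<Psi> (-1)) / 2"
proof -
  obtain \<Psi> where \<Psi>: "\<And>w. w \<in> strip k \<Longrightarrow> (\<Psi> has_field_derivative \<phi> k (u(k := w))) (at w)"
    using holomorphic_convex_primitive'[OF convex_strip open_strip \<phi>_hol_strip[OF u]]
    by (metis at_within_open[OF _ open_strip])
  have "cdf k u w = (\<Psi> w - \<Psi> (-1)) / 2" if w: "w \<in> strip k" for w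
  proof -
    have d: "((\<lambda>t. \<Psi> (mid w t)) has_vector_derivative (w + 1) / 2 * \<phi> k (u(k := mid w t))) (at t within {-1..1})"
      if t: "t \<in> {-1..1}" for t
    proof -
      have "(mid w has_vector_derivative (w + 1) / 2) (at t within {-1..1})"
        unfolding mid_def has_vector_derivative_def
        by (auto intro!: derivative_eq_intros simp: scaleR_conv_of_real field_simps)
      from field_vector_diff_chain_within[OF this] \<Psi>[OF mid_strip[OF w t]]
      show ?thesis by (simp add: o_def has_field_derivative_at_within)
    qed
    have "((\<lambda>t. (w + 1) / 2 * \<phi> k (u(k := mid w t))) has_integral (\<Psi> (mid w 1) - \<Psi> (mid w (-1)))) {-1..1}"
      by (rule fundamental_theorem_of_calculus) (use d in auto)
    then have i: "integral {-1..1} (\<lambda>t. (w + 1) / 2 * \<phi> k (u(k := mid w t))) = \<Psi> w - \<Psi> (-1)"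
      by (auto simp: mid_def dest: integral_unique)
    have c: "continuous_on {-1..1} (\<lambda>t. \<phi> k (u(k := mid w t)))"
      by (rule continuous_on_compose2[OF holomorphic_on_imp_continuous_on[OF \<phi>_hol_strip[OF u]], where f = "mid w"])
        (use mid_strip[OF w] in \<open>auto simp: mid_def intro!: continuous_intros\<close>)
    have "cdf k u w = (w + 1) / 2 * ((1/2) *\<^sub>R integral {-1..1} (\<lambda>t. \<phi> k (u(k := mid w t))))"
      unfolding cdf_def integral_mu1[OF c] ..
    also have "\<dots> = (1/2) *\<^sub>R integral {-1..1} (\<lambda>t. (w + 1) / 2 * \<phi> k (u(k := mid w t)))"
      by (simp add: integral_mult_right)
    finally show ?thesis unfolding i by (simp add: scaleR_conv_of_real)
  qed
  then show ?thesis using \<Psi> that by blast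
qed

lemma cdf_deriv:
  assumes u: "u \<in> nbhd b k (\<delta> / 2)" and w: "w \<in> strip k"
  shows "(cdf k u has_field_derivative \<phi> k (u(k := w)) / 2) (at w)"
proof -
  obtain \<Psi> where \<Psi>: "\<And>w. w \<in> strip k \<Longrightarrow> (\<Psi> has_field_derivative \<phi> k (u(k := w))) (at w)"
    "\<And>w. w \<in> strip k \<Longrightarrow> cdf k u w = (\<Psi> w - \<Psi> (-1)) / 2" using cdf_primitive[OF u] by blast
  have "((\<lambda>w. (\<Psi> w - \<Psi> (-1)) / 2) has_field_derivative \<phi> k (u(k := w)) / 2) (at w)"
    using \<Psi>(1)[OF w] by (auto intro!: derivative_eq_intros)
  then show ?thesis
    by (rule has_field_derivative_transform_within_open[OF _ open_strip w]) (use \<Psi>(2) in auto)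
qed

lemma cdf_m1 [simp]: "cdf k u (-1) = 0"
  by (simp add: cdf_def)

lemma cdf_1: "y \<in> cube \<Longrightarrow> cdf k (complex_of_real \<circ> y) 1 = 1"
proof -
  assume y: "y \<in> cube"
  have "(complex_of_real \<circ> y)(k := mid 1 t) = complex_of_real \<circ> y(k := t)" for t
    by (auto simp: mid_def fun_eq_iff field_simps)
  then show ?thesis using \<phi>_norm[OF y, of k] by (simp add: cdf_def)
qed

lemma cdf_lipschitz:
  assumes u: "u \<in> nbhd b k (\<delta> / 2)" and w: "w \<in> strip k" "w' \<in> strip k"
  shows "cmod (cdf k u w - cdf k u w') \<le> K / 2 * cmod (w - w')"
proof (rule field_differentiable_bound[OF convex_strip])
  show "cmod (\<phi> k (u(k := z)) / 2) \<le> K / 2" if "z \<in> strip k" for z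
    using \<phi>_le[OF strip_nbhd[OF u that]] by (simp add: norm_divide)
  show "(cdf k u has_field_derivative \<phi> k (u(k := z)) / 2) (at z within strip k)" if "z \<in> strip k" for z
    by (rule has_field_derivative_at_within[OF cdf_deriv[OF u that]])
qed (use w in auto)

section \<open>Inversion of the distribution functions by a contraction\<close>

definition \<kappa> :: real where "\<kappa> = 2 * m / K\<^sup>2"
definition rate :: real where "rate = sqrt (1 - (m / K)\<^sup>2)"

lemma K_pos: "0 < K" using m_pos m_le_K by simp

lemma \<kappa>_pos: "0 < \<kappa>" using m_pos K_pos by (simp add: \<kappa>_def)

lemma rate_bounds: "0 \<le> rate" "rate < 1"
proof -
  have "(m / K)\<^sup>2 \<le> 1" using m_le_K m_pos K_pos by (simp add: power_le_one_iff)
  then show "0 \<le> rate" by (simp add: rate_def)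
  have "0 < (m / K)\<^sup>2" using m_pos K_pos by simp
  then show "rate < 1" by (simp add: rate_def)
qed

text \<open>The choice of \<open>\<kappa>\<close> minimises the bound \<open>1 - \<kappa> m + \<kappa>\<^sup>2 K\<^sup>2 / 4\<close> for \<open>\<bar>1 - \<kappa> \<phi> / 2\<bar>\<^sup>2\<close>.\<close>

lemma cdf_contraction:
  assumes u: "u \<in> nbhd b k (\<delta> / 2)" and w: "w \<in> strip k" "w' \<in> strip k"
  shows "cmod ((w - of_real \<kappa> * (cdf k u w - a)) - (w' - of_real \<kappa> * (cdf k u w' - a))) \<le> rate * cmod (w - w')"
proof (rule field_differentiable_bound[OF convex_strip])
  fix z assume z: "z \<in> strip k"
  show "((\<lambda>w. w - of_real \<kappa> * (cdf k u w - a)) has_field_derivative (1 - of_real \<kappa> * (\<phi> k (u(k := z)) / 2))) (at z within strip k)"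
    by (rule has_field_derivative_at_within, (rule derivative_eq_intros cdf_deriv[OF u z] refl)+) simp
  define p where "p = \<phi> k (u(k := z))"
  have p: "cmod p \<le> K" "m \<le> Re p" using \<phi>_le \<phi>_ge strip_nbhd[OF u z] by (auto simp: p_def)
  have "(cmod (1 - of_real \<kappa> * (p / 2)))\<^sup>2 = 1 - \<kappa> * Re p + \<kappa>\<^sup>2 / 4 * (cmod p)\<^sup>2"
    unfolding cmod_power2 by (simp add: power2_eq_square algebra_simps)
  also have "\<dots> \<le> 1 - \<kappa> * m + \<kappa>\<^sup>2 / 4 * K\<^sup>2"
    using p \<kappa>_pos by (intro add_mono diff_mono mult_left_mono power_mono) auto
  also have "\<dots> = 1 - (m / K)\<^sup>2"
    using K_pos by (simp add: \<kappa>_def field_simps power2_eq_square)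
  finally have "cmod (1 - of_real \<kappa> * (p / 2)) \<le> sqrt (1 - (m / K)\<^sup>2)" by (rule real_le_rsqrt)
  then show "cmod (1 - of_real \<kappa> * (\<phi> k (u(k := z)) / 2)) \<le> rate" by (simp add: p_def rate_def)
qed (use w in auto)

definition stab :: real where "stab = \<kappa> / (1 - rate)"

lemma stab_pos: "0 < stab" using \<kappa>_pos rate_bounds by (simp add: stab_def)

text \<open>The identity is a contraction with factor \<open>rate\<close> plus \<kappa> times
  \<open>cdf\<close>, so the differences of \<open>cdf\<close> must carry at least the share
  \<open>1 - rate\<close> of \<open>w - w'\<close>. Injectivity on the strip follows.\<close>

lemma cdf_expand:
  assumes u: "u \<in> nbhd b k (\<delta> / 2)" and w: "w \<in> strip k" "w' \<in> strip k"
  shows "cmod (w - w') \<le> stab * cmod (cdf k u w - cdf k u w')"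
proof -
  have "cmod ((w - w') - of_real \<kappa> * (cdf k u w - cdf k u w')) \<le> rate * cmod (w - w')"
    using cdf_contraction[OF assms, of 0] by (simp add: algebra_simps)
  moreover have "cmod (w - w') \<le> cmod ((w - w') - of_real \<kappa> * (cdf k u w - cdf k u w')) + cmod (of_real \<kappa> * (cdf k u w - cdf k u w'))"
    using norm_triangle_ineq[of "(w - w') - of_real \<kappa> * (cdf k u w - cdf k u w')" "of_real \<kappa> * (cdf k u w - cdf k u w')"] by simp
  moreover have "cmod (of_real \<kappa> * (cdf k u w - cdf k u w')) = \<kappa> * cmod (cdf k u w - cdf k u w')"
    using \<kappa>_pos by (simp add: norm_mult)
  ultimately have "(1 - rate) * cmod (w - w') \<le> \<kappa> * cmod (cdf k u w - cdf k u w')"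
    by (simp add: left_diff_distrib)
  then show ?thesis using rate_bounds by (simp add: stab_def field_simps)
qed

text \<open>Banach's theorem for the damped iteration on a disc around x. The first part of
  \<open>r\<close> says that the first step moves x by at most \<open>(1 - rate) * r\<close>, which
  makes the disc invariant; the second part keeps the disc inside the strip.\<close>

lemma cdf_solution:
  assumes u: "u \<in> nbhd b k (\<delta> / 2)" and x: "x \<in> {-1..1}"
    and r: "stab * cmod (cdf k u (of_real x) - a) \<le> r" "b k * r < \<delta> / 2"
  obtains w where "w \<in> strip k" "cdf k u w = a" "cmod (w - of_real x) \<le> r"
proof -
  have r0: "0 \<le> r" using r(1) stab_pos by (smt (verit, best) norm_ge_zero zero_le_mult_iff)
  have sub: "cball (of_real x) r \<subseteq> strip k"
  proof
    fix w assume "w \<in> cball (complex_of_real x) r"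
    then have "b k * cmod (w - of_real x) \<le> b k * r"
      using b_nonneg by (intro mult_left_mono) (auto simp: dist_norm norm_minus_commute)
    then show "w \<in> strip k" using x r(2) by (auto simp: strip_def intro!: bexI[of _ x])
  qed
  define f where "f w = w - of_real \<kappa> * (cdf k u w - a)" for w
  have "\<exists>!w\<in>cball (complex_of_real x) r. f w = w"
  proof (rule Banach_fix[OF complete_eq_closed[THEN iffD2, OF closed_cball]])
    show "cball (complex_of_real x) r \<noteq> {}" using r0 by simp
    have lip: "dist (f w) (f w') \<le> rate * dist w w'" if "w \<in> cball (of_real x) r" "w' \<in> cball (of_real x) r" for w w'
      using cdf_contraction[OF u subsetD[OF sub that(1)] subsetD[OF sub that(2)], of a] by (simp add: dist_norm f_def)
    show "\<And>w w'. w \<in> cball (of_real x) r \<Longrightarrow> w' \<in> cball (of_real x) r \<Longrightarrow> dist (f w) (f w') \<le> rate * dist w w'"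
      by (rule lip)
    show "f ` cball (of_real x) r \<subseteq> cball (of_real x) r"
    proof (rule image_subsetI)
      fix w assume w: "w \<in> cball (complex_of_real x) r"
      have "dist (f w) (of_real x) \<le> dist (f w) (f (of_real x)) + dist (f (of_real x)) (of_real x)"
        by (rule dist_triangle)
      also have "\<dots> \<le> rate * r + \<kappa> * cmod (cdf k u (of_real x) - a)"
      proof (rule add_mono)
        have "dist (f w) (f (of_real x)) \<le> rate * dist w (of_real x)" using w r0 by (intro lip) auto
        also have "\<dots> \<le> rate * r" using w rate_bounds by (intro mult_left_mono) (auto simp: dist_commute)
        finally show "dist (f w) (f (of_real x)) \<le> rate * r" .
        show "dist (f (of_real x)) (of_real x) \<le> \<kappa> * cmod (cdf k u (of_real x) - a)"
          using \<kappa>_pos by (simp add: f_def dist_norm norm_mult)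
      qed
      also have "\<dots> = rate * r + (1 - rate) * (stab * cmod (cdf k u (of_real x) - a))"
        using rate_bounds by (simp add: stab_def)
      also have "\<dots> \<le> rate * r + (1 - rate) * r"
        using r(1) rate_bounds by (intro add_left_mono mult_left_mono) auto
      finally show "f w \<in> cball (of_real x) r" by (simp add: dist_commute algebra_simps)
    qed
  qed (use rate_bounds in auto)
  then obtain w where w: "w \<in> cball (of_real x) r" "f w = w" by blast
  then have "cdf k u w = a" using \<kappa>_pos by (auto simp: f_def)
  then show ?thesis using that w sub by (auto simp: dist_norm norm_minus_commute)
qed

lemma cdf_inj: "u \<in> nbhd b k (\<delta> / 2) \<Longrightarrow> w \<in> strip k \<Longrightarrow> w' \<in> strip k \<Longrightarrow> cdf k u w = cdf k u w' \<Longrightarrow> w = w'"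
  using cdf_expand[of u k w w'] by simp

lemma cdf_cong:
  assumes "u \<in> nbhd b k (\<delta> / 2)" "w \<in> strip k" "\<And>j. j < k \<Longrightarrow> u j = u' j"
  shows "cdf k u w = cdf k u' w"
proof -
  have "\<phi> k (u(k := mid w t)) = \<phi> k (u'(k := mid w t))" if "t \<in> space mu1" for t
    using that assms by (intro curve_hol_cong[OF \<phi>_hol] strip_nbhd mid_strip) (auto simp: space_mu1)
  then show ?thesis unfolding cdf_def by (simp cong: Bochner_Integration.integral_cong)
qed

text \<open>Subtracting the uniform distribution function \<open>(x + 1) / 2\<close> leaves a
  function of size \<open>A * b k\<close> by \<open>\<phi>_one\<close>, and
  \<open>curve_hol_lipschitz\<close> turns this small size into a small Lipschitz constant. Without
  the subtraction the factor \<open>b k\<close> would be lost.\<close>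

lemma cdf_variation:
  assumes x: "x \<in> {-1..1}" and u: "u \<in> nbhd b k (\<delta> / 4)" "u' \<in> nbhd b k (\<delta> / 2)"
  shows "cmod (cdf k u' (of_real x) - cdf k u (of_real x)) \<le> 16 * A * b k / \<delta> * sdist k u' u"
proof -
  define h where "h u = cdf k u (of_real x) - (of_real x + 1) / 2" for u
  have hol: "curve_hol b k (\<delta> / 2) h"
  proof (rule curve_holI)
    fix S \<zeta> assume "open S" "\<And>j. j < k \<Longrightarrow> (\<lambda>s. \<zeta> s j) holomorphic_on S" "\<And>s. s \<in> S \<Longrightarrow> \<zeta> s \<in> nbhd b k (\<delta> / 2)"
    then show "(\<lambda>s. h (\<zeta> s)) holomorphic_on S"
      unfolding h_def by (intro holomorphic_intros cdf_hol) (use real_in_strip[OF x] in auto)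
  qed
  have bd: "cmod (h u) \<le> A * b k" if u: "u \<in> nbhd b k (\<delta> / 2)" for u
  proof -
    have *: "cmod (\<phi> k (u(k := mid (of_real x) t)) - 1) \<le> A * b k" if t: "t \<in> {-1..1}" for t
    proof -
      define x' where "x' = -1 + (t + 1) / 2 * (x + 1)"
      have e: "mid (of_real x) t = of_real x'" by (simp add: mid_def x'_def)
      have "(1 - (t + 1) / 2) *\<^sub>R (-1) + ((t + 1) / 2) *\<^sub>R x \<in> {-1..1::real}"
        using t x by (intro convexD) auto
      moreover have "(1 - (t + 1) / 2) *\<^sub>R (-1) + ((t + 1) / 2) *\<^sub>R x = x'" by (simp add: x'_def field_simps)
      ultimately have x': "x' \<in> {-1..1}" by simp
      obtain y where y: "y \<in> cube" "sdist k u (complex_of_real \<circ> y) \<le> \<delta> / 2" using u nbhd_sdist by auto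
      \<comment> \<open>Coordinate k of the centre is moved to the real point x' itself, so the
        distance term in \<open>\<phi>_one\<close> vanishes.\<close>
      have "sdist (Suc k) (u(k := of_real x')) (complex_of_real \<circ> y(k := x')) = sdist k u (complex_of_real \<circ> y)"
        unfolding sdist_Suc by (simp) (rule sdist_cong, auto)
      then have "near b (Suc k) \<delta> (y(k := x')) (u(k := of_real x'))" unfolding near_sdist using y \<delta>_pos by simp
      moreover have "y(k := x') \<in> cube" using y x' by (auto simp: cube_def)
      ultimately have "cmod (\<phi> k (u(k := of_real x')) - 1) \<le> A * b k * (1 + cmod ((u(k := of_real x')) k - of_real ((y(k := x')) k)))"
        by (rule \<phi>_one[rotated])
      then show ?thesis by (simp add: e)
    qed
    have m: "(\<lambda>t. \<phi> k (u(k := mid (of_real x) t))) \<in> borel_measurable mu1"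
      by (rule measurable_\<phi>_mid[OF u real_in_strip[OF x]])
    interpret prob_space mu1 by (rule prob_space_mu1)
    have i: "integrable mu1 (\<lambda>t. \<phi> k (u(k := mid (of_real x) t)))"
      using m \<phi>_le[OF strip_nbhd[OF u mid_strip[OF real_in_strip[OF x]]]]
      by (intro integrable_const_bound[where B = K]) (auto simp: space_mu1)
    have "h u = (of_real x + 1) / 2 * (\<integral>t. \<phi> k (u(k := mid (of_real x) t)) - 1 \<partial>mu1)"
      using i by (simp add: h_def cdf_def prob_space algebra_simps add_divide_distrib)
    also have "cmod \<dots> = cmod ((of_real x + 1) / 2) * cmod (\<integral>t. \<phi> k (u(k := mid (of_real x) t)) - 1 \<partial>mu1)"
      by (rule norm_mult)
    also have "\<dots> \<le> 1 * (A * b k)"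
    proof (rule mult_mono)
      have "(of_real x + 1) / 2 = complex_of_real ((x + 1) / 2)" by simp
      then have "cmod ((of_real x + 1) / 2) = \<bar>(x + 1) / 2\<bar>" by (simp only: norm_of_real)
      then show "cmod ((of_real x + 1) / 2) \<le> 1" using x by auto
      have "cmod (\<integral>t. \<phi> k (u(k := mid (of_real x) t)) - 1 \<partial>mu1) \<le> (\<integral>t. A * b k \<partial>mu1)"
        using i * by (intro Bochner_Integration.integral_norm_bound_integral) (auto simp: space_mu1)
      then show "cmod (\<integral>t. \<phi> k (u(k := mid (of_real x) t)) - 1 \<partial>mu1) \<le> A * b k" by (simp add: prob_space)
    qed auto
    finally show ?thesis by simp
  qed
  have "cmod (h u' - h u) \<le> 8 * (A * b k) / (\<delta> / 2) * sdist k u' u"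
    by (rule curve_hol_lipschitz[OF hol bd]) (use u \<delta>_pos in auto)
  then show ?thesis by (simp add: h_def)
qed

lemma cdf_real:
  assumes y: "y \<in> cube" and x: "x \<in> {-1..1}"
  shows "cdf k (complex_of_real \<circ> y) (of_real x) \<in> \<real>"
proof -
  have "\<phi> k ((complex_of_real \<circ> y)(k := mid (of_real x) t)) \<in> \<real>" if t: "t \<in> {-1..1}" for t
  proof -
    define x' where "x' = -1 + (t + 1) / 2 * (x + 1)"
    have "(1 - (t + 1) / 2) *\<^sub>R (-1) + ((t + 1) / 2) *\<^sub>R x \<in> {-1..1::real}"
      using t x by (intro convexD) auto
    moreover have "(1 - (t + 1) / 2) *\<^sub>R (-1) + ((t + 1) / 2) *\<^sub>R x = x'" by (simp add: x'_def field_simps)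
    ultimately have x': "x' \<in> {-1..1}" by simp
    have "(complex_of_real \<circ> y)(k := mid (of_real x) t) = complex_of_real \<circ> y(k := x')"
      by (auto simp: mid_def x'_def fun_eq_iff)
    then show ?thesis using \<phi>_real[of "y(k := x')" k] y x' by (auto simp: cube_def)
  qed
  then have "(\<integral>t. \<phi> k ((complex_of_real \<circ> y)(k := mid (of_real x) t)) \<partial>mu1) =
      (\<integral>t. of_real (Re (\<phi> k ((complex_of_real \<circ> y)(k := mid (of_real x) t)))) \<partial>mu1)"
    by (intro Bochner_Integration.integral_cong) (auto simp: space_mu1)
  then have "(\<integral>t. \<phi> k ((complex_of_real \<circ> y)(k := mid (of_real x) t)) \<partial>mu1) \<in> \<real>"
    by (simp only: integral_complex_of_real) simp
  then show ?thesis by (simp add: cdf_def)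
qed

lemma Re_cdf_deriv:
  assumes y: "y \<in> cube" and x: "x \<in> {-1..1}"
  shows "((\<lambda>x. Re (cdf k (complex_of_real \<circ> y) (of_real x))) has_real_derivative Re (\<phi> k (complex_of_real \<circ> y(k := x))) / 2) (at x within S)"
proof -
  have u: "complex_of_real \<circ> y \<in> nbhd b k (\<delta> / 2)" using y \<delta>_pos by (intro cube_in_nbhd) auto
  have e: "(complex_of_real \<circ> y)(k := of_real x) = complex_of_real \<circ> y(k := x)" by (auto simp: fun_eq_iff)
  have "((\<lambda>x. cdf k (complex_of_real \<circ> y) (of_real x)) has_vector_derivative \<phi> k (complex_of_real \<circ> y(k := x)) / 2) (at x within S)"
  proof -
    have "(of_real has_vector_derivative (1::complex)) (at x within S)"
      by (auto simp: has_vector_derivative_def scaleR_conv_of_real intro!: derivative_eq_intros)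
    moreover have "(cdf k (complex_of_real \<circ> y) has_field_derivative \<phi> k (complex_of_real \<circ> y(k := x)) / 2) (at (of_real x) within of_real ` S)"
      using cdf_deriv[OF u real_in_strip[OF x, of k]] unfolding e by (rule has_field_derivative_at_within)
    ultimately show ?thesis
      using field_vector_diff_chain_within[of of_real 1 x S "cdf k (complex_of_real \<circ> y)"] by (simp add: o_def)
  qed
  then show ?thesis
    unfolding has_real_derivative_iff_has_vector_derivative
    using bounded_linear.has_vector_derivative[OF bounded_linear_Re, of "\<lambda>x. cdf k (complex_of_real \<circ> y) (of_real x)"] by fastforce
qed

end

section \<open>The complexified triangular transport\<close>

locale density_pair = weights b + R: density_family b \<phi>\<^sub>R \<delta> m K A + P: density_family b \<phi>\<^sub>P \<delta> m K A
  for b \<phi>\<^sub>R \<phi>\<^sub>P \<delta> m K A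
begin

text \<open>The recursion pads the earlier components with 0; by \<open>cdf_cong\<close> the value
  of \<open>P.cdf k\<close> is determined by the coordinates below k. Restricting to the strip makes
  the solution unique (\<open>cdf_inj\<close>); existence is shown only near the cube.\<close>

fun transport :: "nat \<Rightarrow> (nat \<Rightarrow> complex) \<Rightarrow> complex" where
  "transport k z = (THE w. w \<in> R.strip k \<and>
     P.cdf k (\<lambda>j. if j < k then transport j z else 0) w = R.cdf k z (z k))"

declare transport.simps [simp del]

lemma transport_eqI:
  assumes "(\<lambda>j. if j < k then transport j z else 0) \<in> nbhd b k (\<delta> / 2)" "w \<in> R.strip k"
    "P.cdf k (\<lambda>j. if j < k then transport j z else 0) w = R.cdf k z (z k)"
  shows "transport k z = w"
  unfolding transport.simps[of k z]
  by (rule the_equality) (use assms P.cdf_inj[OF assms(1)] in auto)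

text \<open>For real arguments this is the Knothe--Rosenblatt transport; see \<open>KR_rtrans\<close>.\<close>

definition rtrans :: "(nat \<Rightarrow> real) \<Rightarrow> nat \<Rightarrow> real" where
  "rtrans y k = Re (transport k (complex_of_real \<circ> y))"

lemma (in density_family) Re_cdf_mono:
  assumes y: "y \<in> cube" and x: "-1 \<le> x" "x \<le> x'" "x' \<le> 1"
  shows "Re (cdf k (complex_of_real \<circ> y) (of_real x)) + m / 2 * (x' - x) \<le> Re (cdf k (complex_of_real \<circ> y) (of_real x'))"
proof -
  have "Re (cdf k (complex_of_real \<circ> y) (of_real x)) - m / 2 * x \<le> Re (cdf k (complex_of_real \<circ> y) (of_real x')) - m / 2 * x'"
  proof (rule DERIV_nonneg_imp_nondecreasing[OF x(2)])
    fix t assume t: "x \<le> t" "t \<le> x'"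
    then have t1: "t \<in> {-1..1}" using x by auto
    have "complex_of_real \<circ> y(k := t) \<in> nbhd b (Suc k) \<delta>"
      using y t1 \<delta>_pos by (intro cube_in_nbhd) (auto simp: cube_def)
    then have "m \<le> Re (\<phi> k (complex_of_real \<circ> y(k := t)))" by (rule \<phi>_ge)
    moreover have "((\<lambda>x. Re (cdf k (complex_of_real \<circ> y) (of_real x)) - m / 2 * x) has_real_derivative
       Re (\<phi> k (complex_of_real \<circ> y(k := t))) / 2 - m / 2) (at t)"
      by (rule derivative_eq_intros Re_cdf_deriv[OF y t1] refl)+ simp
    ultimately show "\<exists>d. ((\<lambda>x. Re (cdf k (complex_of_real \<circ> y) (of_real x)) - m / 2 * x) has_real_derivative d) (at t) \<and> 0 \<le> d"
      by (auto intro!: exI[of _ "Re (\<phi> k (complex_of_real \<circ> y(k := t))) / 2 - m / 2"])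
  qed
  then show ?thesis by (simp add: right_diff_distrib diff_divide_distrib)
qed

text \<open>For real y both distribution functions are real and run from 0 to 1, so the intermediate
  value theorem yields a solution in the interval; uniqueness in the strip identifies it with the
  complex one. The claims are proved together because component k is solved at the earlier
  components, which must be known to be real and in the interval.\<close>

lemma rtrans_props:
  assumes y: "y \<in> cube"
  shows "rtrans y k \<in> {-1..1} \<and> transport k (complex_of_real \<circ> y) = of_real (rtrans y k) \<and>
    P.cdf k (\<lambda>j. if j < k then of_real (rtrans y j) else 0) (of_real (rtrans y k)) = R.cdf k (complex_of_real \<circ> y) (of_real (y k))"
proof (induction k rule: less_induct)
  case (less k)
  define v where "v j = (if j < k then rtrans y j else 0)" for j
  have v: "v \<in> cube" using less by (auto simp: v_def cube_def)
  have u: "(\<lambda>j. if j < k then transport j (complex_of_real \<circ> y) else 0) = complex_of_real \<circ> v"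
  proof
    fix j
    show "(if j < k then transport j (complex_of_real \<circ> y) else 0) = (complex_of_real \<circ> v) j"
    proof (cases "j < k")
      case True
      then have "transport j (complex_of_real \<circ> y) = of_real (rtrans y j)" using less.IH by blast
      then show ?thesis unfolding v_def o_apply if_P[OF True] .
    qed (simp add: v_def)
  qed
  have vn: "complex_of_real \<circ> v \<in> nbhd b k (\<delta> / 2)" using v R.\<delta>_pos by (intro cube_in_nbhd) auto
  have yk: "y k \<in> {-1..1}" using y by (auto simp: cube_def)
  define a where "a = Re (R.cdf k (complex_of_real \<circ> y) (of_real (y k)))"
  have a: "R.cdf k (complex_of_real \<circ> y) (of_real (y k)) = of_real a"
    using R.cdf_real[OF y yk, of k] by (simp add: a_def)
  have "0 \<le> a" using R.Re_cdf_mono[OF y, of "-1" "y k" k] yk R.m_pos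
    by (simp add: a_def) (smt (verit, best) mult_nonneg_nonneg divide_nonneg_nonneg)
  moreover have "a \<le> 1" using R.Re_cdf_mono[OF y, of "y k" 1 k] yk R.m_pos R.cdf_1[OF y, of k]
    by (simp add: a_def) (smt (verit, best) mult_nonneg_nonneg divide_nonneg_nonneg)
  moreover have "continuous_on {-1..1} (\<lambda>x. Re (P.cdf k (complex_of_real \<circ> v) (of_real x)))"
    unfolding continuous_on_eq_continuous_within
    using DERIV_continuous[OF P.Re_cdf_deriv[OF v]] by blast
  ultimately obtain x where x: "-1 \<le> x" "x \<le> 1" "Re (P.cdf k (complex_of_real \<circ> v) (of_real x)) = a"
    using IVT'[of "\<lambda>x. Re (P.cdf k (complex_of_real \<circ> v) (of_real x))" "-1" a 1] P.cdf_1[OF v, of k] by auto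
  have x1: "x \<in> {-1..1}" using x by auto
  have "P.cdf k (complex_of_real \<circ> v) (of_real x) = of_real a"
    using P.cdf_real[OF v x1, of k] x(3) by (metis Reals_cases Re_complex_of_real)
  then have e: "transport k (complex_of_real \<circ> y) = of_real x"
    using vn a P.real_in_strip[OF x1] by (intro transport_eqI) (auto simp: u)
  then have r: "rtrans y k = x" by (simp add: rtrans_def)
  have "(\<lambda>j. if j < k then of_real (rtrans y j) else 0) = complex_of_real \<circ> v"
    by (auto simp: v_def)
  then show ?case unfolding r
    using e x1 a \<open>P.cdf k (complex_of_real \<circ> v) (of_real x) = of_real a\<close> by (intro conjI) (simp_all only:)
qed

lemma rtrans_cube: "y \<in> cube \<Longrightarrow> rtrans y \<in> cube"
  using rtrans_props by (auto simp: cube_def)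

lemma transport_real: "y \<in> cube \<Longrightarrow> transport k (complex_of_real \<circ> y) = of_real (rtrans y k)"
  using rtrans_props by blast

lemma rtrans_cdf:
  assumes y: "y \<in> cube"
  shows "P.cdf k (complex_of_real \<circ> rtrans y) (of_real (rtrans y k)) = R.cdf k (complex_of_real \<circ> y) (of_real (y k))"
proof -
  have "P.cdf k (complex_of_real \<circ> rtrans y) (of_real (rtrans y k)) = P.cdf k (\<lambda>j. if j < k then of_real (rtrans y j) else 0) (of_real (rtrans y k))"
    using rtrans_cube[OF y] rtrans_props[OF y, of k] R.\<delta>_pos
    by (intro P.cdf_cong P.real_in_strip cube_in_nbhd) auto
  then show ?thesis using rtrans_props[OF y, of k] by simp
qed

text \<open>\<open>gain\<close> is the inverse Lipschitz constant \<open>stab\<close> times the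
  constants of \<open>cdf_variation\<close> (with \<open>b k\<close> split off) and of
  \<open>cdf_lipschitz\<close>. \<open>growth\<close> is the resulting Gronwall factor, bounded
  through \<open>sum_b_squares\<close>, and \<open>\<delta>\<^sub>1\<close> is chosen so that images
  are displaced by at most \<open>\<delta> / 8\<close> in total.\<close>

definition gain :: real where "gain = R.stab * max (16 * A / \<delta>) (K / 2)"
definition growth :: real where "growth = exp (gain * (suminf b)\<^sup>2) * (gain + 1)"
definition \<delta>\<^sub>1 :: real where "\<delta>\<^sub>1 = \<delta> / (8 * growth)"

lemma gain_pos: "0 < gain"
  unfolding gain_def by (intro mult_pos_pos R.stab_pos) (use R.K_pos in auto)

lemma growth_ge1: "1 \<le> growth"
  using gain_pos mult_mono[of 1 "exp (gain * (suminf b)\<^sup>2)" 1 "gain + 1"] by (simp add: growth_def)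

lemma \<delta>\<^sub>1: "0 < \<delta>\<^sub>1" "growth * \<delta>\<^sub>1 = \<delta> / 8" "\<delta>\<^sub>1 \<le> \<delta> / 8"
  using growth_ge1 R.\<delta>_pos by (auto simp: \<delta>\<^sub>1_def field_simps)

lemma sum_b_squares: "(\<Sum>j<n. (b j)\<^sup>2) \<le> (suminf b)\<^sup>2"
proof -
  have "(\<Sum>j<n. (b j)\<^sup>2) \<le> (\<Sum>j<n. b j)\<^sup>2"
  proof (induction n)
    case (Suc n)
    have "0 \<le> sum b {..<n} * b n" by (intro mult_nonneg_nonneg sum_nonneg b_nonneg)
    then show ?case using Suc by (simp add: power2_sum)
  qed simp
  also have "\<dots> \<le> (suminf b)\<^sup>2"
    by (intro power_mono sum_le_suminf b_summable sum_nonneg) (auto simp: b_nonneg)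
  finally show ?thesis .
qed

text \<open>A discrete Gronwall argument: the displacement of component \<open>k\<close> is controlled by \<open>b k\<close> times the weighted
  displacements of the earlier components, and the weights \<open>b\<close> are square-summable.\<close>

lemma transport_main:
  assumes y: "y \<in> cube"
  defines "t \<equiv> complex_of_real \<circ> rtrans y"
  defines "D \<equiv> \<lambda>n z. sdist n z (complex_of_real \<circ> y)" and "Q \<equiv> \<lambda>n z. sdist n (\<lambda>j. transport j z) t + sdist n z (complex_of_real \<circ> y)"
  assumes z: "near b n \<delta>\<^sub>1 y z"
  shows "Q n z \<le> exp (gain * (\<Sum>j<n. (b j)\<^sup>2)) * (gain + 1) * D n z \<and>
    (\<forall>k<n. transport k z \<in> R.strip k \<and> P.cdf k (\<lambda>j. transport j z) (transport k z) = R.cdf k z (z k) \<and>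
      cmod (transport k z - t k) \<le> gain * (b k * Q k z + cmod (z k - of_real (y k))))"
  using z
proof (induction n)
  case 0
  then show ?case by (simp add: Q_def D_def sdist_def)
next
  case (Suc n)
  have D: "D (Suc n) z \<le> \<delta>\<^sub>1" using Suc.prems by (simp add: near_sdist D_def)
  have Ds: "D (Suc n) z = D n z + b n * cmod (z n - of_real (y n))" by (simp add: D_def sdist_Suc)
  have D0: "0 \<le> D n z" by (simp add: D_def sdist_nonneg)
  have bz: "0 \<le> b n * cmod (z n - of_real (y n))" using b_nonneg by simp
  have "near b n \<delta>\<^sub>1 y z" using D Ds bz by (simp add: near_sdist D_def)
  note IH = Suc.IH[OF this]
  define X where "X = exp (gain * (\<Sum>j<n. (b j)\<^sup>2)) * (gain + 1)"
  have Xg: "exp (gain * (\<Sum>j<n. (b j)\<^sup>2)) * (gain + 1) \<le> growth" for n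
    unfolding growth_def using gain_pos sum_b_squares[of n] by (intro mult_right_mono) auto
  have QX: "Q n z \<le> X * D n z" using IH by (simp add: X_def)
  have Q0: "0 \<le> Q n z" by (simp add: Q_def sdist_nonneg)
  have X1: "gain + 1 \<le> X" unfolding X_def
    using gain_pos mult_right_mono[of 1 "exp (gain * (\<Sum>j<n. (b j)\<^sup>2))" "gain + 1"] by (simp add: sum_nonneg)
  \<comment> \<open>The recursion of the Gronwall argument, closed by
    \<open>1 + x \<le> exp x\<close>. The 1 in \<open>gain + 1\<close> pays for the displacement of
    z itself, which is part of Q.\<close>
  have step: "Q n z + gain * (b n)\<^sup>2 * Q n z + (gain + 1) * (b n * cmod (z n - of_real (y n))) \<le>
      exp (gain * (\<Sum>j<Suc n. (b j)\<^sup>2)) * (gain + 1) * D (Suc n) z"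
  proof -
    define e where "e = exp (gain * (b n)\<^sup>2)"
    have e1: "1 + gain * (b n)\<^sup>2 \<le> e" unfolding e_def by (rule exp_ge_add_one_self)
    have e2: "1 \<le> e" unfolding e_def using gain_pos by simp
    have eX: "exp (gain * (\<Sum>j<Suc n. (b j)\<^sup>2)) * (gain + 1) = e * X"
      by (simp add: e_def X_def exp_add distrib_left)
    have "(1 + gain * (b n)\<^sup>2) * Q n z \<le> e * (X * D n z)"
      using e1 QX Q0 e2 by (intro mult_mono) auto
    moreover have "(gain + 1) * (b n * cmod (z n - of_real (y n))) \<le> e * X * (b n * cmod (z n - of_real (y n)))"
      using X1 e2 gain_pos mult_mono[of 1 e "gain + 1" X] by (intro mult_right_mono bz) auto
    ultimately show ?thesis unfolding eX Ds by (simp add: algebra_simps)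
  qed
  have step2: "exp (gain * (\<Sum>j<Suc n. (b j)\<^sup>2)) * (gain + 1) * D (Suc n) z \<le> \<delta> / 8"
  proof -
    have "exp (gain * (\<Sum>j<Suc n. (b j)\<^sup>2)) * (gain + 1) * D (Suc n) z \<le> growth * \<delta>\<^sub>1"
      using Xg[of "Suc n"] D growth_ge1 D0 bz Ds by (intro mult_mono) auto
    then show ?thesis using \<delta>\<^sub>1 by simp
  qed
  \<comment> \<open>Radius of the disc in which component n is to be found; \<open>br8\<close> shows
    that \<open>b n * r\<close> uses at most \<open>\<delta> / 8\<close> of the budget.\<close>
  define r where "r = gain * (b n * Q n z + cmod (z n - of_real (y n)))"
  have br: "b n * r = gain * (b n)\<^sup>2 * Q n z + gain * (b n * cmod (z n - of_real (y n)))"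
    by (simp add: r_def power2_eq_square algebra_simps)
  have br8: "Q n z + b n * r + b n * cmod (z n - of_real (y n)) \<le> \<delta> / 8"
    using step step2 unfolding br by (simp add: algebra_simps)
  define u where "u j = (if j < n then transport j z else 0)" for j
  have su: "sdist n u t = sdist n (\<lambda>j. transport j z) t"
    by (rule sdist_cong) (auto simp: u_def)
  have S8: "sdist n u t \<le> Q n z" by (simp add: su Q_def sdist_nonneg)
  have br0: "0 \<le> b n * r" unfolding br using gain_pos Q0 bz by auto
  have Q8: "Q n z \<le> \<delta> / 8" using br8 br0 bz by linarith
  have u2: "u \<in> nbhd b n (\<delta> / 2)" unfolding nbhd_sdist using S8 Q8 R.\<delta>_pos rtrans_cube[OF y]
    by (auto simp: t_def intro!: bexI[of _ "rtrans y"])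
  have t4: "t \<in> nbhd b n (\<delta> / 4)" unfolding t_def using rtrans_cube[OF y] R.\<delta>_pos by (intro cube_in_nbhd) auto
  have y4: "complex_of_real \<circ> y \<in> nbhd b n (\<delta> / 4)" using y R.\<delta>_pos by (intro cube_in_nbhd) auto
  have z2: "z \<in> nbhd b n (\<delta> / 2)" unfolding nbhd_sdist
    using D Ds bz \<delta>\<^sub>1 R.\<delta>_pos y by (auto simp: D_def intro!: bexI[of _ y])
  have yn: "y n \<in> {-1..1}" "rtrans y n \<in> {-1..1}" using y rtrans_cube[OF y] by (auto simp: cube_def)
  have zs: "z n \<in> R.strip n" unfolding R.strip_def
    using D Ds D0 \<delta>\<^sub>1 R.\<delta>_pos yn by (auto intro!: bexI[of _ "y n"])
  define a where "a = R.cdf n z (z n)"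
  have v1: "cmod (P.cdf n u (of_real (rtrans y n)) - P.cdf n t (of_real (rtrans y n))) \<le> 16 * A * b n / \<delta> * sdist n u t"
    by (rule P.cdf_variation[OF yn(2) t4 u2])
  have v2: "cmod (R.cdf n z (of_real (y n)) - R.cdf n (complex_of_real \<circ> y) (of_real (y n))) \<le> 16 * A * b n / \<delta> * D n z"
    unfolding D_def by (rule R.cdf_variation[OF yn(1) y4 z2])
  have v3: "cmod (R.cdf n z (z n) - R.cdf n z (of_real (y n))) \<le> K / 2 * cmod (z n - of_real (y n))"
    by (rule R.cdf_lipschitz[OF z2 zs R.real_in_strip[OF yn(1)]])
  have e: "P.cdf n t (of_real (rtrans y n)) = R.cdf n (complex_of_real \<circ> y) (of_real (y n))"
    unfolding t_def by (rule rtrans_cdf[OF y])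
  have "cmod (P.cdf n u (of_real (rtrans y n)) - a) \<le> 16 * A * b n / \<delta> * sdist n u t + 16 * A * b n / \<delta> * D n z + K / 2 * cmod (z n - of_real (y n))"
  proof -
    \<comment> \<open>At the real point both distribution functions agree, so the defect is a sum of
      three variations: of the earlier image coordinates, of the earlier source coordinates, and of
      coordinate n.\<close>
    have "P.cdf n u (of_real (rtrans y n)) - a = (P.cdf n u (of_real (rtrans y n)) - P.cdf n t (of_real (rtrans y n)))
       - (R.cdf n z (of_real (y n)) - R.cdf n (complex_of_real \<circ> y) (of_real (y n))) - (R.cdf n z (z n) - R.cdf n z (of_real (y n)))"
      using e by (simp add: a_def)
    then show ?thesis using v1 v2 v3 norm_triangle_ineq4 by (smt (verit, best))
  qed
  also have "\<dots> = 16 * A / \<delta> * (b n * Q n z) + K / 2 * cmod (z n - of_real (y n))"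
    by (simp add: Q_def D_def su algebra_simps)
  also have "\<dots> \<le> max (16 * A / \<delta>) (K / 2) * (b n * Q n z) + max (16 * A / \<delta>) (K / 2) * cmod (z n - of_real (y n))"
    using b_nonneg Q0 by (intro add_mono mult_right_mono) auto
  finally have "R.stab * cmod (P.cdf n u (of_real (rtrans y n)) - a) \<le> R.stab * (max (16 * A / \<delta>) (K / 2) * (b n * Q n z) + max (16 * A / \<delta>) (K / 2) * cmod (z n - of_real (y n)))"
    using R.stab_pos by (intro mult_left_mono) auto
  also have "\<dots> = r" by (simp add: r_def gain_def algebra_simps)
  finally have sr: "R.stab * cmod (P.cdf n u (of_real (rtrans y n)) - a) \<le> r" .
  have "b n * r < \<delta> / 2" using br8 Q0 bz R.\<delta>_pos by linarith
  from P.cdf_solution[OF u2 yn(2) sr this]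
  obtain w where w: "w \<in> R.strip n" "P.cdf n u w = a" "cmod (w - of_real (rtrans y n)) \<le> r" by blast
  have tw: "transport n z = w"
    by (rule transport_eqI) (use u2 w in \<open>simp_all add: u_def[abs_def] a_def\<close>)
  have "P.cdf n (\<lambda>j. transport j z) w = a"
    using P.cdf_cong[OF u2 w(1), of "\<lambda>j. transport j z"] w(2) by (simp add: u_def)
  then have new: "transport n z \<in> R.strip n \<and> P.cdf n (\<lambda>j. transport j z) (transport n z) = R.cdf n z (z n) \<and>
      cmod (transport n z - t n) \<le> gain * (b n * Q n z + cmod (z n - of_real (y n)))"
    using w tw by (simp add: a_def t_def r_def)
  have "b n * cmod (transport n z - t n) \<le> b n * r"
    using w(3) tw b_nonneg by (intro mult_left_mono) (auto simp: t_def)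
  then have "Q (Suc n) z \<le> Q n z + b n * r + b n * cmod (z n - of_real (y n))"
    by (simp add: Q_def sdist_Suc)
  then have "Q (Suc n) z \<le> exp (gain * (\<Sum>j<Suc n. (b j)\<^sup>2)) * (gain + 1) * D (Suc n) z"
    using step unfolding br by (simp add: algebra_simps)
  then show ?case using new IH less_Suc_eq by auto
qed

lemma transport_near:
  assumes y: "y \<in> cube" and z: "near b n \<delta>\<^sub>1 y z"
  shows "near b n (\<delta> / 8) (rtrans y) (\<lambda>j. transport j z)" (is ?near)
    and "k < n \<Longrightarrow> transport k z \<in> R.strip k"
    and "k < n \<Longrightarrow> P.cdf k (\<lambda>j. transport j z) (transport k z) = R.cdf k z (z k)"
    and "k < n \<Longrightarrow> cmod (transport k z - of_real (rtrans y k)) \<le> gain * (b k * (\<delta> / 8) + cmod (z k - of_real (y k)))"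

proof -
  have Q8: "sdist n (\<lambda>j. transport j z) (complex_of_real \<circ> rtrans y) + sdist n z (complex_of_real \<circ> y) \<le> \<delta> / 8" if "near b n \<delta>\<^sub>1 y z" for n
  proof -
    have "exp (gain * (\<Sum>j<n. (b j)\<^sup>2)) * (gain + 1) * sdist n z (complex_of_real \<circ> y) \<le> growth * \<delta>\<^sub>1"
      using gain_pos sum_b_squares[of n] growth_ge1 that sdist_nonneg[of n z "complex_of_real \<circ> y"] unfolding growth_def
      by (intro mult_mono) (auto simp: near_sdist)
    then show ?thesis using transport_main[OF y that] \<delta>\<^sub>1 by simp
  qed
  have near_le: "near b k \<delta>\<^sub>1 y z" if "k \<le> n" for k
    using z sdist_less_Suc[OF that, of z "complex_of_real \<circ> y"] by (simp add: near_sdist)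
  show ?near using Q8[OF z] sdist_nonneg[of n z "complex_of_real \<circ> y"] by (simp add: near_sdist)
  show "k < n \<Longrightarrow> transport k z \<in> R.strip k" "k < n \<Longrightarrow> P.cdf k (\<lambda>j. transport j z) (transport k z) = R.cdf k z (z k)"
    using transport_main[OF y z] by auto
  assume k: "k < n"
  have "cmod (transport k z - of_real (rtrans y k)) \<le> gain * (b k * (sdist k (\<lambda>j. transport j z) (complex_of_real \<circ> rtrans y) + sdist k z (complex_of_real \<circ> y)) + cmod (z k - of_real (y k)))"
    using transport_main[OF y z] k by simp
  also have "\<dots> \<le> gain * (b k * (\<delta> / 8) + cmod (z k - of_real (y k)))"
    using gain_pos b_nonneg Q8[OF near_le[of k]] k by (intro mult_left_mono add_right_mono) auto
  finally show "cmod (transport k z - of_real (rtrans y k)) \<le> gain * (b k * (\<delta> / 8) + cmod (z k - of_real (y k)))" .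
qed

text \<open>An implicit function theorem by hand: near a point the solution is the uniform limit of
  the iterates of the contraction, each of which is holomorphic by \<open>cdf_hol\<close>. Halving
  \<open>\<delta>\<^sub>1\<close> leaves room for a whole disc of parameters with one common centre
  y.\<close>

lemma transport_hol: "curve_hol b (Suc k) (\<delta>\<^sub>1 / 2) (transport k)"
proof (induction k rule: less_induct)
  case (less k)
  show ?case
  proof (rule curve_holI)
    fix S \<zeta> assume S: "open S" and \<zeta>: "\<And>j. j < Suc k \<Longrightarrow> (\<lambda>s. \<zeta> s j) holomorphic_on S"
      and nb: "\<And>s. s \<in> S \<Longrightarrow> \<zeta> s \<in> nbhd b (Suc k) (\<delta>\<^sub>1 / 2)"
    have "(\<lambda>s. transport k (\<zeta> s)) field_differentiable at s0" if s0: "s0 \<in> S" for s0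
    proof -
      obtain y where y: "y \<in> cube" "sdist (Suc k) (\<zeta> s0) (complex_of_real \<circ> y) \<le> \<delta>\<^sub>1 / 2"
        using nb[OF s0] by (auto simp: nbhd_sdist)
      have cont: "continuous_on S (\<lambda>s. \<zeta> s j)" if "j < Suc k" for j
        using \<zeta>[OF that] by (rule holomorphic_on_imp_continuous_on)
      \<comment> \<open>The second condition bounds coordinate k, which the tube leaves unbounded
        when \<open>b k = 0\<close>; uniform convergence of the iteration rests on this
        bound.\<close>
      have "open {s \<in> S. sdist (Suc k) (\<zeta> s) (complex_of_real \<circ> y) < \<delta>\<^sub>1 \<and> cmod (\<zeta> s k - of_real (y k)) < cmod (\<zeta> s0 k - of_real (y k)) + 1}"
      proof -
        have "continuous_on S (\<lambda>s. sdist (Suc k) (\<zeta> s) (complex_of_real \<circ> y))"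
          unfolding sdist_def by (intro continuous_intros cont) auto
        moreover have "continuous_on S (\<lambda>s. cmod (\<zeta> s k - of_real (y k)))"
          by (intro continuous_intros cont) auto
        ultimately have "open (S \<inter> (\<lambda>s. sdist (Suc k) (\<zeta> s) (complex_of_real \<circ> y)) -` {..<\<delta>\<^sub>1})"
          "open (S \<inter> (\<lambda>s. cmod (\<zeta> s k - of_real (y k))) -` {..<cmod (\<zeta> s0 k - of_real (y k)) + 1})"
          using S by (auto intro!: continuous_open_preimage)
        from open_Int[OF this] show ?thesis by (rule back_subst[where P = "open"]) auto
      qed
      moreover have "s0 \<in> {s \<in> S. sdist (Suc k) (\<zeta> s) (complex_of_real \<circ> y) < \<delta>\<^sub>1 \<and> cmod (\<zeta> s k - of_real (y k)) < cmod (\<zeta> s0 k - of_real (y k)) + 1}"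
        using s0 y \<delta>\<^sub>1 by auto
      ultimately obtain e where e: "e > 0" "ball s0 e \<subseteq> {s \<in> S. sdist (Suc k) (\<zeta> s) (complex_of_real \<circ> y) < \<delta>\<^sub>1 \<and> cmod (\<zeta> s k - of_real (y k)) < cmod (\<zeta> s0 k - of_real (y k)) + 1}"
        using openE by blast
      define B where "B = ball s0 e"
      have BS: "B \<subseteq> S" using e by (auto simp: B_def)
      have near: "near b (Suc k) \<delta>\<^sub>1 y (\<zeta> s)" if "s \<in> B" for s
        using that e by (auto simp: B_def near_sdist)
      have near_k: "near b k \<delta>\<^sub>1 y (\<zeta> s)" if "s \<in> B" for s
        using near[OF that] b_nonneg by (auto simp: near_def intro: order_trans[rotated])
      define u where "u s j = (if j < k then transport j (\<zeta> s) else 0)" for s j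
      define a where "a s = R.cdf k (\<zeta> s) (\<zeta> s k)" for s
      define x where "x = rtrans y k"
      have x: "x \<in> {-1..1}" using rtrans_cube[OF y(1)] by (auto simp: x_def cube_def)
      have u_hol: "(\<lambda>s. u s j) holomorphic_on B" if "j < k" for j
      proof -
        have "(\<lambda>s. transport j (\<zeta> s)) holomorphic_on S"
          using that nb nbhd_drop[of "Suc j" "Suc k" "\<delta>\<^sub>1 / 2"]
          by (intro curve_holD[OF less[OF that] S] \<zeta>) auto
        then show ?thesis using that BS by (auto simp: u_def holomorphic_on_subset)
      qed
      have u_nb: "u s \<in> nbhd b k (\<delta> / 2)" if "s \<in> B" for s
      proof -
        have "near b k (\<delta> / 8) (rtrans y) (u s)"
          using transport_near(1)[OF y(1) near_k[OF that]] unfolding near_def by (simp add: u_def)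
        then show ?thesis using rtrans_cube[OF y(1)] R.\<delta>_pos nbhd_mono[of "\<delta> / 8" "\<delta> / 2"] by (auto simp: nbhd_def)
      qed
      have a_hol: "a holomorphic_on B"
        unfolding a_def
      proof (rule R.cdf_hol)
        show "open B" by (simp add: B_def)
        show "(\<lambda>s. \<zeta> s j) holomorphic_on B" if "j < k" for j
          using \<zeta>[of j] that BS by (auto intro: holomorphic_on_subset)
        show "(\<lambda>s. \<zeta> s k) holomorphic_on B"
          using \<zeta>[of k] BS by (auto intro: holomorphic_on_subset)
        show "\<zeta> s \<in> nbhd b k (\<delta> / 2)" if "s \<in> B" for s
          using near_k[OF that] y(1) \<delta>\<^sub>1 R.\<delta>_pos nbhd_mono[of "\<delta>\<^sub>1" "\<delta> / 2"] by (auto simp: nbhd_def)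
        show "\<zeta> s k \<in> R.strip k" if "s \<in> B" for s
        proof -
          have "b k * cmod (\<zeta> s k - of_real (y k)) \<le> \<delta>\<^sub>1"
            using near[OF that] sdist_nonneg[of k "\<zeta> s" "complex_of_real \<circ> y"] by (simp add: near_sdist sdist_Suc)
          then show ?thesis unfolding R.strip_def using y(1) \<delta>\<^sub>1 R.\<delta>_pos
            by (auto simp: cube_def intro!: bexI[of _ "y k"])
        qed
      qed
      define w where "w s = transport k (\<zeta> s)" for s
      have w: "w s \<in> R.strip k" "P.cdf k (u s) (w s) = a s" "b k * cmod (w s - of_real x) \<le> \<delta> / 8"
        "cmod (w s - of_real x) \<le> gain * (b k * (\<delta> / 8) + (cmod (\<zeta> s0 k - of_real (y k)) + 1))" if s: "s \<in> B" for s
      proof -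
        note tn = transport_near(1)[OF y(1) near[OF s]] transport_near(2-4)[OF y(1) near[OF s] lessI]
        show 1: "w s \<in> R.strip k" using tn(2) by (simp add: w_def)
        have "P.cdf k (u s) (w s) = P.cdf k (\<lambda>j. transport j (\<zeta> s)) (w s)"
          by (rule P.cdf_cong[OF u_nb[OF s] 1]) (simp add: u_def)
        then show "P.cdf k (u s) (w s) = a s" using tn(3) by (simp add: w_def a_def)
        show "b k * cmod (w s - of_real x) \<le> \<delta> / 8"
          using tn(1) sdist_nonneg[of k "\<lambda>j. transport j (\<zeta> s)" "complex_of_real \<circ> rtrans y"]
          by (simp add: near_sdist sdist_Suc w_def x_def)
        have "gain * (b k * (\<delta> / 8) + cmod (\<zeta> s k - of_real (y k))) \<le> gain * (b k * (\<delta> / 8) + (cmod (\<zeta> s0 k - of_real (y k)) + 1))"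
          using s e gain_pos by (intro mult_left_mono add_left_mono) (auto simp: B_def)
        then show "cmod (w s - of_real x) \<le> gain * (b k * (\<delta> / 8) + (cmod (\<zeta> s0 k - of_real (y k)) + 1))"
          using tn(4) by (simp add: w_def x_def)
      qed
      \<comment> \<open>All iterations start at the same real point x, so the zeroth iterate is
        constant in s.\<close>
      define W where "W n s = ((\<lambda>w. w - of_real R.\<kappa> * (P.cdf k (u s) w - a s)) ^^ n) (of_real x)" for n s
      have W: "cmod (W n s - w s) \<le> R.rate ^ n * cmod (of_real x - w s) \<and> W n s \<in> R.strip k" if s: "s \<in> B" for n s
      proof (induction n)
        case 0
        then show ?case using R.real_in_strip[OF x] by (simp add: W_def)
      next
        case (Suc n)
        have "W (Suc n) s - w s = (W n s - of_real R.\<kappa> * (P.cdf k (u s) (W n s) - a s)) - (w s - of_real R.\<kappa> * (P.cdf k (u s) (w s) - a s))"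
          using w(2)[OF s] by (simp add: W_def)
        then have "cmod (W (Suc n) s - w s) \<le> R.rate * cmod (W n s - w s)"
          using P.cdf_contraction[OF u_nb[OF s], of "W n s" "w s" "a s"] Suc w(1)[OF s] by (simp only:)
        also have "\<dots> \<le> R.rate * (R.rate ^ n * cmod (of_real x - w s))"
          using Suc R.rate_bounds by (intro mult_left_mono) auto
        finally have 1: "cmod (W (Suc n) s - w s) \<le> R.rate ^ Suc n * cmod (of_real x - w s)" by simp
        also have "\<dots> \<le> 1 * cmod (of_real x - w s)"
          using R.rate_bounds by (intro mult_right_mono power_le_one) auto
        \<comment> \<open>An iterate is at most as far from the limit as x is, hence within twice
          that distance of x. This uses \<open>\<delta> / 4\<close> of the budget and stays in the
          strip.\<close>
        finally have "cmod (W (Suc n) s - of_real x) \<le> 2 * cmod (w s - of_real x)"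
          using norm_triangle_ineq[of "W (Suc n) s - w s" "w s - of_real x"] by (simp add: norm_minus_commute)
        then have "b k * cmod (W (Suc n) s - of_real x) \<le> b k * (2 * cmod (w s - of_real x))"
          using b_nonneg by (rule mult_left_mono)
        also have "\<dots> < \<delta> / 2" using w(3)[OF s] R.\<delta>_pos by simp
        finally show ?case using 1 x unfolding R.strip_def by blast
      qed
      have Wh: "W n holomorphic_on B" for n
      proof (induction n)
        case (Suc n)
        have "W (Suc n) = (\<lambda>s. W n s - of_real R.\<kappa> * (P.cdf k (u s) (W n s) - a s))"
          by (auto simp: W_def)
        moreover have "(\<lambda>s. P.cdf k (u s) (W n s)) holomorphic_on B"
          by (rule P.cdf_hol) (use u_hol u_nb Suc W in \<open>auto simp: B_def\<close>)
        ultimately show ?case using Suc a_hol by (auto intro!: holomorphic_intros)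
      qed (simp add: W_def[abs_def])
      have unif: "uniform_limit B W w sequentially"
      proof (rule uniform_limitI)
        fix \<epsilon> :: real assume "\<epsilon> > 0"
        define C where "C = gain * (b k * (\<delta> / 8) + (cmod (\<zeta> s0 k - of_real (y k)) + 1))"
        have "(\<lambda>n. R.rate ^ n * C) \<longlonglongrightarrow> 0 * C"
          using R.rate_bounds by (intro tendsto_intros LIMSEQ_power_zero) auto
        then have "\<forall>\<^sub>F n in sequentially. R.rate ^ n * C < \<epsilon>"
          using \<open>\<epsilon> > 0\<close> by (auto dest: order_tendstoD(2)[where a = \<epsilon>])
        then show "\<forall>\<^sub>F n in sequentially. \<forall>s\<in>B. dist (W n s) (w s) < \<epsilon>"
        proof eventually_elim
          case (elim n)
          show ?case
          proof
            fix s assume s: "s \<in> B"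
            have "R.rate ^ n * cmod (of_real x - w s) \<le> R.rate ^ n * C"
              using w(4)[OF s] R.rate_bounds by (intro mult_left_mono) (auto simp: C_def norm_minus_commute)
            then show "dist (W n s) (w s) < \<epsilon>" using W[OF s, of n] elim by (auto simp: dist_norm)
          qed
        qed
      qed
      have "w holomorphic_on B"
      proof (rule holomorphic_uniform_sequence)
        show "open B" by (simp add: B_def)
        show "\<exists>d>0. cball z d \<subseteq> B \<and> uniform_limit (cball z d) W w sequentially" if "z \<in> B" for z
        proof -
          obtain d where "d > 0" "cball z d \<subseteq> B"
            using \<open>z \<in> B\<close> open_contains_cball[of B] unfolding B_def by blast
          then show ?thesis using uniform_limit_on_subset[OF unif] by blast
        qed
      qed (use Wh in auto)
      then show ?thesis unfolding w_def using e by (auto simp: B_def holomorphic_on_open field_differentiable_def)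
    qed
    then show "(\<lambda>s. transport k (\<zeta> s)) holomorphic_on S"
      using S by (auto simp: holomorphic_on_open field_differentiable_def)
  qed
qed

text \<open>Implicit differentiation of the defining equation of \<open>transport k\<close> gives
  this quotient as the derivative in coordinate k; \<open>rtrans_deriv\<close> proves it on the
  cube.\<close>

definition ratio :: "nat \<Rightarrow> (nat \<Rightarrow> complex) \<Rightarrow> complex" where
  "ratio k z = \<phi>\<^sub>R k z / \<phi>\<^sub>P k (\<lambda>j. transport j z)"

lemma transport_nbhd:
  assumes "z \<in> nbhd b n \<delta>\<^sub>1" shows "(\<lambda>j. transport j z) \<in> nbhd b n \<delta>"
proof -
  obtain y where "y \<in> cube" "near b n \<delta>\<^sub>1 y z" using assms by (auto simp: nbhd_def)
  from transport_near(1)[OF this] rtrans_cube[OF this(1)]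
  have "(\<lambda>j. transport j z) \<in> nbhd b n (\<delta> / 8)" by (auto simp: nbhd_def)
  then show ?thesis using nbhd_mono[of "\<delta> / 8" \<delta>] R.\<delta>_pos by auto
qed

lemma nbhd_\<delta>\<^sub>1: "z \<in> nbhd b n (\<delta>\<^sub>1 / 2) \<Longrightarrow> z \<in> nbhd b n \<delta>\<^sub>1" "z \<in> nbhd b n \<delta>\<^sub>1 \<Longrightarrow> z \<in> nbhd b n \<delta>"
  using nbhd_mono[of "\<delta>\<^sub>1 / 2" \<delta>\<^sub>1] nbhd_mono[of \<delta>\<^sub>1 \<delta>] \<delta>\<^sub>1 R.\<delta>_pos by auto

lemma Re_ge_nonzero: "m \<le> Re w \<Longrightarrow> w \<noteq> 0 \<and> m \<le> cmod w"
  using complex_Re_le_cmod[of w] R.m_pos by auto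

lemma ratio_hol: "curve_hol b (Suc k) (\<delta>\<^sub>1 / 2) (ratio k)"
proof (rule curve_holI)
  fix S \<zeta> assume S: "open S" and \<zeta>: "\<And>j. j < Suc k \<Longrightarrow> (\<lambda>s. \<zeta> s j) holomorphic_on S"
    and nb: "\<And>s. s \<in> S \<Longrightarrow> \<zeta> s \<in> nbhd b (Suc k) (\<delta>\<^sub>1 / 2)"
  have "(\<lambda>s. \<phi>\<^sub>R k (\<zeta> s)) holomorphic_on S"
    using nb nbhd_\<delta>\<^sub>1 by (intro curve_holD[OF R.\<phi>_hol S] \<zeta>) auto
  moreover have "(\<lambda>s. \<phi>\<^sub>P k (\<lambda>j. transport j (\<zeta> s))) holomorphic_on S"
  proof (rule curve_holD[OF P.\<phi>_hol S])
    show "(\<lambda>s. transport j (\<zeta> s)) holomorphic_on S" if "j < Suc k" for j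
      using that nb nbhd_drop[of "Suc j" "Suc k" "\<delta>\<^sub>1 / 2"]
      by (intro curve_holD[OF transport_hol S] \<zeta>) auto
    show "(\<lambda>j. transport j (\<zeta> s)) \<in> nbhd b (Suc k) \<delta>" if "s \<in> S" for s
      using transport_nbhd nbhd_\<delta>\<^sub>1 nb[OF that] by blast
  qed
  moreover have "\<phi>\<^sub>P k (\<lambda>j. transport j (\<zeta> s)) \<noteq> 0" if "s \<in> S" for s
    using P.\<phi>_ge[OF transport_nbhd[OF nbhd_\<delta>\<^sub>1(1)[OF nb[OF that]]]] Re_ge_nonzero by blast
  ultimately show "(\<lambda>s. ratio k (\<zeta> s)) holomorphic_on S"
    unfolding ratio_def by (intro holomorphic_intros) auto
qed

lemma ratio_le:
  assumes "z \<in> nbhd b (Suc k) \<delta>\<^sub>1" shows "cmod (ratio k z) \<le> K / m"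
  using R.\<phi>_le[OF nbhd_\<delta>\<^sub>1(2)[OF assms]] Re_ge_nonzero[OF P.\<phi>_ge[OF transport_nbhd[OF assms]]] R.m_pos
    R.K_pos by (auto simp: ratio_def norm_divide intro!: frac_le)

definition rratio :: "(nat \<Rightarrow> real) \<Rightarrow> nat \<Rightarrow> real" where
  "rratio y k = Re (\<phi>\<^sub>R k (complex_of_real \<circ> y)) / Re (\<phi>\<^sub>P k (complex_of_real \<circ> rtrans y))"

lemma rratio:
  assumes y: "y \<in> cube"
  shows "ratio k (complex_of_real \<circ> y) = of_real (rratio y k)" "m / K \<le> rratio y k" "rratio y k \<le> K / m"
proof -
  have t: "(\<lambda>j. transport j (complex_of_real \<circ> y)) = complex_of_real \<circ> rtrans y"
    using transport_real[OF y] by auto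
  have n: "complex_of_real \<circ> y \<in> nbhd b (Suc k) \<delta>" "complex_of_real \<circ> rtrans y \<in> nbhd b (Suc k) \<delta>"
    using y rtrans_cube[OF y] R.\<delta>_pos by (auto intro!: cube_in_nbhd)
  show 1: "ratio k (complex_of_real \<circ> y) = of_real (rratio y k)"
    unfolding ratio_def t rratio_def using R.\<phi>_real[OF y, of k] P.\<phi>_real[OF rtrans_cube[OF y], of k] by (simp add: of_real_divide)
  have "m \<le> Re (\<phi>\<^sub>R k (complex_of_real \<circ> y))" "m \<le> Re (\<phi>\<^sub>P k (complex_of_real \<circ> rtrans y))"
    "Re (\<phi>\<^sub>R k (complex_of_real \<circ> y)) \<le> K" "Re (\<phi>\<^sub>P k (complex_of_real \<circ> rtrans y)) \<le> K"
    using R.\<phi>_ge[OF n(1)] P.\<phi>_ge[OF n(2)] R.\<phi>_le[OF n(1)] P.\<phi>_le[OF n(2)] complex_Re_le_cmod order_trans by blast+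
  then show "m / K \<le> rratio y k" "rratio y k \<le> K / m"
    unfolding rratio_def using R.m_pos by (auto intro!: frac_le)
qed

text \<open>The Lipschitz constant of \<open>ratio\<close> is
  \<open>16 * K / (m * \<delta>\<^sub>1)\<close>, and its values on the cube are at least
  \<open>m / K\<close>. This radius allows a change by half of that lower bound, so
  \<open>ratio\<close> stays in the right half plane, where \<open>csqrt\<close> is
  holomorphic.\<close>

definition \<delta>\<^sub>2 :: real where "\<delta>\<^sub>2 = \<delta>\<^sub>1 * (m / K)\<^sup>2 / 32"

lemma \<delta>\<^sub>2: "0 < \<delta>\<^sub>2" "\<delta>\<^sub>2 \<le> \<delta>\<^sub>1 / 32"
proof -
  have "(m / K)\<^sup>2 \<le> 1" using R.m_le_K R.m_pos R.K_pos by (simp add: power_le_one_iff)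
  then show "\<delta>\<^sub>2 \<le> \<delta>\<^sub>1 / 32" using \<delta>\<^sub>1 by (simp add: \<delta>\<^sub>2_def mult_left_le)
  show "0 < \<delta>\<^sub>2" using \<delta>\<^sub>1 R.m_pos R.K_pos by (simp add: \<delta>\<^sub>2_def)
qed

lemma Re_ratio_pos:
  assumes "z \<in> nbhd b (Suc k) \<delta>\<^sub>2" shows "0 < Re (ratio k z)"
proof -
  obtain y where y: "y \<in> cube" "sdist (Suc k) z (complex_of_real \<circ> y) \<le> \<delta>\<^sub>2" using assms by (auto simp: nbhd_sdist)
  have "cmod (ratio k z - ratio k (complex_of_real \<circ> y)) \<le> 8 * (K / m) / (\<delta>\<^sub>1 / 2) * sdist (Suc k) z (complex_of_real \<circ> y)"
  proof (rule curve_hol_lipschitz[OF ratio_hol])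
    show "complex_of_real \<circ> y \<in> nbhd b (Suc k) (\<delta>\<^sub>1 / 2 / 2)" using y \<delta>\<^sub>1 by (intro cube_in_nbhd) auto
    show "z \<in> nbhd b (Suc k) (\<delta>\<^sub>1 / 2)" using assms nbhd_mono[of \<delta>\<^sub>2 "\<delta>\<^sub>1 / 2"] \<delta>\<^sub>2 \<delta>\<^sub>1 by auto
  qed (use ratio_le nbhd_\<delta>\<^sub>1 \<delta>\<^sub>1 in auto)
  also have "\<dots> \<le> 8 * (K / m) / (\<delta>\<^sub>1 / 2) * \<delta>\<^sub>2"
    using y R.m_pos R.K_pos \<delta>\<^sub>1 by (intro mult_left_mono) auto
  also have "\<dots> = m / K / 2" using R.m_pos R.K_pos \<delta>\<^sub>1 by (simp add: \<delta>\<^sub>2_def field_simps power2_eq_square)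
  finally have "cmod (ratio k z - ratio k (complex_of_real \<circ> y)) \<le> m / K / 2" .
  define q where "q = m / K"
  have "\<bar>Re (ratio k z) - Re (ratio k (complex_of_real \<circ> y))\<bar> \<le> cmod (ratio k z - ratio k (complex_of_real \<circ> y))"
    by (metis abs_Re_le_cmod minus_complex.sel(1))
  also have "\<dots> \<le> q / 2" unfolding q_def by fact
  finally have "\<bar>Re (ratio k z) - Re (ratio k (complex_of_real \<circ> y))\<bar> \<le> q / 2" .
  moreover have "q \<le> Re (ratio k (complex_of_real \<circ> y))" using rratio[OF y(1), of k] by (simp add: q_def)
  moreover have "0 < q" using R.m_pos R.K_pos by (simp add: q_def)
  ultimately show ?thesis by linarith
qed

text \<open>The square of \<open>root k\<close> is \<open>\<partial>\<^sub>k T\<^sub>k\<close>; the polynomials of the ansatz approximate \<open>root k - 1\<close>.\<close>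

definition root :: "nat \<Rightarrow> (nat \<Rightarrow> complex) \<Rightarrow> complex" where
  "root k z = csqrt (ratio k z)"

lemma root_hol: "curve_hol b (Suc k) \<delta>\<^sub>2 (root k)"
proof (rule curve_holI)
  fix S \<zeta> assume S: "open S" and \<zeta>: "\<And>j. j < Suc k \<Longrightarrow> (\<lambda>s. \<zeta> s j) holomorphic_on S"
    and nb: "\<And>s. s \<in> S \<Longrightarrow> \<zeta> s \<in> nbhd b (Suc k) \<delta>\<^sub>2"
  have "(\<lambda>s. ratio k (\<zeta> s)) holomorphic_on S"
    using nb nbhd_mono[of \<delta>\<^sub>2 "\<delta>\<^sub>1 / 2"] \<delta>\<^sub>2 \<delta>\<^sub>1 by (intro curve_holD[OF ratio_hol S] \<zeta>) auto
  moreover have "ratio k (\<zeta> s) \<notin> \<real>\<^sub>\<le>\<^sub>0" if "s \<in> S" for s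
    using Re_ratio_pos[OF nb[OF that]] by (auto simp: complex_nonpos_Reals_iff)
  ultimately show "(\<lambda>s. root k (\<zeta> s)) holomorphic_on S"
    unfolding root_def by (rule holomorphic_on_csqrt')
qed

definition root_const :: real where "root_const = A / m * (2 + gain * (suminf b * (\<delta> / 8) + 1))"

text \<open>Both densities are within order \<open>b k\<close> of 1, hence so is their quotient.
  Passing to the root loses nothing: \<open>csqrt\<close> has nonnegative real part, so
  \<open>root k z + 1\<close> has modulus at least 1.\<close>

lemma root_one:
  assumes y: "y \<in> cube" and z: "near b (Suc k) \<delta>\<^sub>2 y z"
  shows "cmod (root k z - 1) \<le> root_const * b k * (1 + cmod (z k - of_real (y k)))"
proof -
  define d e where "d = cmod (z k - of_real (y k))" and "e = cmod (transport k z - of_real (rtrans y k))"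
  have z1: "near b (Suc k) \<delta>\<^sub>1 y z" using z \<delta>\<^sub>2 \<delta>\<^sub>1 by (auto simp: near_def)
  have zn: "z \<in> nbhd b (Suc k) \<delta>\<^sub>1" "z \<in> nbhd b (Suc k) \<delta>\<^sub>2" using z1 z y by (auto simp: nbhd_def)
  note tn = transport_near(1)[OF y z1] transport_near(2-4)[OF y z1 lessI]
  have 1: "cmod (\<phi>\<^sub>R k z - 1) \<le> A * b k * (1 + d)"
    unfolding d_def by (rule R.\<phi>_one[OF y]) (use z1 \<delta>\<^sub>1 R.\<delta>_pos in \<open>auto simp: near_def\<close>)
  have 2: "cmod (\<phi>\<^sub>P k (\<lambda>j. transport j z) - 1) \<le> A * b k * (1 + e)"
    unfolding e_def by (rule P.\<phi>_one[OF rtrans_cube[OF y]]) (use tn(1) R.\<delta>_pos in \<open>auto simp: near_def\<close>)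
  have p: "\<phi>\<^sub>P k (\<lambda>j. transport j z) \<noteq> 0" "m \<le> cmod (\<phi>\<^sub>P k (\<lambda>j. transport j z))"
    using Re_ge_nonzero[OF P.\<phi>_ge[OF transport_nbhd[OF zn(1)]]] by auto
  have bk: "b k \<le> suminf b"
    using sum_le_suminf[OF b_summable, where I = "{k}"] b_nonneg by simp
  have e: "e \<le> gain * (suminf b * (\<delta> / 8) + d)"
  proof -
    have "gain * (b k * (\<delta> / 8) + d) \<le> gain * (suminf b * (\<delta> / 8) + d)"
      using bk gain_pos R.\<delta>_pos by (intro mult_left_mono add_right_mono mult_right_mono) auto
    then show ?thesis using tn(4) by (simp add: e_def d_def)
  qed
  have "ratio k z - 1 = ((\<phi>\<^sub>R k z - 1) - (\<phi>\<^sub>P k (\<lambda>j. transport j z) - 1)) / \<phi>\<^sub>P k (\<lambda>j. transport j z)"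
    using p by (simp add: ratio_def field_simps)
  then have "cmod (ratio k z - 1) = cmod ((\<phi>\<^sub>R k z - 1) - (\<phi>\<^sub>P k (\<lambda>j. transport j z) - 1)) / cmod (\<phi>\<^sub>P k (\<lambda>j. transport j z))"
    by (simp only: norm_divide)
  also have "\<dots> \<le> (A * b k * (1 + d) + A * b k * (1 + e)) / m"
    using 1 2 p R.m_pos norm_triangle_ineq4[of "\<phi>\<^sub>R k z - 1" "\<phi>\<^sub>P k (\<lambda>j. transport j z) - 1"]
    using R.A_nonneg b_nonneg by (intro frac_le add_nonneg_nonneg mult_nonneg_nonneg) (auto simp: d_def e_def)
  also have "\<dots> = A / m * b k * (2 + d + e)" by (simp add: field_simps)
  also have "\<dots> \<le> A / m * b k * ((2 + gain * (suminf b * (\<delta> / 8) + 1)) * (1 + d))"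
  proof (rule mult_left_mono)
    define G where "G = gain * (suminf b * (\<delta> / 8))"
    have "0 \<le> suminf b" using bk b_nonneg[of k] by linarith
    then have G: "0 \<le> G" using gain_pos R.\<delta>_pos by (simp add: G_def)
    have d: "0 \<le> d" by (simp add: d_def)
    have "e \<le> G + gain * d" using e by (simp add: G_def distrib_left)
    moreover have "(2 + gain * (suminf b * (\<delta> / 8) + 1)) * (1 + d) = 2 + 2 * d + G + G * d + gain + gain * d"
      by (simp add: G_def algebra_simps)
    ultimately show "2 + d + e \<le> (2 + gain * (suminf b * (\<delta> / 8) + 1)) * (1 + d)"
      using G d gain_pos mult_nonneg_nonneg[OF G d] by linarith
    show "0 \<le> A / m * b k" using R.A_nonneg R.m_pos b_nonneg by simp
  qed
  finally have r: "cmod (ratio k z - 1) \<le> root_const * b k * (1 + d)" by (simp add: root_const_def mult_ac)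
  have "ratio k z - 1 = (root k z - 1) * (root k z + 1)"
    by (simp add: root_def algebra_simps flip: power2_eq_square)
  then have "cmod (ratio k z - 1) = cmod (root k z - 1) * cmod (root k z + 1)" by (simp only: norm_mult)
  moreover have "1 \<le> cmod (root k z + 1)"
  proof -
    have "0 \<le> Re (root k z)" unfolding root_def by (rule Re_csqrt)
    then have "1 \<le> Re (root k z + 1)" by (simp only: plus_complex.sel one_complex.sel)
    then show ?thesis using complex_Re_le_cmod[of "root k z + 1"] by linarith
  qed
  ultimately have "cmod (root k z - 1) \<le> cmod (ratio k z - 1)"
    by (metis mult.right_neutral mult_left_mono norm_ge_zero)
  then show ?thesis using r by (simp add: d_def)
qed

lemma root_real:
  assumes "y \<in> cube" shows "root k (complex_of_real \<circ> y) = of_real (sqrt (rratio y k))"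
  using rratio[OF assms, of k] R.m_pos R.K_pos
  by (simp add: root_def csqrt_of_real_nonneg order_trans[of 0 "m / K"])

text \<open>With the earlier coordinates frozen, the defining equation holds on a complex
  neighbourhood of the interval. \<open>transport_hol\<close> gives differentiability there, so
  comparing the derivatives of both sides determines the derivative, which is then restricted to
  real arguments.\<close>

lemma rtrans_deriv:
  assumes y: "y \<in> cube" and x: "x \<in> {-1..1}"
  shows "((\<lambda>t. rtrans (y(k := t)) k) has_real_derivative rratio (y(k := x)) k) (at x within S')"
proof -
  define S where "S = {s. \<exists>x\<in>{-1..1}. b k * cmod (s - of_real x) < \<delta>\<^sub>1 / 2}"
  have S: "open S"
  proof -
    have "S = (\<Union>x\<in>{-1..1}. {w. b k * cmod (w - of_real x) < \<delta>\<^sub>1 / 2})" by (auto simp: S_def)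
    also have "open \<dots>" by (intro open_UN ballI open_Collect_less continuous_intros)
    finally show ?thesis .
  qed
  have xS: "of_real x \<in> S" using x \<delta>\<^sub>1 by (auto simp: S_def intro!: bexI[of _ x])
  define \<zeta> where "\<zeta> s = (complex_of_real \<circ> y)(k := s)" for s
  have near: "\<exists>y'\<in>cube. near b (Suc k) (\<delta>\<^sub>1 / 2) y' (\<zeta> s)" if "s \<in> S" for s
  proof -
    obtain x' where x': "x' \<in> {-1..1}" "b k * cmod (s - of_real x') < \<delta>\<^sub>1 / 2" using \<open>s \<in> S\<close> by (auto simp: S_def)
    have "sdist k (\<zeta> s) (complex_of_real \<circ> y(k := x')) = sdist k (complex_of_real \<circ> y) (complex_of_real \<circ> y)"
      by (rule sdist_cong) (auto simp: \<zeta>_def)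
    then have "sdist (Suc k) (\<zeta> s) (complex_of_real \<circ> y(k := x')) = b k * cmod (s - of_real x')"
      unfolding sdist_Suc by (simp add: \<zeta>_def)
    moreover have "y(k := x') \<in> cube" using y x' by (auto simp: cube_def)
    ultimately show ?thesis using x' by (intro bexI[of _ "y(k := x')"]) (auto simp: near_sdist)
  qed
  have nb: "\<zeta> s \<in> nbhd b (Suc k) (\<delta>\<^sub>1 / 2)" if "s \<in> S" for s using near[OF that] by (auto simp: nbhd_def)
  define w where "w s = transport k (\<zeta> s)" for s
  have "w holomorphic_on S"
    unfolding w_def[abs_def]
  proof (rule curve_holD[OF transport_hol S])
    show "(\<lambda>s. \<zeta> s j) holomorphic_on S" for j by (cases "j = k") (auto simp: \<zeta>_def intro: holomorphic_intros)
  qed (use nb in auto)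
  then have w': "(w has_field_derivative deriv w (of_real x)) (at (of_real x))"
    using S xS by (rule holomorphic_derivI)
  define v where "v = complex_of_real \<circ> rtrans y"
  have tv: "transport j (\<zeta> s) = v j" if "s \<in> S" "j < k" for s j
  proof -
    have "\<zeta> s \<in> nbhd b (Suc j) (\<delta>\<^sub>1 / 2)" using nb[OF that(1)] that nbhd_drop[of "Suc j" "Suc k"] by auto
    then have "transport j (\<zeta> s) = transport j (complex_of_real \<circ> y)"
      using that by (intro curve_hol_cong[OF transport_hol]) (auto simp: \<zeta>_def)
    then show ?thesis by (simp add: v_def transport_real[OF y])
  qed
  have yn: "complex_of_real \<circ> y \<in> nbhd b k (\<delta> / 2)" and vn: "v \<in> nbhd b k (\<delta> / 2)"
    unfolding v_def using y rtrans_cube[OF y] R.\<delta>_pos by (auto intro!: cube_in_nbhd)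
  have eq: "w s \<in> R.strip k \<and> P.cdf k v (w s) = R.cdf k (complex_of_real \<circ> y) s \<and> s \<in> R.strip k" if s: "s \<in> S" for s
  proof -
    obtain y' where y': "y' \<in> cube" "near b (Suc k) (\<delta>\<^sub>1 / 2) y' (\<zeta> s)" using near[OF s] by blast
    then have n: "near b (Suc k) \<delta>\<^sub>1 y' (\<zeta> s)" using \<delta>\<^sub>1 by (auto simp: near_def)
    note tn = transport_near(1)[OF y'(1) n] transport_near(2-4)[OF y'(1) n lessI]
    have ws: "w s \<in> R.strip k" using tn(2) by (simp add: w_def)
    have ss: "s \<in> R.strip k"
    proof -
      obtain x' where "x' \<in> {-1..1}" "b k * cmod (s - of_real x') < \<delta>\<^sub>1 / 2" using s by (auto simp: S_def)
      then show ?thesis using \<delta>\<^sub>1 R.\<delta>_pos by (auto simp: R.strip_def intro!: bexI[of _ x'])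
    qed
    have "P.cdf k v (w s) = P.cdf k (\<lambda>j. transport j (\<zeta> s)) (w s)"
      by (rule P.cdf_cong[OF vn ws]) (simp add: tv[OF s])
    also have "\<dots> = R.cdf k (\<zeta> s) s" using tn(3) by (simp add: w_def \<zeta>_def)
    also have "\<dots> = R.cdf k (complex_of_real \<circ> y) s"
      by (rule R.cdf_cong[OF yn ss, symmetric]) (simp add: \<zeta>_def)
    finally show ?thesis using ws ss by blast
  qed
  have d1: "((\<lambda>s. P.cdf k v (w s)) has_field_derivative \<phi>\<^sub>P k (v(k := w (of_real x))) / 2 * deriv w (of_real x)) (at (of_real x))"
    by (rule DERIV_chain2[OF P.cdf_deriv[OF vn] w']) (use eq[OF xS] in auto)
  have "((\<lambda>s. R.cdf k (complex_of_real \<circ> y) s) has_field_derivative \<phi>\<^sub>R k ((complex_of_real \<circ> y)(k := of_real x)) / 2) (at (of_real x))"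
    using eq[OF xS] by (intro R.cdf_deriv[OF yn]) auto
  then have "((\<lambda>s. P.cdf k v (w s)) has_field_derivative \<phi>\<^sub>R k ((complex_of_real \<circ> y)(k := of_real x)) / 2) (at (of_real x))"
    by (rule has_field_derivative_transform_within_open[OF _ S xS]) (use eq in auto)
  from DERIV_unique[OF d1 this]
  have prod: "\<phi>\<^sub>P k (v(k := w (of_real x))) * deriv w (of_real x) = \<phi>\<^sub>R k (\<zeta> (of_real x))" by (simp add: \<zeta>_def)
  have \<zeta>x: "\<zeta> (of_real x) = complex_of_real \<circ> y(k := x)" by (auto simp: \<zeta>_def)
  have zn: "\<zeta> (of_real x) \<in> nbhd b (Suc k) \<delta>\<^sub>1" using nb[OF xS] nbhd_\<delta>\<^sub>1 by blast
  have "\<phi>\<^sub>P k (\<lambda>j. transport j (\<zeta> (of_real x))) = \<phi>\<^sub>P k (v(k := w (of_real x)))"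
    by (rule curve_hol_cong[OF P.\<phi>_hol transport_nbhd[OF zn]]) (use tv[OF xS] in \<open>auto simp: w_def\<close>)
  moreover have "\<phi>\<^sub>P k (\<lambda>j. transport j (\<zeta> (of_real x))) \<noteq> 0"
    using Re_ge_nonzero[OF P.\<phi>_ge[OF transport_nbhd[OF zn]]] by blast
  ultimately have "deriv w (of_real x) = ratio k (\<zeta> (of_real x))"
    using prod by (simp add: ratio_def field_simps)
  then have dw: "deriv w (of_real x) = of_real (rratio (y(k := x)) k)"
    using rratio(1)[of "y(k := x)" k] x y unfolding \<zeta>x by (auto simp: cube_def)
  have "((\<lambda>t. w (of_real t)) has_vector_derivative of_real (rratio (y(k := x)) k)) (at x within S')"
  proof -
    have "(of_real has_vector_derivative (1::complex)) (at x within S')"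
      by (auto simp: has_vector_derivative_def scaleR_conv_of_real intro!: derivative_eq_intros)
    moreover have "(w has_field_derivative of_real (rratio (y(k := x)) k)) (at (of_real x) within of_real ` S')"
      using w' unfolding dw by (rule has_field_derivative_at_within)
    ultimately show ?thesis
      using field_vector_diff_chain_within[of of_real 1 x S' w] by (simp add: o_def)
  qed
  from bounded_linear.has_vector_derivative[OF bounded_linear_Re this]
  have "((\<lambda>t. Re (w (of_real t))) has_real_derivative rratio (y(k := x)) k) (at x within S')"
    by (simp add: has_real_derivative_iff_has_vector_derivative)
  moreover have "Re (w (of_real t)) = rtrans (y(k := t)) k" for t
  proof -
    have "\<zeta> (of_real t) = complex_of_real \<circ> y(k := t)" by (auto simp: \<zeta>_def)
    then show ?thesis by (simp add: w_def rtrans_def)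
  qed
  ultimately show ?thesis by simp
qed

lemma rtrans_cong:
  assumes "y \<in> cube" "\<And>j. j \<le> k \<Longrightarrow> y j = y' j" shows "rtrans y k = rtrans y' k"
  unfolding rtrans_def using assms \<delta>\<^sub>1
  by (intro arg_cong[of _ _ Re] curve_hol_cong[OF transport_hol] cube_in_nbhd) auto

end

section \<open>Chebyshev expansions\<close>

lemma integrable_mu1_continuous:
  fixes f :: "real \<Rightarrow> 'b::euclidean_space"
  assumes "continuous_on {-1..1} f" shows "integrable mu1 f"
proof -
  interpret prob_space mu1 by (rule prob_space_mu1)
  have "bounded (f ` {-1..1})"
    using assms by (intro compact_imp_bounded compact_continuous_image) auto
  then obtain B where B: "\<forall>x\<in>f ` {-1..1}. norm x \<le> B" unfolding bounded_iff by blast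
  then show ?thesis
    using measurable_mu1_continuous[OF assms] B by (intro integrable_const_bound[where B = B]) (auto simp: space_mu1)
qed

lemma integral_mu1_cong: "(\<And>t. t \<in> {-1..1} \<Longrightarrow> f t = g t) \<Longrightarrow> (\<integral>t. f t \<partial>mu1) = (\<integral>t. g t \<partial>mu1)"
  by (rule Bochner_Integration.integral_cong) (auto simp: space_mu1)

lemma measure_space_mu1 [simp]: "Sigma_Algebra.measure mu1 (space mu1) = 1"
  by (rule prob_space.prob_space[OF prob_space_mu1])

lemma integral_mu1_cos_int: "(\<integral>t. cos (of_int j * (pi * t)) \<partial>mu1) = (if j = 0 then 1 else 0)"
proof (cases "j = 0")
  case False
  have "((\<lambda>t. cos (of_int j * (pi * t))) has_integral
      (sin (of_int j * (pi * 1)) / (of_int j * pi) - sin (of_int j * (pi * (-1))) / (of_int j * pi))) {-1..1::real}"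
    by (rule fundamental_theorem_of_calculus)
      (use False in \<open>auto intro!: derivative_eq_intros simp flip: has_real_derivative_iff_has_vector_derivative\<close>)
  moreover have "sin (of_int j * pi) = 0" by (simp add: sin_zero_iff_int2)
  ultimately have "integral {-1..1} (\<lambda>t. cos (of_int j * (pi * t))) = 0" by (auto dest!: integral_unique)
  then show ?thesis using False by (subst integral_mu1) (auto intro!: continuous_intros)
qed simp

lemma integral_mu1_cos_mult:
  "(\<integral>t. cos (real m * (pi * t)) * cos (real n * (pi * t)) \<partial>mu1) = (if m = n then if n = 0 then 1 else 1 / 2 else 0)"
proof -
  have "cos (real m * (pi * t)) * cos (real n * (pi * t)) =
      (1/2) * cos (of_int (int m - int n) * (pi * t)) + (1/2) * cos (of_int (int m + int n) * (pi * t))" for t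
    by (simp add: cos_add cos_diff left_diff_distrib distrib_right field_simps)
  moreover have "integrable mu1 (\<lambda>t. (1/2) * cos (of_int j * (pi * t)))" for j
    by (intro integrable_mu1_continuous continuous_intros)
  ultimately have "(\<integral>t. cos (real m * (pi * t)) * cos (real n * (pi * t)) \<partial>mu1) =
     (1/2) * (\<integral>t. cos (of_int (int m - int n) * (pi * t)) \<partial>mu1) + (1/2) * (\<integral>t. cos (of_int (int m + int n) * (pi * t)) \<partial>mu1)"
    by (simp only: Bochner_Integration.integral_add integral_mult_right_zero)
  then show ?thesis unfolding integral_mu1_cos_int by auto
qed

fun cheb :: "nat \<Rightarrow> real \<Rightarrow> real" where
  "cheb 0 x = 1"
| "cheb (Suc 0) x = x"
| "cheb (Suc (Suc n)) x = 2 * x * cheb (Suc n) x - cheb n x"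

lemma cheb_cos: "cheb n (cos t) = cos (real n * t)"
proof (induction n "cos t" rule: cheb.induct)
  case (3 n)
  have 1: "cos (real (Suc (Suc n)) * t) = cos (real (Suc n) * t + t)" "cos (real n * t) = cos (real (Suc n) * t - t)"
    by (simp_all add: algebra_simps)
  show ?case using 3 unfolding 1 cos_add cos_diff by simp
qed auto

lemma cos_pi_onto: assumes "x \<in> {-1..1::real}" obtains t where "t \<in> {-1..1}" "x = cos (pi * t)"
proof
  show "x = cos (pi * (arccos x / pi))" using assms by simp
  show "arccos x / pi \<in> {-1..1}" using assms arccos_lbound[of x] arccos_ubound[of x]
    by (auto intro: order_trans[of "-1" 0])
qed

lemma cheb_le_1: "x \<in> {-1..1} \<Longrightarrow> \<bar>cheb n x\<bar> \<le> 1"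
  by (erule cos_pi_onto) (simp add: cheb_cos)

lemma continuous_cheb: "continuous_on S (cheb n)"
proof (induction n "0::real" rule: cheb.induct)
  case (3 n)
  have "cheb (Suc (Suc n)) = (\<lambda>x. 2 * x * cheb (Suc n) x - cheb n x)" by auto
  then show ?case using 3 by (auto intro!: continuous_intros)
qed (simp_all add: continuous_on_id cheb.simps[abs_def])

lemma continuous_on_cos_pi:
  assumes "continuous_on {-1..1} G" shows "continuous_on {-1..1} (\<lambda>t. G (cos (pi * t)))"
  by (rule continuous_on_compose2[OF assms]) (auto intro!: continuous_intros)

text \<open>Completeness of the cosines. The product formula lifts orthogonality to all powers of
  \<open>cos (pi * t)\<close>, so G is orthogonal to all polynomials, and Weierstrass approximation
  makes its square integral zero.\<close>

lemma cheb_unique: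
  fixes G :: "real \<Rightarrow> real"
  assumes G: "continuous_on {-1..1} G"
    and 0: "\<And>m. (\<integral>t. G (cos (pi * t)) * cos (real m * (pi * t)) \<partial>mu1) = 0" and x: "x \<in> {-1..1}"
  shows "G x = 0"
proof -
  note cG = continuous_on_cos_pi[OF G]
  have mono: "(\<integral>t. G (cos (pi * t)) * cos (pi * t) ^ i * cos (real m * (pi * t)) \<partial>mu1) = 0" for i m
  proof (induction i arbitrary: m)
    case (Suc i)
    note IH = Suc.IH
    show ?case
    proof (cases m)
      case 0
      have "G (cos (pi * t)) * cos (pi * t) ^ Suc i * cos (real m * (pi * t)) = G (cos (pi * t)) * cos (pi * t) ^ i * cos (real 1 * (pi * t))" for t
        by (simp add: 0)
      then show ?thesis using Suc[of 1] by presburger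
    next
      case (Suc m')
      have "G (cos (pi * t)) * cos (pi * t) ^ Suc i * cos (real m * (pi * t)) =
          (1/2) * (G (cos (pi * t)) * cos (pi * t) ^ i * cos (real (Suc m) * (pi * t))) + (1/2) * (G (cos (pi * t)) * cos (pi * t) ^ i * cos (real m' * (pi * t)))" for t
      proof -
        have 1: "cos (real (Suc m) * (pi * t)) = cos (real m * (pi * t) + pi * t)" "cos (real m' * (pi * t)) = cos (real m * (pi * t) - pi * t)"
          by (simp_all add: Suc algebra_simps)
        show ?thesis unfolding 1 cos_add cos_diff by (simp add: algebra_simps)
      qed
      moreover have "integrable mu1 (\<lambda>t. (1/2) * (G (cos (pi * t)) * cos (pi * t) ^ i * cos (real m * (pi * t))))" for m
        by (intro integrable_mu1_continuous continuous_intros cG)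
      ultimately have "(\<integral>t. G (cos (pi * t)) * cos (pi * t) ^ Suc i * cos (real m * (pi * t)) \<partial>mu1) =
        (1/2) * (\<integral>t. G (cos (pi * t)) * cos (pi * t) ^ i * cos (real (Suc m) * (pi * t)) \<partial>mu1) + (1/2) * (\<integral>t. G (cos (pi * t)) * cos (pi * t) ^ i * cos (real m' * (pi * t)) \<partial>mu1)"
        by (simp only: Bochner_Integration.integral_add integral_mult_right_zero)
      then show ?thesis unfolding IH by simp
    qed
  qed (use 0 in simp)
  have poly: "(\<integral>t. G (cos (pi * t)) * q (cos (pi * t)) \<partial>mu1) = 0" if "real_polynomial_function q" for q
  proof -
    obtain a n where q: "q = (\<lambda>x. \<Sum>i\<le>n. a i * x ^ i)" using \<open>real_polynomial_function q\<close> real_polynomial_function_iff_sum by auto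
    have "(\<integral>t. G (cos (pi * t)) * q (cos (pi * t)) \<partial>mu1) = (\<integral>t. (\<Sum>i\<le>n. a i * (G (cos (pi * t)) * cos (pi * t) ^ i * cos (real 0 * (pi * t)))) \<partial>mu1)"
      by (rule integral_mu1_cong) (simp add: q sum_distrib_left mult_ac)
    also have "\<dots> = (\<Sum>i\<le>n. a i * (\<integral>t. G (cos (pi * t)) * cos (pi * t) ^ i * cos (real 0 * (pi * t)) \<partial>mu1))"
      by (subst Bochner_Integration.integral_sum) (auto intro!: integrable_mu1_continuous continuous_intros cG)
    finally show ?thesis unfolding mono by simp
  qed
  have "bounded (G ` {-1..1})" using G by (intro compact_imp_bounded compact_continuous_image) auto
  then obtain B where "\<forall>x\<in>G ` {-1..1}. norm x \<le> B" unfolding bounded_iff by blast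
  then have B: "\<And>t. t \<in> {-1..1} \<Longrightarrow> \<bar>G t\<bar> \<le> B" by auto
  have B0: "0 \<le> B" using B[of 0] by auto
  \<comment> \<open>Since G is orthogonal to q, the square integral equals the integral of G against
    \<open>G - q\<close>.\<close>
  have sq: "(\<integral>t. (G (cos (pi * t)))\<^sup>2 \<partial>mu1) \<le> e * (B + 1)" if e: "e > 0" for e
  proof -
    obtain q where q: "real_polynomial_function q" "\<And>x. x \<in> {-1..1} \<Longrightarrow> \<bar>G x - q x\<bar> < e"
      using Stone_Weierstrass_real_polynomial_function[of "{-1..1}" G e] G e by auto
    have cq: "continuous_on {-1..1} (\<lambda>t. q (cos (pi * t)))"
      using continuous_on_cos_pi[of q] q(1) continuous_real_polymonial_function continuous_at_imp_continuous_on by blast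
    have "(\<integral>t. (G (cos (pi * t)))\<^sup>2 \<partial>mu1) = (\<integral>t. G (cos (pi * t)) * (G (cos (pi * t)) - q (cos (pi * t))) + G (cos (pi * t)) * q (cos (pi * t)) \<partial>mu1)"
      by (rule integral_mu1_cong) (simp add: power2_eq_square algebra_simps)
    also have "\<dots> = (\<integral>t. G (cos (pi * t)) * (G (cos (pi * t)) - q (cos (pi * t))) \<partial>mu1)"
      using poly[OF q(1)] cG cq by (subst Bochner_Integration.integral_add) (auto intro!: integrable_mu1_continuous continuous_intros)
    also have "\<dots> \<le> (\<integral>t. B * e \<partial>mu1)"
    proof (rule integral_mono)
      show "G (cos (pi * t)) * (G (cos (pi * t)) - q (cos (pi * t))) \<le> B * e" if "t \<in> space mu1" for t
      proof -
        have "\<bar>G (cos (pi * t))\<bar> * \<bar>G (cos (pi * t)) - q (cos (pi * t))\<bar> \<le> B * e"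
          using B[of "cos (pi * t)"] q(2)[of "cos (pi * t)"] B0 by (intro mult_mono) auto
        then show ?thesis by (metis abs_le_D1 abs_mult)
      qed
    qed (use cG cq in \<open>auto intro!: integrable_mu1_continuous continuous_intros\<close>)
    finally show ?thesis using e by (simp add: algebra_simps)
  qed
  have "(\<integral>t. (G (cos (pi * t)))\<^sup>2 \<partial>mu1) \<le> 0"
  proof (rule field_le_epsilon)
    fix e :: real assume "e > 0"
    then show "(\<integral>t. (G (cos (pi * t)))\<^sup>2 \<partial>mu1) \<le> 0 + e" using sq[of "e / (B + 1)"] B0 by simp
  qed
  moreover have "0 \<le> (\<integral>t. (G (cos (pi * t)))\<^sup>2 \<partial>mu1)" by (intro Bochner_Integration.integral_nonneg) simp
  moreover have c2: "continuous_on {-1..1} (\<lambda>t. (G (cos (pi * t)))\<^sup>2)" by (intro continuous_intros cG)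
  ultimately have "integral {-1..1} (\<lambda>t. (G (cos (pi * t)))\<^sup>2) = 0" using integral_mu1[OF c2] by simp
  then have z: "\<forall>t\<in>{-1..1}. (G (cos (pi * t)))\<^sup>2 = 0"
    by (subst (asm) integral_eq_0_iff[OF c2]) auto
  obtain t where "t \<in> {-1..1}" "x = cos (pi * t)" using cos_pi_onto[OF x] by blast
  then show ?thesis using z by simp
qed

text \<open>The substitution \<open>x = cos (pi * t)\<close> replaces the arcsine weight of the
  Chebyshev polynomials by \<open>mu1\<close>. The factor 2 compensates the mean 1/2 of a squared
  cosine.\<close>

definition cheb_coeff :: "(real \<Rightarrow> complex) \<Rightarrow> nat \<Rightarrow> complex" where
  "cheb_coeff g m = (if m = 0 then 1 else 2) * (\<integral>t. g (cos (pi * t)) * of_real (cos (real m * (pi * t))) \<partial>mu1)"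

text \<open>Absolute summability makes the series a continuous function that has, by orthogonality,
  the coefficients of g. The difference has only zero coefficients and vanishes by
  \<open>cheb_unique\<close>, applied to its real and imaginary parts.\<close>

lemma cheb_expansion:
  assumes g: "continuous_on {-1..1} g" and s: "summable (\<lambda>m. cmod (cheb_coeff g m))" and x: "x \<in> {-1..1}"
  shows "(\<lambda>m. cheb_coeff g m * of_real (cheb m x)) sums g x"
proof -
  define S where "S x = (\<Sum>m. cheb_coeff g m * of_real (cheb m x))" for x
  have bd: "cmod (cheb_coeff g m * of_real (cheb m x)) \<le> cmod (cheb_coeff g m)" if "x \<in> {-1..1}" for m x
    using cheb_le_1[OF that, of m] by (simp add: norm_mult mult_left_le)
  have sums: "(\<lambda>m. cheb_coeff g m * of_real (cheb m x)) sums S x" if "x \<in> {-1..1}" for x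
    unfolding S_def
    by (intro summable_sums summable_norm_cancel[OF summable_comparison_test'[OF s, of 0]]) (use bd[OF that] in auto)
  have "uniform_limit {-1..1} (\<lambda>n x. \<Sum>m<n. cheb_coeff g m * of_real (cheb m x)) S sequentially"
    unfolding S_def[abs_def] using bd s by (intro Weierstrass_m_test) auto
  then have cS: "continuous_on {-1..1} S"
    by (rule uniform_limit_theorem[rotated]) (auto intro!: always_eventually continuous_intros continuous_cheb)
  define D where "D x = g x - S x" for x
  have cD: "continuous_on {-1..1} D" unfolding D_def[abs_def] by (intro continuous_intros g cS)
  have orth: "(\<integral>t. D (cos (pi * t)) * of_real (cos (real n * (pi * t))) \<partial>mu1) = 0" for n
  proof -
    define f where "f m t = cheb_coeff g m * of_real (cheb m (cos (pi * t))) * of_real (cos (real n * (pi * t)))" for m t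
    have cf: "continuous_on {-1..1} (f m)" for m
      unfolding f_def[abs_def] using continuous_on_cos_pi[OF continuous_cheb] by (intro continuous_intros) auto
    have fbd: "cmod (f m t) \<le> cmod (cheb_coeff g m)" for m t
      using bd[of "cos (pi * t)" m] mult_left_le[of "\<bar>cos (real n * (pi * t))\<bar>" "cmod (cheb_coeff g m * of_real (cheb m (cos (pi * t))))"]
      by (simp add: f_def norm_mult)
    have fs: "(\<integral>t. (\<Sum>m. f m t) \<partial>mu1) = (\<Sum>m. \<integral>t. f m t \<partial>mu1)"
    proof (rule integral_suminf)
      show "integrable mu1 (f m)" for m by (rule integrable_mu1_continuous[OF cf])
      show "AE t in mu1. summable (\<lambda>m. norm (f m t))"
        by (intro AE_I2 summable_comparison_test'[OF s, of 0]) (use fbd in auto)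
      have "(\<integral>t. norm (f m t) \<partial>mu1) \<le> cmod (cheb_coeff g m)" for m
        using integral_mono[of mu1 "\<lambda>t. norm (f m t)" "\<lambda>_. cmod (cheb_coeff g m)"] fbd
        by (auto intro!: integrable_mu1_continuous continuous_intros cf)
      then show "summable (\<lambda>m. \<integral>t. norm (f m t) \<partial>mu1)"
        by (intro summable_comparison_test'[OF s, of 0]) auto
    qed
    have fi: "(\<integral>t. f m t \<partial>mu1) = (if m = n then cheb_coeff g n * (if n = 0 then 1 else 1/2) else 0)" for m
    proof -
      have "(\<integral>t. f m t \<partial>mu1) = (\<integral>t. cheb_coeff g m * of_real (cos (real m * (pi * t)) * cos (real n * (pi * t))) \<partial>mu1)"
        by (rule integral_mu1_cong) (simp add: f_def cheb_cos)
      also have "\<dots> = cheb_coeff g m * of_real (\<integral>t. cos (real m * (pi * t)) * cos (real n * (pi * t)) \<partial>mu1)"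
        by (simp only: integral_mult_right_zero integral_complex_of_real)
      finally show ?thesis unfolding integral_mu1_cos_mult by auto
    qed
    have "(\<integral>t. S (cos (pi * t)) * of_real (cos (real n * (pi * t))) \<partial>mu1) = (\<integral>t. (\<Sum>m. f m t) \<partial>mu1)"
    proof (rule integral_mu1_cong)
      fix t :: real assume "t \<in> {-1..1}"
      have "(\<lambda>m. f m t) sums (S (cos (pi * t)) * of_real (cos (real n * (pi * t))))"
        unfolding f_def by (rule sums_mult2, rule sums) auto
      then show "S (cos (pi * t)) * of_real (cos (real n * (pi * t))) = (\<Sum>m. f m t)" by (simp add: sums_iff)
    qed
    also have "\<dots> = cheb_coeff g n * (if n = 0 then 1 else 1/2)"
      unfolding fs fi by (rule sums_unique[symmetric], rule sums_single)
    also have "\<dots> = (\<integral>t. g (cos (pi * t)) * of_real (cos (real n * (pi * t))) \<partial>mu1)"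
      by (simp add: cheb_coeff_def)
    finally have e: "(\<integral>t. S (cos (pi * t)) * of_real (cos (real n * (pi * t))) \<partial>mu1) = (\<integral>t. g (cos (pi * t)) * of_real (cos (real n * (pi * t))) \<partial>mu1)" .
    have "(\<integral>t. D (cos (pi * t)) * of_real (cos (real n * (pi * t))) \<partial>mu1) =
      (\<integral>t. g (cos (pi * t)) * of_real (cos (real n * (pi * t))) - S (cos (pi * t)) * of_real (cos (real n * (pi * t))) \<partial>mu1)"
      by (rule integral_mu1_cong) (simp add: D_def algebra_simps)
    also have "\<dots> = 0"
      using e continuous_on_cos_pi[OF g] continuous_on_cos_pi[OF cS]
      by (subst Bochner_Integration.integral_diff) (auto intro!: integrable_mu1_continuous continuous_intros)
    finally show ?thesis .
  qed
  have iD: "integrable mu1 (\<lambda>t. D (cos (pi * t)) * of_real (cos (real n * (pi * t))))" for n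
    using continuous_on_cos_pi[OF cD] by (intro integrable_mu1_continuous continuous_intros)
  have "Re (D x) = 0"
  proof (rule cheb_unique[of "\<lambda>x. Re (D x)", OF _ _ x])
    show "continuous_on {-1..1} (\<lambda>x. Re (D x))" by (intro continuous_intros cD)
    show "(\<integral>t. Re (D (cos (pi * t))) * cos (real m * (pi * t)) \<partial>mu1) = 0" for m
      using integral_Re[OF iD, of m] orth[of m] by simp
  qed
  moreover have "Im (D x) = 0"
  proof (rule cheb_unique[of "\<lambda>x. Im (D x)", OF _ _ x])
    show "continuous_on {-1..1} (\<lambda>x. Im (D x))" by (intro continuous_intros cD)
    show "(\<integral>t. Im (D (cos (pi * t))) * cos (real m * (pi * t)) \<partial>mu1) = 0" for m
      using integral_Im[OF iD, of m] orth[of m] by simp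
  qed
  ultimately have "D x = 0" by (simp add: complex_eq_iff)
  then show ?thesis using sums[OF x] by (simp add: D_def)
qed

text \<open>For fixed c the points run over a Bernstein ellipse with parameter
  \<open>r = exp \<bar>c\<bar>\<close>. The bound \<open>r - 1\<close> on the distance from the
  interval is what such an ellipse costs in the budget of \<open>nbhd\<close>.\<close>

lemma cmod_cos_diff: "cmod (cos (of_real a + \<i> * of_real c) - of_real (cos a)) \<le> exp \<bar>c\<bar> - 1"
proof -
  have "cos (of_real a + \<i> * of_real c) - of_real (cos a) = of_real (cos a * (cosh c - 1)) - \<i> * of_real (sin a * sinh c)"
  proof -
    have "cos (\<i> * complex_of_real c) = of_real (cosh c)" "sin (\<i> * complex_of_real c) = \<i> * of_real (sinh c)"
      by (simp_all add: cos_exp_eq sin_exp_eq cosh_def sinh_def scaleR_conv_of_real field_simps flip: exp_of_real)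
    then show ?thesis by (simp add: cos_add cos_of_real sin_of_real algebra_simps)
  qed
  then have "cmod (cos (of_real a + \<i> * of_real c) - of_real (cos a)) \<le> \<bar>cos a * (cosh c - 1)\<bar> + \<bar>sin a * sinh c\<bar>"
    using norm_triangle_ineq4[of "complex_of_real (cos a * (cosh c - 1))" "\<i> * of_real (sin a * sinh c)"]
    by (simp only: norm_mult norm_of_real norm_ii mult_1)
  also have "\<dots> \<le> (cosh c - 1) + \<bar>sinh c\<bar>"
    using cosh_real_ge_1[of c] by (intro add_mono) (auto simp: abs_mult mult_left_le_one_le)
  also have "\<dots> = exp \<bar>c\<bar> - 1"
    using cosh_plus_sinh[of "\<bar>c\<bar>"] by (simp flip: sinh_real_abs)
  finally show ?thesis .
qed

text \<open>A primitive \<open>\<Psi>\<close> on the strip has \<open>\<Psi> (s + 2) - \<Psi> s\<close> constant, which replaces a contour argument.\<close>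

lemma periodic_shift:
  assumes f: "f holomorphic_on {s. \<bar>Im s\<bar> < \<tau>}" and per: "\<And>s. \<bar>Im s\<bar> < \<tau> \<Longrightarrow> f (s + 2) = f s" and \<eta>: "\<bar>\<eta>\<bar> < \<tau>"
  shows "(\<integral>t. f (of_real t) \<partial>mu1) = (\<integral>t. f (of_real t + \<i> * of_real \<eta>) \<partial>mu1)"
proof -
  define V where "V = {s. \<bar>Im s\<bar> < \<tau>}"
  have V: "V = {s. Im s < \<tau>} \<inter> {s. Im s > - \<tau>}" by (auto simp: V_def)
  have oV: "open V" unfolding V by (intro open_Int open_halfspace_Im_lt open_halfspace_Im_gt)
  have cV: "convex V" unfolding V by (intro convex_Int convex_halfspace_Im_lt convex_halfspace_Im_gt)
  obtain \<Psi> where \<Psi>: "\<And>s. s \<in> V \<Longrightarrow> (\<Psi> has_field_derivative f s) (at s)"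
    using holomorphic_convex_primitive'[OF cV oV f[folded V_def]] at_within_open[OF _ oV] by metis
  have cont: "continuous_on V f" using f holomorphic_on_imp_continuous_on by (auto simp: V_def)
  have "\<exists>c. \<forall>s\<in>V. \<Psi> (s + 2) - \<Psi> s = c"
  proof (rule has_field_derivative_zero_constant[OF cV])
    fix s assume s: "s \<in> V"
    then have s2: "s + 2 \<in> V" by (simp add: V_def)
    have "((\<lambda>s. \<Psi> (s + 2) - \<Psi> s) has_field_derivative f (s + 2) * 1 - f s) (at s)"
      by (intro DERIV_diff \<Psi>[OF s] DERIV_chain2[where g = "\<lambda>s. s + 2", OF \<Psi>[OF s2]]) (auto intro!: derivative_eq_intros)
    then show "((\<lambda>s. \<Psi> (s + 2) - \<Psi> s) has_field_derivative 0) (at s within V)"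
      using per s by (simp add: V_def has_field_derivative_at_within)
  qed
  then obtain c where c: "\<And>s. s \<in> V \<Longrightarrow> \<Psi> (s + 2) - \<Psi> s = c" by blast
  have "(\<integral>t. f (of_real t + \<i> * of_real \<eta>) \<partial>mu1) = (1/2) *\<^sub>R c" if \<eta>: "\<bar>\<eta>\<bar> < \<tau>" for \<eta>
  proof -
    have inV: "of_real t + \<i> * of_real \<eta> \<in> V" for t using \<eta> by (simp add: V_def)
    have "((\<lambda>t. f (of_real t + \<i> * of_real \<eta>)) has_integral (\<Psi> (of_real 1 + \<i> * of_real \<eta>) - \<Psi> (of_real (-1) + \<i> * of_real \<eta>))) {-1..1}"
    proof (rule fundamental_theorem_of_calculus)
      fix t :: real assume "t \<in> {-1..1}"
      have "((\<lambda>t. of_real t + \<i> * of_real \<eta>) has_vector_derivative 1) (at t within {-1..1})"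
        by (auto simp: has_vector_derivative_def scaleR_conv_of_real intro!: derivative_eq_intros)
      from field_vector_diff_chain_within[OF this has_field_derivative_at_within[OF \<Psi>[OF inV]]]
      show "((\<lambda>t. \<Psi> (of_real t + \<i> * of_real \<eta>)) has_vector_derivative f (of_real t + \<i> * of_real \<eta>)) (at t within {-1..1})"
        by (simp add: o_def)
    qed simp
    moreover have "\<Psi> (of_real 1 + \<i> * of_real \<eta>) - \<Psi> (of_real (-1) + \<i> * of_real \<eta>) = c"
      using c[OF inV[of "-1"]] by (simp add: algebra_simps)
    moreover have "continuous_on {-1..1} (\<lambda>t. f (of_real t + \<i> * of_real \<eta>))"
      by (rule continuous_on_compose2[OF cont]) (use inV in \<open>auto intro!: continuous_intros\<close>)
    ultimately show ?thesis by (simp add: integral_mu1 integral_unique)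
  qed
  from this[of 0] this[OF \<eta>] \<eta> show ?thesis by simp
qed

text \<open>The cosine is split into two exponentials, and the line of integration is moved up for
  the one that decays upwards and down for the other; the sign \<sigma> distinguishes the
  two.\<close>

lemma periodic_coeff_bound:
  assumes f: "f holomorphic_on {s. \<bar>Im s\<bar> < \<tau>}" and per: "\<And>s. \<bar>Im s\<bar> < \<tau> \<Longrightarrow> f (s + 2) = f s" and \<eta>: "0 \<le> \<eta>" "\<eta> < \<tau>"
    and bd: "\<And>t. t \<in> {-1..1} \<Longrightarrow> cmod (f (of_real t + \<i> * of_real \<eta>)) \<le> B"
      "\<And>t. t \<in> {-1..1} \<Longrightarrow> cmod (f (of_real t + \<i> * of_real (-\<eta>))) \<le> B"
  shows "cmod (\<integral>t. f (of_real t) * of_real (cos (real m * (pi * t))) \<partial>mu1) \<le> exp (- (real m * (pi * \<eta>))) * B"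
proof -
  have \<tau>: "\<bar>\<eta>\<bar> < \<tau>" "\<bar>-\<eta>\<bar> < \<tau>" "\<bar>0\<bar> < \<tau>" using \<eta> by auto
  have main: "cmod (\<integral>t. f (of_real t) * exp (\<i> * (of_real (\<sigma> * real m * pi) * of_real t)) \<partial>mu1) \<le> exp (- (real m * (pi * \<eta>))) * B"
    and cont: "continuous_on {-1..1} (\<lambda>t. f (of_real t) * exp (\<i> * (of_real (\<sigma> * real m * pi) * of_real t)))"
    if \<sigma>: "\<sigma> = 1 \<or> \<sigma> = -1" for \<sigma> :: real
  proof -
    define h where "h s = f s * exp (\<i> * (of_real (\<sigma> * real m * pi) * s))" for s
    have hol: "h holomorphic_on {s. \<bar>Im s\<bar> < \<tau>}" unfolding h_def by (intro holomorphic_intros f)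
    have hper: "h (s + 2) = h s" if "\<bar>Im s\<bar> < \<tau>" for s
    proof -
      have "exp (\<i> * (of_real (\<sigma> * real m * pi) * (s + 2))) = exp (\<i> * (of_real (\<sigma> * real m * pi) * s)) * exp (of_int (if \<sigma> = 1 then int m else - int m) * (of_real (2 * pi) * \<i>))"
        using \<sigma> by (auto simp: algebra_simps simp flip: exp_add)
      also have "exp (of_int (if \<sigma> = 1 then int m else - int m) * (of_real (2 * pi) * \<i>)) = 1"
        unfolding exp_eq_1 by (auto intro!: exI[of _ "if \<sigma> = 1 then int m else - int m"])
      finally show ?thesis using per[OF that] by (simp add: h_def)
    qed
    have c: "continuous_on {-1..1} (\<lambda>t. h (of_real t + \<i> * of_real e))" if "\<bar>e\<bar> < \<tau>" for e
      by (rule continuous_on_compose2[OF holomorphic_on_imp_continuous_on[OF hol]]) (use that in \<open>auto intro!: continuous_intros\<close>)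
    then show "continuous_on {-1..1} (\<lambda>t. f (of_real t) * exp (\<i> * (of_real (\<sigma> * real m * pi) * of_real t)))"
      using c[OF \<tau>(3)] by (simp add: h_def)
    have "cmod (\<integral>t. h (of_real t) \<partial>mu1) = cmod (\<integral>t. h (of_real t + \<i> * of_real (\<sigma> * \<eta>)) \<partial>mu1)"
      using \<sigma> \<tau> by (subst periodic_shift[OF hol hper, of "\<sigma> * \<eta>"]) auto
    also have "\<dots> \<le> (\<integral>t. exp (- (real m * (pi * \<eta>))) * B \<partial>mu1)"
    proof (rule Bochner_Integration.integral_norm_bound_integral)
      show "integrable mu1 (\<lambda>t. h (of_real t + \<i> * of_real (\<sigma> * \<eta>)))"
        using c[of "\<sigma> * \<eta>"] \<tau> \<sigma> by (intro integrable_mu1_continuous) auto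
      fix t assume "t \<in> space mu1"
      then have t: "t \<in> {-1..1}" by (simp add: space_mu1)
      have "cmod (h (of_real t + \<i> * of_real (\<sigma> * \<eta>))) = cmod (f (of_real t + \<i> * of_real (\<sigma> * \<eta>))) * exp (- (real m * (pi * \<eta>)))"
        using \<sigma> by (auto simp: h_def norm_mult norm_exp algebra_simps)
      also have "\<dots> \<le> B * exp (- (real m * (pi * \<eta>)))"
        using bd[OF t] \<sigma> by (intro mult_right_mono) auto
      finally show "cmod (h (of_real t + \<i> * of_real (\<sigma> * \<eta>))) \<le> exp (- (real m * (pi * \<eta>))) * B" by (simp add: mult.commute)
    qed (intro integrable_mu1_continuous continuous_intros)
    finally show "cmod (\<integral>t. f (of_real t) * exp (\<i> * (of_real (\<sigma> * real m * pi) * of_real t)) \<partial>mu1) \<le> exp (- (real m * (pi * \<eta>))) * B"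
      by (simp add: h_def)
  qed
  have "f (of_real t) * of_real (cos (real m * (pi * t))) =
     (1/2) * (f (of_real t) * exp (\<i> * (of_real (1 * real m * pi) * of_real t))) + (1/2) * (f (of_real t) * exp (\<i> * (of_real (-1 * real m * pi) * of_real t)))" for t
  proof -
    have "complex_of_real (cos (real m * (pi * t))) = (exp (\<i> * of_real (real m * (pi * t))) + exp (- (\<i> * of_real (real m * (pi * t))))) / 2"
      by (simp add: cos_exp_eq flip: cos_of_real)
    moreover have "\<i> * (of_real (1 * real m * pi) * of_real t) = \<i> * of_real (real m * (pi * t))"
      "\<i> * (of_real (-1 * real m * pi) * of_real t) = - (\<i> * of_real (real m * (pi * t)))" by simp_all
    ultimately show ?thesis by (simp only:) (simp add: field_simps)
  qed
  then have "(\<integral>t. f (of_real t) * of_real (cos (real m * (pi * t))) \<partial>mu1) =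
     (1/2) * (\<integral>t. f (of_real t) * exp (\<i> * (of_real (1 * real m * pi) * of_real t)) \<partial>mu1) + (1/2) * (\<integral>t. f (of_real t) * exp (\<i> * (of_real (-1 * real m * pi) * of_real t)) \<partial>mu1)"
    using integrable_mu1_continuous[OF cont[of 1]] integrable_mu1_continuous[OF cont[of "-1"]]
    by (simp only:) (subst Bochner_Integration.integral_add, auto)
  also have "cmod \<dots> \<le> (1/2) * (exp (- (real m * (pi * \<eta>))) * B) + (1/2) * (exp (- (real m * (pi * \<eta>))) * B)"
    by (rule norm_triangle_mono; subst norm_mult; rule mult_mono) (use main[of 1] main[of "-1"] in auto)
  finally show ?thesis by (simp add: mult.commute)
qed

section \<open>Tensor Chebyshev coefficients\<close>

text \<open>A finite set of multi-indices lies in a box, and over a box the sum of products is the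
  product of sums.\<close>

lemma sum_PiE_prod_le:
  fixes q :: "'i \<Rightarrow> nat \<Rightarrow> real"
  assumes I: "finite I" and F: "finite F" "F \<subseteq> PiE I (\<lambda>_. UNIV)"
    and q: "\<And>j m. j \<in> I \<Longrightarrow> 0 \<le> q j m" and S: "\<And>j M. j \<in> I \<Longrightarrow> (\<Sum>m\<le>M. q j m) \<le> S j"
  shows "(\<Sum>\<nu>\<in>F. \<Prod>j\<in>I. q j (\<nu> j)) \<le> (\<Prod>j\<in>I. S j)"
proof -
  have "finite (\<Union>\<nu>\<in>F. \<nu> ` I)" using F I by auto
  then obtain M where M: "(\<Union>\<nu>\<in>F. \<nu> ` I) \<subseteq> {..M}" using finite_nat_iff_bounded_le by blast
  have "F \<subseteq> PiE I (\<lambda>_. {..M})" using F(2) M by (force simp: PiE_def Pi_def)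
  then have "(\<Sum>\<nu>\<in>F. \<Prod>j\<in>I. q j (\<nu> j)) \<le> (\<Sum>\<nu>\<in>PiE I (\<lambda>_. {..M}). \<Prod>j\<in>I. q j (\<nu> j))"
    using I q by (intro sum_mono2 finite_PiE prod_nonneg) auto
  also have "\<dots> = (\<Prod>j\<in>I. \<Sum>m\<le>M. q j m)" using I by (subst prod_sum_PiE) auto
  also have "\<dots> \<le> (\<Prod>j\<in>I. S j)" using q S by (intro prod_mono conjI sum_nonneg) auto
  finally show ?thesis .
qed

lemma geometric_partial_sum_le: "0 \<le> (x::real) \<Longrightarrow> x < 1 \<Longrightarrow> (\<Sum>m\<le>M. x ^ m) \<le> 1 / (1 - x)"
  using sum_le_suminf[OF summable_geometric[of x], of "{..M}"] suminf_geometric[of x] by simp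

definition cw :: "nat \<Rightarrow> real" where "cw m = (if m = 0 then 1 else 2)"

lemma cw: "1 \<le> cw m" "cw m \<le> 2" "0 < cw m" by (auto simp: cw_def)

text \<open>\<open>ctrans j m\<close> takes the \<open>m\<close>-th Chebyshev coefficient in the variable \<open>j\<close>, so that \<open>iter_coeff n \<nu> g\<close> is the
  tensor Chebyshev coefficient with index \<open>\<nu>\<close> in the first \<open>n\<close> variables.\<close>

definition ctrans :: "nat \<Rightarrow> nat \<Rightarrow> ((nat \<Rightarrow> complex) \<Rightarrow> complex) \<Rightarrow> (nat \<Rightarrow> complex) \<Rightarrow> complex" where
  "ctrans j m g z = cheb_coeff (\<lambda>x. g (z(j := of_real x))) m"

primrec iter_coeff :: "nat \<Rightarrow> (nat \<Rightarrow> nat) \<Rightarrow> ((nat \<Rightarrow> complex) \<Rightarrow> complex) \<Rightarrow> (nat \<Rightarrow> complex) \<Rightarrow> complex" where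
  "iter_coeff 0 \<nu> g = g"
| "iter_coeff (Suc n) \<nu> g = ctrans n (\<nu> n) (iter_coeff n \<nu> g)"

lemma iter_coeff_cong: "(\<And>j. j < n \<Longrightarrow> \<nu> j = \<nu>' j) \<Longrightarrow> iter_coeff n \<nu> g = iter_coeff n \<nu>' g"
  by (induction n) auto

lemma iter_coeff_indep: "(\<And>j. n \<le> j \<Longrightarrow> z j = z' j) \<Longrightarrow> iter_coeff n \<nu> g z = iter_coeff n \<nu> g z'"
proof (induction n arbitrary: z z')
  case 0
  then have "z = z'" by auto
  then show ?case by simp
next
  case (Suc n)
  have "iter_coeff n \<nu> g (z(n := of_real x)) = iter_coeff n \<nu> g (z'(n := of_real x))" for x
    using Suc.prems by (intro Suc.IH) (auto simp: Suc_le_eq)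
  then show ?case by (simp add: ctrans_def)
qed

context weights
begin

text \<open>The conditions are imposed on every strictly smaller tube and not on the limiting one,
  since moving a contour needs an open set beyond it. \<open>ctrans\<close> preserves the notion
  with the same \<delta>, at the price of doubling B.\<close>

definition tame :: "nat \<Rightarrow> real \<Rightarrow> real \<Rightarrow> ((nat \<Rightarrow> complex) \<Rightarrow> complex) \<Rightarrow> bool" where
  "tame N \<delta> B g \<longleftrightarrow> (\<forall>\<delta>'<\<delta>. curve_hol b N \<delta>' g \<and> (\<forall>z\<in>nbhd b N \<delta>'. cmod (g z) \<le> B))"

lemma tameD:
  assumes "tame N \<delta> B g" "\<delta>' < \<delta>" shows "curve_hol b N \<delta>' g" "z \<in> nbhd b N \<delta>' \<Longrightarrow> cmod (g z) \<le> B"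
  using assms by (auto simp: tame_def)

lemma nbhd_upd:
  assumes z: "z \<in> nbhd b N \<delta>" and x: "x \<in> {-1..1}" and e: "b j * cmod (w - of_real x) \<le> e"
  shows "z(j := w) \<in> nbhd b N (\<delta> + e)"
proof -
  obtain y where y: "y \<in> cube" "sdist N z (complex_of_real \<circ> y) \<le> \<delta>" using z by (auto simp: nbhd_sdist)
  have "sdist N (z(j := w)) (complex_of_real \<circ> y(j := x)) \<le> (\<Sum>i<N. b i * cmod (z i - of_real (y i)) + (if i = j then b j * cmod (w - of_real x) else 0))"
    unfolding sdist_def using b_nonneg by (intro sum_mono) auto
  also have "\<dots> \<le> sdist N z (complex_of_real \<circ> y) + b j * cmod (w - of_real x)"
    using b_nonneg by (simp add: sum.distrib sdist_def)
  finally have "sdist N (z(j := w)) (complex_of_real \<circ> y(j := x)) \<le> \<delta> + e" using y e by linarith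
  moreover have "y(j := x) \<in> cube" using y x by (auto simp: cube_def)
  ultimately show ?thesis unfolding nbhd_sdist by blast
qed

lemma nbhd_upd_cos:
  assumes z: "z \<in> nbhd b N \<delta>" and \<tau>: "\<bar>Im s\<bar> \<le> \<tau>"
  shows "z(j := cos (of_real pi * s)) \<in> nbhd b N (\<delta> + b j * (exp (pi * \<tau>) - 1))"
proof (rule nbhd_upd[OF z])
  show "cos (pi * Re s) \<in> {-1..1}" by auto
  have "of_real pi * s = of_real (pi * Re s) + \<i> * of_real (pi * Im s)" by (simp add: complex_eq_iff)
  then have "cmod (cos (of_real pi * s) - of_real (cos (pi * Re s))) \<le> exp \<bar>pi * Im s\<bar> - 1"
    using cmod_cos_diff[of "pi * Re s" "pi * Im s"] by simp
  also have "\<dots> \<le> exp (pi * \<tau>) - 1" using \<tau> by (simp add: abs_mult)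
  finally show "b j * cmod (cos (of_real pi * s) - of_real (cos (pi * Re s))) \<le> b j * (exp (pi * \<tau>) - 1)"
    using b_nonneg by (rule mult_left_mono)
qed

lemma tame_slice_continuous:
  assumes g: "tame N \<delta> B g" and z: "z \<in> nbhd b N \<delta>'" "\<delta>' < \<delta>"
  shows "continuous_on {-1..1} (\<lambda>x. g (z(j := of_real x)))"
proof -
  define S where "S = {s. \<exists>x\<in>{-1..1}. b j * cmod (s - of_real x) < (\<delta> - \<delta>') / 2}"
  have S: "open S"
  proof -
    have "S = (\<Union>x\<in>{-1..1}. {w. b j * cmod (w - of_real x) < (\<delta> - \<delta>') / 2})" by (auto simp: S_def)
    also have "open \<dots>" by (intro open_UN ballI open_Collect_less continuous_intros)
    finally show ?thesis .
  qed
  have "(\<lambda>s. g (z(j := s))) holomorphic_on S"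
  proof (rule curve_holD[OF tameD(1)[OF g] S])
    show "\<delta>' + (\<delta> - \<delta>') / 2 < \<delta>" using z by (simp add: field_simps)
    show "(\<lambda>s. (z(j := s)) i) holomorphic_on S" for i by (cases "i = j") (auto intro: holomorphic_intros)
    show "z(j := s) \<in> nbhd b N (\<delta>' + (\<delta> - \<delta>') / 2)" if s: "s \<in> S" for s
    proof -
      obtain x where "x \<in> {-1..1}" "b j * cmod (s - of_real x) < (\<delta> - \<delta>') / 2" using s by (auto simp: S_def)
      then show ?thesis by (intro nbhd_upd[OF z(1)]) auto
    qed
  qed
  then have "continuous_on S (\<lambda>s. g (z(j := s)))" by (rule holomorphic_on_imp_continuous_on)
  moreover have "of_real x \<in> S" if "x \<in> {-1..1}" for x using that z by (auto simp: S_def intro!: bexI[of _ x])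
  ultimately show ?thesis by (intro continuous_on_compose2[where f = of_real and g = "\<lambda>s. g (z(j := s))" and t = S]) (auto intro!: continuous_intros)
qed

lemma tame_ctrans:
  assumes g: "tame N \<delta> B g" shows "tame N \<delta> (2 * B) (ctrans j m g)"
  unfolding tame_def
proof (intro allI impI conjI ballI)
  fix \<delta>' assume \<delta>': "\<delta>' < \<delta>"
  have real_upd: "z(j := of_real (cos (pi * t))) \<in> nbhd b N \<delta>'" if "z \<in> nbhd b N \<delta>'" for z t
    using nbhd_upd[OF that, of "cos (pi * t)" j "of_real (cos (pi * t))" 0] by simp
  have bd: "cmod (g (z(j := of_real (cos (pi * t)))) * of_real (cos (real m * (pi * t)))) \<le> B" if "z \<in> nbhd b N \<delta>'" for z t
    using mult_mono[OF tameD(2)[OF g \<delta>' real_upd[OF that, of t]] abs_cos_le_one[of "real m * (pi * t)"]]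
      order_trans[OF norm_ge_zero tameD(2)[OF g \<delta>' real_upd[OF that, of t]]] by (simp add: norm_mult)
  have cont: "continuous_on {-1..1} (\<lambda>t. g (z(j := of_real (cos (pi * t)))) * of_real (cos (real m * (pi * t))))" if "z \<in> nbhd b N \<delta>'" for z
    using continuous_on_cos_pi[OF tame_slice_continuous[OF g that \<delta>', of j]] by (intro continuous_intros) auto
  show "curve_hol b N \<delta>' (ctrans j m g)"
  proof (rule curve_holI)
    fix S \<zeta> assume S: "open S" and \<zeta>: "\<And>i. i < N \<Longrightarrow> (\<lambda>s. \<zeta> s i) holomorphic_on S" and nb: "\<And>s. s \<in> S \<Longrightarrow> \<zeta> s \<in> nbhd b N \<delta>'"
    have "(\<lambda>s. \<integral>t. g ((\<zeta> s)(j := of_real (cos (pi * t)))) * of_real (cos (real m * (pi * t))) \<partial>mu1) holomorphic_on S"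
    proof (rule holomorphic_on_integral[OF finite_measure_mu1 S])
      show "(\<lambda>s. g ((\<zeta> s)(j := of_real (cos (pi * t)))) * of_real (cos (real m * (pi * t)))) holomorphic_on S" for t
      proof (intro holomorphic_intros curve_holD[OF tameD(1)[OF g \<delta>'] S])
        show "(\<lambda>s. ((\<zeta> s)(j := of_real (cos (pi * t)))) i) holomorphic_on S" if "i < N" for i
          using \<zeta>[OF that] by (cases "i = j") auto
      qed (use real_upd nb in auto)
      show "(\<lambda>t. g ((\<zeta> s)(j := of_real (cos (pi * t)))) * of_real (cos (real m * (pi * t)))) \<in> borel_measurable mu1" if "s \<in> S" for s
        by (rule measurable_mu1_continuous[OF cont[OF nb[OF that]]])
    qed (use bd nb in auto)
    then show "(\<lambda>s. ctrans j m g (\<zeta> s)) holomorphic_on S"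
      unfolding ctrans_def cheb_coeff_def by (intro holomorphic_intros)
  qed
  fix z assume z: "z \<in> nbhd b N \<delta>'"
  have "cmod (\<integral>t. g (z(j := of_real (cos (pi * t)))) * of_real (cos (real m * (pi * t))) \<partial>mu1) \<le> (\<integral>t. B \<partial>mu1)"
    using bd[OF z] by (intro Bochner_Integration.integral_norm_bound_integral integrable_mu1_continuous[OF cont[OF z]] integrable_mu1_continuous) auto
  then have 1: "cmod (\<integral>t. g (z(j := of_real (cos (pi * t)))) * of_real (cos (real m * (pi * t))) \<partial>mu1) \<le> B" by simp
  then have "0 \<le> B" using norm_ge_zero order_trans by blast
  then show "cmod (ctrans j m g z) \<le> 2 * B"
    unfolding ctrans_def cheb_coeff_def norm_mult using 1 by (intro mult_mono) auto
qed

lemma tame_iter_coeff: "tame N \<delta> B g \<Longrightarrow> tame N \<delta> (2 ^ n * B) (iter_coeff n \<nu> g)"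
  by (induction n) (auto dest: tame_ctrans simp: mult.assoc)

lemma ctrans_bound:
  assumes g: "tame N \<delta> B0 g" and z: "z \<in> nbhd b N \<delta>'" and \<eta>: "0 \<le> \<eta>" "\<delta>' + b j * (exp (pi * \<eta>) - 1) < \<delta>"
    and bd: "\<And>t. t \<in> {-1..1} \<Longrightarrow> cmod (g (z(j := cos (of_real pi * (of_real t + \<i> * of_real \<eta>))))) \<le> B"
      "\<And>t. t \<in> {-1..1} \<Longrightarrow> cmod (g (z(j := cos (of_real pi * (of_real t + \<i> * of_real (-\<eta>)))))) \<le> B"
  shows "cmod (ctrans j m g z) \<le> cw m * exp (- (real m * (pi * \<eta>))) * B"
proof -
  \<comment> \<open>Some \<tau> beyond \<eta> still respects the strict budget, so the contour at
    height \<eta> lies inside an open strip of holomorphy.\<close>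
  have "((\<lambda>\<tau>. \<delta>' + b j * (exp (pi * \<tau>) - 1)) \<longlongrightarrow> \<delta>' + b j * (exp (pi * \<eta>) - 1)) (at_right \<eta>)"
    by (intro tendsto_intros)
  then have "\<forall>\<^sub>F \<tau> in at_right \<eta>. \<delta>' + b j * (exp (pi * \<tau>) - 1) < \<delta>" using \<eta>(2) order_tendstoD(2) by blast
  then have "\<forall>\<^sub>F \<tau> in at_right \<eta>. \<delta>' + b j * (exp (pi * \<tau>) - 1) < \<delta> \<and> \<eta> < \<tau>"
    by (intro eventually_conj eventually_at_right_less)
  then obtain \<tau> where \<tau>: "\<delta>' + b j * (exp (pi * \<tau>) - 1) < \<delta>" "\<eta> < \<tau>"
    using eventually_happens'[OF trivial_limit_at_right_real] by blast
  define f where "f s = g (z(j := cos (of_real pi * s)))" for s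
  define V where "V = {s. \<bar>Im s\<bar> < \<tau>}"
  have oV: "open V"
  proof -
    have "V = {s. Im s < \<tau>} \<inter> {s. Im s > - \<tau>}" by (auto simp: V_def)
    then show ?thesis by (auto intro!: open_Int open_halfspace_Im_lt open_halfspace_Im_gt)
  qed
  have hol: "f holomorphic_on V"
    unfolding f_def
  proof (rule curve_holD[OF tameD(1)[OF g \<tau>(1)] oV])
    show "(\<lambda>s. (z(j := cos (of_real pi * s))) i) holomorphic_on V" for i
      by (cases "i = j") (auto intro!: holomorphic_intros)
    show "z(j := cos (of_real pi * s)) \<in> nbhd b N (\<delta>' + b j * (exp (pi * \<tau>) - 1))" if "s \<in> V" for s
      using that by (intro nbhd_upd_cos z) (auto simp: V_def)
  qed
  have per: "f (s + 2) = f s" for s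
  proof -
    have "of_real pi * (s + 2) = of_real pi * s + of_real (2 * pi)" by (simp add: algebra_simps)
    then have "cos (of_real pi * (s + 2)) = cos (of_real pi * s)" by (simp add: cos_add cos_of_real sin_of_real)
    then show ?thesis by (simp add: f_def)
  qed
  have "cmod (\<integral>t. f (of_real t) * of_real (cos (real m * (pi * t))) \<partial>mu1) \<le> exp (- (real m * (pi * \<eta>))) * B"
    by (rule periodic_coeff_bound[OF hol[unfolded V_def] per \<eta>(1) \<tau>(2)]) (use bd in \<open>auto simp: f_def\<close>)
  moreover have "f (of_real t) = g (z(j := of_real (cos (pi * t))))" for t
    by (simp add: f_def cos_of_real flip: of_real_mult)
  ultimately show ?thesis
    unfolding ctrans_def cheb_coeff_def norm_mult cw_def by (cases "m = 0") (simp_all add: mult_left_mono)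
qed

text \<open>The variables are shifted to their ellipses one after the other, starting with the
  outermost transform, each paying \<open>b j * (exp (pi * \<eta> j) - 1)\<close>. In the end only
  values of g with all these coordinates on the ellipses enter, and they can be much smaller than
  the global bound \<open>B0\<close>.\<close>

lemma iter_coeff_bound:
  assumes g: "tame N \<delta> B0 g" and \<eta>: "\<And>j. 0 \<le> \<eta> j"
    and z: "z \<in> nbhd b N \<delta>'" "\<delta>' + (\<Sum>j<n. b j * (exp (pi * \<eta> j) - 1)) < \<delta>"
    and bd: "\<And>z'. (\<And>i. n \<le> i \<Longrightarrow> z' i = z i) \<Longrightarrow>
       (\<And>j. j < n \<Longrightarrow> \<exists>t\<in>{-1..1}. \<exists>\<sigma>\<in>{1,-1}. z' j = cos (of_real pi * (of_real t + \<i> * of_real (\<sigma> * \<eta> j)))) \<Longrightarrow> cmod (g z') \<le> B"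
  shows "cmod (iter_coeff n \<nu> g z) \<le> (\<Prod>j<n. cw (\<nu> j) * exp (- (real (\<nu> j) * (pi * \<eta> j)))) * B"
  using z bd
proof (induction n arbitrary: z \<delta>')
  case 0
  then show ?case by simp
next
  case (Suc n)
  define X where "X = (\<Prod>j<n. cw (\<nu> j) * exp (- (real (\<nu> j) * (pi * \<eta> j)))) * B"
  have pos: "0 \<le> b j * (exp (pi * \<eta> j) - 1)" for j using b_nonneg \<eta> by simp
  have main: "cmod (iter_coeff n \<nu> g (z(n := cos (of_real pi * (of_real t + \<i> * of_real (\<sigma> * \<eta> n)))))) \<le> X"
    if t: "t \<in> {-1..1}" and \<sigma>: "\<sigma> \<in> {1, -1}" for t \<sigma>
    unfolding X_def
  proof (rule Suc.IH)
    show "z(n := cos (of_real pi * (of_real t + \<i> * of_real (\<sigma> * \<eta> n)))) \<in> nbhd b N (\<delta>' + b n * (exp (pi * \<eta> n) - 1))"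
      by (rule nbhd_upd_cos[OF Suc.prems(1)]) (use \<sigma> \<eta>[of n] in auto)
    show "\<delta>' + b n * (exp (pi * \<eta> n) - 1) + (\<Sum>j<n. b j * (exp (pi * \<eta> j) - 1)) < \<delta>"
      using Suc.prems(2) by simp
    fix z' assume z': "\<And>i. n \<le> i \<Longrightarrow> z' i = (z(n := cos (of_real pi * (of_real t + \<i> * of_real (\<sigma> * \<eta> n))))) i"
      "\<And>j. j < n \<Longrightarrow> \<exists>t\<in>{-1..1}. \<exists>\<sigma>\<in>{1, - 1}. z' j = cos (of_real pi * (of_real t + \<i> * of_real (\<sigma> * \<eta> j)))"
    show "cmod (g z') \<le> B"
    proof (rule Suc.prems(3))
      show "z' i = z i" if "Suc n \<le> i" for i using z'(1)[of i] that by simp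
      show "\<exists>t\<in>{-1..1}. \<exists>\<sigma>\<in>{1, - 1}. z' j = cos (of_real pi * (of_real t + \<i> * of_real (\<sigma> * \<eta> j)))" if "j < Suc n" for j
      proof (cases "j = n")
        case True
        then show ?thesis using z'(1)[of n] t \<sigma> by (intro bexI[of _ t] bexI[of _ \<sigma>]) auto
      qed (use z'(2) that in auto)
    qed
  qed
  have "cmod (ctrans n (\<nu> n) (iter_coeff n \<nu> g) z) \<le> cw (\<nu> n) * exp (- (real (\<nu> n) * (pi * \<eta> n))) * X"
  proof (rule ctrans_bound[OF tame_iter_coeff[OF g] Suc.prems(1) \<eta>])
    have "0 \<le> (\<Sum>j<n. b j * (exp (pi * \<eta> j) - 1))" by (intro sum_nonneg pos)
    then show "\<delta>' + b n * (exp (pi * \<eta> n) - 1) < \<delta>" using Suc.prems(2) by simp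
  qed (use main[of _ 1] main[of _ "-1"] in simp_all)
  then show ?case by (simp add: X_def mult_ac)
qed

text \<open>For fixed earlier indices the sum over the last index is a one-variable Chebyshev
  expansion. Absolute summability over all indices allows iterated summation; the crude geometric
  decay behind it may depend on n, as no rate is extracted here.\<close>

lemma tame_expansion:
  assumes g: "tame N \<delta> B g" and \<delta>: "0 < \<delta>" and y: "y \<in> cube"
  shows "((\<lambda>\<nu>. iter_coeff n \<nu> g (complex_of_real \<circ> y) * (\<Prod>j<n. of_real (cheb (\<nu> j) (y j)))) has_sum g (complex_of_real \<circ> y)) (PiE {..<n} (\<lambda>_. UNIV))"
proof (induction n)
  case 0
  show ?case using has_sum_finite[of "{\<lambda>x. undefined}" "\<lambda>\<nu>::nat\<Rightarrow>nat. g (complex_of_real \<circ> y)"] by (simp add: o_def)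
next
  case (Suc n)
  define Y where "Y = complex_of_real \<circ> y"
  have Y: "Y \<in> nbhd b N 0" unfolding Y_def using y by (intro cube_in_nbhd) auto
  have yj: "y j \<in> {-1..1}" for j using y by (auto simp: cube_def)
  have B0: "0 \<le> B" using tameD(2)[OF g \<delta> Y] norm_ge_zero order_trans by blast
  define s where "s = (\<Sum>j<Suc n. b j)"
  have s0: "0 \<le> s" unfolding s_def by (intro sum_nonneg b_nonneg)
  \<comment> \<open>One common height for all variables, with ellipse parameter
    \<open>1 + \<delta> / (2 * (s + 1))\<close>, so that the total cost is less than
    \<delta>.\<close>
  define \<eta> where "\<eta> = ln (1 + \<delta> / (2 * (s + 1))) / pi"
  have pos: "0 < \<delta> / (2 * (s + 1))" using \<delta> s0 by simp
  then have \<eta>: "0 < \<eta>" "exp (pi * \<eta>) - 1 = \<delta> / (2 * (s + 1))"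
    unfolding \<eta>_def using exp_ln[of "1 + \<delta> / (2 * (s + 1))"] by (auto intro!: divide_pos_pos ln_gt_zero simp del: exp_ln_iff)
  have budget: "(\<Sum>j<Suc n. b j * (exp (pi * \<eta>) - 1)) < \<delta>"
  proof -
    have "(\<Sum>j<Suc n. b j * (exp (pi * \<eta>) - 1)) = s * (\<delta> / (2 * (s + 1)))" unfolding s_def \<eta>(2)[unfolded s_def] sum_distrib_right ..
    also have "\<dots> < \<delta>" using \<delta> s0 by (simp add: field_simps add_nonneg_pos)
    finally show ?thesis .
  qed
  define \<rho> where "\<rho> = exp (- (pi * \<eta>))"
  have \<rho>: "0 < \<rho>" "\<rho> < 1" using \<eta> by (auto simp: \<rho>_def)
  have coeff: "cmod (iter_coeff (Suc n) \<nu> g Y) \<le> (\<Prod>j<Suc n. 2 * \<rho> ^ \<nu> j) * B" for \<nu>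
  proof -
    have "cmod (iter_coeff (Suc n) \<nu> g Y) \<le> (\<Prod>j<Suc n. cw (\<nu> j) * exp (- (real (\<nu> j) * (pi * \<eta>)))) * B"
    proof (rule iter_coeff_bound[OF g _ Y])
      show "0 + (\<Sum>j<Suc n. b j * (exp (pi * \<eta>) - 1)) < \<delta>" using budget by simp
      fix z' assume z': "\<And>i. Suc n \<le> i \<Longrightarrow> z' i = Y i" "\<And>j. j < Suc n \<Longrightarrow> \<exists>t\<in>{-1..1}. \<exists>\<sigma>\<in>{1, - 1}. z' j = cos (of_real pi * (of_real t + \<i> * of_real (\<sigma> * \<eta>)))"
      have "\<exists>x\<in>{-1..1}. cmod (z' j - of_real x) \<le> (if j < Suc n then exp (pi * \<eta>) - 1 else 0)" for j
      proof (cases "j < Suc n")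
        case True
        then obtain t \<sigma> where t: "\<sigma> \<in> {1, -1}" "z' j = cos (of_real pi * (of_real t + \<i> * of_real (\<sigma> * \<eta>)))" using z'(2) by blast
        have "of_real pi * (of_real t + \<i> * of_real (\<sigma> * \<eta>)) = of_real (pi * t) + \<i> * of_real (pi * (\<sigma> * \<eta>))" by (simp add: algebra_simps)
        then have "cmod (z' j - of_real (cos (pi * t))) \<le> exp \<bar>pi * (\<sigma> * \<eta>)\<bar> - 1" using t(2) cmod_cos_diff[of "pi * t" "pi * (\<sigma> * \<eta>)"] by simp
        also have "\<bar>pi * (\<sigma> * \<eta>)\<bar> = pi * \<eta>" using t(1) \<eta> by (auto simp: abs_mult)
        finally show ?thesis using True by (intro bexI[of _ "cos (pi * t)"]) auto
      next
        case False
        then show ?thesis using z'(1)[of j] yj by (intro bexI[of _ "y j"]) (auto simp: Y_def)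
      qed
      then obtain x where x: "\<And>j. x j \<in> {-1..1}" "\<And>j. cmod (z' j - of_real (x j)) \<le> (if j < Suc n then exp (pi * \<eta>) - 1 else 0)"
        by metis
      have "sdist N z' (complex_of_real \<circ> x) \<le> (\<Sum>j<N. if j < Suc n then b j * (exp (pi * \<eta>) - 1) else 0)"
        unfolding sdist_def
      proof (rule sum_mono)
        fix j
        have "b j * cmod (z' j - (complex_of_real \<circ> x) j) \<le> b j * (if j < Suc n then exp (pi * \<eta>) - 1 else 0)"
          using x(2)[of j] b_nonneg by (intro mult_left_mono) auto
        then show "b j * cmod (z' j - (complex_of_real \<circ> x) j) \<le> (if j < Suc n then b j * (exp (pi * \<eta>) - 1) else 0)" by (auto split: if_splits)
      qed
      also have "\<dots> = (\<Sum>j\<in>{..<N} \<inter> {..<Suc n}. b j * (exp (pi * \<eta>) - 1))"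
        by (simp add: sum.inter_restrict)
      also have "\<dots> \<le> (\<Sum>j<Suc n. b j * (exp (pi * \<eta>) - 1))"
        using b_nonneg \<eta> pos by (intro sum_mono2 mult_nonneg_nonneg) auto
      finally have "sdist N z' (complex_of_real \<circ> x) \<le> (\<Sum>j<Suc n. b j * (exp (pi * \<eta>) - 1))" .
      moreover have "x \<in> cube" using x by (auto simp: cube_def)
      ultimately have "z' \<in> nbhd b N (\<Sum>j<Suc n. b j * (exp (pi * \<eta>) - 1))" unfolding nbhd_sdist by blast
      then show "cmod (g z') \<le> B" using tameD(2)[OF g budget] by blast
    qed (use \<eta> in auto)
    also have "\<dots> \<le> (\<Prod>j<Suc n. 2 * \<rho> ^ \<nu> j) * B"
    proof (intro mult_right_mono prod_mono B0 conjI)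
      fix j
      have "exp (- (real (\<nu> j) * (pi * \<eta>))) = \<rho> ^ \<nu> j" by (simp add: \<rho>_def exp_of_nat_mult[symmetric])
      then show "cw (\<nu> j) * exp (- (real (\<nu> j) * (pi * \<eta>))) \<le> 2 * \<rho> ^ \<nu> j" using cw(2)[of "\<nu> j"] \<rho> by (simp add: mult_right_mono)
      show "0 \<le> cw (\<nu> j) * exp (- (real (\<nu> j) * (pi * \<eta>)))" using cw(3)[of "\<nu> j"] by simp
    qed
    finally show ?thesis .
  qed
  have gs: "(\<Sum>m\<le>M. 2 * \<rho> ^ m) \<le> 2 * (1 / (1 - \<rho>))" for M
    unfolding sum_distrib_left[symmetric] using \<rho> by (intro mult_left_mono geometric_partial_sum_le) auto
  define A where "A = PiE {..<n} (\<lambda>_. UNIV :: nat set)"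
  define T where "T \<nu> = iter_coeff (Suc n) \<nu> g Y * (\<Prod>j<Suc n. of_real (cheb (\<nu> j) (y j)))" for \<nu>
  define f where "f = (\<lambda>(\<nu>, m). T (\<nu>(n := m)))"
  have Tle: "cmod (T \<nu>) \<le> (\<Prod>j<Suc n. 2 * \<rho> ^ \<nu> j) * B" for \<nu>
  proof -
    have "cmod (\<Prod>j<Suc n. of_real (cheb (\<nu> j) (y j))) \<le> 1"
      using cheb_le_1[OF yj] by (simp only: prod_norm[symmetric] norm_of_real) (intro prod_le_1, auto)
    then have "cmod (T \<nu>) \<le> cmod (iter_coeff (Suc n) \<nu> g Y)" unfolding T_def norm_mult by (rule mult_left_le) simp
    then show ?thesis using coeff[of \<nu>] by linarith
  qed
  have img: "PiE {..<Suc n} (\<lambda>_. UNIV) = (\<lambda>(\<nu>, m). \<nu>(n := m)) ` (A \<times> UNIV)"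
    unfolding A_def lessThan_Suc PiE_insert_eq by (auto simp: image_def)
  have inj: "inj_on (\<lambda>(\<nu>, m). \<nu>(n := m)) (A \<times> UNIV)"
  proof (rule inj_onI, clarsimp)
    fix \<nu> m \<nu>' m' assume a: "\<nu> \<in> A" "\<nu>' \<in> A" "\<nu>(n := m) = \<nu>'(n := m')"
    have "\<nu> j = \<nu>' j" for j
    proof (cases "j = n")
      case True
      then show ?thesis using a by (auto simp: A_def PiE_def extensional_def)
    qed (use fun_cong[OF a(3), of j] in simp)
    then show "\<nu> = \<nu>' \<and> m = m'" using fun_cong[OF a(3), of n] by auto
  qed
  have "(\<lambda>\<nu>. norm (T \<nu>)) summable_on PiE {..<Suc n} (\<lambda>_. UNIV)"
  proof (rule nonneg_bdd_above_summable_on)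
    show "bdd_above (sum (\<lambda>\<nu>. norm (T \<nu>)) ` {F. F \<subseteq> PiE {..<Suc n} (\<lambda>_. UNIV) \<and> finite F})"
    proof (rule bdd_aboveI)
      fix v assume "v \<in> sum (\<lambda>\<nu>. norm (T \<nu>)) ` {F. F \<subseteq> PiE {..<Suc n} (\<lambda>_. UNIV) \<and> finite F}"
      then obtain F where F: "F \<subseteq> PiE {..<Suc n} (\<lambda>_. UNIV)" "finite F" "v = (\<Sum>\<nu>\<in>F. norm (T \<nu>))" by auto
      have "v \<le> (\<Sum>\<nu>\<in>F. \<Prod>j<Suc n. 2 * \<rho> ^ \<nu> j) * B" unfolding F(3) sum_distrib_right by (rule sum_mono, rule Tle)
      also have "\<dots> \<le> (\<Prod>j<Suc n. 2 * (1 / (1 - \<rho>))) * B"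
        using F B0 \<rho> by (intro mult_right_mono sum_PiE_prod_le[where q = "\<lambda>j m. 2 * \<rho> ^ m"])
          (use gs in auto)
      finally show "v \<le> (\<Prod>j<Suc n. 2 * (1 / (1 - \<rho>))) * B" .
    qed
  qed simp
  then have "T summable_on PiE {..<Suc n} (\<lambda>_. UNIV)" by (rule abs_summable_summable)
  then obtain a where a: "(T has_sum a) (PiE {..<Suc n} (\<lambda>_. UNIV))" by (auto simp: summable_on_def)
  then have fa: "(f has_sum a) (A \<times> UNIV)"
    unfolding img has_sum_reindex[OF inj] by (simp add: f_def o_def case_prod_unfold)
  have row: "((\<lambda>m. f (\<nu>, m)) has_sum (iter_coeff n \<nu> g Y * (\<Prod>j<n. of_real (cheb (\<nu> j) (y j))))) UNIV" if "\<nu> \<in> A" for \<nu>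
  proof -
    define h where "h x = iter_coeff n \<nu> g (Y(n := of_real x))" for x
    have ch: "continuous_on {-1..1} h"
      unfolding h_def[abs_def] by (rule tame_slice_continuous[OF tame_iter_coeff[OF g] Y \<delta>])
    have hc: "cheb_coeff h m = iter_coeff (Suc n) (\<nu>(n := m)) g Y" for m
      using iter_coeff_cong[of n "\<nu>(n := m)" \<nu> g] by (simp add: ctrans_def h_def[abs_def])
    have hs: "summable (\<lambda>m. cmod (cheb_coeff h m))"
    proof (rule summable_comparison_test'[of "\<lambda>m. (\<Prod>j<n. 2 * \<rho> ^ \<nu> j) * 2 * B * \<rho> ^ m" 0])
      show "summable (\<lambda>m. (\<Prod>j<n. 2 * \<rho> ^ \<nu> j) * 2 * B * \<rho> ^ m)" using \<rho> by (intro summable_mult summable_geometric) auto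
      show "norm (cmod (cheb_coeff h m)) \<le> (\<Prod>j<n. 2 * \<rho> ^ \<nu> j) * 2 * B * \<rho> ^ m" for m
        using coeff[of "\<nu>(n := m)"] unfolding hc by (simp add: mult_ac)
    qed
    have "(\<lambda>m. cheb_coeff h m * of_real (cheb m (y n))) sums h (y n)" by (rule cheb_expansion[OF ch hs yj])
    moreover have "summable (\<lambda>m. norm (cheb_coeff h m * of_real (cheb m (y n))))"
      by (rule summable_comparison_test'[OF hs, of 0]) (use cheb_le_1[OF yj] in \<open>auto simp: norm_mult intro!: mult_left_le\<close>)
    ultimately have "((\<lambda>m. cheb_coeff h m * of_real (cheb m (y n))) has_sum h (y n)) UNIV" by (intro norm_summable_imp_has_sum)
    moreover have "h (y n) = iter_coeff n \<nu> g Y" by (simp add: h_def Y_def fun_upd_idem)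
    ultimately have "((\<lambda>m. cheb_coeff h m * of_real (cheb m (y n)) * (\<Prod>j<n. of_real (cheb (\<nu> j) (y j)))) has_sum (iter_coeff n \<nu> g Y * (\<Prod>j<n. of_real (cheb (\<nu> j) (y j))))) UNIV"
      using has_sum_cmult_left[where f = "\<lambda>m. cheb_coeff h m * of_real (cheb m (y n))" and a = "h (y n)" and A = UNIV and c = "\<Prod>j<n. of_real (cheb (\<nu> j) (y j))"] by simp
    moreover have "f (\<nu>, m) = cheb_coeff h m * of_real (cheb m (y n)) * (\<Prod>j<n. of_real (cheb (\<nu> j) (y j)))" for m
      by (simp add: f_def T_def hc mult_ac del: iter_coeff.simps)
    ultimately show ?thesis by simp
  qed
  \<comment> \<open>The full sum is the sum of the row sums, which the induction hypothesis
    evaluates.\<close>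
  have "((\<lambda>\<nu>. iter_coeff n \<nu> g Y * (\<Prod>j<n. of_real (cheb (\<nu> j) (y j)))) has_sum a) A"
    by (rule has_sum_SigmaD[OF fa row])
  then have "a = g Y" using Suc.IH has_sum_unique unfolding A_def Y_def by blast
  then show ?case using a by (simp only: T_def[abs_def] Y_def)
qed

end

section \<open>Summability with respect to the weights\<close>

lemma sum_PiE_insert:
  assumes "i \<notin> I"
  shows "(\<Sum>\<eta>\<in>PiE (insert i I) (\<lambda>_. S). f \<eta>) = (\<Sum>m\<in>S. \<Sum>\<eta>\<in>PiE I (\<lambda>_. S). f (\<eta>(i := m)))"
proof -
  have "(\<Sum>\<eta>\<in>PiE (insert i I) (\<lambda>_. S). f \<eta>) = (\<Sum>(m, \<eta>)\<in>S \<times> PiE I (\<lambda>_. S). f (\<eta>(i := m)))"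
    unfolding PiE_insert_eq by (subst sum.reindex[OF inj_combinator[OF assms]]) (simp add: case_prod_unfold o_def)
  then show ?thesis by (simp add: sum.cartesian_product)
qed

text \<open>The negative binomial series: multiplication by \<open>1 - q\<close> telescopes by
  Pascal's rule and lowers s by one.\<close>

lemma neg_binomial_partial_sum_le:
  fixes q :: real assumes q: "0 \<le> q" "q < 1"
  shows "(\<Sum>m\<le>M. real ((s + m) choose m) * q ^ m) \<le> 1 / (1 - q) ^ Suc s"
proof (induction s)
  case 0
  then show ?case using geometric_partial_sum_le[OF q] by simp
next
  case (Suc s)
  define C where "C s m = real ((s + m) choose m)" for s m
  have pascal: "C (Suc s) (Suc M) = C (Suc s) M + C s (Suc M)" for M by (simp add: C_def)
  have "(1 - q) * (\<Sum>m\<le>M. C (Suc s) m * q ^ m) = (\<Sum>m\<le>M. C s m * q ^ m) - C (Suc s) M * q ^ Suc M"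
  proof (induction M)
    case 0
    then show ?case by (simp add: C_def)
  next
    case (Suc M)
    have "(1 - q) * (c * q ^ Suc M) = c * q ^ Suc M - c * q ^ Suc (Suc M)" for c by (simp add: algebra_simps)
    then show ?case by (simp only: sum.atMost_Suc distrib_left Suc.IH pascal distrib_right)
  qed
  then have "(1 - q) * (\<Sum>m\<le>M. real ((Suc s + m) choose m) * q ^ m) = (\<Sum>m\<le>M. real ((s + m) choose m) * q ^ m) - real ((Suc s + M) choose M) * q ^ Suc M"
    by (simp only: C_def)
  also have "\<dots> \<le> 1 / (1 - q) ^ Suc s" using Suc q by (smt (verit, best) mult_nonneg_nonneg of_nat_0_le_iff zero_le_power)
  finally have "(\<Sum>m\<le>M. real ((Suc s + m) choose m) * q ^ m) \<le> (1 / (1 - q) ^ Suc s) / (1 - q)"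
    using q by (simp only: pos_le_divide_eq mult.commute)
  then show ?case by (simp add: mult.commute)
qed

text \<open>For \<open>low = (\<lambda>_. False)\<close> and \<open>s = 0\<close> this is the multinomial series \<open>\<Sum>\<^sub>\<eta> \<bar>\<eta>\<bar>! / \<eta>! x\<^sup>\<eta> = 1 / (1 - \<Sum>x)\<close>;
  the shift \<open>s\<close> makes the induction over the index set work.\<close>

lemma mixed_multinomial_sum_le:
  fixes x :: "'i \<Rightarrow> real" and \<theta> :: real
  assumes I: "finite I" and \<theta>: "0 < \<theta>" "\<theta> < 1" and x: "\<And>j. 0 \<le> x j" and X: "(\<Sum>j\<in>I. if low j then 0 else x j) < 1"
  shows "(\<Sum>\<eta>\<in>PiE I (\<lambda>_. {..M}). (\<Prod>j\<in>I. if low j then 2 * \<theta> ^ \<eta> j else x j ^ \<eta> j / fact (\<eta> j)) * fact (s + (\<Sum>j\<in>I. if low j then 0 else \<eta> j)))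
     \<le> (2 / (1 - \<theta>)) ^ card {j \<in> I. low j} * fact s / (1 - (\<Sum>j\<in>I. if low j then 0 else x j)) ^ Suc s"
  using I X
proof (induction I arbitrary: s rule: finite_induct)
  case empty
  then show ?case by simp
next
  case (insert i I)
  define X where "X = (\<Sum>j\<in>I. if low j then 0 else x j)"
  define c where "c = card {j \<in> I. low j}"
  define u where "u \<eta> = (\<Prod>j\<in>I. if low j then 2 * \<theta> ^ \<eta> j else x j ^ \<eta> j / fact (\<eta> j))" for \<eta> :: "'i \<Rightarrow> nat"
  define e where "e \<eta> = (\<Sum>j\<in>I. if low j then 0 else \<eta> j)" for \<eta> :: "'i \<Rightarrow> nat"
  have X1: "(if low i then 0 else x i) + X < 1" using insert.prems insert.hyps by (simp add: X_def)
  have "0 \<le> X" unfolding X_def using x by (intro sum_nonneg) auto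
  moreover have "X < 1" using X1 x[of i] by (cases "low i") auto
  ultimately have X01: "0 \<le> X" "X < 1" by auto
  have IH: "(\<Sum>\<eta>\<in>PiE I (\<lambda>_. {..M}). u \<eta> * fact (s + e \<eta>)) \<le> (2 / (1 - \<theta>)) ^ c * fact s / (1 - X) ^ Suc s" for s
    using insert.IH[of s] X01 by (simp add: u_def e_def c_def X_def)
  have upd: "u (\<eta>(i := m)) = u \<eta>" "e (\<eta>(i := m)) = e \<eta>" for \<eta> m
    unfolding u_def e_def using insert.hyps by (auto intro!: prod.cong sum.cong)
  have "(\<Sum>\<eta>\<in>PiE (insert i I) (\<lambda>_. {..M}). (\<Prod>j\<in>insert i I. if low j then 2 * \<theta> ^ \<eta> j else x j ^ \<eta> j / fact (\<eta> j)) * fact (s + (\<Sum>j\<in>insert i I. if low j then 0 else \<eta> j)))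
    = (\<Sum>\<eta>\<in>PiE (insert i I) (\<lambda>_. {..M}). (if low i then 2 * \<theta> ^ \<eta> i else x i ^ \<eta> i / fact (\<eta> i)) * u \<eta> * fact (s + ((if low i then 0 else \<eta> i) + e \<eta>)))"
    using insert.hyps by (simp add: u_def e_def)
  also have "\<dots> = (\<Sum>m\<le>M. \<Sum>\<eta>\<in>PiE I (\<lambda>_. {..M}). (if low i then 2 * \<theta> ^ m else x i ^ m / fact m) * u \<eta> * fact (s + ((if low i then 0 else m) + e \<eta>)))"
    unfolding sum_PiE_insert[OF insert.hyps(2)] by (cases "low i") (simp_all add: upd)
  also have "\<dots> = (\<Sum>m\<le>M. (if low i then 2 * \<theta> ^ m else x i ^ m / fact m) * (\<Sum>\<eta>\<in>PiE I (\<lambda>_. {..M}). u \<eta> * fact ((s + (if low i then 0 else m)) + e \<eta>)))"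
    by (simp add: sum_distrib_left mult.assoc add.assoc)
  also have "\<dots> \<le> (\<Sum>m\<le>M. (if low i then 2 * \<theta> ^ m else x i ^ m / fact m) * ((2 / (1 - \<theta>)) ^ c * fact (s + (if low i then 0 else m)) / (1 - X) ^ Suc (s + (if low i then 0 else m))))"
    using \<theta> x by (intro sum_mono mult_left_mono IH) auto
  also have "\<dots> \<le> (2 / (1 - \<theta>)) ^ card {j \<in> insert i I. low j} * fact s / (1 - ((if low i then 0 else x i) + X)) ^ Suc s"
  \<comment> \<open>A low variable leaves s alone and contributes a geometric series. Any other
    variable raises s by m and contributes a negative binomial series in
    \<open>q = x i / (1 - X)\<close>, which is absorbed because
    \<open>(1 - X) * (1 - q) = 1 - (x i + X)\<close>.\<close>
  proof (cases "low i")
    case True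
    then have "{j \<in> insert i I. low j} = insert i {j \<in> I. low j}" by auto
    then have card: "card {j \<in> insert i I. low j} = Suc c" using insert.hyps by (simp add: c_def)
    have "(\<Sum>m\<le>M. 2 * \<theta> ^ m * ((2 / (1 - \<theta>)) ^ c * fact s / (1 - X) ^ Suc s)) = (\<Sum>m\<le>M. \<theta> ^ m) * (2 * ((2 / (1 - \<theta>)) ^ c * fact s / (1 - X) ^ Suc s))"
      unfolding sum_distrib_right by (intro sum.cong) (simp_all add: mult_ac)
    also have "\<dots> \<le> 1 / (1 - \<theta>) * (2 * ((2 / (1 - \<theta>)) ^ c * fact s / (1 - X) ^ Suc s))"
      using \<theta> X01 by (intro mult_right_mono geometric_partial_sum_le) auto
    finally show ?thesis using True card by simp
  next
    case False
    then have card: "card {j \<in> insert i I. low j} = c" by (auto simp: c_def intro!: arg_cong[of _ _ card])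
    define q where "q = x i / (1 - X)"
    have xi: "x i + X < 1" using X1 False by simp
    have q: "0 \<le> q" "q < 1" using x[of i] X01 xi by (auto simp: q_def)
    have "(\<Sum>m\<le>M. x i ^ m / fact m * ((2 / (1 - \<theta>)) ^ c * fact (s + m) / (1 - X) ^ Suc (s + m)))
      = (2 / (1 - \<theta>)) ^ c * fact s / (1 - X) ^ Suc s * (\<Sum>m\<le>M. real ((s + m) choose m) * q ^ m)"
      unfolding sum_distrib_left
    proof (rule sum.cong[OF refl])
      fix m
      have "real ((s + m) choose m) = fact (s + m) / (fact m * fact s)" by (subst binomial_fact) auto
      then show "x i ^ m / fact m * ((2 / (1 - \<theta>)) ^ c * fact (s + m) / (1 - X) ^ Suc (s + m)) = (2 / (1 - \<theta>)) ^ c * fact s / (1 - X) ^ Suc s * (real ((s + m) choose m) * q ^ m)"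
        by (simp add: q_def power_divide power_add mult_ac)
    qed
    also have "\<dots> \<le> (2 / (1 - \<theta>)) ^ c * fact s / (1 - X) ^ Suc s * (1 / (1 - q) ^ Suc s)"
      using \<theta> X01 by (intro mult_left_mono neg_binomial_partial_sum_le q) auto
    also have "\<dots> = (2 / (1 - \<theta>)) ^ c * fact s / ((1 - X) * (1 - q)) ^ Suc s" by (simp add: power_mult_distrib)
    also have "(1 - X) * (1 - q) = 1 - (x i + X)" using X01 by (simp add: q_def field_simps)
    finally show ?thesis using False card by simp
  qed
  finally show ?case using insert.hyps by (simp add: X_def)
qed

text \<open>Truncated subtraction in coordinate k identifies only indices with
  \<open>\<nu> k = 0\<close> and \<open>\<nu> k = 1\<close>, so the shift is at most two-to-one. It
  arises from the exponent \<open>max 1 (\<nu> k)\<close> of \<open>gamma_weight\<close>.\<close>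

lemma sum_shift_le:
  fixes f :: "(nat \<Rightarrow> nat) \<Rightarrow> real"
  assumes k: "k \<in> I" and F: "finite F" "F \<subseteq> PiE I (\<lambda>_. UNIV)" and f: "\<And>\<nu>. 0 \<le> f \<nu>"
    and S: "\<And>F. finite F \<Longrightarrow> F \<subseteq> PiE I (\<lambda>_. UNIV) \<Longrightarrow> (\<Sum>\<nu>\<in>F. f \<nu>) \<le> S"
  shows "(\<Sum>\<nu>\<in>F. f (\<nu>(k := \<nu> k - 1))) \<le> 2 * S"
proof -
  have part: "(\<Sum>\<nu>\<in>{\<nu>\<in>F. P (\<nu> k)}. f (\<nu>(k := \<nu> k - 1))) \<le> S" if P: "\<And>m n. P m \<Longrightarrow> P n \<Longrightarrow> m - 1 = n - 1 \<Longrightarrow> m = n" for P :: "nat \<Rightarrow> bool"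
  proof -
    have inj: "inj_on (\<lambda>\<nu>. \<nu>(k := \<nu> k - 1)) {\<nu>\<in>F. P (\<nu> k)}"
    proof (rule inj_onI)
      fix \<nu> \<nu>' assume a: "\<nu> \<in> {\<nu>\<in>F. P (\<nu> k)}" "\<nu>' \<in> {\<nu>\<in>F. P (\<nu> k)}" "\<nu>(k := \<nu> k - 1) = \<nu>'(k := \<nu>' k - 1)"
      have "\<nu> k = \<nu>' k" using fun_cong[OF a(3), of k] a P by auto
      moreover have "\<nu> j = \<nu>' j" if "j \<noteq> k" for j using fun_cong[OF a(3), of j] that by simp
      ultimately have "\<nu> j = \<nu>' j" for j by (cases "j = k") auto
      then show "\<nu> = \<nu>'" by auto
    qed
    have "(\<Sum>\<nu>\<in>{\<nu>\<in>F. P (\<nu> k)}. f (\<nu>(k := \<nu> k - 1))) = sum f ((\<lambda>\<nu>. \<nu>(k := \<nu> k - 1)) ` {\<nu>\<in>F. P (\<nu> k)})"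
      unfolding sum.reindex[OF inj] o_def ..
    also have "\<dots> \<le> S" using F k by (intro S) (auto simp: PiE_def extensional_def)
    finally show ?thesis .
  qed
  have "F = {\<nu>\<in>F. \<nu> k = 0} \<union> {\<nu>\<in>F. \<nu> k \<noteq> 0}" by auto
  then have "(\<Sum>\<nu>\<in>F. f (\<nu>(k := \<nu> k - 1))) = (\<Sum>\<nu>\<in>{\<nu>\<in>F. \<nu> k = 0} \<union> {\<nu>\<in>F. \<nu> k \<noteq> 0}. f (\<nu>(k := \<nu> k - 1)))" by simp
  also have "\<dots> = (\<Sum>\<nu>\<in>{\<nu>\<in>F. \<nu> k = 0}. f (\<nu>(k := \<nu> k - 1))) + (\<Sum>\<nu>\<in>{\<nu>\<in>F. \<nu> k \<noteq> 0}. f (\<nu>(k := \<nu> k - 1)))"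
    using F by (intro sum.union_disjoint) auto
  also have "\<dots> \<le> S + S" by (intro add_mono part) auto
  also have "\<dots> = 2 * S" by simp
  finally show ?thesis .
qed

text \<open>The left side divided by \<open>fact n\<close> is one term of the exponential series at
  n.\<close>

lemma power_self_le_exp_fact: "real n ^ n \<le> exp (real n) * fact n"
proof -
  have "(\<Sum>m\<in>{n}. inverse (fact m) * real n ^ m) \<le> (\<Sum>m. inverse (fact m) * real n ^ m)"
    using summable_exp[of "real n"] by (intro sum_le_suminf) (auto simp: inverse_eq_divide)
  also have "\<dots> = exp (real n)" by (simp add: exp_def scaleR_conv_of_real)
  finally show ?thesis by (simp add: field_simps)
qed

section \<open>Choice of the constants and the reciprocal weights\<close>

locale sparse = weights b for b +
  fixes p \<delta> :: real
  assumes p: "0 < p" "p < 1" and b_p: "summable (\<lambda>j. b j powr p)" and \<delta>: "0 < \<delta>"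
begin

definition "bsum = suminf b"
definition "bpsum = (\<Sum>j. b j powr p)"
text \<open>Only finitely many weights are \<open>low\<close>, that is at least \<open>\<beta>\<close>.  The ellipse radius used for such a variable is \<open>1 + \<kappa>\<close>;
  for the other variables it depends on the index (see \<open>cf_le\<close>), and \<open>\<beta>\<close> is so small that the \<open>x j\<close> of these
  variables sum to at most \<open>1 / 2\<close>.  The value \<open>g j\<close> is the reciprocal of \<open>weight \<alpha> b j\<close>.\<close>

definition "\<kappa> = min 1 (\<delta> / (4 * (bsum + 1)))"
definition "\<beta> = (\<delta> / (16 * exp 1 * (bpsum + 1))) powr (1 / (1 - p)) / 2"
text \<open>For a low variable \<open>weight \<alpha> b j\<close> is then at most
  \<open>1 + \<kappa> / 2\<close>, strictly below the ellipse parameter \<open>1 + \<kappa>\<close>;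
  \<theta> is the quotient of these two numbers and leaves a convergent geometric series.\<close>

definition "\<alpha> = \<beta> * \<kappa> / 2"
definition "low j \<longleftrightarrow> \<beta> \<le> b j"
definition "\<theta> = (1 + \<kappa> / 2) / (1 + \<kappa>)"
text \<open>What remains of \<open>8 * exp 1 * b j / \<delta>\<close> after
  \<open>g j powr (1 - p)\<close> has been split off by \<open>b_powr_split\<close>, for
  \<open>b j \<le> \<beta>\<close> and \<open>\<alpha> \<le> \<beta>\<close>: a multiple of
  \<open>b j powr p\<close>, hence summable.\<close>

definition "x j = 8 * exp 1 / \<delta> * (2 * \<beta>) powr (1 - p) * b j powr p"
definition "g j = b j / (b j + \<alpha>)"
definition "Q = (2 / (1 - \<theta>)) ^ card {j. low j} * 2"

lemma b_le_bsum: "b j \<le> bsum"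
  unfolding bsum_def using sum_le_suminf[OF b_summable, where I = "{j}"] b_nonneg by simp

lemma bsum_nonneg: "0 \<le> bsum" using b_le_bsum[of 0] b_nonneg[of 0] by linarith

lemma bpsum_nonneg: "0 \<le> bpsum" unfolding bpsum_def by (intro suminf_nonneg b_p) auto

lemma \<kappa>: "0 < \<kappa>" "\<kappa> \<le> 1" "\<kappa> * bsum \<le> \<delta> / 4"
proof -
  show "0 < \<kappa>" "\<kappa> \<le> 1" using \<delta> bsum_nonneg by (auto simp: \<kappa>_def)
  have "\<kappa> * bsum \<le> \<delta> / (4 * (bsum + 1)) * bsum" using bsum_nonneg by (intro mult_right_mono) (auto simp: \<kappa>_def)
  also have "\<dots> \<le> \<delta> / 4" using \<delta> bsum_nonneg by (simp add: field_simps)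
  finally show "\<kappa> * bsum \<le> \<delta> / 4" .
qed

lemma \<beta>: "0 < \<beta>" "(2 * \<beta>) powr (1 - p) = \<delta> / (16 * exp 1 * (bpsum + 1))"
  using \<delta> bpsum_nonneg p by (auto simp: \<beta>_def powr_powr intro!: divide_pos_pos mult_pos_pos)

lemma \<alpha>: "0 < \<alpha>" "\<alpha> \<le> \<beta>" "\<alpha> \<le> \<beta> * (\<kappa> / 2)"
  using \<beta>(1) \<kappa> mult_left_mono[of \<kappa> 1 \<beta>] by (auto simp: \<alpha>_def)

lemma \<theta>: "0 < \<theta>" "\<theta> < 1" using \<kappa> by (auto simp: \<theta>_def)

lemma finite_low: "finite {j. low j}"
proof -
  have "b \<longlonglongrightarrow> 0" using b_summable by (rule summable_LIMSEQ_zero)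
  then have "\<forall>\<^sub>F j in sequentially. b j < \<beta>" using \<beta>(1) by (rule order_tendstoD)
  then obtain N where N: "\<And>j. j \<ge> N \<Longrightarrow> b j < \<beta>" by (auto simp: eventually_sequentially)
  have "{j. low j} \<subseteq> {..<N}" using N by (force simp: low_def not_le[symmetric])
  then show ?thesis using finite_subset by blast
qed

lemma x: "0 \<le> x j" unfolding x_def using \<delta> by (intro mult_nonneg_nonneg) auto

lemma sum_x: "finite I \<Longrightarrow> (\<Sum>j\<in>I. if low j then 0 else x j) \<le> 1 / 2"
proof -
  assume I: "finite I"
  have "(\<Sum>j\<in>I. if low j then 0 else x j) \<le> (\<Sum>j\<in>I. x j)" using x by (intro sum_mono) auto
  also have "\<dots> = 8 * exp 1 / \<delta> * (2 * \<beta>) powr (1 - p) * (\<Sum>j\<in>I. b j powr p)" by (simp add: x_def sum_distrib_left)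
  also have "\<dots> \<le> 8 * exp 1 / \<delta> * (2 * \<beta>) powr (1 - p) * (bpsum + 1)"
    using sum_le_suminf[OF b_p I] \<delta> by (intro mult_left_mono) (auto simp: bpsum_def)
  also have "\<dots> = 1 / 2"
  proof -
    define c where "c = bpsum + 1"
    have "c > 0" using bpsum_nonneg by (simp add: c_def)
    then show ?thesis unfolding \<beta>(2) c_def[symmetric] using \<delta> by (simp add: field_simps)
  qed
  finally show ?thesis .
qed

lemma g: "0 \<le> g j" "g j < 1" "g j \<le> bsum / (bsum + \<alpha>)"
proof -
  show "0 \<le> g j" "g j < 1" using b_nonneg[of j] \<alpha> by (auto simp: g_def)
  show "g j \<le> bsum / (bsum + \<alpha>)"
    using b_nonneg[of j] \<alpha>(1) b_le_bsum[of j] bsum_nonneg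
    by (simp add: g_def divide_simps) (simp add: algebra_simps mult_right_mono)
qed

text \<open>Writing \<open>b j = (b j + \<alpha>) * g j\<close> and splitting off the exponent
  \<open>1 - p\<close> trades this share of \<open>b j\<close> for the weight \<open>g j\<close>.
  The share in g becomes the rate in \<epsilon>, while \<open>b j powr p\<close> keeps the
  summability in j.\<close>

lemma b_powr_split: "b j \<le> c \<Longrightarrow> b j \<le> b j powr p * ((c + \<alpha>) powr (1 - p) * g j powr (1 - p))"
proof -
  assume c: "b j \<le> c"
  have "b j = b j powr p * b j powr (1 - p)" using b_nonneg[of j] by (cases "b j = 0") (auto simp flip: powr_add)
  also have "b j powr (1 - p) = ((b j + \<alpha>) * g j) powr (1 - p)" using b_nonneg[of j] \<alpha> by (simp add: g_def)
  also have "\<dots> = (b j + \<alpha>) powr (1 - p) * g j powr (1 - p)" using b_nonneg[of j] \<alpha> g by (simp add: powr_mult)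
  also have "\<dots> \<le> (c + \<alpha>) powr (1 - p) * g j powr (1 - p)"
    using c b_nonneg[of j] \<alpha> p by (intro mult_right_mono powr_mono2) auto
  finally show ?thesis by (simp add: mult_left_mono)
qed

text \<open>The size of a coefficient once the factors \<open>g j powr (1 - p)\<close> are removed:
  geometric in the low variables, a multinomial term in the others. Its sums are bounded by Q
  uniformly in k.\<close>

definition u :: "nat \<Rightarrow> (nat \<Rightarrow> nat) \<Rightarrow> real" where
  "u k \<eta> = (\<Prod>j\<le>k. if low j then 2 * \<theta> ^ \<eta> j else x j ^ \<eta> j / fact (\<eta> j)) * fact (\<Sum>j\<le>k. if low j then 0 else \<eta> j)"

lemma u_nonneg: "0 \<le> u k \<eta>"
  unfolding u_def using \<theta> x by (intro mult_nonneg_nonneg prod_nonneg) auto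

lemma sum_u: assumes F: "finite F" "F \<subseteq> PiE {..k} (\<lambda>_. UNIV)" shows "(\<Sum>\<eta>\<in>F. u k \<eta>) \<le> Q"
proof -
  have "finite (\<Union>\<nu>\<in>F. \<nu> ` {..k})" using F by auto
  then obtain M where M: "(\<Union>\<nu>\<in>F. \<nu> ` {..k}) \<subseteq> {..M}" using finite_nat_iff_bounded_le by blast
  have "F \<subseteq> PiE {..k} (\<lambda>_. {..M})" using F(2) M by (force simp: PiE_def Pi_def)
  then have "(\<Sum>\<eta>\<in>F. u k \<eta>) \<le> (\<Sum>\<eta>\<in>PiE {..k} (\<lambda>_. {..M}). u k \<eta>)"
    using u_nonneg by (intro sum_mono2 finite_PiE) auto
  also have "\<dots> \<le> (2 / (1 - \<theta>)) ^ card {j \<in> {..k}. low j} * fact 0 / (1 - (\<Sum>j\<le>k. if low j then 0 else x j)) ^ Suc 0"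
    unfolding u_def using mixed_multinomial_sum_le[where I = "{..k}" and M = M and s = 0 and low = low, OF _ \<theta> x] sum_x[of "{..k}"] by simp
  also have "\<dots> = (2 / (1 - \<theta>)) ^ card {j \<in> {..k}. low j} * (1 / (1 - (\<Sum>j\<le>k. if low j then 0 else x j)))" by simp
  also have "\<dots> \<le> (2 / (1 - \<theta>)) ^ card {j. low j} * 2"
  proof (rule mult_mono)
    show "(2 / (1 - \<theta>)) ^ card {j \<in> {..k}. low j} \<le> (2 / (1 - \<theta>)) ^ card {j. low j}"
      using \<theta> by (intro power_increasing card_mono finite_low) auto
    show "1 / (1 - (\<Sum>j\<le>k. if low j then 0 else x j)) \<le> 2" using sum_x[of "{..k}"] by (simp add: divide_simps)
  qed (use \<theta> sum_x[of "{..k}"] in auto)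
  finally show ?thesis by (simp add: Q_def)
qed

definition Gam :: "nat \<Rightarrow> (nat \<Rightarrow> nat) \<Rightarrow> real" where
  "Gam k \<nu> = g k ^ max 1 (\<nu> k) * (\<Prod>j<k. g j ^ \<nu> j)"

text \<open>\<open>max 1 n\<close> is \<open>Suc (n - 1)\<close> for natural numbers, so the
  convention for the last exponent amounts to one factor \<open>g k\<close> and a plain product at
  the shifted index.\<close>

lemma Gam_shift: "Gam k \<nu> = g k * (\<Prod>j\<le>k. g j ^ (\<nu>(k := \<nu> k - 1)) j)"
proof -
  have "max 1 (\<nu> k) = Suc (\<nu> k - 1)" by simp
  then have "g k ^ max 1 (\<nu> k) = g k * g k ^ (\<nu> k - 1)" by (simp only: power_Suc)
  moreover have "(\<Prod>j\<le>k. g j ^ (\<nu>(k := \<nu> k - 1)) j) = g k ^ (\<nu> k - 1) * (\<Prod>j<k. g j ^ \<nu> j)"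
    unfolding lessThan_Suc_atMost[symmetric] by simp
  ultimately show ?thesis by (simp add: Gam_def)
qed

lemma inverse_weight: "inverse (weight \<alpha> b j) = ennreal (g j)"
proof (cases "b j = 0")
  case True
  then show ?thesis using \<alpha> by (simp add: weight_def g_def)
next
  case False
  then have bj: "0 < b j" using b_nonneg[of j] by simp
  have "weight \<alpha> b j = ennreal (1 + \<alpha> / b j)"
    using bj \<alpha> by (simp add: weight_def divide_ennreal flip: ennreal_plus ennreal_1)
  then have "inverse (weight \<alpha> b j) = ennreal (inverse (1 + \<alpha> / b j))"
    by (simp only:) (rule inverse_ennreal, use bj \<alpha> in \<open>simp add: add_pos_pos\<close>)
  also have "inverse (1 + \<alpha> / b j) = g j" using bj \<alpha> by (simp add: g_def field_simps)
  finally show ?thesis .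
qed

lemma gamma_weight_eq: "gamma_weight (weight \<alpha> b) k \<nu> = ennreal (Gam k \<nu>)"
  unfolding gamma_weight_def Gam_def ennreal_inverse_power inverse_weight using g(1)
  by (simp add: ennreal_mult ennreal_power prod_ennreal prod_nonneg)

lemma Gam_nonneg: "0 \<le> Gam k \<nu>" unfolding Gam_def using g(1) by (intro mult_nonneg_nonneg prod_nonneg) auto

lemma Lambda_iff: "\<epsilon> > 0 \<Longrightarrow> \<nu> \<in> Lambda (weight \<alpha> b) \<epsilon> k \<longleftrightarrow> \<nu> \<in> PiE {..k} (\<lambda>_. UNIV) \<and> \<epsilon> \<le> Gam k \<nu>"
  by (simp add: Lambda_def gamma_weight_eq Gam_nonneg)

end

section \<open>Sparse polynomial approximation\<close>

lemma powr_power_commute: "0 \<le> (x::real) \<Longrightarrow> (x powr s) ^ n = (x ^ n) powr s"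
  by (induction n) (auto simp: powr_mult)

lemma prod_powr: "(\<And>j. j \<in> I \<Longrightarrow> 0 \<le> f j) \<Longrightarrow> (\<Prod>j\<in>I. f j powr s) = (\<Prod>j\<in>I. f j :: real) powr s"
  by (induction I rule: infinite_finite_induct) (auto simp: powr_mult prod_nonneg)

lemma cos_points:
  assumes y: "y \<in> cube" and \<eta>: "\<And>j. 0 \<le> \<eta> j"
    and z1: "\<And>i. n \<le> i \<Longrightarrow> z i = of_real (y i)"
    and z2: "\<And>j. j < n \<Longrightarrow> \<exists>t\<in>{-1..1}. \<exists>\<sigma>\<in>{1,-1}. z j = cos (of_real pi * (of_real t + \<i> * of_real (\<sigma> * \<eta> j)))"
  obtains x where "x \<in> cube" "\<And>j. cmod (z j - of_real (x j)) \<le> (if j < n then exp (pi * \<eta> j) - 1 else 0)"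
proof -
  have "\<exists>x\<in>{-1..1}. cmod (z j - of_real x) \<le> (if j < n then exp (pi * \<eta> j) - 1 else 0)" for j
  proof (cases "j < n")
    case True
    then obtain t \<sigma> where t: "\<sigma> \<in> {1, -1}" "z j = cos (of_real pi * (of_real t + \<i> * of_real (\<sigma> * \<eta> j)))" using z2 by blast
    have "of_real pi * (of_real t + \<i> * of_real (\<sigma> * \<eta> j)) = of_real (pi * t) + \<i> * of_real (pi * (\<sigma> * \<eta> j))" by (simp add: algebra_simps)
    then have "cmod (z j - of_real (cos (pi * t))) \<le> exp \<bar>pi * (\<sigma> * \<eta> j)\<bar> - 1" using t(2) cmod_cos_diff[of "pi * t" "pi * (\<sigma> * \<eta> j)"] by simp
    also have "\<bar>pi * (\<sigma> * \<eta> j)\<bar> = pi * \<eta> j" using t(1) \<eta> by (auto simp: abs_mult)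
    finally show ?thesis using True by (intro bexI[of _ "cos (pi * t)"]) auto
  next
    case False
    then show ?thesis using z1[of j] y by (intro bexI[of _ "y j"]) (auto simp: cube_def)
  qed
  then obtain x where "\<And>j. x j \<in> {-1..1}" "\<And>j. cmod (z j - of_real (x j)) \<le> (if j < n then exp (pi * \<eta> j) - 1 else 0)"
    by metis
  then show ?thesis using that[of x] by (auto simp: cube_def)
qed

lemma cheb_poly: "\<exists>a. \<forall>x. cheb n x = (\<Sum>i\<le>n. a i * x ^ i)"
proof -
  have "\<exists>q. degree q \<le> n \<and> (\<forall>x. cheb n x = poly q x)"
  proof (induction n "0::real" rule: cheb.induct)
    case 1
    show ?case by (intro exI[of _ "[:1:]"]) auto
  next
    case 2
    show ?case by (intro exI[of _ "[:0, 1:]"]) auto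
  next
    case (3 n)
    then obtain q q' where q: "degree q \<le> Suc n" "\<And>x. cheb (Suc n) x = poly q x" "degree q' \<le> n" "\<And>x. cheb n x = poly q' x" by blast
    have "degree ([:0, 2:] * q) \<le> Suc (Suc n)" using degree_mult_le[of "[:0, 2:]" q] q(1) by simp
    then have "degree ([:0, 2:] * q - q') \<le> Suc (Suc n)" using q(3) by (intro degree_diff_le) auto
    then show ?case using q(2,4) by (intro exI[of _ "[:0, 2:] * q - q'"]) auto
  qed
  then obtain q where q: "degree q \<le> n" "\<And>x. cheb n x = poly q x" by blast
  have "poly q x = (\<Sum>i\<le>n. coeff q i * x ^ i)" for x
    unfolding poly_altdef using q(1) by (intro sum.mono_neutral_left) (auto simp: coeff_eq_0)
  then show ?thesis using q(2) by auto
qed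

text \<open>Each Chebyshev product expands into monomials with componentwise smaller or equal
  exponents. They belong to \<Lambda> because it is downward closed, and interchanging the sums
  collects the coefficient of each monomial.\<close>

lemma poly_space_sum_cheb:
  assumes fin: "finite \<Lambda>" and sub: "\<Lambda> \<subseteq> PiE {..k} (\<lambda>_. UNIV)"
    and down: "\<And>\<nu> \<mu>. \<nu> \<in> \<Lambda> \<Longrightarrow> \<mu> \<in> PiE {..k} (\<lambda>_. UNIV) \<Longrightarrow> (\<And>j. j \<le> k \<Longrightarrow> \<mu> j \<le> \<nu> j) \<Longrightarrow> \<mu> \<in> \<Lambda>"
  shows "(\<lambda>y. \<Sum>\<nu>\<in>\<Lambda>. a \<nu> * (\<Prod>j\<le>k. cheb (\<nu> j) (y j))) \<in> poly_space k \<Lambda>"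
proof -
  obtain c where c: "\<And>n x. cheb n x = (\<Sum>i\<le>n. c n i * x ^ i)" using cheb_poly by metis
  define B where "B \<nu> = PiE {..k} (\<lambda>j. {..\<nu> j})" for \<nu> :: "nat \<Rightarrow> nat"
  have B: "B \<nu> = {\<mu> \<in> \<Lambda>. \<mu> \<in> B \<nu>}" if "\<nu> \<in> \<Lambda>" for \<nu>
  proof -
    have "\<mu> \<in> \<Lambda>" if "\<mu> \<in> B \<nu>" for \<mu>
      by (rule down[OF \<open>\<nu> \<in> \<Lambda>\<close>]) (use that in \<open>auto simp: B_def PiE_def Pi_def\<close>)
    then show ?thesis by auto
  qed
  have prod: "(\<Prod>j\<le>k. cheb (\<nu> j) (y j)) = (\<Sum>\<mu>\<in>B \<nu>. (\<Prod>j\<le>k. c (\<nu> j) (\<mu> j)) * (\<Prod>j\<le>k. y j ^ \<mu> j))" for \<nu> y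
    unfolding c B_def by (subst prod_sum_PiE) (auto simp: prod.distrib)
  have "(\<Sum>\<nu>\<in>\<Lambda>. a \<nu> * (\<Prod>j\<le>k. cheb (\<nu> j) (y j))) =
     (\<Sum>\<mu>\<in>\<Lambda>. (\<Sum>\<nu>\<in>{\<nu>\<in>\<Lambda>. \<mu> \<in> B \<nu>}. a \<nu> * (\<Prod>j\<le>k. c (\<nu> j) (\<mu> j))) * (\<Prod>j\<le>k. y j ^ \<mu> j))" for y
  proof -
    have "(\<Sum>\<nu>\<in>\<Lambda>. a \<nu> * (\<Prod>j\<le>k. cheb (\<nu> j) (y j))) = (\<Sum>\<nu>\<in>\<Lambda>. \<Sum>\<mu>\<in>{\<mu>\<in>\<Lambda>. \<mu> \<in> B \<nu>}. a \<nu> * (\<Prod>j\<le>k. c (\<nu> j) (\<mu> j)) * (\<Prod>j\<le>k. y j ^ \<mu> j))"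
    proof (rule sum.cong[OF refl])
      fix \<nu> assume "\<nu> \<in> \<Lambda>"
      then show "a \<nu> * (\<Prod>j\<le>k. cheb (\<nu> j) (y j)) = (\<Sum>\<mu>\<in>{\<mu>\<in>\<Lambda>. \<mu> \<in> B \<nu>}. a \<nu> * (\<Prod>j\<le>k. c (\<nu> j) (\<mu> j)) * (\<Prod>j\<le>k. y j ^ \<mu> j))"
        unfolding prod B[symmetric, OF \<open>\<nu> \<in> \<Lambda>\<close>] sum_distrib_left by (simp add: mult.assoc)
    qed
    also have "\<dots> = (\<Sum>\<mu>\<in>\<Lambda>. \<Sum>\<nu>\<in>{\<nu>\<in>\<Lambda>. \<mu> \<in> B \<nu>}. a \<nu> * (\<Prod>j\<le>k. c (\<nu> j) (\<mu> j)) * (\<Prod>j\<le>k. y j ^ \<mu> j))"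
      by (rule sum.swap_restrict[OF fin fin])
    finally show ?thesis by (simp add: sum_distrib_right)
  qed
  then show ?thesis unfolding poly_space_def using fin by (auto intro!: exI[of _ \<Lambda>] exI[of _ "\<lambda>\<mu>. \<Sum>\<nu>\<in>{\<nu>\<in>\<Lambda>. \<mu> \<in> B \<nu>}. a \<nu> * (\<Prod>j\<le>k. c (\<nu> j) (\<mu> j))"])
qed

section \<open>Cardinality of the index sets\<close>

context sparse
begin

definition "W = exp (bpsum / \<alpha> powr p / (1 - (bsum / (bsum + \<alpha>)) powr p))"
definition "Ncst = 2 * W / \<alpha> powr p"

lemma gm: "(bsum / (bsum + \<alpha>)) powr p < 1"
proof -
  have "bsum / (bsum + \<alpha>) < 1" using bsum_nonneg \<alpha>(1) by simp
  then have "(bsum / (bsum + \<alpha>)) powr p < 1 powr p" using bsum_nonneg \<alpha>(1) p by (intro powr_less_mono2) auto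
  then show ?thesis by simp
qed

lemma W_pos: "0 < W" by (simp add: W_def)

lemma Ncst_pos: "0 < Ncst" using W_pos \<alpha> by (simp add: Ncst_def)

lemma g_powr: "g j powr p \<le> (bsum / (bsum + \<alpha>)) powr p" "g j powr p \<le> b j powr p / \<alpha> powr p" "0 \<le> g j powr p" "g j powr p < 1"
proof -
  show 1: "g j powr p \<le> (bsum / (bsum + \<alpha>)) powr p" using g p by (intro powr_mono2) auto
  have "g j \<le> b j / \<alpha>" unfolding g_def using b_nonneg[of j] \<alpha> by (intro divide_left_mono) auto
  then have "g j powr p \<le> (b j / \<alpha>) powr p" using g p by (intro powr_mono2) auto
  then show "g j powr p \<le> b j powr p / \<alpha> powr p" using b_nonneg \<alpha> by (simp add: powr_divide)
  show "g j powr p < 1" using 1 gm by simp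
qed simp

text \<open>\<open>1 / (1 - t)\<close> is at most \<open>exp (t / (1 - t))\<close>, which turns the
  product into a sum controlled by \<open>bpsum\<close>; the denominators are bounded below because
  all \<open>g j\<close> stay below one number less than 1.\<close>

lemma prod_geometric_le: "(\<Prod>j\<le>k. 1 / (1 - g j powr p)) \<le> W"
proof -
  define c where "c = 1 - (bsum / (bsum + \<alpha>)) powr p"
  have c: "c > 0" using gm by (simp add: c_def)
  have "(\<Prod>j\<le>k. 1 / (1 - g j powr p)) \<le> (\<Prod>j\<le>k. exp (b j powr p / \<alpha> powr p / c))"
  proof (intro prod_mono conjI)
    fix j
    have "1 / (1 - g j powr p) = 1 + g j powr p / (1 - g j powr p)" using g_powr(4)[of j] by (simp add: field_simps)
    also have "\<dots> \<le> exp (g j powr p / (1 - g j powr p))" by (rule exp_ge_add_one_self)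
    also have "\<dots> \<le> exp (b j powr p / \<alpha> powr p / c)"
      using g_powr[of j] c by (simp only: exp_le_cancel_iff) (intro frac_le, auto simp: c_def)
    finally show "1 / (1 - g j powr p) \<le> exp (b j powr p / \<alpha> powr p / c)" .
    show "0 \<le> 1 / (1 - g j powr p)" using g_powr(4)[of j] by simp
  qed
  also have "\<dots> = exp ((\<Sum>j\<le>k. b j powr p) / \<alpha> powr p / c)" by (simp add: exp_sum sum_divide_distrib)
  also have "\<dots> \<le> W"
    unfolding W_def c_def[symmetric] bpsum_def using sum_le_suminf[OF b_p, where I = "{..k}"] c \<alpha>
    by (simp add: divide_right_mono)
  finally show ?thesis .
qed

text \<open>Markov's inequality for the counting measure: every index contributes at least
  \<open>\<epsilon> powr p\<close> to the sum of the p-th powers of \<open>Gam\<close>, which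
  factorises into geometric series. The factor \<open>g k powr p\<close> in front makes the bound
  summable over k.\<close>

lemma card_Lambda:
  assumes \<epsilon>: "0 < \<epsilon>" and F: "finite F" "F \<subseteq> Lambda (weight \<alpha> b) \<epsilon> k"
  shows "real (card F) \<le> Ncst * \<epsilon> powr (- p) * b k powr p"
proof -
  have FP: "F \<subseteq> PiE {..k} (\<lambda>_. UNIV)" and FG: "\<And>\<nu>. \<nu> \<in> F \<Longrightarrow> \<epsilon> \<le> Gam k \<nu>" using F Lambda_iff[OF \<epsilon>] by blast+
  have Gp: "Gam k \<nu> powr p = g k powr p * (\<Prod>j\<le>k. (g j powr p) ^ (\<nu>(k := \<nu> k - 1)) j)" for \<nu>
    unfolding Gam_shift using g(1) by (simp add: powr_mult prod_nonneg powr_power_commute prod_powr del: fun_upd_apply)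
  have "real (card F) * \<epsilon> powr p = (\<Sum>\<nu>\<in>F. \<epsilon> powr p)" by simp
  also have "\<dots> \<le> (\<Sum>\<nu>\<in>F. Gam k \<nu> powr p)" using FG \<epsilon> p by (intro sum_mono powr_mono2) auto
  also have "\<dots> = g k powr p * (\<Sum>\<nu>\<in>F. \<Prod>j\<le>k. (g j powr p) ^ (\<nu>(k := \<nu> k - 1)) j)" unfolding Gp sum_distrib_left ..
  also have "\<dots> \<le> g k powr p * (2 * W)"
  proof (rule mult_left_mono)
    show "(\<Sum>\<nu>\<in>F. \<Prod>j\<le>k. (g j powr p) ^ (\<nu>(k := \<nu> k - 1)) j) \<le> 2 * W"
    proof (rule sum_shift_le[where f = "\<lambda>\<nu>. \<Prod>j\<le>k. (g j powr p) ^ \<nu> j" and I = "{..k}"])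
      fix F :: "(nat \<Rightarrow> nat) set" assume "finite F" "F \<subseteq> PiE {..k} (\<lambda>_. UNIV)"
      then have "(\<Sum>\<nu>\<in>F. \<Prod>j\<le>k. (g j powr p) ^ \<nu> j) \<le> (\<Prod>j\<le>k. 1 / (1 - g j powr p))"
        by (intro sum_PiE_prod_le geometric_partial_sum_le) (use g_powr in auto)
      then show "(\<Sum>\<nu>\<in>F. \<Prod>j\<le>k. (g j powr p) ^ \<nu> j) \<le> W" using prod_geometric_le by (rule order_trans)
    qed (use F FP in \<open>auto intro!: prod_nonneg\<close>)
  qed simp
  also have "\<dots> \<le> b k powr p / \<alpha> powr p * (2 * W)" using g_powr(2) W_pos by (intro mult_right_mono) auto
  finally have "real (card F) \<le> b k powr p / \<alpha> powr p * (2 * W) / \<epsilon> powr p" using \<epsilon> by (subst pos_le_divide_eq) auto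
  then show ?thesis by (simp add: Ncst_def powr_minus divide_inverse mult_ac)
qed

lemma finite_Lambda: "0 < \<epsilon> \<Longrightarrow> finite (Lambda (weight \<alpha> b) \<epsilon> k)"
proof -
  assume \<epsilon>: "0 < \<epsilon>"
  have "card F \<le> nat \<lceil>Ncst * \<epsilon> powr (- p) * b k powr p\<rceil>" if "F \<subseteq> Lambda (weight \<alpha> b) \<epsilon> k" "finite F" for F
    using card_Lambda[OF \<epsilon> that(2,1)] by linarith
  then show ?thesis using finite_if_finite_subsets_card_bdd by blast
qed

lemma N_dim_le: assumes \<epsilon>: "0 < \<epsilon>" shows "N_dim (weight \<alpha> b) \<epsilon> \<le> ennreal (Ncst * bpsum * \<epsilon> powr (- p))"
proof -
  have "N_dim (weight \<alpha> b) \<epsilon> \<le> (\<Sum>k. ennreal (Ncst * \<epsilon> powr (- p) * b k powr p))"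
    unfolding N_dim_def
  proof (rule suminf_le)
    fix k
    have "emeasure (count_space UNIV) (Lambda (weight \<alpha> b) \<epsilon> k) = ennreal (real (card (Lambda (weight \<alpha> b) \<epsilon> k)))"
      using finite_Lambda[OF \<epsilon>] by (simp add: emeasure_count_space_finite ennreal_of_nat_eq_real_of_nat)
    then show "emeasure (count_space UNIV) (Lambda (weight \<alpha> b) \<epsilon> k) \<le> ennreal (Ncst * \<epsilon> powr (- p) * b k powr p)"
      using card_Lambda[OF \<epsilon> finite_Lambda[OF \<epsilon>] order_refl, of k] by (simp add: ennreal_leI)
  qed auto
  also have "\<dots> = ennreal (\<Sum>k. Ncst * \<epsilon> powr (- p) * b k powr p)"
    using Ncst_pos by (intro suminf_ennreal2 summable_mult b_p) auto
  also have "(\<Sum>k. Ncst * \<epsilon> powr (- p) * b k powr p) = Ncst * bpsum * \<epsilon> powr (- p)"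
    unfolding bpsum_def by (subst suminf_mult[OF b_p]) simp
  finally show ?thesis .
qed

end

section \<open>Coefficient decay and truncation error for one function\<close>

locale sparse_fun = sparse +
  fixes k :: nat and h :: "(nat \<Rightarrow> complex) \<Rightarrow> complex" and C :: real
  assumes h_hol: "curve_hol b (Suc k) \<delta> h" and C: "0 \<le> C"
    and h_bd: "\<And>y z. y \<in> cube \<Longrightarrow> near b (Suc k) \<delta> y z \<Longrightarrow> cmod (h z) \<le> C * b k * (1 + cmod (z k - of_real (y k)))"
begin

lemma h_tame: "tame (Suc k) \<delta> (C * (bsum + \<delta>)) h"
  unfolding tame_def
proof (intro allI impI conjI ballI)
  fix \<delta>' assume \<delta>': "\<delta>' < \<delta>"
  show "curve_hol b (Suc k) \<delta>' h" using curve_hol_mono[OF h_hol] \<delta>' by simp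
  fix z assume "z \<in> nbhd b (Suc k) \<delta>'"
  then obtain y where y: "y \<in> cube" "sdist (Suc k) z (complex_of_real \<circ> y) \<le> \<delta>'" by (auto simp: nbhd_sdist)
  have "b k * cmod (z k - of_real (y k)) \<le> \<delta>" using y \<delta>' sdist_nonneg[of k z "complex_of_real \<circ> y"] by (simp add: sdist_Suc)
  then have "C * (b k + b k * cmod (z k - of_real (y k))) \<le> C * (bsum + \<delta>)" using C b_le_bsum by (intro mult_left_mono add_mono) auto
  moreover have "near b (Suc k) \<delta> y z" using y \<delta>' by (simp add: near_sdist)
  ultimately show "cmod (h z) \<le> C * (bsum + \<delta>)" using h_bd[OF y(1), of z] by (simp add: algebra_simps)
qed

text \<open>The base point is a mere convention: the coefficient does not depend on the first k + 1
  coordinates, nor h on the later ones.\<close>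

definition "cf \<nu> = iter_coeff (Suc k) \<nu> h (\<lambda>_. 0)"

text \<open>\<open>iter_coeff_bound\<close> in terms of the ellipse parameters
  \<open>r j = exp (pi * \<eta> j)\<close>. The bound on h is evaluated on the ellipses only, so the
  factor \<open>b k\<close> survives, with a single \<open>r k\<close>, where the global bound of
  \<open>h_tame\<close> would lose it.\<close>

lemma cf_radii:
  assumes r: "\<And>j. 1 \<le> r j" "(\<Sum>j\<le>k. b j * (r j - 1)) < \<delta>"
  shows "cmod (cf \<nu>) \<le> (\<Prod>j\<le>k. cw (\<nu> j) / r j ^ \<nu> j) * (C * b k * r k)"
proof -
  define \<eta> where "\<eta> j = ln (r j) / pi" for j
  have \<eta>: "0 \<le> \<eta> j" for j using r(1)[of j] by (simp add: \<eta>_def)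
  have r0: "0 < r j" for j using r(1)[of j] by linarith
  have e: "exp (pi * \<eta> j) = r j" for j using r0[of j] by (simp add: \<eta>_def)
  have e2: "exp (- (real n * (pi * \<eta> j))) = 1 / r j ^ n" for j n
    using e[of j] by (simp add: exp_minus inverse_eq_divide exp_of_nat_mult)
  have zero: "(\<lambda>_. 0) = complex_of_real \<circ> (\<lambda>_. 0)" by auto
  have c0: "(\<lambda>_. 0) \<in> cube" by (auto simp: cube_def)
  have "cmod (cf \<nu>) \<le> (\<Prod>j<Suc k. cw (\<nu> j) * exp (- (real (\<nu> j) * (pi * \<eta> j)))) * (C * b k * r k)"
    unfolding cf_def
  proof (rule iter_coeff_bound[OF h_tame \<eta>, where \<delta>' = 0])
    show "(\<lambda>_. 0) \<in> nbhd b (Suc k) 0" unfolding zero by (rule cube_in_nbhd[OF c0]) simp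
    show "0 + (\<Sum>j<Suc k. b j * (exp (pi * \<eta> j) - 1)) < \<delta>" using r(2) by (simp add: e lessThan_Suc_atMost del: sum.lessThan_Suc)
    fix z' assume z': "\<And>i. Suc k \<le> i \<Longrightarrow> z' i = 0" "\<And>j. j < Suc k \<Longrightarrow> \<exists>t\<in>{-1..1}. \<exists>\<sigma>\<in>{1, - 1}. z' j = cos (of_real pi * (of_real t + \<i> * of_real (\<sigma> * \<eta> j)))"
    obtain x where x: "x \<in> cube" "\<And>j. cmod (z' j - of_real (x j)) \<le> (if j < Suc k then exp (pi * \<eta> j) - 1 else 0)"
      by (rule cos_points[OF c0 \<eta>, of "Suc k" z']) (use z' in auto)
    have xr: "cmod (z' j - of_real (x j)) \<le> r j - 1" if "j < Suc k" for j using x(2)[of j] that by (simp add: e)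
    have "sdist (Suc k) z' (complex_of_real \<circ> x) \<le> (\<Sum>j<Suc k. b j * (r j - 1))"
      unfolding sdist_def using xr b_nonneg by (intro sum_mono mult_left_mono) auto
    then have "near b (Suc k) \<delta> x z'" using r(2) by (simp add: near_sdist lessThan_Suc_atMost del: sum.lessThan_Suc)
    then have "cmod (h z') \<le> C * b k * (1 + cmod (z' k - of_real (x k)))" by (rule h_bd[OF x(1)])
    also have "\<dots> \<le> C * b k * r k" using xr[of k] C b_nonneg by (intro mult_left_mono) auto
    finally show "cmod (h z') \<le> C * b k * r k" .
  qed
  then show ?thesis by (simp add: e2 lessThan_Suc_atMost del: prod.lessThan_Suc)
qed

text \<open>A variable of weight 0 costs no budget, so its ellipse can be taken arbitrarily large,
  which forces the coefficient to vanish. For \<open>j = k\<close> the bound on h itself contains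
  the factor \<open>b k = 0\<close>. This matches the infinite value of \<open>weight\<close> at
  such j.\<close>

lemma cf_zero:
  assumes j: "j \<le> k" "b j = 0" "0 < (\<nu>(k := \<nu> k - 1)) j" shows "cf \<nu> = 0"
proof (cases "j = k")
  case True
  have "cmod (cf \<nu>) \<le> (\<Prod>j\<le>k. cw (\<nu> j) / 1 ^ \<nu> j) * (C * b k * 1)" using \<delta> by (intro cf_radii) auto
  then show ?thesis using True j by simp
next
  case False
  define K where "K = 2 ^ Suc k * (C * b k)"
  have K: "0 \<le> K" using C b_nonneg by (simp add: K_def)
  have le: "cmod (cf \<nu>) \<le> K / R" if R: "1 \<le> R" for R
  proof -
    define r where "r = (\<lambda>i. if i = j then R else 1)"
    have "(\<Sum>i\<le>k. b i * (r i - 1)) = 0" using j by (intro sum.neutral) (auto simp: r_def)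
    then have "cmod (cf \<nu>) \<le> (\<Prod>i\<le>k. cw (\<nu> i) / r i ^ \<nu> i) * (C * b k * r k)" using \<delta> R by (intro cf_radii) (auto simp: r_def)
    also have "\<dots> = (\<Prod>i\<le>k. cw (\<nu> i) / r i ^ \<nu> i) * (C * b k)" using False by (simp add: r_def)
    also have "(\<Prod>i\<le>k. cw (\<nu> i) / r i ^ \<nu> i) \<le> (\<Prod>i\<le>k. 2 * (if i = j then 1 / R else 1))"
    proof (intro prod_mono conjI)
      fix i
      show "0 \<le> cw (\<nu> i) / r i ^ \<nu> i" using cw(3)[of "\<nu> i"] R by (simp add: r_def)
      show "cw (\<nu> i) / r i ^ \<nu> i \<le> 2 * (if i = j then 1 / R else 1)"
      proof (cases "i = j")
        case True
        have "R ^ 1 \<le> R ^ \<nu> j" using R j False by (intro power_increasing) auto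
        then have "cw (\<nu> i) / r i ^ \<nu> i \<le> 2 / R" using True cw[of "\<nu> i"] R by (intro frac_le) (auto simp: r_def)
        then show ?thesis using True by simp
      qed (use cw[of "\<nu> i"] in \<open>auto simp: r_def\<close>)
    qed
    also have "\<dots> = 2 ^ Suc k * (1 / R)" using j by (simp add: prod.distrib)
    finally show ?thesis using C b_nonneg by (simp add: K_def mult_right_mono)
  qed
  have "cmod (cf \<nu>) \<le> e" if "e > 0" for e
  proof -
    have "cmod (cf \<nu>) \<le> K / max 1 (K / e)" by (rule le) simp
    also have "\<dots> \<le> e" using that K by (cases "K \<le> e") (auto simp: divide_simps max_def)
    finally show ?thesis .
  qed
  then have "cmod (cf \<nu>) \<le> 0" by (meson dense_ge)
  then show ?thesis by simp
qed

text \<open>For \<open>\<eta> = \<nu>(k := \<nu> k - 1)\<close> the radius in a variable that is not \<open>low\<close> is \<open>1 + \<delta> \<eta> j / (4 n b j)\<close>, where \<open>n\<close> is the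
  total degree of \<open>\<eta>\<close> in these variables.  This spends the budget \<open>\<delta>\<close> of \<open>nbhd\<close> in proportion to \<open>\<eta>\<close> and leaves
  \<open>n ^ n \<le> exp n * fact n\<close>, hence the factorials of the multinomial series.  One power of the last variable is
  lost because \<open>h\<close> is only bounded by \<open>b k * (1 + \<dots>)\<close>, which matches the exponent \<open>max 1 (\<nu> k)\<close> in \<open>gamma_weight\<close>.\<close>

lemma cf_le:
  defines "\<eta> \<equiv> \<lambda>\<nu>. \<nu>(k := \<nu> k - 1)"
  shows "cmod (cf \<nu>) \<le> 2 * C * b k * (u k (\<eta> \<nu>) * (\<Prod>j\<le>k. (g j powr (1 - p)) ^ \<eta> \<nu> j))"
proof (cases "\<exists>j\<le>k. b j = 0 \<and> 0 < \<eta> \<nu> j")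
  case True
  then have "cf \<nu> = 0" using cf_zero unfolding \<eta>_def by blast
  moreover have "0 \<le> 2 * C * b k * (u k (\<eta> \<nu>) * (\<Prod>j\<le>k. (g j powr (1 - p)) ^ \<eta> \<nu> j))"
    using C b_nonneg u_nonneg by (intro mult_nonneg_nonneg prod_nonneg) auto
  ultimately show ?thesis by simp
next
  case False
  define e where "e = \<eta> \<nu>"
  have bpos: "0 < b j" if "j \<le> k" "0 < e j" for j using False that b_nonneg[of j] by (force simp: e_def)
  define n where "n = (\<Sum>j\<le>k. if low j then 0 else e j)"
  \<comment> \<open>If n or \<open>b j\<close> is 0, division by zero yields the radius 1; in the
    present case \<open>b j = 0\<close> occurs only together with \<open>e j = 0\<close>.\<close>
  define r where "r j = (if low j then 1 + \<kappa> else 1 + \<delta> / 4 * e j / (n * b j))" for j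
  have r1: "1 \<le> r j" for j using \<kappa> \<delta> b_nonneg[of j] by (auto simp: r_def)
  have budget: "(\<Sum>j\<le>k. b j * (r j - 1)) < \<delta>"
  proof -
    have "b j * (r j - 1) \<le> \<kappa> * b j + \<delta> / 4 * real (if low j then 0 else e j) / n" if "j \<le> k" for j
      using b_nonneg[of j] \<kappa> \<delta> by (auto simp: r_def)
    then have "(\<Sum>j\<le>k. b j * (r j - 1)) \<le> (\<Sum>j\<le>k. \<kappa> * b j + \<delta> / 4 * real (if low j then 0 else e j) / n)" by (intro sum_mono) auto
    also have "\<dots> = \<kappa> * (\<Sum>j\<le>k. b j) + \<delta> / 4 * (real n / n)"
      unfolding sum.distrib n_def of_nat_sum by (simp only: sum_distrib_left[symmetric] sum_divide_distrib[symmetric] times_divide_eq_right)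
    also have "\<dots> \<le> \<delta> / 4 + \<delta> / 4 * 1"
    proof (intro add_mono mult_left_mono)
      have "\<kappa> * (\<Sum>j\<le>k. b j) \<le> \<kappa> * bsum" unfolding bsum_def using \<kappa> b_nonneg by (intro mult_left_mono sum_le_suminf b_summable) auto
      then show "\<kappa> * (\<Sum>j\<le>k. b j) \<le> \<delta> / 4" using \<kappa>(3) by linarith
    qed (use \<delta> in auto)
    finally show ?thesis using \<delta> by linarith
  qed
  \<comment> \<open>The extra factor \<open>r k\<close> of \<open>cf_radii\<close> cancels one power
    in the last variable and turns \<nu> into e. If \<open>\<nu> k = 0\<close> there is none to
    cancel, but then \<open>r k \<le> 2\<close>.\<close>
  have 1: "(\<Prod>j\<le>k. cw (\<nu> j) / r j ^ \<nu> j) * r k \<le> 2 * (\<Prod>j\<le>k. cw (e j) / r j ^ e j)"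
  proof -
    have ek: "e j = (if j = k then \<nu> k - 1 else \<nu> j)" for j by (simp add: e_def \<eta>_def)
    define Z where "Z = (\<Prod>j<k. cw (\<nu> j) / r j ^ \<nu> j)"
    have Z0: "0 \<le> Z" unfolding Z_def using cw(3) r1 by (intro prod_nonneg divide_nonneg_nonneg zero_le_power) (auto intro: order_trans[of 0 1] less_imp_le)
    have "cw (\<nu> k) / r k ^ \<nu> k * r k \<le> 2 * (cw (e k) / r k ^ e k)"
    proof (cases "\<nu> k")
      case 0
      then have "r k \<le> 2" using \<kappa> by (simp add: r_def ek)
      then show ?thesis using 0 by (simp add: cw_def ek)
    next
      case (Suc m)
      have "r k \<noteq> 0" using r1[of k] by auto
      then have "cw (\<nu> k) / r k ^ \<nu> k * r k = 2 * (1 / r k ^ m)" using Suc by (simp add: cw_def)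
      also have "\<dots> \<le> 2 * (cw (e k) / r k ^ e k)" using Suc cw(1)[of m] r1[of k] by (simp add: ek divide_right_mono)
      finally show ?thesis .
    qed
    then have "Z * (cw (\<nu> k) / r k ^ \<nu> k * r k) \<le> Z * (2 * (cw (e k) / r k ^ e k))" using Z0 by (rule mult_left_mono)
    moreover have "(\<Prod>j\<le>k. cw (e j) / r j ^ e j) = Z * (cw (e k) / r k ^ e k)"
      unfolding lessThan_Suc_atMost[symmetric] prod.lessThan_Suc Z_def by (simp add: ek)
    moreover have "(\<Prod>j\<le>k. cw (\<nu> j) / r j ^ \<nu> j) = Z * (cw (\<nu> k) / r k ^ \<nu> k)"
      unfolding lessThan_Suc_atMost[symmetric] prod.lessThan_Suc Z_def ..
    ultimately show ?thesis by (simp add: mult_ac)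
  qed
  define G where "G j = (g j powr (1 - p)) ^ e j" for j
  have G0: "0 \<le> G j" for j by (simp add: G_def)
  \<comment> \<open>Each factor is bounded by its share of \<open>u\<close>, its share of the
    weight, and, for variables that are not low, by \<open>(n / exp 1) ^ e j\<close>; over all j the
    last factors multiply to \<open>n ^ n / exp n\<close>.\<close>
  have fac: "cw (e j) / r j ^ e j \<le> (if low j then 2 * \<theta> ^ e j else x j ^ e j / fact (e j)) * G j * ((if low j then 1 else real n ^ e j) / (if low j then 1 else exp 1 ^ e j))"
    if jk: "j \<le> k" for j
  proof (cases "low j")
    case True
    have gl: "1 / (1 + \<kappa> / 2) \<le> g j"
    proof -
      have "\<beta> * (\<kappa> / 2) \<le> b j * (\<kappa> / 2)" using True \<kappa> by (intro mult_right_mono) (auto simp: low_def)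
      then have "\<alpha> \<le> b j * (\<kappa> / 2)" using \<alpha>(3) by linarith
      moreover have "0 < b j" using True \<beta> by (simp add: low_def)
      ultimately show ?thesis using \<kappa> \<alpha> by (simp add: g_def field_simps)
    qed
    have "1 / (1 + \<kappa> / 2) \<le> g j powr (1 - p)"
    proof -
      have "g j \<le> g j powr (1 - p)" using powr_mono'[of "1 - p" 1 "g j"] g(1)[of j] g(2)[of j] p by simp
      then show ?thesis using gl by linarith
    qed
    then have "1 / (1 + \<kappa>) \<le> \<theta> * g j powr (1 - p)"
      using mult_left_mono[of "1 / (1 + \<kappa> / 2)" "g j powr (1 - p)" \<theta>] \<theta> \<kappa> by (simp add: \<theta>_def)
    then have "(1 / (1 + \<kappa>)) ^ e j \<le> (\<theta> * g j powr (1 - p)) ^ e j" using \<kappa> by (intro power_mono) auto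
    then have "cw (e j) * (1 / (1 + \<kappa>)) ^ e j \<le> 2 * (\<theta> * g j powr (1 - p)) ^ e j" using cw[of "e j"] \<kappa> by (intro mult_mono) auto
    then show ?thesis using True by (simp add: r_def G_def power_mult_distrib power_divide)
  next
    case nlow: False
    show ?thesis
    proof (cases "e j = 0")
      case True
      then show ?thesis using nlow by (simp add: G_def cw_def)
    next
      case False
      then have bj: "0 < b j" using bpos jk by simp
      have "e j \<le> n" unfolding n_def using jk nlow member_le_sum[of j "{..k}" "\<lambda>j. if low j then 0 else e j"] by simp
      then have n: "0 < n" using False by simp
      define s where "s = \<delta> / 4 * e j / (n * b j)"
      have s: "0 < s" using \<delta> False n bj by (simp add: s_def)
      have xb: "8 * exp 1 * b j / \<delta> \<le> x j * g j powr (1 - p)"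
      proof -
        have "b j \<le> b j powr p * ((\<beta> + \<alpha>) powr (1 - p) * g j powr (1 - p))" by (rule b_powr_split) (use nlow in \<open>simp add: low_def\<close>)
        also have "\<dots> \<le> b j powr p * ((2 * \<beta>) powr (1 - p) * g j powr (1 - p))"
          using \<alpha> \<beta> p by (intro mult_left_mono mult_right_mono powr_mono2) auto
        finally have "8 * exp 1 / \<delta> * b j \<le> 8 * exp 1 / \<delta> * (b j powr p * ((2 * \<beta>) powr (1 - p) * g j powr (1 - p)))"
          using \<delta> by (intro mult_left_mono) auto
        then show ?thesis by (simp add: x_def mult_ac)
      qed
      \<comment> \<open>The 1 in the radius is dropped; as \<open>e j\<close> is at least 1, the
        normalisation factor is absorbed in \<open>2 ^ e j\<close>.\<close>
      have "cw (e j) / r j ^ e j \<le> 2 ^ e j / s ^ e j"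
      proof (rule frac_le)
        show "cw (e j) \<le> 2 ^ e j" using False cw(2)[of "e j"] power_increasing[of 1 "e j" "2::real"] by simp
        show "s ^ e j \<le> r j ^ e j" using s nlow by (intro power_mono) (auto simp: r_def s_def)
      qed (use s in auto)
      also have "\<dots> = (2 / s) ^ e j" by (simp add: power_divide)
      also have "2 / s = (8 * exp 1 * b j / \<delta>) * real n / (exp 1 * e j)" using \<delta> n bj False by (simp add: s_def field_simps)
      also have "\<dots> ^ e j = (8 * exp 1 * b j / \<delta>) ^ e j / real (e j) ^ e j * (real n ^ e j / exp 1 ^ e j)"
        by (simp add: power_mult_distrib power_divide mult_ac)
      also have "\<dots> \<le> (x j * g j powr (1 - p)) ^ e j / fact (e j) * (real n ^ e j / exp 1 ^ e j)"
      proof (rule mult_right_mono, rule frac_le)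
        show "(8 * exp 1 * b j / \<delta>) ^ e j \<le> (x j * g j powr (1 - p)) ^ e j" using xb \<delta> bj by (intro power_mono) auto
        show "fact (e j) \<le> real (e j) ^ e j" using fact_le_power[of "e j", where 'a = real] by simp
      qed (use x in auto)
      finally show ?thesis using nlow by (simp add: G_def power_mult_distrib)
    qed
  qed
  define V where "V = (\<Prod>j\<le>k. if low j then 2 * \<theta> ^ e j else x j ^ e j / fact (e j))"
  have V0: "0 \<le> V" unfolding V_def using \<theta> x by (intro prod_nonneg) auto
  have "(\<Prod>j\<le>k. cw (e j) / r j ^ e j) \<le> (\<Prod>j\<le>k. (if low j then 2 * \<theta> ^ e j else x j ^ e j / fact (e j)) * G j * ((if low j then 1 else real n ^ e j) / (if low j then 1 else exp 1 ^ e j)))"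
    using fac cw(3) r1 by (intro prod_mono conjI divide_nonneg_nonneg zero_le_power) (auto intro: order_trans[of 0 1] less_imp_le)
  also have "\<dots> = V * (\<Prod>j\<le>k. G j) * ((\<Prod>j\<le>k. if low j then 1 else real n ^ e j) / (\<Prod>j\<le>k. if low j then 1 else exp 1 ^ e j))"
    unfolding V_def prod.distrib prod_dividef ..
  also have "\<dots> = V * (\<Prod>j\<le>k. G j) * (real n ^ n / exp (real n))"
  proof -
    have pn: "(\<Prod>j\<le>k. if low j then 1 else c ^ e j) = c ^ n" for c :: real
      unfolding n_def power_sum by (intro prod.cong) auto
    have "exp (1::real) ^ n = exp (real n)" by (simp flip: exp_of_nat_mult)
    then show ?thesis by (simp only: pn)
  qed
  also have "V * (\<Prod>j\<le>k. G j) * (real n ^ n / exp (real n)) \<le> V * (\<Prod>j\<le>k. G j) * fact n"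
    using power_self_le_exp_fact[of n] V0 G0 by (intro mult_left_mono mult_nonneg_nonneg prod_nonneg) (auto simp: field_simps)
  also have "\<dots> = u k e * (\<Prod>j\<le>k. G j)" by (simp add: u_def V_def n_def)
  finally have 2: "(\<Prod>j\<le>k. cw (e j) / r j ^ e j) \<le> u k e * (\<Prod>j\<le>k. G j)" .
  have "cmod (cf \<nu>) \<le> (\<Prod>j\<le>k. cw (\<nu> j) / r j ^ \<nu> j) * (C * b k * r k)" by (rule cf_radii[OF r1 budget])
  also have "\<dots> = C * b k * ((\<Prod>j\<le>k. cw (\<nu> j) / r j ^ \<nu> j) * r k)" by (simp add: mult_ac)
  also have "\<dots> \<le> C * b k * (2 * (u k e * (\<Prod>j\<le>k. G j)))" using 1 2 C b_nonneg by (intro mult_left_mono) auto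
  finally show ?thesis by (simp add: e_def G_def[abs_def] mult_ac)
qed

definition "E = 4 * (bsum + \<alpha>) powr (1 - p) * Q"

text \<open>The weights in \<open>cf_le\<close>, together with the share split off from
  \<open>b k\<close>, form \<open>Gam k \<nu> powr (1 - p)\<close>, which is at most
  \<open>\<epsilon> powr (1 - p)\<close> here. The remaining factors sum to at most
  \<open>2 * Q\<close>, the 2 being due to the index shift.\<close>

lemma sum_cf:
  assumes F: "finite F" "F \<subseteq> PiE {..k} (\<lambda>_. UNIV)" and \<epsilon>: "\<And>\<nu>. \<nu> \<in> F \<Longrightarrow> Gam k \<nu> \<le> \<epsilon>"
  shows "(\<Sum>\<nu>\<in>F. cmod (cf \<nu>)) \<le> E * C * \<epsilon> powr (1 - p) * b k powr p"
proof -
  define D where "D = (bsum + \<alpha>) powr (1 - p)"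
  have D: "0 \<le> D" by (simp add: D_def)
  have "cmod (cf \<nu>) \<le> 2 * C * D * b k powr p * \<epsilon> powr (1 - p) * u k (\<nu>(k := \<nu> k - 1))" if \<nu>: "\<nu> \<in> F" for \<nu>
  proof -
    define e where "e = \<nu>(k := \<nu> k - 1)"
    have Gp: "Gam k \<nu> powr (1 - p) = g k powr (1 - p) * (\<Prod>j\<le>k. (g j powr (1 - p)) ^ e j)"
      unfolding Gam_shift e_def using g(1) by (simp add: powr_mult prod_nonneg powr_power_commute prod_powr del: fun_upd_apply)
    have P0: "0 \<le> (\<Prod>j\<le>k. (g j powr (1 - p)) ^ e j)" by (intro prod_nonneg) auto
    have "cmod (cf \<nu>) \<le> 2 * C * b k * (u k e * (\<Prod>j\<le>k. (g j powr (1 - p)) ^ e j))" unfolding e_def by (rule cf_le)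
    also have "\<dots> = 2 * C * (u k e * (\<Prod>j\<le>k. (g j powr (1 - p)) ^ e j)) * b k" by (simp add: mult_ac)
    also have "\<dots> \<le> 2 * C * (u k e * (\<Prod>j\<le>k. (g j powr (1 - p)) ^ e j)) * (b k powr p * (D * g k powr (1 - p)))"
      unfolding D_def using C u_nonneg P0 by (intro mult_left_mono b_powr_split b_le_bsum mult_nonneg_nonneg) auto
    also have "\<dots> = 2 * C * D * b k powr p * u k e * Gam k \<nu> powr (1 - p)" unfolding Gp by (simp add: mult_ac)
    also have "\<dots> \<le> 2 * C * D * b k powr p * u k e * \<epsilon> powr (1 - p)"
      using C u_nonneg D p \<epsilon>[OF \<nu>] Gam_nonneg by (intro mult_left_mono powr_mono2 mult_nonneg_nonneg) auto
    finally show ?thesis by (simp add: e_def mult_ac)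
  qed
  then have "(\<Sum>\<nu>\<in>F. cmod (cf \<nu>)) \<le> (\<Sum>\<nu>\<in>F. 2 * C * D * b k powr p * \<epsilon> powr (1 - p) * u k (\<nu>(k := \<nu> k - 1)))" by (intro sum_mono)
  also have "\<dots> = 2 * C * D * b k powr p * \<epsilon> powr (1 - p) * (\<Sum>\<nu>\<in>F. u k (\<nu>(k := \<nu> k - 1)))" by (simp add: sum_distrib_left)
  also have "\<dots> \<le> 2 * C * D * b k powr p * \<epsilon> powr (1 - p) * (2 * Q)"
    using C D by (intro mult_left_mono sum_shift_le[OF _ F u_nonneg sum_u] mult_nonneg_nonneg) auto
  finally show ?thesis by (simp add: E_def D_def mult_ac)
qed

definition approx :: "real \<Rightarrow> (nat \<Rightarrow> real) \<Rightarrow> real" where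
  "approx \<epsilon> y = (\<Sum>\<nu>\<in>Lambda (weight \<alpha> b) \<epsilon> k. Re (cf \<nu>) * (\<Prod>j\<le>k. cheb (\<nu> j) (y j)))"

text \<open>The index set is downward closed because all \<open>g j\<close> are below 1 and
  \<open>max 1\<close> is monotone, so the Chebyshev products stay in the monomial span.\<close>

lemma approx_poly: assumes \<epsilon>: "0 < \<epsilon>" shows "approx \<epsilon> \<in> poly_space k (Lambda (weight \<alpha> b) \<epsilon> k)"
  unfolding approx_def[abs_def]
proof (rule poly_space_sum_cheb[OF finite_Lambda[OF \<epsilon>]])
  show "Lambda (weight \<alpha> b) \<epsilon> k \<subseteq> PiE {..k} (\<lambda>_. UNIV)" by (auto simp: Lambda_def)
  fix \<nu> \<mu> assume \<nu>: "\<nu> \<in> Lambda (weight \<alpha> b) \<epsilon> k" and \<mu>: "\<mu> \<in> PiE {..k} (\<lambda>_. UNIV)" and le: "\<And>j. j \<le> k \<Longrightarrow> \<mu> j \<le> \<nu> j"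
  have "Gam k \<nu> \<le> Gam k \<mu>" unfolding Gam_def
  proof (rule mult_mono)
    show "g k ^ max 1 (\<nu> k) \<le> g k ^ max 1 (\<mu> k)" using g[of k] le[of k] by (intro power_decreasing) auto
    show "(\<Prod>j<k. g j ^ \<nu> j) \<le> (\<Prod>j<k. g j ^ \<mu> j)" using g(1) g(2)[THEN less_imp_le] le by (intro prod_mono conjI power_decreasing) auto
  qed (use g(1) in \<open>auto intro!: prod_nonneg\<close>)
  then show "\<mu> \<in> Lambda (weight \<alpha> b) \<epsilon> k" using \<nu> \<mu> by (simp add: Lambda_iff[OF \<epsilon>])
qed

lemma approx_error:
  assumes \<epsilon>: "0 < \<epsilon>" and y: "y \<in> cube"
  shows "\<bar>Re (h (complex_of_real \<circ> y)) - approx \<epsilon> y\<bar> \<le> E * C * \<epsilon> powr (1 - p) * b k powr p"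
proof -
  \<comment> \<open>Coordinates beyond k are replaced by 0 so that the coefficients taken at y' are
    the numbers \<open>cf\<close>.\<close>
  define y' where "y' j = (if j \<le> k then y j else 0)" for j
  have y': "y' \<in> cube" using y by (auto simp: y'_def cube_def)
  have cf: "iter_coeff (Suc k) \<nu> h (complex_of_real \<circ> y') = cf \<nu>" for \<nu>
    unfolding cf_def by (rule iter_coeff_indep) (auto simp: y'_def)
  have hy: "h (complex_of_real \<circ> y') = h (complex_of_real \<circ> y)"
    by (rule curve_hol_cong[OF h_hol cube_in_nbhd[OF y']]) (use \<delta> in \<open>auto simp: y'_def\<close>)
  define f where "f \<nu> = Re (cf \<nu>) * (\<Prod>j\<le>k. cheb (\<nu> j) (y j))" for \<nu>
  define A where "A = PiE {..k} (\<lambda>_. UNIV :: nat set)"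
  define \<Lambda> where "\<Lambda> = Lambda (weight \<alpha> b) \<epsilon> k"
  have "((\<lambda>\<nu>. cf \<nu> * (\<Prod>j<Suc k. of_real (cheb (\<nu> j) (y' j)))) has_sum h (complex_of_real \<circ> y)) (PiE {..<Suc k} (\<lambda>_. UNIV))"
    using tame_expansion[OF h_tame \<delta> y', of "Suc k"] unfolding cf hy .
  then have "((\<lambda>\<nu>. Re (cf \<nu> * (\<Prod>j<Suc k. of_real (cheb (\<nu> j) (y' j))))) has_sum Re (h (complex_of_real \<circ> y))) (PiE {..<Suc k} (\<lambda>_. UNIV))"
    by (rule has_sum_Re)
  moreover have "Re (cf \<nu> * (\<Prod>j<Suc k. of_real (cheb (\<nu> j) (y' j)))) = f \<nu>" for \<nu>
  proof -
    have "(\<Prod>j<Suc k. cheb (\<nu> j) (y' j)) = (\<Prod>j\<le>k. cheb (\<nu> j) (y j))"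
      unfolding lessThan_Suc_atMost by (intro prod.cong) (auto simp: y'_def)
    then have "(\<Prod>j<Suc k. complex_of_real (cheb (\<nu> j) (y' j))) = of_real (\<Prod>j\<le>k. cheb (\<nu> j) (y j))"
      by (simp only: of_real_prod[symmetric])
    moreover have "Re (c * complex_of_real r) = Re c * r" for c r by simp
    ultimately show ?thesis unfolding f_def by (simp only:)
  qed
  ultimately have 1: "(f has_sum Re (h (complex_of_real \<circ> y))) A" by (simp add: A_def lessThan_Suc_atMost)
  have fin: "finite \<Lambda>" unfolding \<Lambda>_def by (rule finite_Lambda[OF \<epsilon>])
  have 2: "(f has_sum (approx \<epsilon> y)) \<Lambda>" using has_sum_finite[OF fin, of f] by (simp add: approx_def f_def \<Lambda>_def)
  have 3: "(f has_sum (Re (h (complex_of_real \<circ> y)) - approx \<epsilon> y)) (A - \<Lambda>)"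
    by (rule has_sum_Diff[OF 1 2]) (auto simp: \<Lambda>_def A_def Lambda_def)
  \<comment> \<open>The error is a sum over the complement of the index set; a bound on all its
    finite partial sums suffices, used for both signs.\<close>
  have bound: "(\<Sum>\<nu>\<in>F. \<bar>f \<nu>\<bar>) \<le> E * C * \<epsilon> powr (1 - p) * b k powr p" if F: "finite F" "F \<subseteq> A - \<Lambda>" for F
  proof -
    have "\<bar>f \<nu>\<bar> \<le> cmod (cf \<nu>)" for \<nu>
    proof -
      have "\<bar>\<Prod>j\<le>k. cheb (\<nu> j) (y j)\<bar> \<le> 1" unfolding abs_prod
        by (intro prod_le_1) (use cheb_le_1 y in \<open>auto simp: cube_def\<close>)
      then have "\<bar>Re (cf \<nu>)\<bar> * \<bar>\<Prod>j\<le>k. cheb (\<nu> j) (y j)\<bar> \<le> cmod (cf \<nu>) * 1" by (intro mult_mono abs_Re_le_cmod) auto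
      then show ?thesis by (simp add: f_def abs_mult)
    qed
    then have "(\<Sum>\<nu>\<in>F. \<bar>f \<nu>\<bar>) \<le> (\<Sum>\<nu>\<in>F. cmod (cf \<nu>))" by (rule sum_mono)
    also have "\<dots> \<le> E * C * \<epsilon> powr (1 - p) * b k powr p"
      using F Lambda_iff[OF \<epsilon>] by (intro sum_cf) (auto simp: A_def \<Lambda>_def)
    finally show ?thesis .
  qed
  have "Re (h (complex_of_real \<circ> y)) - approx \<epsilon> y \<le> E * C * \<epsilon> powr (1 - p) * b k powr p"
    by (rule has_sum_le_finite_sums[OF 3]) (rule order_trans[OF sum_mono bound], auto)
  moreover have "- (Re (h (complex_of_real \<circ> y)) - approx \<epsilon> y) \<le> E * C * \<epsilon> powr (1 - p) * b k powr p"
    by (rule has_sum_le_finite_sums[where f = "\<lambda>\<nu>. - f \<nu>" and A = "A - \<Lambda>"]) (use 3 in \<open>simp add: has_sum_uminus\<close>, rule order_trans[OF sum_mono bound], auto)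
  ultimately show ?thesis by linarith
qed

end

section \<open>Marginals of an analytic density\<close>

lemma append_seq_eq_comb_seq: "append_seq = comb_seq"
  by (intro ext) (simp add: append_seq_def comb_seq_def)

interpretation mu1: prob_space mu1 by (rule prob_space_mu1)

interpretation mu: sequence_space mu1
  unfolding sequence_space_def by unfold_locales

lemma prob_space_mu: "prob_space mu" unfolding mu_def by unfold_locales

interpretation mu_prob: prob_space mu by (rule prob_space_mu)

lemma measurable_append [measurable]: "(\<lambda>(y, t). append_seq n y t) \<in> mu \<Otimes>\<^sub>M mu \<rightarrow>\<^sub>M mu"
  unfolding append_seq_eq_comb_seq mu_def by (rule measurable_comb_seq)

lemma measurable_append' [measurable (raw)]:
  "f \<in> N \<rightarrow>\<^sub>M mu \<Longrightarrow> g \<in> N \<rightarrow>\<^sub>M mu \<Longrightarrow> (\<lambda>x. append_seq n (f x) (g x)) \<in> N \<rightarrow>\<^sub>M mu"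
  unfolding append_seq_eq_comb_seq mu_def by (rule measurable_comb_seq')

lemma distr_append: "distr (mu \<Otimes>\<^sub>M mu) mu (\<lambda>(y, t). append_seq n y t) = mu"
  unfolding append_seq_eq_comb_seq mu_def by (rule mu.PiM_comb_seq)

lemma measurable_case_nat_mu [measurable]: "(\<lambda>(x, t). case_nat x t) \<in> mu1 \<Otimes>\<^sub>M mu \<rightarrow>\<^sub>M mu"
  unfolding mu_def by measurable

lemma distr_case_nat: "distr (mu1 \<Otimes>\<^sub>M mu) mu (\<lambda>(x, t). case_nat x t) = mu"
  unfolding mu_def by (rule mu.PiM_iter)

lemma append_cube: "y \<in> cube \<Longrightarrow> t \<in> cube \<Longrightarrow> append_seq n y t \<in> cube"
  by (auto simp: cube_def append_seq_def)

lemma append_case_nat: "append_seq n y (case_nat x t) = append_seq (Suc n) (y(n := x)) t"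
proof
  fix j
  show "append_seq n y (case_nat x t) j = append_seq (Suc n) (y(n := x)) t j"
    by (cases rule: linorder_cases[of j n]) (auto simp: append_seq_def dest!: less_imp_Suc_add)
qed

lemma measurable_mu_component [measurable]: "(\<lambda>y. y j) \<in> borel_measurable mu"
proof -
  have "(\<lambda>y. y j) \<in> mu \<rightarrow>\<^sub>M mu1" unfolding mu_def by (rule measurable_component_singleton) simp
  moreover have "(\<lambda>x. x) \<in> mu1 \<rightarrow>\<^sub>M borel"
    using measurable_restrict_space1[of "\<lambda>x. x" borel borel] by (subst measurable_cong_sets[OF sets_mu1 refl]) auto
  ultimately show ?thesis using measurable_compose by fastforce
qed

lemma measurable_id_mu_borel: "(\<lambda>y. y) \<in> mu \<rightarrow>\<^sub>M (borel :: (nat \<Rightarrow> real) measure)"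
proof -
  have "(\<lambda>y. y) \<in> mu \<rightarrow>\<^sub>M (\<Pi>\<^sub>M i\<in>(UNIV::nat set). (borel :: real measure))"
    by (rule measurable_PiM_single') auto
  then show ?thesis using measurable_cong_sets[OF refl sets_PiM_equal_borel] by blast
qed

lemma measurable_mu_continuous:
  fixes f :: "(nat \<Rightarrow> real) \<Rightarrow> 'b::topological_space"
  assumes "continuous_on cube f" shows "f \<in> borel_measurable mu"
proof -
  have "(\<lambda>y. y) \<in> mu \<rightarrow>\<^sub>M restrict_space borel cube"
    using measurable_id_mu_borel by (rule measurable_restrict_space2[rotated]) (simp add: space_mu)
  from measurable_compose[OF this borel_measurable_continuous_on_restrict[OF assms]] show ?thesis .
qed

lemma compact_cube: "compact cube"
proof -
  have "compactin (product_topology (\<lambda>_. euclidean) UNIV) (PiE UNIV (\<lambda>_::nat. {-1..1::real}))"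
    unfolding compactin_PiE by auto
  moreover have "PiE UNIV (\<lambda>_::nat. {-1..1::real}) = cube" by (auto simp: cube_def PiE_UNIV_domain)
  ultimately show ?thesis by (simp add: euclidean_product_topology)
qed

lemma integral_mu_case_nat:
  fixes f :: "(nat \<Rightarrow> real) \<Rightarrow> 'b::{banach, second_countable_topology}"
  assumes f: "f \<in> borel_measurable mu" and bd: "\<And>y. y \<in> cube \<Longrightarrow> norm (f y) \<le> B"
  shows "(\<integral>y. f y \<partial>mu) = (\<integral>x. (\<integral>t. f (case_nat x t) \<partial>mu) \<partial>mu1)"
proof -
  interpret pair_prob_space mu1 mu by unfold_locales
  have m: "(\<lambda>(x, t). f (case_nat x t)) \<in> borel_measurable (mu1 \<Otimes>\<^sub>M mu)"
    using measurable_compose[OF measurable_case_nat_mu f] by (simp add: case_prod_unfold)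
  have "integrable (mu1 \<Otimes>\<^sub>M mu) (\<lambda>(x, t). f (case_nat x t))"
  proof (rule integrable_const_bound[OF _ m])
    show "AE z in mu1 \<Otimes>\<^sub>M mu. norm (case z of (x, t) \<Rightarrow> f (case_nat x t)) \<le> B"
      by (rule AE_I2) (auto intro!: bd simp: space_pair_measure space_mu space_mu1 cube_def split: nat.split)
  qed
  then have "(\<integral>x. (\<integral>t. f (case_nat x t) \<partial>mu) \<partial>mu1) = (\<integral>z. (case z of (x, t) \<Rightarrow> f (case_nat x t)) \<partial>(mu1 \<Otimes>\<^sub>M mu))"
    by (subst integral_fst'[symmetric]) auto
  also have "\<dots> = (\<integral>y. f y \<partial>distr (mu1 \<Otimes>\<^sub>M mu) mu (\<lambda>(x, t). case_nat x t))"
    using f by (subst integral_distr) (auto simp: case_prod_unfold)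
  finally show ?thesis unfolding distr_case_nat by simp
qed

lemma density_family_mono:
  assumes "density_family b \<phi> \<delta> m K A" "0 < \<delta>'" "\<delta>' \<le> \<delta>" "A \<le> A'"
  shows "density_family b \<phi> \<delta>' m K A'"
proof -
  interpret density_family b \<phi> \<delta> m K A by fact
  have sub: "nbhd b n \<delta>' \<subseteq> nbhd b n \<delta>" for n using nbhd_mono assms(3) .
  show ?thesis
  proof
    show "curve_hol b (Suc k) \<delta>' (\<phi> k)" for k using curve_hol_mono[OF \<phi>_hol assms(3)] by blast
    fix k y z assume y: "y \<in> cube" and z: "near b (Suc k) \<delta>' y z"
    have "A * b k * (1 + cmod (z k - of_real (y k))) \<le> A' * b k * (1 + cmod (z k - of_real (y k)))"
      using assms(4) b_nonneg by (intro mult_right_mono) auto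
    moreover have "near b (Suc k) \<delta> y z" using z assms(3) by (simp add: near_def)
    ultimately show "cmod (\<phi> k z - 1) \<le> A' * b k * (1 + cmod (z k - of_real (y k)))" using \<phi>_one[OF y, of k z] by linarith
  next
    show "m \<le> Re (\<phi> k z)" "cmod (\<phi> k z) \<le> K" if "z \<in> nbhd b (Suc k) \<delta>'" for k z
      using \<phi>_ge \<phi>_le sub that by blast+
  qed (use assms(2,4) m_pos A_nonneg \<phi>_real \<phi>_norm in auto)
qed

section \<open>Complex extension of the density and of its marginals\<close>

locale analytic_density = weights b for b +
  fixes p M L :: real and \<psi> :: "nat \<Rightarrow> 'a::banach" and S F
  assumes M: "0 < M" "M \<le> L" and dens: "density_assumption p M L \<psi> S F" and \<psi>_le: "\<And>j. norm (\<psi> j) \<le> b j"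
begin

abbreviation "f \<equiv> induced_density \<psi> F"

lemma dens_simps:
  shows S_open: "open S"
    and F_deriv: "z \<in> S \<Longrightarrow> \<exists>D. (F has_derivative D) (at z) \<and> (\<forall>c v. D (cscale c v) = c * D v)"
    and in_S: "y \<in> cube \<Longrightarrow> (expansion \<psi> y, 0) \<in> S"
    and F_real: "y \<in> cube \<Longrightarrow> F (expansion \<psi> y, 0) \<in> \<real>"
    and F_ge: "z \<in> S \<Longrightarrow> M \<le> cmod (F z)" and F_le: "z \<in> S \<Longrightarrow> cmod (F z) \<le> L"
    and f_pos: "y \<in> cube \<Longrightarrow> 0 < f y" and f_norm: "(\<integral>y. f y \<partial>mu) = 1"
  using dens by (auto simp: density_assumption_def complex_differentiable_on_def)

lemma F_f: "y \<in> cube \<Longrightarrow> F (expansion \<psi> y, 0) = of_real (f y)"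
  using F_real by (simp add: induced_density_def)

lemma f_bounds: "y \<in> cube \<Longrightarrow> M \<le> f y \<and> f y \<le> L"
  using F_ge[OF in_S, of y] F_le[OF in_S, of y] f_pos[of y] by (simp add: F_f)

lemma expansion_summable: assumes "\<And>j. n \<le> j \<Longrightarrow> \<bar>c j\<bar> \<le> 1" shows "summable (\<lambda>j. c j *\<^sub>R \<psi> j)"
proof (rule summable_comparison_test'[OF b_summable])
  fix j assume "n \<le> j"
  then have "\<bar>c j\<bar> * norm (\<psi> j) \<le> 1 * b j" using assms \<psi>_le by (intro mult_mono) auto
  then show "norm (c j *\<^sub>R \<psi> j) \<le> b j" by simp
qed

lemma expansion_continuous: "continuous_on cube (expansion \<psi>)"
proof -
  have "uniform_limit cube (\<lambda>n y. \<Sum>j<n. y j *\<^sub>R \<psi> j) (\<lambda>y. \<Sum>j. y j *\<^sub>R \<psi> j) sequentially"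
  proof (rule Weierstrass_m_test[OF _ b_summable])
    fix n y assume "y \<in> cube"
    then have "\<bar>y n\<bar> * norm (\<psi> n) \<le> 1 * b n" using \<psi>_le by (intro mult_mono) (auto simp: cube_def abs_le_iff minus_le_iff)
    then show "norm (y n *\<^sub>R \<psi> n) \<le> b n" by simp
  qed
  then show ?thesis unfolding expansion_def[abs_def]
    by (rule uniform_limit_theorem[rotated])
      (auto intro!: always_eventually continuous_intros continuous_on_subset[OF continuous_on_product_coordinates])
qed

text \<open>\<open>Ec\<close> extends the expansion to complex coefficients, and \<open>mc n\<close> below extends the marginal \<open>n\<close>.\<close>

definition Ec :: "(nat \<Rightarrow> complex) \<Rightarrow> 'a \<times> 'a" where
  "Ec z = (expansion \<psi> (Re \<circ> z), expansion \<psi> (Im \<circ> z))"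

definition cappend :: "nat \<Rightarrow> (nat \<Rightarrow> complex) \<Rightarrow> (nat \<Rightarrow> real) \<Rightarrow> nat \<Rightarrow> complex" where
  "cappend n z t = (\<lambda>j. if j < n then z j else of_real (t (j - n)))"

lemma expansion_append:
  assumes t: "t \<in> cube"
  shows "expansion \<psi> (append_seq n c t) = (\<Sum>j<n. c j *\<^sub>R \<psi> j) + expansion \<psi> (append_seq n (\<lambda>_. 0) t)"
proof -
  have s: "summable (\<lambda>j. append_seq n c t j *\<^sub>R \<psi> j)" for c
    using t by (intro expansion_summable[of n]) (auto simp: append_seq_def cube_def abs_le_iff minus_le_iff)
  have "expansion \<psi> (append_seq n c t) - expansion \<psi> (append_seq n (\<lambda>_. 0) t) = (\<Sum>j. append_seq n c t j *\<^sub>R \<psi> j - append_seq n (\<lambda>_. 0) t j *\<^sub>R \<psi> j)"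
    unfolding expansion_def by (rule suminf_diff[OF s s])
  also have "\<dots> = (\<Sum>j<n. append_seq n c t j *\<^sub>R \<psi> j - append_seq n (\<lambda>_. 0) t j *\<^sub>R \<psi> j)"
    by (rule suminf_finite) (auto simp: append_seq_def)
  also have "\<dots> = (\<Sum>j<n. c j *\<^sub>R \<psi> j)" by (intro sum.cong) (auto simp: append_seq_def)
  finally show ?thesis by (simp add: algebra_simps)
qed

text \<open>Only finitely many coordinates are complex, so they enter through a finite sum, and the
  real tail is one fixed vector. Holomorphy and Lipschitz estimates thereby concern finitely many
  variables.\<close>

lemma Ec_append:
  assumes t: "t \<in> cube"
  shows "Ec (cappend n z t) = (\<Sum>j<n. cscale (z j) (\<psi> j, 0)) + (expansion \<psi> (append_seq n (\<lambda>_. 0) t), 0)"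
proof -
  have "Re \<circ> cappend n z t = append_seq n (Re \<circ> z) t" "Im \<circ> cappend n z t = append_seq n (Im \<circ> z) (\<lambda>_. 0)"
    by (auto simp: cappend_def append_seq_def)
  moreover have "expansion \<psi> (append_seq n (Im \<circ> z) (\<lambda>_. 0)) = (\<Sum>j<n. Im (z j) *\<^sub>R \<psi> j)"
  proof -
    have "(\<lambda>_. 0) \<in> cube" by (auto simp: cube_def)
    from expansion_append[OF this, of n "Im \<circ> z"]
    show ?thesis by (simp add: expansion_def append_seq_def)
  qed
  moreover have "(\<Sum>j<n. cscale (z j) (\<psi> j, 0)) = (\<Sum>j<n. Re (z j) *\<^sub>R \<psi> j, \<Sum>j<n. Im (z j) *\<^sub>R \<psi> j)"
    by (induction n) (auto simp: cscale_def zero_prod_def)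
  ultimately show ?thesis using expansion_append[OF t, of n "Re \<circ> z"] by (simp add: Ec_def)
qed

lemma Ec_real: assumes "y \<in> cube" "t \<in> cube" shows "Ec (cappend n (complex_of_real \<circ> y) t) = (expansion \<psi> (append_seq n y t), 0)"
proof -
  have "Re \<circ> cappend n (complex_of_real \<circ> y) t = append_seq n y t" "Im \<circ> cappend n (complex_of_real \<circ> y) t = (\<lambda>_. 0)"
    by (auto simp: cappend_def append_seq_def)
  then show ?thesis by (simp add: Ec_def expansion_def)
qed

lemma norm_Ec_diff:
  assumes "t \<in> cube"
  shows "norm (Ec (cappend n z t) - Ec (cappend n z' t)) \<le> 2 * sdist n z z'"
proof -
  have "Ec (cappend n z t) - Ec (cappend n z' t) = (\<Sum>j<n. cscale (z j) (\<psi> j, 0) - cscale (z' j) (\<psi> j, 0))"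
    unfolding Ec_append[OF assms] by (simp add: sum_subtractf)
  also have "norm \<dots> \<le> (\<Sum>j<n. norm (cscale (z j) (\<psi> j, 0) - cscale (z' j) (\<psi> j, 0)))" by (rule norm_sum)
  also have "\<dots> \<le> (\<Sum>j<n. 2 * (b j * cmod (z j - z' j)))"
  proof (rule sum_mono)
    fix j
    have "cscale (z j) (\<psi> j, 0) - cscale (z' j) (\<psi> j, 0) = (Re (z j - z' j) *\<^sub>R \<psi> j, Im (z j - z' j) *\<^sub>R \<psi> j)"
      by (simp add: cscale_def scaleR_diff_left)
    then have "norm (cscale (z j) (\<psi> j, 0) - cscale (z' j) (\<psi> j, 0)) \<le> \<bar>Re (z j - z' j)\<bar> * norm (\<psi> j) + \<bar>Im (z j - z' j)\<bar> * norm (\<psi> j)"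
      using norm_Pair_le[of "Re (z j - z' j) *\<^sub>R \<psi> j" "Im (z j - z' j) *\<^sub>R \<psi> j"] by (simp only: norm_scaleR)
    also have "\<dots> \<le> cmod (z j - z' j) * b j + cmod (z j - z' j) * b j"
      by (intro add_mono mult_mono abs_Re_le_cmod abs_Im_le_cmod \<psi>_le) auto
    finally show "norm (cscale (z j) (\<psi> j, 0) - cscale (z' j) (\<psi> j, 0)) \<le> 2 * (b j * cmod (z j - z' j))" by (simp add: mult_ac)
  qed
  finally show ?thesis by (simp add: sdist_def sum_distrib_left)
qed

text \<open>The image of the cube is compact, hence has a neighbourhood of uniform width inside S.
  The complexified expansion is Lipschitz with constant 2 in \<open>sdist\<close>, so this pulls
  back to a tube that serves all n and all tails t at once.\<close>

lemma domain: obtains \<delta> where "0 < \<delta>" "\<And>n z t. z \<in> nbhd b n \<delta> \<Longrightarrow> t \<in> cube \<Longrightarrow> Ec (cappend n z t) \<in> S"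
proof -
  have "compact ((\<lambda>y. (expansion \<psi> y, 0::'a)) ` cube)"
    by (intro compact_continuous_image compact_cube continuous_intros expansion_continuous)
  moreover have "(\<lambda>y. (expansion \<psi> y, 0::'a)) ` cube \<subseteq> S" using in_S by auto
  moreover have "(\<lambda>y. (expansion \<psi> y, 0::'a)) ` cube \<noteq> {}" by (auto simp: cube_def intro!: exI[of _ "\<lambda>_. 0"])
  ultimately obtain e where e: "e > 0" "(\<Union>x\<in>(\<lambda>y. (expansion \<psi> y, 0::'a)) ` cube. ball x e) \<subseteq> S"
    using compact_subset_open_imp_ball_epsilon_subset[OF _ S_open] by metis
  show ?thesis
  proof (rule that[of "e / 4"])
    fix n z t assume z: "z \<in> nbhd b n (e / 4)" and t: "t \<in> cube"
    obtain y where y: "y \<in> cube" "sdist n z (complex_of_real \<circ> y) \<le> e / 4" using z by (auto simp: nbhd_sdist)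
    have "norm (Ec (cappend n z t) - (expansion \<psi> (append_seq n y t), 0)) < e"
      using norm_Ec_diff[OF t, of n z "complex_of_real \<circ> y"] y e(1) unfolding Ec_real[OF y(1) t] by linarith
    then have "Ec (cappend n z t) \<in> ball (expansion \<psi> (append_seq n y t), 0) e" by (simp add: dist_norm norm_minus_commute)
    then show "Ec (cappend n z t) \<in> S" using e(2) append_cube[OF y(1) t] by blast
  qed (use e in auto)
qed

definition "\<delta>\<^sub>a = (SOME \<delta>. 0 < \<delta> \<and> (\<forall>n z t. z \<in> nbhd b n \<delta> \<longrightarrow> t \<in> cube \<longrightarrow> Ec (cappend n z t) \<in> S))"

lemma \<delta>\<^sub>a: "0 < \<delta>\<^sub>a" and Ec_in_S: "z \<in> nbhd b n \<delta>\<^sub>a \<Longrightarrow> t \<in> cube \<Longrightarrow> Ec (cappend n z t) \<in> S"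
proof -
  have "\<exists>\<delta>. 0 < \<delta> \<and> (\<forall>n z t. z \<in> nbhd b n \<delta> \<longrightarrow> t \<in> cube \<longrightarrow> Ec (cappend n z t) \<in> S)" using domain by metis
  from someI_ex[OF this, folded \<delta>\<^sub>a_def]
  show "0 < \<delta>\<^sub>a" "z \<in> nbhd b n \<delta>\<^sub>a \<Longrightarrow> t \<in> cube \<Longrightarrow> Ec (cappend n z t) \<in> S" by blast+
qed

definition mc :: "nat \<Rightarrow> (nat \<Rightarrow> complex) \<Rightarrow> complex" where
  "mc n z = (\<integral>t. F (Ec (cappend n z t)) \<partial>mu)"

lemma F_continuous: "continuous_on S F"
  using F_deriv has_derivative_continuous continuous_at_imp_continuous_on by metis

lemma measurable_F: assumes "z \<in> nbhd b n \<delta>\<^sub>a" shows "(\<lambda>t. F (Ec (cappend n z t))) \<in> borel_measurable mu"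
proof (rule measurable_mu_continuous)
  have "continuous_on cube (\<lambda>t. append_seq n (\<lambda>_. 0) t)"
  proof (rule continuous_on_coordinatewise_then_product)
    fix j
    show "continuous_on cube (\<lambda>t. append_seq n (\<lambda>_. 0::real) t j)"
      by (cases "j < n") (auto simp: append_seq_def intro!: continuous_intros continuous_on_subset[OF continuous_on_product_coordinates])
  qed
  moreover have "(\<lambda>t. append_seq n (\<lambda>_. 0) t) ` cube \<subseteq> cube" by (auto simp: append_seq_def cube_def)
  ultimately have "continuous_on cube (\<lambda>t. expansion \<psi> (append_seq n (\<lambda>_. 0) t))"
    using continuous_on_compose2[OF expansion_continuous] by blast
  then have "continuous_on cube (\<lambda>t. (\<Sum>j<n. cscale (z j) (\<psi> j, 0)) + (expansion \<psi> (append_seq n (\<lambda>_. 0) t), 0))"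
    by (intro continuous_intros)
  then have "continuous_on cube (\<lambda>t. Ec (cappend n z t))"
    by (rule continuous_on_cong[THEN iffD1, rotated -1]) (auto simp: Ec_append)
  then show "continuous_on cube (\<lambda>t. F (Ec (cappend n z t)))"
    by (rule continuous_on_compose2[OF F_continuous]) (use Ec_in_S[OF assms] in auto)
qed

lemma bounded_linear_cscale: "bounded_linear (\<lambda>c. cscale c (v :: 'a, 0))"
  unfolding cscale_def
  by (auto intro!: bounded_linear_Pair bounded_linear_compose[OF bounded_linear_scaleR_left bounded_linear_Re] bounded_linear_compose[OF bounded_linear_scaleR_left bounded_linear_Im])

text \<open>Along a holomorphic curve the derivative of F composed with the expansion is
  multiplication by a complex number, because D commutes with \<open>cscale\<close>; boundedness of
  F then allows integration over t.\<close>

lemma mc_hol: "curve_hol b n \<delta>\<^sub>a (mc n)"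
proof (rule curve_holI)
  fix V \<zeta> assume V: "open V" and \<zeta>: "\<And>j. j < n \<Longrightarrow> (\<lambda>s. \<zeta> s j) holomorphic_on V" and nb: "\<And>s. s \<in> V \<Longrightarrow> \<zeta> s \<in> nbhd b n \<delta>\<^sub>a"
  show "(\<lambda>s. mc n (\<zeta> s)) holomorphic_on V"
    unfolding mc_def
  proof (rule holomorphic_on_integral[OF mu_prob.finite_measure_axioms V])
    fix t assume "t \<in> space mu"
    then have t: "t \<in> cube" by (simp add: space_mu)
    have "(\<lambda>s. F (Ec (cappend n (\<zeta> s) t))) field_differentiable at s" if s: "s \<in> V" for s
    proof -
      define d where "d j = deriv (\<lambda>s. \<zeta> s j) s" for j
      have d: "((\<lambda>s. \<zeta> s j) has_derivative (\<lambda>h. d j * h)) (at s)" if "j < n" for j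
        using holomorphic_derivI[OF \<zeta>[OF that] V s] by (simp add: has_field_derivative_def d_def)
      obtain D where D: "(F has_derivative D) (at (Ec (cappend n (\<zeta> s) t)))" "\<And>c v. D (cscale c v) = c * D v"
        using F_deriv[OF Ec_in_S[OF nb[OF s] t]] by blast
      have "((\<lambda>s. (\<Sum>j<n. cscale (\<zeta> s j) (\<psi> j, 0)) + (expansion \<psi> (append_seq n (\<lambda>_. 0) t), 0)) has_derivative (\<lambda>h. (\<Sum>j<n. cscale (d j * h) (\<psi> j, 0)) + 0)) (at s)"
        by (intro has_derivative_add has_derivative_sum has_derivative_const bounded_linear.has_derivative[OF bounded_linear_cscale d]) auto
      then have E: "((\<lambda>s. Ec (cappend n (\<zeta> s) t)) has_derivative (\<lambda>h. \<Sum>j<n. cscale (d j * h) (\<psi> j, 0))) (at s)"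
        by (simp add: Ec_append[OF t])
      have "((\<lambda>s. F (Ec (cappend n (\<zeta> s) t))) has_derivative (\<lambda>h. D (\<Sum>j<n. cscale (d j * h) (\<psi> j, 0)))) (at s)"
        by (rule has_derivative_compose[OF E D(1)])
      moreover have "D (\<Sum>j<n. cscale (d j * h) (\<psi> j, 0)) = (\<Sum>j<n. d j * D (\<psi> j, 0)) * h" for h
        using linear_sum[OF bounded_linear.linear[OF has_derivative_bounded_linear[OF D(1)]], of "\<lambda>j. cscale (d j * h) (\<psi> j, 0)" "{..<n}"]
        by (simp add: D(2) sum_distrib_left mult_ac)
      ultimately show ?thesis unfolding field_differentiable_def has_field_derivative_def by auto
    qed
    then show "(\<lambda>s. F (Ec (cappend n (\<zeta> s) t))) holomorphic_on V"
      using V by (simp add: holomorphic_on_open field_differentiable_def)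
  next
    fix s t assume "s \<in> V" "t \<in> space mu"
    then show "cmod (F (Ec (cappend n (\<zeta> s) t))) \<le> L" using F_le Ec_in_S nb by (simp add: space_mu)
  qed (use measurable_F nb in auto)
qed

lemma mc_le: assumes "z \<in> nbhd b n \<delta>\<^sub>a" shows "cmod (mc n z) \<le> L"
proof -
  have bd: "cmod (F (Ec (cappend n z t))) \<le> L" if "t \<in> space mu" for t
    using that F_le Ec_in_S[OF assms] by (simp add: space_mu)
  have "cmod (mc n z) \<le> (\<integral>t. L \<partial>mu)" unfolding mc_def
  proof (rule order_trans[OF integral_norm_bound], rule integral_mono)
    have "integrable mu (\<lambda>t. F (Ec (cappend n z t)))"
      using bd measurable_F[OF assms] by (intro mu_prob.integrable_const_bound[where B = L]) auto
    then show "integrable mu (\<lambda>t. cmod (F (Ec (cappend n z t))))" by (rule integrable_norm)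
  qed (use bd in auto)
  then show ?thesis by (simp add: mu_prob.prob_space)
qed

lemma f_measurable: "f \<in> borel_measurable mu"
proof (rule measurable_mu_continuous)
  have "continuous_on cube (\<lambda>y. F (expansion \<psi> y, 0))"
    by (rule continuous_on_compose2[OF F_continuous, of _ "\<lambda>y. (expansion \<psi> y, 0)"])
      (use in_S in \<open>auto intro!: continuous_intros expansion_continuous\<close>)
  then show "continuous_on cube f" unfolding induced_density_def[abs_def] by (intro continuous_intros)
qed

lemma mc_real: assumes y: "y \<in> cube" shows "mc n (complex_of_real \<circ> y) = of_real (marginal f n y)"
proof -
  have "mc n (complex_of_real \<circ> y) = (\<integral>t. complex_of_real (f (append_seq n y t)) \<partial>mu)"
    unfolding mc_def by (rule Bochner_Integration.integral_cong) (auto simp: space_mu Ec_real[OF y] F_f append_cube[OF y])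
  then have "mc n (complex_of_real \<circ> y) = of_real (\<integral>t. f (append_seq n y t) \<partial>mu)" by simp
  moreover have "n = 0 \<Longrightarrow> (\<integral>t. f (append_seq n y t) \<partial>mu) = 1"
    using f_norm by (simp add: append_seq_def)
  ultimately show ?thesis by (cases "n = 0") (simp_all add: marginal_def)
qed

lemma marginal_bounds: assumes y: "y \<in> cube" shows "M \<le> marginal f n y" "marginal f n y \<le> L"
proof -
  have m: "marginal f n y = (\<integral>t. f (append_seq n y t) \<partial>mu)"
    using f_norm by (simp add: marginal_def append_seq_def)
  have me: "(\<lambda>t. f (append_seq n y t)) \<in> borel_measurable mu"
    by (rule measurable_compose[OF _ f_measurable]) (use y in \<open>auto simp: space_mu intro!: measurable_append' measurable_const\<close>)
  have b: "M \<le> f (append_seq n y t) \<and> f (append_seq n y t) \<le> L" if "t \<in> space mu" for t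
    using that by (intro f_bounds append_cube y) (simp add: space_mu)
  have i: "integrable mu (\<lambda>t. f (append_seq n y t))"
  proof (rule mu_prob.integrable_const_bound[OF AE_I2 me, where B = L])
    show "norm (f (append_seq n y t)) \<le> L" if "t \<in> space mu" for t using b[OF that] M by simp
  qed
  have "(\<integral>t. M \<partial>mu) \<le> (\<integral>t. f (append_seq n y t) \<partial>mu)"
    by (rule integral_mono[OF _ i]) (use b in auto)
  moreover have "(\<integral>t. f (append_seq n y t) \<partial>mu) \<le> (\<integral>t. L \<partial>mu)"
    by (rule integral_mono[OF i]) (use b in auto)
  ultimately show "M \<le> marginal f n y" "marginal f n y \<le> L" by (simp_all add: m mu_prob.prob_space)
qed

text \<open>With the Lipschitz constant \<open>8 * L / \<delta>\<^sub>a\<close> of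
  \<open>mc\<close>, this radius allows a change by \<open>M / 2\<close>, half of the lower bound on
  the cube. In the same way \<open>\<delta>\<^sub>c\<close> allows the conditional density to lose
  half of \<open>M / L\<close>.\<close>

definition "\<delta>\<^sub>b = \<delta>\<^sub>a * M / (16 * L)"

lemma L_pos: "0 < L" using M by simp

lemma \<delta>\<^sub>b: "0 < \<delta>\<^sub>b" "\<delta>\<^sub>b \<le> \<delta>\<^sub>a / 16"
proof -
  have "\<delta>\<^sub>b = \<delta>\<^sub>a / 16 * (M / L)" by (simp add: \<delta>\<^sub>b_def)
  moreover have "M / L \<le> 1" "0 < M / L" using M L_pos by auto
  ultimately show "\<delta>\<^sub>b \<le> \<delta>\<^sub>a / 16"
    using \<delta>\<^sub>a mult_left_mono[of "M / L" 1 "\<delta>\<^sub>a / 16"] by simp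
  show "0 < \<delta>\<^sub>b" using \<delta>\<^sub>a M L_pos by (simp add: \<delta>\<^sub>b_def)
qed

lemma Re_mc: assumes z: "z \<in> nbhd b n \<delta>\<^sub>b" shows "M / 2 \<le> Re (mc n z)"
proof -
  obtain y where y: "y \<in> cube" "sdist n z (complex_of_real \<circ> y) \<le> \<delta>\<^sub>b" using z by (auto simp: nbhd_sdist)
  have "cmod (mc n z - mc n (complex_of_real \<circ> y)) \<le> 8 * L / \<delta>\<^sub>a * sdist n z (complex_of_real \<circ> y)"
    by (rule curve_hol_lipschitz[OF mc_hol mc_le]) (use y \<delta>\<^sub>a \<delta>\<^sub>b z nbhd_mono[of \<delta>\<^sub>b \<delta>\<^sub>a] in \<open>auto intro!: cube_in_nbhd\<close>)
  also have "\<dots> \<le> 8 * L / \<delta>\<^sub>a * \<delta>\<^sub>b" using y L_pos \<delta>\<^sub>a by (intro mult_left_mono) auto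
  also have "\<dots> = M / 2" using L_pos \<delta>\<^sub>a by (simp add: \<delta>\<^sub>b_def)
  finally have 1: "cmod (mc n z - mc n (complex_of_real \<circ> y)) \<le> M / 2" .
  have "\<bar>Re (mc n z) - marginal f n y\<bar> = \<bar>Re (mc n z - mc n (complex_of_real \<circ> y))\<bar>" by (simp add: mc_real[OF y(1)])
  also have "\<dots> \<le> M / 2" using 1 abs_Re_le_cmod order_trans by blast
  finally show ?thesis using marginal_bounds(1)[OF y(1), of n] by linarith
qed

definition \<phi> :: "nat \<Rightarrow> (nat \<Rightarrow> complex) \<Rightarrow> complex" where
  "\<phi> k z = mc (Suc k) z / mc k z"

lemma nbhd_b: "z \<in> nbhd b (Suc k) \<delta>\<^sub>b \<Longrightarrow> z \<in> nbhd b k \<delta>\<^sub>b" "z \<in> nbhd b k \<delta>\<^sub>b \<Longrightarrow> z \<in> nbhd b k \<delta>\<^sub>a"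
  using nbhd_drop[of k "Suc k"] nbhd_mono[of \<delta>\<^sub>b \<delta>\<^sub>a] \<delta>\<^sub>b \<delta>\<^sub>a by auto

lemma mc_ge: "z \<in> nbhd b n \<delta>\<^sub>b \<Longrightarrow> M / 2 \<le> cmod (mc n z)" "z \<in> nbhd b n \<delta>\<^sub>b \<Longrightarrow> mc n z \<noteq> 0"
  using Re_mc[of z n] complex_Re_le_cmod[of "mc n z"] M by auto

lemma \<phi>_hol: "curve_hol b (Suc k) \<delta>\<^sub>b (\<phi> k)"
proof (rule curve_holI)
  fix V \<zeta> assume V: "open V" "\<And>j. j < Suc k \<Longrightarrow> (\<lambda>s. \<zeta> s j) holomorphic_on V" "\<And>s. s \<in> V \<Longrightarrow> \<zeta> s \<in> nbhd b (Suc k) \<delta>\<^sub>b"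
  show "(\<lambda>s. \<phi> k (\<zeta> s)) holomorphic_on V" unfolding \<phi>_def
    using V nbhd_b mc_ge(2) by (intro holomorphic_intros curve_holD[OF mc_hol]) auto
qed

lemma \<phi>_le: assumes "z \<in> nbhd b (Suc k) \<delta>\<^sub>b" shows "cmod (\<phi> k z) \<le> 2 * L / M"
proof -
  have "cmod (mc (Suc k) z) / cmod (mc k z) \<le> L / (M / 2)"
    using mc_le[OF nbhd_b(2)[OF assms]] mc_ge(1)[OF nbhd_b(1)[OF assms]] M L_pos by (intro frac_le) auto
  then show ?thesis by (simp add: \<phi>_def norm_divide mult_ac)
qed

lemma \<phi>_real: assumes "y \<in> cube" shows "\<phi> k (complex_of_real \<circ> y) = of_real (conditional f (Suc k) y)"
  by (simp add: \<phi>_def mc_real[OF assms] conditional_def)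

lemma conditional_bounds: assumes "y \<in> cube" shows "M / L \<le> conditional f n y" "conditional f n y \<le> L / M"
  using marginal_bounds[OF assms, of n] marginal_bounds[OF assms, of "n - 1"] M L_pos
  by (auto simp: conditional_def intro!: frac_le)

definition "\<delta>\<^sub>c = \<delta>\<^sub>b * (M / L)\<^sup>2 / 32"

lemma \<delta>\<^sub>c: "0 < \<delta>\<^sub>c" "\<delta>\<^sub>c \<le> \<delta>\<^sub>b / 32"
proof -
  have "(M / L)\<^sup>2 \<le> 1" using M by (simp add: power_le_one_iff)
  then show "\<delta>\<^sub>c \<le> \<delta>\<^sub>b / 32" using \<delta>\<^sub>b by (simp add: \<delta>\<^sub>c_def mult_left_le)
  show "0 < \<delta>\<^sub>c" using \<delta>\<^sub>b M L_pos by (simp add: \<delta>\<^sub>c_def)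
qed

lemma Re_\<phi>: assumes z: "z \<in> nbhd b (Suc k) \<delta>\<^sub>c" shows "M / (2 * L) \<le> Re (\<phi> k z)"
proof -
  obtain y where y: "y \<in> cube" "sdist (Suc k) z (complex_of_real \<circ> y) \<le> \<delta>\<^sub>c" using z by (auto simp: nbhd_sdist)
  have "cmod (\<phi> k z - \<phi> k (complex_of_real \<circ> y)) \<le> 8 * (2 * L / M) / \<delta>\<^sub>b * sdist (Suc k) z (complex_of_real \<circ> y)"
    by (rule curve_hol_lipschitz[OF \<phi>_hol \<phi>_le]) (use y \<delta>\<^sub>c \<delta>\<^sub>b z nbhd_mono[of \<delta>\<^sub>c \<delta>\<^sub>b] in \<open>auto intro!: cube_in_nbhd\<close>)
  also have "\<dots> \<le> 8 * (2 * L / M) / \<delta>\<^sub>b * \<delta>\<^sub>c" using y L_pos M \<delta>\<^sub>b by (intro mult_left_mono) auto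
  also have "\<dots> = M / (2 * L)" using L_pos M \<delta>\<^sub>b by (simp add: \<delta>\<^sub>c_def field_simps power2_eq_square)
  finally have 1: "cmod (\<phi> k z - \<phi> k (complex_of_real \<circ> y)) \<le> M / (2 * L)" .
  have "\<bar>Re (\<phi> k z) - conditional f (Suc k) y\<bar> = \<bar>Re (\<phi> k z - \<phi> k (complex_of_real \<circ> y))\<bar>" by (simp add: \<phi>_real[OF y(1)])
  also have "\<dots> \<le> M / (2 * L)" using 1 abs_Re_le_cmod order_trans by blast
  finally show ?thesis using conditional_bounds(1)[OF y(1), of "Suc k"] by (simp add: abs_le_iff)
qed

lemma cappend_case_nat: "cappend k z (case_nat x t) = cappend (Suc k) (z(k := of_real x)) t"
proof
  fix j
  show "cappend k z (case_nat x t) j = cappend (Suc k) (z(k := of_real x)) t j"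
    by (cases rule: linorder_cases[of j k]) (auto simp: cappend_def dest!: less_imp_Suc_add)
qed

lemma mc_marginal: assumes z: "z \<in> nbhd b k \<delta>\<^sub>a" shows "mc k z = (\<integral>x. mc (Suc k) (z(k := of_real x)) \<partial>mu1)"
  unfolding mc_def cappend_case_nat[symmetric]
  by (rule integral_mu_case_nat[OF measurable_F[OF z], where B = L]) (use F_le Ec_in_S[OF z] in auto)

definition "A = 32 * L / (M * \<delta>\<^sub>a)"

text \<open>By \<open>mc_marginal\<close> the difference \<open>mc (Suc k) z - mc k z\<close> is an
  average of differences in coordinate k alone, and each of these is Lipschitz in
  \<open>sdist\<close>, where that coordinate has weight \<open>b k\<close>.\<close>

lemma \<phi>_one:
  assumes y: "y \<in> cube" and z: "near b (Suc k) \<delta>\<^sub>c y z"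
  shows "cmod (\<phi> k z - 1) \<le> A * b k * (1 + cmod (z k - of_real (y k)))"
proof -
  define d where "d = cmod (z k - of_real (y k))"
  have zc: "z \<in> nbhd b (Suc k) \<delta>\<^sub>c" using y z by (auto simp: nbhd_def)
  then have zb: "z \<in> nbhd b (Suc k) \<delta>\<^sub>b" using nbhd_mono[of \<delta>\<^sub>c \<delta>\<^sub>b] \<delta>\<^sub>c \<delta>\<^sub>b by auto
  have za: "z \<in> nbhd b (Suc k) \<delta>\<^sub>a" "z \<in> nbhd b k \<delta>\<^sub>a" using zb nbhd_b by blast+
  have z2: "z \<in> nbhd b k (\<delta>\<^sub>a / 2)" using zc nbhd_drop[of k "Suc k"] nbhd_mono[of \<delta>\<^sub>c "\<delta>\<^sub>a / 2"] \<delta>\<^sub>c \<delta>\<^sub>b \<delta>\<^sub>a by auto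
  have diff: "cmod (mc (Suc k) z - mc (Suc k) (z(k := of_real x))) \<le> 8 * L / \<delta>\<^sub>a * (b k * (2 * (1 + d)))" if x: "x \<in> {-1..1}" for x
  proof -
    have "cmod (mc (Suc k) z - mc (Suc k) (z(k := of_real x))) \<le> 8 * L / \<delta>\<^sub>a * sdist (Suc k) z (z(k := of_real x))"
      by (rule curve_hol_lipschitz[OF mc_hol mc_le nbhd_Suc_real[OF z2 x] za(1) \<delta>\<^sub>a])
    also have "sdist (Suc k) z (z(k := of_real x)) = b k * cmod (z k - of_real x)" unfolding sdist_Suc by (simp add: sdist_def)
    also have "8 * L / \<delta>\<^sub>a * (b k * cmod (z k - of_real x)) \<le> 8 * L / \<delta>\<^sub>a * (b k * (2 * (1 + d)))"
    proof (intro mult_left_mono)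
      have "cmod (z k - of_real x) \<le> d + cmod (of_real (y k) - of_real x)"
        unfolding d_def using norm_triangle_ineq[of "z k - of_real (y k)" "of_real (y k) - of_real x"] by simp
      moreover have "cmod (complex_of_real (y k) - of_real x) = \<bar>y k - x\<bar>" by (metis norm_of_real of_real_diff)
      moreover have "y k \<in> {-1..1}" using y by (simp add: cube_def)
      moreover have "0 \<le> d" by (simp add: d_def)
      ultimately show "cmod (z k - of_real x) \<le> 2 * (1 + d)" using x by auto
    qed (use L_pos \<delta>\<^sub>a b_nonneg in auto)
    finally show ?thesis .
  qed
  have cont: "continuous_on {-1..1} (\<lambda>x. mc (Suc k) (z(k := of_real x)))"
  proof -
    define V where "V = {s. \<exists>x\<in>{-1..1}. b k * cmod (s - of_real x) < \<delta>\<^sub>a / 2}"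
    have V: "open V"
    proof -
      have "V = (\<Union>x\<in>{-1..1}. {w. b k * cmod (w - of_real x) < \<delta>\<^sub>a / 2})" by (auto simp: V_def)
      also have "open \<dots>" by (intro open_UN ballI open_Collect_less continuous_intros)
      finally show ?thesis .
    qed
    have "(\<lambda>s. mc (Suc k) (z(k := s))) holomorphic_on V"
    proof (rule curve_holD[OF mc_hol V])
      show "(\<lambda>s. (z(k := s)) j) holomorphic_on V" for j by (cases "j = k") (auto intro: holomorphic_intros)
      show "z(k := s) \<in> nbhd b (Suc k) \<delta>\<^sub>a" if "s \<in> V" for s
      proof -
        obtain x where x: "x \<in> {-1..1}" "b k * cmod (s - of_real x) < \<delta>\<^sub>a / 2" using \<open>s \<in> V\<close> by (auto simp: V_def)
        have "sdist (Suc k) (z(k := s)) (z(k := of_real x)) = b k * cmod (s - of_real x)" unfolding sdist_Suc by (simp add: sdist_def)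
        then show ?thesis using nbhd_add[OF nbhd_Suc_real[OF z2 x(1)], of "z(k := s)" "\<delta>\<^sub>a / 2"] x(2) by simp
      qed
    qed
    then have "continuous_on V (\<lambda>s. mc (Suc k) (z(k := s)))" by (rule holomorphic_on_imp_continuous_on)
    moreover have "of_real x \<in> V" if "x \<in> {-1..1}" for x using that \<delta>\<^sub>a by (auto simp: V_def intro!: bexI[of _ x])
    ultimately show ?thesis by (intro continuous_on_compose2[where f = of_real and g = "\<lambda>s. mc (Suc k) (z(k := s))" and t = V]) (auto intro!: continuous_intros)
  qed
  have "mc (Suc k) z - mc k z = (\<integral>x. mc (Suc k) z - mc (Suc k) (z(k := of_real x)) \<partial>mu1)"
    unfolding mc_marginal[OF za(2)] using integrable_mu1_continuous[OF cont] by (subst Bochner_Integration.integral_diff) (auto simp: mu1.prob_space)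
  also have "cmod \<dots> \<le> (\<integral>x. 8 * L / \<delta>\<^sub>a * (b k * (2 * (1 + d))) \<partial>mu1)"
    using diff by (intro Bochner_Integration.integral_norm_bound_integral integrable_mu1_continuous continuous_intros cont) (auto simp: space_mu1)
  finally have n: "cmod (mc (Suc k) z - mc k z) \<le> 8 * L / \<delta>\<^sub>a * (b k * (2 * (1 + d)))" by (simp add: mu1.prob_space)
  have "\<phi> k z - 1 = (mc (Suc k) z - mc k z) / mc k z" using mc_ge(2)[OF nbhd_b(1)[OF zb]] by (simp add: \<phi>_def field_simps)
  then have "cmod (\<phi> k z - 1) = cmod (mc (Suc k) z - mc k z) / cmod (mc k z)" by (simp only: norm_divide)
  also have "\<dots> \<le> 8 * L / \<delta>\<^sub>a * (b k * (2 * (1 + d))) / (M / 2)"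
    using n mc_ge(1)[OF nbhd_b(1)[OF zb]] M order_trans[OF norm_ge_zero n] by (intro frac_le) auto
  also have "\<dots> = A * b k * (1 + d)" using M \<delta>\<^sub>a by (simp add: A_def field_simps)
  finally show ?thesis by (simp add: d_def)
qed

lemma marginal_upd: "marginal f k (y(k := x)) = marginal f k y"
proof -
  have "append_seq k (y(k := x)) t = append_seq k y t" for t by (auto simp: append_seq_def)
  then show ?thesis by (simp add: marginal_def)
qed

lemma \<phi>_norm: assumes y: "y \<in> cube" shows "(\<integral>x. \<phi> k (complex_of_real \<circ> y(k := x)) \<partial>mu1) = 1"
proof -
  have yx: "complex_of_real \<circ> y(k := x) = (complex_of_real \<circ> y)(k := of_real x)" for x by auto
  have n: "complex_of_real \<circ> y \<in> nbhd b k \<delta>\<^sub>a" using y \<delta>\<^sub>a by (intro cube_in_nbhd) auto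
  have "(\<integral>x. \<phi> k (complex_of_real \<circ> y(k := x)) \<partial>mu1) = (\<integral>x. mc (Suc k) ((complex_of_real \<circ> y)(k := of_real x)) / mc k (complex_of_real \<circ> y) \<partial>mu1)"
  proof (rule integral_mu1_cong)
    fix x :: real assume "x \<in> {-1..1}"
    then have "y(k := x) \<in> cube" using y by (auto simp: cube_def)
    then have "mc k (complex_of_real \<circ> y(k := x)) = mc k (complex_of_real \<circ> y)" by (simp add: mc_real y marginal_upd)
    then show "\<phi> k (complex_of_real \<circ> y(k := x)) = mc (Suc k) ((complex_of_real \<circ> y)(k := of_real x)) / mc k (complex_of_real \<circ> y)"
      by (simp add: \<phi>_def yx)
  qed
  also have "\<dots> = mc k (complex_of_real \<circ> y) / mc k (complex_of_real \<circ> y)" by (simp add: mc_marginal[OF n])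
  also have "\<dots> = 1" using marginal_bounds(1)[OF y, of k] M by (simp add: mc_real[OF y])
  finally show ?thesis .
qed

theorem density_family: "density_family b \<phi> \<delta>\<^sub>c (M / (2 * L)) (2 * L / M) A"
proof
  show "curve_hol b (Suc k) \<delta>\<^sub>c (\<phi> k)" for k using curve_hol_mono[OF \<phi>_hol] \<delta>\<^sub>c \<delta>\<^sub>b by simp
  show "cmod (\<phi> k z) \<le> 2 * L / M" if "z \<in> nbhd b (Suc k) \<delta>\<^sub>c" for k z
    using \<phi>_le that nbhd_mono[of \<delta>\<^sub>c \<delta>\<^sub>b] \<delta>\<^sub>c \<delta>\<^sub>b by auto
  show "0 < \<delta>\<^sub>c" "0 < M / (2 * L)" "0 \<le> A" using \<delta>\<^sub>c M L_pos \<delta>\<^sub>a by (auto simp: A_def)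
qed (use Re_\<phi> \<phi>_one \<phi>_real \<phi>_norm in auto)

end

section \<open>The Knothe--Rosenblatt map pushes forward\<close>

lemma space_eq_mu1: "sets N = sets mu1 \<Longrightarrow> space N = {-1..1}"
  using sets_eq_imp_space_eq space_mu1 by metis

lemma sets_mu1_iff: "X \<in> sets mu1 \<longleftrightarrow> X \<subseteq> {-1..1} \<and> X \<in> sets borel"
  unfolding sets_mu1 by (subst sets_restrict_space_iff) auto

lemma measurable_id_mu1: "(\<lambda>x. x) \<in> mu1 \<rightarrow>\<^sub>M borel"
  using measurable_restrict_space1[of "\<lambda>x. x" borel borel] by (subst measurable_cong_sets[OF sets_mu1 refl]) auto

lemma measurable_mu1_I: "f \<in> borel_measurable N \<Longrightarrow> (\<And>x. x \<in> space N \<Longrightarrow> f x \<in> {-1..1}) \<Longrightarrow> f \<in> N \<rightarrow>\<^sub>M mu1"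
  by (subst measurable_cong_sets[OF refl sets_mu1]) (auto intro!: measurable_restrict_space2)

lemma measurable_mono_mu1:
  assumes "mono_on {-1..1} h" "h \<in> {-1..1} \<rightarrow> {-1..1}" "sets N = sets mu1" shows "h \<in> N \<rightarrow>\<^sub>M mu1"
proof (rule measurable_mu1_I)
  show "h \<in> borel_measurable N"
    using borel_measurable_mono_on_fnc[OF assms(1)] measurable_cong_sets[OF assms(3)[unfolded sets_mu1] refl] by blast
qed (use assms space_eq_mu1[OF assms(3)] in auto)

lemma measure_eqI_mu1:
  assumes sets: "sets N = sets mu1" "sets N' = sets mu1" and e1: "emeasure N {-1..1} = 1"
    and eq: "\<And>x. x \<in> {-1..1} \<Longrightarrow> emeasure N {-1..x} = emeasure N' {-1..x}"
  shows "N = N'"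
proof (rule measure_eqI)
  fix X assume "X \<in> sets N"
  then have X: "X \<subseteq> {-1..1}" "X \<in> sets borel" using sets sets_mu1_iff by auto
  have id: "(\<lambda>x. x) \<in> N \<rightarrow>\<^sub>M borel" "(\<lambda>x. x) \<in> N' \<rightarrow>\<^sub>M borel"
    using measurable_id_mu1 measurable_cong_sets[OF sets(1) refl] measurable_cong_sets[OF sets(2) refl] by blast+
  have sp: "space N = {-1..1}" "space N' = {-1..1}" using space_eq_mu1 sets by blast+
  have e1': "emeasure N' {-1..1} = 1" using eq[of 1] e1 by simp
  have dist: "emeasure (distr N borel (\<lambda>x. x)) Y = emeasure N (Y \<inter> {-1..1})" "emeasure (distr N' borel (\<lambda>x. x)) Y = emeasure N' (Y \<inter> {-1..1})" if "Y \<in> sets borel" for Y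
    using that id sp by (auto simp: emeasure_distr)
  have compl: "emeasure K ({-1..1} - {-1..x}) = 1 - emeasure K {-1..x}" if "sets K = sets mu1" "emeasure K {-1..1} = 1" "x \<in> {-1..1}" for K x
  proof -
    have "emeasure K {-1..x} \<le> emeasure K {-1..1}" using that by (intro emeasure_mono) (auto simp: sets_mu1_iff)
    then have "emeasure K {-1..x} \<noteq> \<infinity>" using that(2) by (metis ennreal_one_less_top infinity_ennreal_def not_less)
    then show ?thesis using that by (subst emeasure_Diff) (auto simp: sets_mu1_iff)
  qed
  have "distr N borel (\<lambda>x. x) = distr N' borel (\<lambda>x. x)"
  proof (rule measure_eqI_lessThan)
    fix x :: real
    have tot: "emeasure N ({x<..} \<inter> {-1..1}) = emeasure N' ({x<..} \<inter> {-1..1})"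
    proof (cases "x \<in> {-1..1}")
      case True
      then have "{x<..} \<inter> {-1..1} = {-1..1} - {-1..x}" by auto
      then show ?thesis using compl[OF sets(1) e1 True] compl[OF sets(2) e1' True] eq[OF True] by simp
    next
      case False
      then have "{x<..} \<inter> {-1..1} = {-1..1} \<or> {x<..} \<inter> {-1..1} = {}" by auto
      then show ?thesis using e1 e1' by (elim disjE) (simp_all only: emeasure_empty)
    qed
    then show "emeasure (distr N borel (\<lambda>x. x)) {x<..} = emeasure (distr N' borel (\<lambda>x. x)) {x<..}" by (simp add: dist)
    have "emeasure N ({x<..} \<inter> {-1..1}) \<le> emeasure N {-1..1}" using sets by (intro emeasure_mono) (auto simp: sets_mu1_iff)
    then show "emeasure (distr N borel (\<lambda>x. x)) {x<..} < \<infinity>" using e1 by (simp add: dist order_le_less_trans)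
  qed auto
  then have "emeasure N (X \<inter> {-1..1}) = emeasure N' (X \<inter> {-1..1})" using dist[OF X(2)] by simp
  moreover have "X \<inter> {-1..1} = X" using X by auto
  ultimately show "emeasure N X = emeasure N' X" by simp
qed (use sets in simp)

text \<open>The map is \<open>Fa\<close> followed by the inverse of \<open>Fb\<close>. A competitor
  g satisfies \<open>Fa x \<le> Fb (g x)\<close> by closed intervals and the converse by half-open
  ones, which have the same measure since there are no atoms.\<close>

lemma increasing_transport_eq:
  fixes Fa Fb h :: "real \<Rightarrow> real"
  assumes sets: "sets A = sets mu1" "sets B = sets mu1"
    and A: "\<And>x. x \<in> {-1..1} \<Longrightarrow> emeasure A {-1..x} = ennreal (Fa x)" "\<And>x. x \<in> {-1..1} \<Longrightarrow> emeasure A {-1..<x} = ennreal (Fa x)"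
    and B: "\<And>x. x \<in> {-1..1} \<Longrightarrow> emeasure B {-1..x} = ennreal (Fb x)" "\<And>x. x \<in> {-1..1} \<Longrightarrow> emeasure B {-1..<x} = ennreal (Fb x)"
    and Fa: "continuous_on {-1..1} Fa" "strict_mono_on {-1..1} Fa" "Fa (-1) = 0" "Fa 1 = 1"
    and Fb: "strict_mono_on {-1..1} Fb" "Fb (-1) = 0" "Fb 1 = 1"
    and h: "\<And>x. x \<in> {-1..1} \<Longrightarrow> h x \<in> {-1..1} \<and> Fb (h x) = Fa x"
  shows "h \<in> A \<rightarrow>\<^sub>M mu1" and "distr A mu1 h = B" and "x \<in> {-1..1} \<Longrightarrow> increasing_transport A B x = h x"
proof -
  have leA: "Fa x \<le> Fa x' \<longleftrightarrow> x \<le> x'" if "x \<in> {-1..1}" "x' \<in> {-1..1}" for x x'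
    using strict_mono_on_leD[OF Fa(2)] strict_mono_onD[OF Fa(2), of x' x] that by (metis not_le)
  have leB: "Fb x \<le> Fb x' \<longleftrightarrow> x \<le> x'" if "x \<in> {-1..1}" "x' \<in> {-1..1}" for x x'
    using strict_mono_on_leD[OF Fb(1)] strict_mono_onD[OF Fb(1), of x' x] that by (metis not_le)
  have nonneg: "0 \<le> Fa x" "0 \<le> Fb x" "Fb x \<le> 1" if "x \<in> {-1..1}" for x
    using leA[of "-1" x] leB[of "-1" x] leB[of x 1] that Fa Fb by auto
  have mono: "mono_on {-1..1} h"
  proof (rule mono_onI)
    fix r s :: real assume "r \<in> {-1..1}" "s \<in> {-1..1}" "r \<le> s"
    then show "h r \<le> h s" using leB[of "h r" "h s"] leA[of r s] h by auto
  qed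
  show hm: "h \<in> A \<rightarrow>\<^sub>M mu1" using h by (intro measurable_mono_mu1[OF mono _ sets(1)]) auto
  have spA: "space A = {-1..1}" by (rule space_eq_mu1[OF sets(1)])
  have em: "emeasure (distr A mu1 h) {-1..x} = emeasure B {-1..x}" if x: "x \<in> {-1..1}" for x
  proof -
    obtain s where s: "-1 \<le> s" "s \<le> 1" "Fa s = Fb x"
      using IVT'[of Fa "-1" "Fb x" 1] nonneg[OF x] Fa by auto
    have "h -` {-1..x} \<inter> space A = {-1..s}"
    proof -
      have "h t \<le> x \<longleftrightarrow> t \<le> s" if "t \<in> {-1..1}" for t
        using leB[of "h t" x] leA[of t s] h[OF that] x s that by auto
      then show ?thesis using h s unfolding spA by force
    qed
    then have "emeasure (distr A mu1 h) {-1..x} = emeasure A {-1..s}"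
      using x by (subst emeasure_distr[OF hm]) (auto simp: sets_mu1_iff)
    then show ?thesis using A(1)[of s] B(1)[OF x] s by auto
  qed
  show dB: "distr A mu1 h = B"
  proof (rule measure_eqI_mu1)
    show "emeasure (distr A mu1 h) {-1..1} = 1" using em[of 1] B(1)[of 1] Fb by simp
  qed (use sets em in auto)
  have uniq: "g x = h x" if g: "g \<in> {-1..1} \<rightarrow> {-1..1}" "mono_on {-1..1} g" "distr A mu1 g = B" and x: "x \<in> {-1..1}" for g x
  proof -
    have gm: "g \<in> A \<rightarrow>\<^sub>M mu1" using g by (intro measurable_mono_mu1[OF g(2) _ sets(1)]) auto
    have gx: "g x \<in> {-1..1}" using g x by auto
    have pre: "emeasure B Y = emeasure A (g -` Y \<inter> {-1..1})" if "Y \<in> sets mu1" for Y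
      using emeasure_distr[OF gm that] g(3) spA by simp
    have "emeasure A {-1..x} \<le> emeasure A (g -` {-1..g x} \<inter> {-1..1})"
    proof (rule emeasure_mono)
      show "{-1..x} \<subseteq> g -` {-1..g x} \<inter> {-1..1}"
      proof
        fix t assume "t \<in> {-1..x}"
        then have "t \<in> {-1..1}" "t \<le> x" using x by auto
        moreover have "g t \<in> {-1..1}" using g(1) \<open>t \<in> {-1..1}\<close> by (rule Pi_mem)
        moreover have "g t \<le> g x" using mono_onD[OF g(2) \<open>t \<in> {-1..1}\<close> x \<open>t \<le> x\<close>] .
        ultimately show "t \<in> g -` {-1..g x} \<inter> {-1..1}" by simp
      qed
      show "g -` {-1..g x} \<inter> {-1..1} \<in> sets A" using measurable_sets[OF gm, of "{-1..g x}"] gx spA by (auto simp: sets_mu1_iff)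
    qed
    then have "ennreal (Fa x) \<le> ennreal (Fb (g x))" using pre[of "{-1..g x}"] A(1)[OF x] B(1)[OF gx] gx by (simp add: sets_mu1_iff)
    then have 1: "Fa x \<le> Fb (g x)" using nonneg gx by simp
    have "emeasure A (g -` {-1..<g x} \<inter> {-1..1}) \<le> emeasure A {-1..<x}"
    proof (rule emeasure_mono)
      show "g -` {-1..<g x} \<inter> {-1..1} \<subseteq> {-1..<x}"
      proof
        fix t assume t: "t \<in> g -` {-1..<g x} \<inter> {-1..1}"
        then show "t \<in> {-1..<x}" using mono_onD[OF g(2), of x t] x by (cases "x \<le> t") auto
      qed
      show "{-1..<x} \<in> sets A" using sets x by (auto simp: sets_mu1_iff)
    qed
    then have "ennreal (Fb (g x)) \<le> ennreal (Fa x)" using pre[of "{-1..<g x}"] A(2)[OF x] B(2)[OF gx] gx by (simp add: sets_mu1_iff subset_eq)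
    then have "Fb (g x) = Fa x" using 1 nonneg x by simp
    then have "Fb (g x) = Fb (h x)" using h[OF x] by simp
    then show ?thesis using leB[of "g x" "h x"] leB[of "h x" "g x"] gx h[OF x] by auto
  qed
  have "increasing_transport A B = restrict h {-1..1}"
    unfolding increasing_transport_def
  proof (rule the_equality)
    have "distr A mu1 (restrict h {-1..1}) = distr A mu1 h" by (rule distr_cong) (auto simp: spA)
    then show "restrict h {-1..1} \<in> {-1..1} \<rightarrow>\<^sub>E {-1..1} \<and> mono_on {-1..1} (restrict h {-1..1}) \<and> distr A mu1 (restrict h {-1..1}) = B"
      using h mono dB by (auto simp: mono_on_def)
  next
    fix g assume g: "g \<in> {-1..1} \<rightarrow>\<^sub>E {-1..1} \<and> mono_on {-1..1} g \<and> distr A mu1 g = B"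
    show "g = restrict h {-1..1}"
    proof
      fix x show "g x = restrict h {-1..1} x"
        using uniq[of g x] g by (cases "x \<in> {-1..1}") (auto simp: PiE_def extensional_def)
    qed
  qed
  then show "x \<in> {-1..1} \<Longrightarrow> increasing_transport A B x = h x" by simp
qed

lemma emeasure_mu1_singleton: "emeasure mu1 {x} = 0"
proof (cases "x \<in> {-1..1}")
  case True
  then show ?thesis by (simp add: mu1_def emeasure_restrict_space)
next
  case False
  then have "{x} \<notin> sets mu1" by (simp add: sets_mu1_iff)
  then show ?thesis by (rule emeasure_notin_sets)
qed

section \<open>Integration over single coordinates\<close>

lemma measurable_mu_I:
  assumes "\<And>k. (\<lambda>x. f x k) \<in> borel_measurable N" "\<And>x. x \<in> space N \<Longrightarrow> f x \<in> cube" shows "f \<in> N \<rightarrow>\<^sub>M mu"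
  unfolding mu_def
proof (rule measurable_PiM_single')
  show "(\<lambda>x. f x k) \<in> N \<rightarrow>\<^sub>M mu1" for k using assms by (intro measurable_mu1_I) (auto simp: cube_def)
  show "(\<lambda>x i. f x i) \<in> space N \<rightarrow> UNIV \<rightarrow>\<^sub>E space mu1" using assms(2) by (auto simp: space_mu1 cube_def)
qed

lemma measurable_upd [measurable]: "(\<lambda>(y, x). y(n := x)) \<in> mu \<Otimes>\<^sub>M mu1 \<rightarrow>\<^sub>M mu"
proof (rule measurable_mu_I)
  fix k
  show "(\<lambda>z. (case z of (y, x) \<Rightarrow> y(n := x)) k) \<in> borel_measurable (mu \<Otimes>\<^sub>M mu1)"
  proof (cases "k = n")
    case True
    then show ?thesis using measurable_compose[OF measurable_snd measurable_id_mu1] by (simp add: case_prod_unfold)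
  next
    case False
    then show ?thesis using measurable_compose[OF measurable_fst measurable_mu_component] by (simp add: case_prod_unfold)
  qed
qed (auto simp: space_pair_measure space_mu space_mu1 cube_def)

lemma nn_integral_append:
  assumes "H \<in> borel_measurable mu"
  shows "(\<integral>\<^sup>+y. H y \<partial>mu) = (\<integral>\<^sup>+y. \<integral>\<^sup>+t. H (append_seq n y t) \<partial>mu \<partial>mu)"
proof -
  have m: "(\<lambda>z. H (case z of (y, t) \<Rightarrow> append_seq n y t)) \<in> borel_measurable (mu \<Otimes>\<^sub>M mu)"
    by (rule measurable_compose[OF measurable_append assms])
  have "(\<integral>\<^sup>+y. H y \<partial>mu) = (\<integral>\<^sup>+z. H (case z of (y, t) \<Rightarrow> append_seq n y t) \<partial>(mu \<Otimes>\<^sub>M mu))"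
    by (subst distr_append[of n, symmetric], subst nn_integral_distr) (use assms in auto)
  then show ?thesis using mu_prob.nn_integral_fst[OF m] by simp
qed

lemma nn_integral_case_nat:
  assumes "H \<in> borel_measurable mu"
  shows "(\<integral>\<^sup>+y. H y \<partial>mu) = (\<integral>\<^sup>+x. \<integral>\<^sup>+t. H (case_nat x t) \<partial>mu \<partial>mu1)"
proof -
  have m: "(\<lambda>z. H (case z of (x, t) \<Rightarrow> case_nat x t)) \<in> borel_measurable (mu1 \<Otimes>\<^sub>M mu)"
    by (rule measurable_compose[OF measurable_case_nat_mu assms])
  have "(\<integral>\<^sup>+y. H y \<partial>mu) = (\<integral>\<^sup>+z. H (case z of (x, t) \<Rightarrow> case_nat x t) \<partial>(mu1 \<Otimes>\<^sub>M mu))"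
    by (subst distr_case_nat[symmetric], subst nn_integral_distr) (use assms in auto)
  then show ?thesis using mu_prob.nn_integral_fst[OF m] by simp
qed

lemma measurable_append_const: "y \<in> cube \<Longrightarrow> (\<lambda>t. append_seq n y t) \<in> mu \<rightarrow>\<^sub>M mu"
  by (rule measurable_append') (auto simp: space_mu)

lemma upd_cube: "y \<in> cube \<Longrightarrow> x \<in> {-1..1} \<Longrightarrow> y(n := x) \<in> cube" by (auto simp: cube_def)

text \<open>Coordinate n is replaced by an independent copy. The tail is resampled as well, so that
  the new coordinate and the new tail together form one sample of the product measure through
  \<open>case_nat\<close>.\<close>

lemma nn_integral_resample:
  assumes H: "H \<in> borel_measurable mu"
  shows "(\<integral>\<^sup>+y. H y \<partial>mu) = (\<integral>\<^sup>+y. \<integral>\<^sup>+x. H (y(n := x)) \<partial>mu1 \<partial>mu)"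
proof -
  interpret pair_sigma_finite mu mu1 by unfold_locales
  have upd: "(\<lambda>y. y(n := x)) \<in> mu \<rightarrow>\<^sub>M mu" if "x \<in> {-1..1}" for x
  proof -
    have "(\<lambda>y. (y, x)) \<in> mu \<rightarrow>\<^sub>M mu \<Otimes>\<^sub>M mu1" using that by (intro measurable_Pair) (auto simp: space_mu1)
    from measurable_compose[OF this measurable_upd] show ?thesis by simp
  qed
  have "(\<integral>\<^sup>+y. \<integral>\<^sup>+x. H (y(n := x)) \<partial>mu1 \<partial>mu) = (\<integral>\<^sup>+x. \<integral>\<^sup>+y. H (y(n := x)) \<partial>mu \<partial>mu1)"
    using measurable_compose[OF measurable_upd H] by (intro Fubini'[symmetric]) (simp add: case_prod_unfold)
  also have "\<dots> = (\<integral>\<^sup>+x. \<integral>\<^sup>+y. \<integral>\<^sup>+t. H (append_seq n y (case_nat x t)) \<partial>mu \<partial>mu \<partial>mu1)"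
  proof (rule nn_integral_cong)
    fix x assume "x \<in> space mu1"
    then have x: "x \<in> {-1..1}" by (simp add: space_mu1)
    have "(\<integral>\<^sup>+y. H (y(n := x)) \<partial>mu) = (\<integral>\<^sup>+y. \<integral>\<^sup>+t. H ((append_seq (Suc n) y t)(n := x)) \<partial>mu \<partial>mu)"
      by (rule nn_integral_append[OF measurable_compose[OF upd[OF x] H]])
    moreover have "(append_seq (Suc n) y t)(n := x) = append_seq (Suc n) (y(n := x)) t" for y t
      by (auto simp: append_seq_def)
    ultimately show "(\<integral>\<^sup>+y. H (y(n := x)) \<partial>mu) = (\<integral>\<^sup>+y. \<integral>\<^sup>+t. H (append_seq n y (case_nat x t)) \<partial>mu \<partial>mu)"
      by (simp add: append_case_nat)
  qed
  also have "\<dots> = (\<integral>\<^sup>+y. \<integral>\<^sup>+x. \<integral>\<^sup>+t. H (append_seq n y (case_nat x t)) \<partial>mu \<partial>mu1 \<partial>mu)"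
  proof (rule Fubini')
    have m: "(\<lambda>((y, x), t). append_seq n y (case_nat x t)) \<in> (mu \<Otimes>\<^sub>M mu1) \<Otimes>\<^sub>M mu \<rightarrow>\<^sub>M mu"
      unfolding case_prod_unfold
    proof (rule measurable_append')
      have "(\<lambda>z. (snd (fst z), snd z)) \<in> (mu \<Otimes>\<^sub>M mu1) \<Otimes>\<^sub>M mu \<rightarrow>\<^sub>M mu1 \<Otimes>\<^sub>M mu" by measurable
      from measurable_compose[OF this measurable_case_nat_mu]
      show "(\<lambda>z. case_nat (snd (fst z)) (snd z)) \<in> (mu \<Otimes>\<^sub>M mu1) \<Otimes>\<^sub>M mu \<rightarrow>\<^sub>M mu" by simp
    qed measurable
    have "(\<lambda>z. \<integral>\<^sup>+t. H (append_seq n (fst z) (case_nat (snd z) t)) \<partial>mu) \<in> borel_measurable (mu \<Otimes>\<^sub>M mu1)"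
      using measurable_compose[OF m H] by (intro mu_prob.borel_measurable_nn_integral) (simp add: case_prod_unfold)
    then show "(\<lambda>(y, x). \<integral>\<^sup>+t. H (append_seq n y (case_nat x t)) \<partial>mu) \<in> borel_measurable (mu \<Otimes>\<^sub>M mu1)"
      by (simp add: case_prod_unfold)
  qed
  also have "\<dots> = (\<integral>\<^sup>+y. \<integral>\<^sup>+t. H (append_seq n y t) \<partial>mu \<partial>mu)"
  proof (rule nn_integral_cong)
    fix y assume "y \<in> space mu"
    then have "(\<lambda>t. H (append_seq n y t)) \<in> borel_measurable mu"
      by (intro measurable_compose[OF measurable_append_const H]) (simp add: space_mu)
    from nn_integral_case_nat[OF this]
    show "(\<integral>\<^sup>+x. \<integral>\<^sup>+t. H (append_seq n y (case_nat x t)) \<partial>mu \<partial>mu1) = (\<integral>\<^sup>+t. H (append_seq n y t) \<partial>mu)" by simp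
  qed
  also have "\<dots> = (\<integral>\<^sup>+y. H y \<partial>mu)" by (rule nn_integral_append[OF H, symmetric])
  finally show ?thesis by simp
qed

context analytic_density
begin

lemma marginal_measurable: "marginal f n \<in> borel_measurable mu"
proof -
  have "(\<lambda>y. \<integral>t. f (append_seq n y t) \<partial>mu) \<in> borel_measurable mu"
    using measurable_compose[OF measurable_append f_measurable] by (intro mu_prob.borel_measurable_lebesgue_integral) (simp add: case_prod_unfold)
  moreover have "marginal f n = (\<lambda>y. \<integral>t. f (append_seq n y t) \<partial>mu)"
    using f_norm by (auto simp: marginal_def append_seq_def)
  ultimately show ?thesis by simp
qed

lemma nn_integral_marginal:
  assumes "y \<in> cube" shows "(\<integral>\<^sup>+t. ennreal (f (append_seq n y t)) \<partial>mu) = ennreal (marginal f n y)"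
proof -
  have m: "marginal f n y = (\<integral>t. f (append_seq n y t) \<partial>mu)" using f_norm by (simp add: marginal_def append_seq_def)
  have b: "0 \<le> f (append_seq n y t) \<and> f (append_seq n y t) \<le> L" if "t \<in> space mu" for t
    using f_bounds[OF append_cube[OF assms, of t n]] that M by (simp add: space_mu)
  have "integrable mu (\<lambda>t. f (append_seq n y t))"
    by (rule mu_prob.integrable_const_bound[OF AE_I2 measurable_compose[OF measurable_append_const[OF assms] f_measurable], where B = L])
      (use b in auto)
  then show ?thesis unfolding m using b by (intro nn_integral_eq_integral AE_I2) auto
qed

text \<open>The link between the conditional measures and the complex \<open>cdf\<close>; the
  half-open version records the absence of atoms for \<open>increasing_transport_eq\<close>.\<close>

lemma emeasure_conditional:
  assumes df: "density_family b \<phi> \<delta> m K A'" and y: "y \<in> cube" and x: "x \<in> {-1..1}"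
  shows "emeasure (conditional_measure f k y) {-1..x} = ennreal (Re (density_family.cdf \<phi> k (complex_of_real \<circ> y) (of_real x)))"
    and "emeasure (conditional_measure f k y) {-1..<x} = ennreal (Re (density_family.cdf \<phi> k (complex_of_real \<circ> y) (of_real x)))"
    and "(\<lambda>t. conditional f (Suc k) (y(k := t))) \<in> borel_measurable mu1"
proof -
  interpret D: density_family b \<phi> \<delta> m K A' by fact
  define a where "a t = conditional f (Suc k) (y(k := t))" for t
  have ya: "a t = Re (\<phi> k (complex_of_real \<circ> y(k := t)))" "0 \<le> a t" if "t \<in> {-1..1}" for t
    using \<phi>_real[OF upd_cube[OF y that]] conditional_bounds(1)[OF upd_cube[OF y that], of "Suc k"] M L_pos
    by (auto simp: a_def intro: order_trans[of 0 "M / L"])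
  have cont: "continuous_on {-1..1} a"
  proof -
    have n: "complex_of_real \<circ> y \<in> nbhd b k (\<delta> / 2)" using y D.\<delta>_pos by (intro cube_in_nbhd) auto
    have "continuous_on {-1..1} (\<lambda>t. Re (\<phi> k ((complex_of_real \<circ> y)(k := of_real t))))"
      by (intro continuous_intros continuous_on_compose2[OF holomorphic_on_imp_continuous_on[OF D.\<phi>_hol_strip[OF n]], where f = of_real])
        (use D.real_in_strip in auto)
    moreover have "(complex_of_real \<circ> y)(k := of_real t) = complex_of_real \<circ> y(k := t)" for t by auto
    ultimately show ?thesis using ya(1) by (subst continuous_on_cong[OF refl]) auto
  qed
  have am: "a \<in> borel_measurable mu1" by (rule measurable_mu1_continuous[OF cont])
  then show "(\<lambda>t. conditional f (Suc k) (y(k := t))) \<in> borel_measurable mu1" by (simp add: a_def[abs_def])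
  have cm: "conditional_measure f k y = density mu1 (\<lambda>t. ennreal (a t))" by (simp add: conditional_measure_def a_def)
  have s: "{-1..x} \<in> sets mu1" "{-1..<x} \<in> sets mu1" using x by (auto simp: sets_mu1_iff)
  have "emeasure (density mu1 (\<lambda>t. ennreal (a t))) {-1..x} = (\<integral>\<^sup>+t. ennreal (a t) * indicator {-1..x} t \<partial>mu1)"
    using am s by (subst emeasure_density) auto
  also have "\<dots> = (\<integral>\<^sup>+t. ennreal (indicator {-1..x} t *\<^sub>R a t) \<partial>mu1)"
    by (rule nn_integral_cong) (auto simp: indicator_def)
  also have "\<dots> = ennreal (LINT t:{-1..x}|mu1. a t)"
    unfolding set_lebesgue_integral_def
  proof (rule nn_integral_eq_integral)
    show "integrable mu1 (\<lambda>t. indicator {-1..x} t *\<^sub>R a t)"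
      using integrable_mu1_continuous[OF cont] s by (intro integrable_mult_indicator)
    show "AE t in mu1. 0 \<le> indicator {-1..x} t *\<^sub>R a t" using ya(2) by (intro AE_I2) (auto simp: space_mu1 indicator_def)
  qed
  also have "(LINT t:{-1..x}|mu1. a t) = (1/2) * integral {-1..x} a"
    using integral_mu1_Icc[OF cont, of "-1" x] x by simp
  also have "integral {-1..x} a = 2 * Re (D.cdf k (complex_of_real \<circ> y) (of_real x)) - 2 * Re (D.cdf k (complex_of_real \<circ> y) (of_real (-1)))"
  proof (rule integral_unique, rule fundamental_theorem_of_calculus)
    show "-1 \<le> x" using x by simp
    fix t assume "t \<in> {-1..x}"
    then have t: "t \<in> {-1..1}" using x by auto
    have "((\<lambda>x. 2 * Re (D.cdf k (complex_of_real \<circ> y) (of_real x))) has_real_derivative 2 * (Re (\<phi> k (complex_of_real \<circ> y(k := t))) / 2)) (at t within {-1..x})"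
      by (rule DERIV_cmult[OF D.Re_cdf_deriv[OF y t]])
    then show "((\<lambda>x. 2 * Re (D.cdf k (complex_of_real \<circ> y) (of_real x))) has_vector_derivative a t) (at t within {-1..x})"
      by (simp add: ya(1)[OF t] has_real_derivative_iff_has_vector_derivative)
  qed
  finally show 1: "emeasure (conditional_measure f k y) {-1..x} = ennreal (Re (D.cdf k (complex_of_real \<circ> y) (of_real x)))"
    by (simp add: cm)
  have "{x} \<in> null_sets (density mu1 (\<lambda>t. ennreal (a t)))"
  proof -
    have "{x} \<in> null_sets mu1" using emeasure_mu1_singleton x by (auto simp: null_sets_def sets_mu1_iff)
    then have "AE t in mu1. t \<notin> {x}" by (rule AE_not_in)
    then have "AE t in mu1. t \<in> {x} \<longrightarrow> ennreal (a t) = 0" by eventually_elim auto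
    moreover have "(\<lambda>t. ennreal (a t)) \<in> borel_measurable mu1" using am by simp
    moreover have "{x} \<in> sets mu1" using x by (simp add: sets_mu1_iff)
    ultimately show ?thesis by (simp add: null_sets_density_iff)
  qed
  then have "emeasure (density mu1 (\<lambda>t. ennreal (a t))) ({-1..<x} \<union> {x}) = emeasure (density mu1 (\<lambda>t. ennreal (a t))) {-1..<x}"
    using s by (intro emeasure_Un_null_set) auto
  moreover have "{-1..<x} \<union> {x} = {-1..x}" using x by auto
  ultimately show "emeasure (conditional_measure f k y) {-1..<x} = ennreal (Re (D.cdf k (complex_of_real \<circ> y) (of_real x)))"
    using 1 by (simp add: cm)
qed

end

lemma conditional_measure_cong:
  assumes "\<And>j. j < k \<Longrightarrow> y j = y' j" shows "conditional_measure f k y = conditional_measure f k y'"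
proof -
  have "append_seq (Suc k) (y(k := t)) s = append_seq (Suc k) (y'(k := t)) s" "append_seq k (y(k := t)) s = append_seq k (y'(k := t)) s" for t s
    using assms by (auto simp: append_seq_def fun_eq_iff less_Suc_eq)
  then have "marginal f (Suc k) (y(k := t)) = marginal f (Suc k) (y'(k := t))" "marginal f k (y(k := t)) = marginal f k (y'(k := t))" for t
    unfolding marginal_def by (simp_all cong: if_cong)
  then show ?thesis by (simp add: conditional_measure_def conditional_def)
qed

lemma KR_cong: "(\<And>j. j \<le> k \<Longrightarrow> y j = y' j) \<Longrightarrow> KR f g k y = KR f g k y'"
proof (induction k rule: less_induct)
  case (less k)
  have 1: "conditional_measure f k y = conditional_measure f k y'" using less.prems by (intro conditional_measure_cong) auto
  have 2: "(\<lambda>j. if j < k then KR f g j y else 0) = (\<lambda>j. if j < k then KR f g j y' else 0)"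
    using less by (auto simp: fun_eq_iff)
  have 3: "y k = y' k" using less.prems by simp
  show ?case unfolding KR.simps[of f g k y] KR.simps[of f g k y'] 1 2 3 ..
qed

section \<open>The transport between the two given densities\<close>

locale kr_setting = weights b + R: analytic_density b p M L \<psi>\<^sub>R S\<^sub>R F\<^sub>R + P: analytic_density b p M L \<psi>\<^sub>P S\<^sub>P F\<^sub>P
  for b p M L and \<psi>\<^sub>R :: "nat \<Rightarrow> 'x::banach" and S\<^sub>R F\<^sub>R and \<psi>\<^sub>P :: "nat \<Rightarrow> 'y::banach" and S\<^sub>P F\<^sub>P
begin

definition "\<delta>\<^sub>0 = min R.\<delta>\<^sub>c P.\<delta>\<^sub>c"
definition "A\<^sub>0 = max R.A P.A"

sublocale T: density_pair b R.\<phi> P.\<phi> \<delta>\<^sub>0 "M / (2 * L)" "2 * L / M" A\<^sub>0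
proof -
  interpret R': density_family b R.\<phi> \<delta>\<^sub>0 "M / (2 * L)" "2 * L / M" A\<^sub>0
    using R.\<delta>\<^sub>c P.\<delta>\<^sub>c by (intro density_family_mono[OF R.density_family]) (auto simp: \<delta>\<^sub>0_def A\<^sub>0_def)
  interpret P': density_family b P.\<phi> \<delta>\<^sub>0 "M / (2 * L)" "2 * L / M" A\<^sub>0
    using R.\<delta>\<^sub>c P.\<delta>\<^sub>c by (intro density_family_mono[OF P.density_family]) (auto simp: \<delta>\<^sub>0_def A\<^sub>0_def)
  show "density_pair b R.\<phi> P.\<phi> \<delta>\<^sub>0 (M / (2 * L)) (2 * L / M) A\<^sub>0" by unfold_locales
qed

lemma (in density_family) Re_cdf_props:
  assumes y: "y \<in> cube"
  shows "continuous_on {-1..1} (\<lambda>x. Re (cdf k (complex_of_real \<circ> y) (of_real x)))"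
    "strict_mono_on {-1..1} (\<lambda>x. Re (cdf k (complex_of_real \<circ> y) (of_real x)))"
    "Re (cdf k (complex_of_real \<circ> y) (of_real (-1))) = 0" "Re (cdf k (complex_of_real \<circ> y) (of_real 1)) = 1"
proof -
  show "continuous_on {-1..1} (\<lambda>x. Re (cdf k (complex_of_real \<circ> y) (of_real x)))"
    unfolding continuous_on_eq_continuous_within using DERIV_continuous[OF Re_cdf_deriv[OF y]] by blast
  show "strict_mono_on {-1..1} (\<lambda>x. Re (cdf k (complex_of_real \<circ> y) (of_real x)))"
  proof (rule strict_mono_onI)
    fix r s :: real assume "r \<in> {-1..1}" "s \<in> {-1..1}" "r < s"
    then have "Re (cdf k (complex_of_real \<circ> y) (of_real r)) + m / 2 * (s - r) \<le> Re (cdf k (complex_of_real \<circ> y) (of_real s))" "0 < m / 2 * (s - r)"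
      using Re_cdf_mono[OF y, of r s k] m_pos by auto
    then show "Re (cdf k (complex_of_real \<circ> y) (of_real r)) < Re (cdf k (complex_of_real \<circ> y) (of_real s))" by linarith
  qed
qed (use cdf_1[OF y] in auto)

text \<open>v is prescribed below k only, so that both the zero-padded sequence of \<open>KR\<close>
  and the full image \<open>T.rtrans y\<close> can be inserted.\<close>

lemma transport_cond:
  assumes y: "y \<in> cube" and v: "v \<in> cube" "\<And>j. j < k \<Longrightarrow> v j = T.rtrans y j"
  shows "(\<lambda>t. T.rtrans (y(k := t)) k) \<in> conditional_measure R.f k y \<rightarrow>\<^sub>M mu1"
    and "distr (conditional_measure R.f k y) mu1 (\<lambda>t. T.rtrans (y(k := t)) k) = conditional_measure P.f k v"
    and "x \<in> {-1..1} \<Longrightarrow> increasing_transport (conditional_measure R.f k y) (conditional_measure P.f k v) x = T.rtrans (y(k := x)) k"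
proof -
  have h: "T.rtrans (y(k := t)) k \<in> {-1..1} \<and> Re (T.P.cdf k (complex_of_real \<circ> v) (of_real (T.rtrans (y(k := t)) k))) = Re (T.R.cdf k (complex_of_real \<circ> y) (of_real t))"
    if t: "t \<in> {-1..1}" for t
  proof -
    have yt: "y(k := t) \<in> cube" by (rule upd_cube[OF y t])
    have r: "T.rtrans (y(k := t)) k \<in> {-1..1}" using T.rtrans_cube[OF yt] by (simp add: cube_def)
    have "T.P.cdf k (complex_of_real \<circ> v) (of_real (T.rtrans (y(k := t)) k)) = T.P.cdf k (complex_of_real \<circ> T.rtrans (y(k := t))) (of_real (T.rtrans (y(k := t)) k))"
    proof (rule T.P.cdf_cong)
      show "complex_of_real \<circ> v \<in> nbhd b k (\<delta>\<^sub>0 / 2)" using v T.R.\<delta>_pos by (intro cube_in_nbhd) auto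
      show "(complex_of_real \<circ> v) j = (complex_of_real \<circ> T.rtrans (y(k := t))) j" if "j < k" for j
        using v(2)[OF that] T.rtrans_cong[OF y, of j "y(k := t)"] that by simp
    qed (rule T.P.real_in_strip[OF r])
    also have "\<dots> = T.R.cdf k (complex_of_real \<circ> y(k := t)) (of_real t)"
      using T.rtrans_cdf[OF yt, of k] by simp
    also have "\<dots> = T.R.cdf k (complex_of_real \<circ> y) (of_real t)"
      using yt T.R.\<delta>_pos by (intro T.R.cdf_cong cube_in_nbhd T.R.real_in_strip[OF t]) auto
    finally show ?thesis using r by simp
  qed
  have sets: "sets (conditional_measure R.f k y) = sets mu1" "sets (conditional_measure P.f k v) = sets mu1"
    by (simp_all add: conditional_measure_def)
  note eq = increasing_transport_eq[OF sets R.emeasure_conditional(1,2)[OF T.R.density_family_axioms y] P.emeasure_conditional(1,2)[OF T.P.density_family_axioms v(1)]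
      T.R.Re_cdf_props[OF y] T.P.Re_cdf_props(2-4)[OF v(1)] h]
  show "(\<lambda>t. T.rtrans (y(k := t)) k) \<in> conditional_measure R.f k y \<rightarrow>\<^sub>M mu1"
    "distr (conditional_measure R.f k y) mu1 (\<lambda>t. T.rtrans (y(k := t)) k) = conditional_measure P.f k v"
    "x \<in> {-1..1} \<Longrightarrow> increasing_transport (conditional_measure R.f k y) (conditional_measure P.f k v) x = T.rtrans (y(k := x)) k"
    by (rule eq; assumption)+
qed

lemma KR_rtrans: "y \<in> cube \<Longrightarrow> KR R.f P.f k y = T.rtrans y k"
proof (induction k rule: less_induct)
  case (less k)
  define v where "v j = (if j < k then KR R.f P.f j y else 0)" for j
  have v: "v j = T.rtrans y j" if "j < k" for j using less that by (simp add: v_def)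
  have vc: "v \<in> cube" using v T.rtrans_cube[OF less.prems] by (auto simp: cube_def v_def)
  have "KR R.f P.f k y = increasing_transport (conditional_measure R.f k y) (conditional_measure P.f k v) (y k)"
    unfolding KR.simps[of _ _ k] v_def[abs_def] ..
  also have "\<dots> = T.rtrans (y(k := y k)) k"
    using less.prems by (intro transport_cond(3)[OF less.prems vc v]) (auto simp: cube_def)
  finally show ?case by simp
qed

text \<open>The Gronwall estimate \<open>transport_main\<close> is applied at real points near y; it
  bounds the displacement of component k by finitely many coordinate differences.\<close>

lemma rtrans_continuous: "continuous_on cube (\<lambda>y. T.rtrans y k)"
  unfolding continuous_on_def
proof
  fix y assume y: "y \<in> cube"
  define D where "D n y' = sdist n (complex_of_real \<circ> y') (complex_of_real \<circ> y)" for n y'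
  have Dt: "((\<lambda>y'. D n y') \<longlongrightarrow> 0) (at y within cube)" for n
  proof -
    have "continuous_on cube (\<lambda>y'. D n y')" unfolding D_def sdist_def
      by (intro continuous_intros continuous_on_subset[OF continuous_on_product_coordinates]) (auto intro!: continuous_intros continuous_on_subset[OF continuous_on_product_coordinates])
    then have "((\<lambda>y'. D n y') \<longlongrightarrow> D n y) (at y within cube)" using y by (simp add: continuous_on_def)
    then show ?thesis by (simp add: D_def)
  qed
  have ykt: "((\<lambda>y'. \<bar>y' k - y k\<bar>) \<longlongrightarrow> 0) (at y within cube)"
  proof -
    have "continuous_on cube (\<lambda>y'. \<bar>y' k - y k\<bar>)" by (intro continuous_intros continuous_on_subset[OF continuous_on_product_coordinates]) auto
    then show ?thesis using y by (force simp: continuous_on_def)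
  qed
  define G where "G = exp (T.gain * (\<Sum>j<k. (b j)\<^sup>2)) * (T.gain + 1)"
  have "\<forall>\<^sub>F y' in at y within cube. D (Suc k) y' < T.\<delta>\<^sub>1"
    using Dt T.\<delta>\<^sub>1(1) by (rule order_tendstoD)
  then have ev: "\<forall>\<^sub>F y' in at y within cube. norm (T.rtrans y' k - T.rtrans y k) \<le> T.gain * (b k * (G * D k y') + \<bar>y' k - y k\<bar>)"
    unfolding eventually_at_filter
  proof (rule eventually_mono, intro impI)
    fix y' assume *: "y' \<noteq> y \<longrightarrow> y' \<in> cube \<longrightarrow> D (Suc k) y' < T.\<delta>\<^sub>1" and y': "y' \<noteq> y" "y' \<in> cube"
    have nr: "near b (Suc k) T.\<delta>\<^sub>1 y (complex_of_real \<circ> y')" using * y' by (simp add: near_sdist D_def)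
    have nr': "near b k T.\<delta>\<^sub>1 y (complex_of_real \<circ> y')" using nr sdist_Suc[of k] b_nonneg[of k] by (simp add: near_sdist) (smt (verit, best) mult_nonneg_nonneg norm_ge_zero)
    define Q where "Q = sdist k (\<lambda>j. T.transport j (complex_of_real \<circ> y')) (complex_of_real \<circ> T.rtrans y) + D k y'"
    have 1: "Q \<le> G * D k y'" using T.transport_main[OF y nr'] by (simp add: Q_def D_def G_def)
    have "cmod (T.transport k (complex_of_real \<circ> y') - of_real (T.rtrans y k)) \<le> T.gain * (b k * Q + cmod (of_real (y' k) - of_real (y k)))"
      using T.transport_main[OF y nr] by (simp add: Q_def D_def)
    then have "\<bar>T.rtrans y' k - T.rtrans y k\<bar> \<le> T.gain * (b k * Q + \<bar>y' k - y k\<bar>)"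
      unfolding T.transport_real[OF y'(2)] by (simp flip: of_real_diff)
    also have "\<dots> \<le> T.gain * (b k * (G * D k y') + \<bar>y' k - y k\<bar>)"
      using T.gain_pos 1 b_nonneg by (intro mult_left_mono add_right_mono) auto
    finally show "norm (T.rtrans y' k - T.rtrans y k) \<le> T.gain * (b k * (G * D k y') + \<bar>y' k - y k\<bar>)" by simp
  qed
  have "((\<lambda>y'. T.gain * (b k * (G * D k y') + \<bar>y' k - y k\<bar>)) \<longlongrightarrow> T.gain * (b k * (G * 0) + 0)) (at y within cube)"
    by (intro tendsto_intros Dt ykt)
  then have "((\<lambda>y'. T.rtrans y' k - T.rtrans y k) \<longlongrightarrow> 0) (at y within cube)"
    by (intro Lim_null_comparison[OF ev]) simp
  then show "((\<lambda>y'. T.rtrans y' k) \<longlongrightarrow> T.rtrans y k) (at y within cube)" by (simp add: LIM_zero_iff)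
qed

lemma rtrans_measurable: "T.rtrans \<in> mu \<rightarrow>\<^sub>M mu"
  using T.rtrans_cube by (intro measurable_mu_I measurable_mu_continuous[OF rtrans_continuous]) (auto simp: space_mu)

lemma measurable_upd_const: "y \<in> cube \<Longrightarrow> (\<lambda>x. y(n := x)) \<in> mu1 \<rightarrow>\<^sub>M mu"
  using measurable_compose[OF measurable_Pair1'[of y mu mu1] measurable_upd[of n]] by (simp add: space_mu)

text \<open>Induction on the number of coordinates that G sees: the last one is integrated out
  against the conditional law, which the one-dimensional transport maps to the conditional law of
  the target at the image point.\<close>

lemma pushforward_marginal:
  fixes G :: "(nat \<Rightarrow> real) \<Rightarrow> ennreal"
  assumes "G \<in> borel_measurable mu"
    and "\<And>y y'. y \<in> cube \<Longrightarrow> y' \<in> cube \<Longrightarrow> (\<And>j. j < n \<Longrightarrow> y j = y' j) \<Longrightarrow> G y = G y'"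
  shows "(\<integral>\<^sup>+y. ennreal (marginal R.f n y) * G (T.rtrans y) \<partial>mu) = (\<integral>\<^sup>+y. ennreal (marginal P.f n y) * G y \<partial>mu)"
  using assms
proof (induction n arbitrary: G)
  case 0
  have "G (T.rtrans y) = G y" if "y \<in> cube" for y using 0(2)[OF T.rtrans_cube[OF that] that] by simp
  then show ?case by (intro nn_integral_cong) (simp add: marginal_def space_mu)
next
  case (Suc n)
  note Gm = Suc.prems(1) and dep = Suc.prems(2)
  \<comment> \<open>G averaged over its last coordinate under the conditional law of the target,
    hence a function of one coordinate less.\<close>
  define G' where "G' v = (\<integral>\<^sup>+x. ennreal (conditional P.f (Suc n) (v(n := x))) * G (v(n := x)) \<partial>mu1)" for v
  have mm: "marginal f n (y(n := x)) = marginal f n y" for f y x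
  proof -
    have "append_seq n (y(n := x)) t = append_seq n y t" for t by (auto simp: append_seq_def)
    then show ?thesis by (simp add: marginal_def)
  qed
  have split: "ennreal (marginal R.f (Suc n) (y(n := x))) = ennreal (marginal R.f n y) * ennreal (conditional R.f (Suc n) (y(n := x)))"
      "ennreal (marginal P.f (Suc n) (y(n := x))) = ennreal (marginal P.f n y) * ennreal (conditional P.f (Suc n) (y(n := x)))"
    if "y \<in> cube" for y x
    using R.marginal_bounds(1)[OF that, of n] P.marginal_bounds(1)[OF that, of n] R.M
    by (auto simp: conditional_def mm simp flip: ennreal_mult')
  have cm: "conditional P.f (Suc n) \<in> borel_measurable mu" "conditional R.f (Suc n) \<in> borel_measurable mu"
    unfolding conditional_def using P.marginal_measurable R.marginal_measurable by (auto intro!: borel_measurable_divide)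
  have G'm: "G' \<in> borel_measurable mu"
  proof -
    have "(\<lambda>v. ennreal (conditional P.f (Suc n) v) * G v) \<in> borel_measurable mu" using cm Gm by simp
    from measurable_compose[OF measurable_upd this]
    have "(\<lambda>z. ennreal (conditional P.f (Suc n) ((fst z)(n := snd z))) * G ((fst z)(n := snd z))) \<in> borel_measurable (mu \<Otimes>\<^sub>M mu1)"
      by (simp add: case_prod_unfold)
    then show ?thesis unfolding G'_def by (intro sigma_finite_measure.borel_measurable_nn_integral mu1.sigma_finite_measure_axioms) (simp add: case_prod_unfold)
  qed
  have dep': "G' y = G' y'" if y: "y \<in> cube" "y' \<in> cube" "\<And>j. j < n \<Longrightarrow> y j = y' j" for y y'
    unfolding G'_def
  proof (rule nn_integral_cong)
    fix x assume "x \<in> space mu1"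
    then have x: "x \<in> {-1..1}" by (simp add: space_mu1)
    have "append_seq (Suc n) (y(n := x)) t = append_seq (Suc n) (y'(n := x)) t" "append_seq n (y(n := x)) t = append_seq n (y'(n := x)) t" for t
      using y(3) by (auto simp: append_seq_def less_Suc_eq)
    then have "conditional P.f (Suc n) (y(n := x)) = conditional P.f (Suc n) (y'(n := x))"
      by (simp add: conditional_def marginal_def cong: if_cong)
    moreover have "G (y(n := x)) = G (y'(n := x))" using y by (intro dep upd_cube x) (auto simp: less_Suc_eq)
    ultimately show "ennreal (conditional P.f (Suc n) (y(n := x))) * G (y(n := x)) = ennreal (conditional P.f (Suc n) (y'(n := x))) * G (y'(n := x))"
      by simp
  qed
  have inner: "(\<integral>\<^sup>+x. ennreal (marginal R.f (Suc n) (y(n := x))) * G (T.rtrans (y(n := x))) \<partial>mu1) = ennreal (marginal R.f n y) * G' (T.rtrans y)"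
    if y: "y \<in> cube" for y
  proof -
    let ?h = "\<lambda>x. T.rtrans (y(n := x)) n" and ?v = "T.rtrans y"
    have v: "?v \<in> cube" by (rule T.rtrans_cube[OF y])
    note tc = transport_cond[OF y v refl, of n]
    have gm: "(\<lambda>s. G (?v(n := s))) \<in> borel_measurable mu1" by (rule measurable_compose[OF measurable_upd_const[OF v] Gm])
    have cRm: "(\<lambda>x. conditional R.f (Suc n) (y(n := x))) \<in> borel_measurable mu1" by (rule measurable_compose[OF measurable_upd_const[OF y] cm(2)])
    have cPm: "(\<lambda>x. conditional P.f (Suc n) (?v(n := x))) \<in> borel_measurable mu1" by (rule measurable_compose[OF measurable_upd_const[OF v] cm(1)])
    have hm: "?h \<in> mu1 \<rightarrow>\<^sub>M mu1" using tc(1) by (simp add: conditional_measure_def)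
    have GT: "G (T.rtrans (y(n := x))) = G (?v(n := ?h x))" if x: "x \<in> {-1..1}" for x
    proof (rule dep)
      have yx: "y(n := x) \<in> cube" by (rule upd_cube[OF y x])
      show "T.rtrans (y(n := x)) \<in> cube" by (rule T.rtrans_cube[OF yx])
      then show "?v(n := ?h x) \<in> cube" by (intro upd_cube v) (simp add: cube_def)
      show "T.rtrans (y(n := x)) j = (?v(n := ?h x)) j" if "j < Suc n" for j
        using that T.rtrans_cong[OF y, of j "y(n := x)"] by (auto simp: less_Suc_eq)
    qed
    have "(\<integral>\<^sup>+x. ennreal (marginal R.f (Suc n) (y(n := x))) * G (T.rtrans (y(n := x))) \<partial>mu1)
        = (\<integral>\<^sup>+x. ennreal (marginal R.f n y) * (ennreal (conditional R.f (Suc n) (y(n := x))) * G (?v(n := ?h x))) \<partial>mu1)"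
      using GT by (intro nn_integral_cong) (simp add: split[OF y] space_mu1 mult.assoc)
    also have "\<dots> = ennreal (marginal R.f n y) * (\<integral>\<^sup>+x. ennreal (conditional R.f (Suc n) (y(n := x))) * G (?v(n := ?h x)) \<partial>mu1)"
      using cRm measurable_compose[OF hm gm] by (intro nn_integral_cmult) simp
    also have "(\<integral>\<^sup>+x. ennreal (conditional R.f (Suc n) (y(n := x))) * G (?v(n := ?h x)) \<partial>mu1) = (\<integral>\<^sup>+x. G (?v(n := ?h x)) \<partial>conditional_measure R.f n y)"
      unfolding conditional_measure_def using cRm measurable_compose[OF hm gm] by (intro nn_integral_density[symmetric]) simp_all
    also have "\<dots> = (\<integral>\<^sup>+s. G (?v(n := s)) \<partial>distr (conditional_measure R.f n y) mu1 ?h)"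
      using tc(1) gm by (intro nn_integral_distr[symmetric]) simp_all
    also have "\<dots> = (\<integral>\<^sup>+s. G (?v(n := s)) \<partial>conditional_measure P.f n ?v)" by (simp only: tc(2))
    also have "\<dots> = G' ?v" unfolding conditional_measure_def G'_def using cPm gm by (intro nn_integral_density) simp_all
    finally show ?thesis .
  qed
  have "(\<integral>\<^sup>+y. ennreal (marginal R.f (Suc n) y) * G (T.rtrans y) \<partial>mu)
      = (\<integral>\<^sup>+y. \<integral>\<^sup>+x. ennreal (marginal R.f (Suc n) (y(n := x))) * G (T.rtrans (y(n := x))) \<partial>mu1 \<partial>mu)"
    using R.marginal_measurable measurable_compose[OF rtrans_measurable Gm] by (intro nn_integral_resample) simp
  also have "\<dots> = (\<integral>\<^sup>+y. ennreal (marginal R.f n y) * G' (T.rtrans y) \<partial>mu)"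
    using inner by (intro nn_integral_cong) (simp add: space_mu)
  also have "\<dots> = (\<integral>\<^sup>+y. ennreal (marginal P.f n y) * G' y \<partial>mu)"
    by (rule Suc.IH[OF G'm dep'])
  also have "\<dots> = (\<integral>\<^sup>+y. \<integral>\<^sup>+x. ennreal (marginal P.f (Suc n) (y(n := x))) * G (y(n := x)) \<partial>mu1 \<partial>mu)"
  proof (rule nn_integral_cong)
    fix y assume "y \<in> space mu"
    then have y: "y \<in> cube" by (simp add: space_mu)
    have "(\<lambda>x. ennreal (conditional P.f (Suc n) (y(n := x))) * G (y(n := x))) \<in> borel_measurable mu1"
      by (intro borel_measurable_times_ennreal measurable_compose[OF measurable_upd_const[OF y] Gm]
        measurable_compose[OF measurable_compose[OF measurable_upd_const[OF y] cm(1)] measurable_ennreal])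
    from nn_integral_cmult[OF this, of "ennreal (marginal P.f n y)"]
    show "ennreal (marginal P.f n y) * G' y = (\<integral>\<^sup>+x. ennreal (marginal P.f (Suc n) (y(n := x))) * G (y(n := x)) \<partial>mu1)"
      by (simp add: G'_def split[OF y] mult.assoc)
  qed
  also have "\<dots> = (\<integral>\<^sup>+y. ennreal (marginal P.f (Suc n) y) * G y \<partial>mu)"
    using P.marginal_measurable Gm by (intro nn_integral_resample[symmetric]) simp
  finally show ?case .
qed

lemma (in analytic_density) nn_integral_density_cylinder:
  assumes G: "G \<in> borel_measurable mu"
    and dep: "\<And>y y'. y \<in> cube \<Longrightarrow> y' \<in> cube \<Longrightarrow> (\<And>j. j < n \<Longrightarrow> y j = y' j) \<Longrightarrow> G y = G y'"
  shows "(\<integral>\<^sup>+y. ennreal (f y) * G y \<partial>mu) = (\<integral>\<^sup>+y. ennreal (marginal f n y) * G y \<partial>mu)"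
proof -
  have "(\<integral>\<^sup>+y. ennreal (f y) * G y \<partial>mu) = (\<integral>\<^sup>+y. \<integral>\<^sup>+t. ennreal (f (append_seq n y t)) * G (append_seq n y t) \<partial>mu \<partial>mu)"
    using f_measurable G by (intro nn_integral_append) simp
  also have "\<dots> = (\<integral>\<^sup>+y. ennreal (marginal f n y) * G y \<partial>mu)"
  proof (rule nn_integral_cong)
    fix y assume "y \<in> space mu"
    then have y: "y \<in> cube" by (simp add: space_mu)
    have "(\<integral>\<^sup>+t. ennreal (f (append_seq n y t)) * G (append_seq n y t) \<partial>mu) = (\<integral>\<^sup>+t. ennreal (f (append_seq n y t)) * G y \<partial>mu)"
      using append_cube[OF y] y by (intro nn_integral_cong arg_cong2[where f = "(*)"] refl dep) (auto simp: space_mu append_seq_def)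
    also have "\<dots> = (\<integral>\<^sup>+t. ennreal (f (append_seq n y t)) \<partial>mu) * G y"
      using measurable_compose[OF measurable_append_const[OF y] f_measurable] by (intro nn_integral_multc) simp
    finally show "(\<integral>\<^sup>+t. ennreal (f (append_seq n y t)) * G (append_seq n y t) \<partial>mu) = ennreal (marginal f n y) * G y"
      by (simp add: nn_integral_marginal[OF y])
  qed
  finally show ?thesis .
qed

lemma (in analytic_density) prob_space_density: "prob_space (density mu (\<lambda>y. ennreal (f y)))"
proof
  have "emeasure (density mu (\<lambda>y. ennreal (f y))) (space mu) = (\<integral>\<^sup>+y. ennreal (f y) * 1 \<partial>mu)"
    using f_measurable by (subst emeasure_density) (auto intro!: nn_integral_cong)
  also have "\<dots> = (\<integral>\<^sup>+y. ennreal (marginal f 0 y) * 1 \<partial>mu)"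
    by (rule nn_integral_density_cylinder) auto
  finally show "emeasure (density mu (\<lambda>y. ennreal (f y))) (space (density mu (\<lambda>y. ennreal (f y)))) = 1"
    by (simp add: marginal_def mu_prob.emeasure_space_1)
qed

text \<open>Cylinder sets determine the measure, and against a function of n coordinates each
  density may be replaced by its marginal.\<close>

theorem pushforward: "distr (density mu (\<lambda>y. ennreal (R.f y))) mu T.rtrans = density mu (\<lambda>y. ennreal (P.f y))"
proof (rule measure_eqI_PiM_infinite[where I = UNIV and M = "\<lambda>_. mu1"])
  interpret \<rho>: prob_space "density mu (\<lambda>y. ennreal (R.f y))" by (rule R.prob_space_density)
  have rm: "T.rtrans \<in> density mu (\<lambda>y. ennreal (R.f y)) \<rightarrow>\<^sub>M mu" using rtrans_measurable by simp
  show "finite_measure (distr (density mu (\<lambda>y. ennreal (R.f y))) mu T.rtrans)"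
    using \<rho>.prob_space_distr[OF rm] by (simp add: prob_space_def)
  fix A :: "nat \<Rightarrow> real set" and J :: "nat set"
  assume J: "finite J" and A: "\<And>i. i \<in> J \<Longrightarrow> A i \<in> sets mu1"
  define X where "X = prod_emb UNIV (\<lambda>_. mu1) J (Pi\<^sub>E J A)"
  have X: "X \<in> sets mu" unfolding X_def mu_def using J A by (intro sets_PiM_I) auto
  obtain n where n: "J \<subseteq> {..<n}" using J finite_nat_iff_bounded by auto
  have Xmem: "y \<in> X \<longleftrightarrow> (\<forall>j\<in>J. y j \<in> A j)" if "y \<in> cube" for y
    using that by (auto simp: X_def prod_emb_def cube_def space_mu1 PiE_def extensional_def Pi_def)
  define G :: "(nat \<Rightarrow> real) \<Rightarrow> ennreal" where "G = indicator X"
  have Gm: "G \<in> borel_measurable mu" using X by (simp add: G_def)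
  have dep: "G y = G y'" if "y \<in> cube" "y' \<in> cube" "\<And>j. j < n \<Longrightarrow> y j = y' j" for y y'
    using that n Xmem[of y] Xmem[of y'] by (auto simp: G_def indicator_def subset_eq)
  have GTm: "(\<lambda>y. G (T.rtrans y)) \<in> borel_measurable mu" by (rule measurable_compose[OF rtrans_measurable Gm])
  have "emeasure (distr (density mu (\<lambda>y. ennreal (R.f y))) mu T.rtrans) X = (\<integral>\<^sup>+y. G y \<partial>distr (density mu (\<lambda>y. ennreal (R.f y))) mu T.rtrans)"
    using X by (simp add: G_def)
  also have "\<dots> = (\<integral>\<^sup>+y. G (T.rtrans y) \<partial>density mu (\<lambda>y. ennreal (R.f y)))" by (rule nn_integral_distr[OF rm]) (use Gm in simp)
  also have "\<dots> = (\<integral>\<^sup>+y. ennreal (R.f y) * G (T.rtrans y) \<partial>mu)"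
    using R.f_measurable GTm by (intro nn_integral_density) simp_all
  also have "\<dots> = (\<integral>\<^sup>+y. ennreal (marginal R.f n y) * G (T.rtrans y) \<partial>mu)"
  proof (rule R.nn_integral_density_cylinder[OF GTm])
    show "G (T.rtrans y) = G (T.rtrans y')" if "y \<in> cube" "y' \<in> cube" "\<And>j. j < n \<Longrightarrow> y j = y' j" for y y'
      using that by (intro dep T.rtrans_cube T.rtrans_cong) auto
  qed
  also have "\<dots> = (\<integral>\<^sup>+y. ennreal (marginal P.f n y) * G y \<partial>mu)" by (rule pushforward_marginal[OF Gm dep])
  also have "\<dots> = (\<integral>\<^sup>+y. ennreal (P.f y) * G y \<partial>mu)" by (rule P.nn_integral_density_cylinder[OF Gm dep, symmetric])
  also have "\<dots> = emeasure (density mu (\<lambda>y. ennreal (P.f y))) X"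
    unfolding G_def using P.f_measurable X by (subst emeasure_density) auto
  finally show "emeasure (distr (density mu (\<lambda>y. ennreal (R.f y))) mu T.rtrans) (prod_emb UNIV (\<lambda>_. mu1) J (Pi\<^sub>E J A))
      = emeasure (density mu (\<lambda>y. ennreal (P.f y))) (prod_emb UNIV (\<lambda>_. mu1) J (Pi\<^sub>E J A))"
    by (simp add: X_def)
qed (simp_all add: mu_def)

end

section \<open>Rational maps and couplings\<close>

locale rational_map =
  fixes P :: "nat \<Rightarrow> (nat \<Rightarrow> real) \<Rightarrow> real" and \<Lambda> :: "nat \<Rightarrow> (nat \<Rightarrow> nat) set" and s :: real
  assumes poly: "\<And>k. P k \<in> poly_space k (\<Lambda> k)" and s: "0 < s"
    and P_ge: "\<And>k y. y \<in> cube \<Longrightarrow> s \<le> P k y + 1"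
begin

definition T' :: "(nat \<Rightarrow> real) \<Rightarrow> nat \<Rightarrow> real" where "T' y k = rational_component (P k) k y"
definition w :: "nat \<Rightarrow> (nat \<Rightarrow> real) \<Rightarrow> real" where "w k y = (P k y + 1)\<^sup>2"
definition W :: "nat \<Rightarrow> (nat \<Rightarrow> real) \<Rightarrow> real" where "W k y = (\<integral>t. w k (y(k := t)) \<partial>mu1)"

lemma P_cong: "(\<And>j. j \<le> k \<Longrightarrow> y j = y' j) \<Longrightarrow> P k y = P k y'"
  using poly[of k] by (auto simp: poly_space_def intro!: sum.cong prod.cong)

lemma T'_cong: assumes "\<And>j. j \<le> k \<Longrightarrow> y j = y' j" shows "T' y k = T' y' k"
proof -
  have "P k (y(k := t)) = P k (y'(k := t))" for t using assms by (intro P_cong) auto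
  then show ?thesis using assms[of k] by (simp add: T'_def rational_component_def)
qed

lemma P_continuous: "continuous_on S (P k)"
proof -
  obtain F a where "P k = (\<lambda>y. \<Sum>\<nu>\<in>F. a \<nu> * (\<Prod>j\<le>k. y j ^ \<nu> j))" using poly[of k] by (auto simp: poly_space_def)
  then show ?thesis by (auto intro!: continuous_intros continuous_on_subset[OF continuous_on_product_coordinates])
qed

lemma w_continuous: "continuous_on S (\<lambda>t. w k (y(k := t)))"
proof -
  have "continuous_on S (\<lambda>t. (y(k := t)) j)" for j by (cases "j = k") (auto intro!: continuous_intros)
  then have "continuous_on S (\<lambda>t. y(k := t))" by (rule continuous_on_coordinatewise_then_product)
  then have "continuous_on S (\<lambda>t. P k (y(k := t)))" by (rule continuous_on_compose2[OF P_continuous]) auto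
  then show ?thesis unfolding w_def by (intro continuous_intros)
qed

lemma w_ge: "y \<in> cube \<Longrightarrow> s\<^sup>2 \<le> w k y"
  unfolding w_def using P_ge[of y k] s by (intro power_mono) auto

lemma W_eq: "W k y = (1/2) * integral {-1..1} (\<lambda>t. w k (y(k := t)))"
  unfolding W_def by (subst integral_mu1[OF w_continuous]) simp

lemma W_ge: assumes y: "y \<in> cube" shows "s\<^sup>2 \<le> W k y"
proof -
  have "integral {-1..1::real} (\<lambda>t. s\<^sup>2) \<le> integral {-1..1} (\<lambda>t. w k (y(k := t)))"
    by (intro integral_le integrable_continuous_interval w_continuous) (auto intro!: w_ge upd_cube y)
  then show ?thesis by (simp add: W_eq)
qed

lemma W_pos: "y \<in> cube \<Longrightarrow> 0 < W k y"
  using W_ge[of y k] s by (auto intro: less_le_trans[of 0 "s\<^sup>2"])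

lemma T'_eq: "x \<in> {-1..1} \<Longrightarrow> T' (y(k := x)) k = -1 + integral {-1..x} (\<lambda>t. w k (y(k := t))) / W k y"
proof -
  assume x: "x \<in> {-1..1}"
  have "(LINT t:{-1..c}|mu1. (P k (y(k := t)) + 1)\<^sup>2) = (1/2) * integral {-1..c} (\<lambda>t. w k (y(k := t)))" if "c \<le> 1" for c
    using integral_mu1_Icc[OF w_continuous, of "-1" c k y] that by (simp add: w_def)
  from this[of x] this[of 1] x show ?thesis by (simp only: T'_def rational_component_def W_eq fun_upd_upd fun_upd_same) auto
qed

lemma T'_deriv:
  assumes x: "x \<in> {-1..1}"
  shows "((\<lambda>t. T' (y(k := t)) k) has_real_derivative w k (y(k := x)) / W k y) (at x within {-1..1})"
proof (rule has_field_derivative_transform_within[OF _ zero_less_one x])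
  show "((\<lambda>x. -1 + integral {-1..x} (\<lambda>t. w k (y(k := t))) / W k y) has_real_derivative w k (y(k := x)) / W k y) (at x within {-1..1})"
    using DERIV_add[OF DERIV_const DERIV_cdivide[OF integral_has_real_derivative[OF w_continuous x, of k y], of "W k y"], of "-1"] by simp
qed (use T'_eq in auto)

lemma T'_ends: assumes "y \<in> cube" shows "T' (y(k := -1)) k = -1" "T' (y(k := 1)) k = 1"
  using T'_eq[of "-1" y k] T'_eq[of 1 y k] W_pos[OF assms, of k] by (simp_all add: W_eq)

lemma T'_mono: assumes y: "y \<in> cube" shows "strict_mono_on {-1..1} (\<lambda>t. T' (y(k := t)) k)"
proof (rule strict_mono_onI)
  fix r t :: real assume rt: "r \<in> {-1..1}" "t \<in> {-1..1}" "r < t"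
  have i: "(\<lambda>t. w k (y(k := t))) integrable_on {a..c}" for a c by (intro integrable_continuous_interval w_continuous)
  have "integral {r..t} (\<lambda>_. s\<^sup>2) \<le> integral {r..t} (\<lambda>t. w k (y(k := t)))"
    using rt by (intro integral_le i integrable_continuous_interval continuous_intros) (auto intro!: w_ge upd_cube y)
  moreover have "0 < integral {r..t} (\<lambda>_. s\<^sup>2)" using rt s by simp
  moreover have "integral {-1..r} (\<lambda>t. w k (y(k := t))) + integral {r..t} (\<lambda>t. w k (y(k := t))) = integral {-1..t} (\<lambda>t. w k (y(k := t)))"
    using rt by (intro Henstock_Kurzweil_Integration.integral_combine i) auto
  ultimately show "T' (y(k := r)) k < T' (y(k := t)) k"
    using W_pos[OF y, of k] rt by (simp add: T'_eq divide_strict_right_mono)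
qed

lemma T'_cube: assumes y: "y \<in> cube" shows "T' y \<in> cube"
  unfolding cube_def
proof (intro CollectI allI)
  fix k
  have "y k \<in> {-1..1}" using y by (auto simp: cube_def)
  then show "T' y k \<in> {-1..1}"
    using strict_mono_on_leD[OF T'_mono[OF y, of k], of "-1" "y k"] strict_mono_on_leD[OF T'_mono[OF y, of k], of "y k" 1] T'_ends[OF y, of k]
    by auto
qed

lemma T'_IVT:
  assumes y: "y \<in> cube" and v: "v \<in> {-1..1}" shows "\<exists>x. x \<in> {-1..1} \<and> T' (y(k := x)) k = v"
proof -
  have "continuous_on {-1..1} (\<lambda>t. T' (y(k := t)) k)"
    unfolding continuous_on_eq_continuous_within using DERIV_continuous[OF T'_deriv] by blast
  then show ?thesis using IVT'[of "\<lambda>t. T' (y(k := t)) k" "-1" v 1] v by (auto simp: T'_ends[OF y])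
qed

text \<open>Triangularity allows the inverse to be built coordinate by coordinate; component k does
  not see the padding by 0 beyond k.\<close>

fun preimage :: "(nat \<Rightarrow> real) \<Rightarrow> nat \<Rightarrow> real" where
  "preimage v k = (SOME x. x \<in> {-1..1} \<and> T' ((\<lambda>j. if j < k then preimage v j else 0)(k := x)) k = v k)"

declare preimage.simps [simp del]

lemma preimage: assumes v: "v \<in> cube" shows "preimage v \<in> cube" "T' (preimage v) = v"
proof -
  have *: "preimage v k \<in> {-1..1} \<and> T' (preimage v) k = v k" for k
  proof (induction k rule: less_induct)
    case (less k)
    let ?y = "\<lambda>j. if j < k then preimage v j else 0"
    have y: "?y \<in> cube" using less by (auto simp: cube_def)
    have "v k \<in> {-1..1}" using v by (simp add: cube_def)
    from someI_ex[OF T'_IVT[OF y this, of k]]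
    have 1: "preimage v k \<in> {-1..1}" "T' (?y(k := preimage v k)) k = v k" unfolding preimage.simps[of v k] by auto
    have "T' (?y(k := preimage v k)) k = T' (preimage v) k" by (rule T'_cong) auto
    then show ?case using 1 by simp
  qed
  show "preimage v \<in> cube" using * by (simp add: cube_def)
  show "T' (preimage v) = v" using * by auto
qed

lemma bij: "bij_betw T' cube cube"
  unfolding bij_betw_def
proof
  show "inj_on T' cube"
  proof (rule inj_onI)
    fix x y assume xy: "x \<in> cube" "y \<in> cube" "T' x = T' y"
    have "x k = y k" for k
    proof (induction k rule: less_induct)
      case (less k)
      have "T' (y(k := x k)) k = T' x k" using less by (intro T'_cong) auto
      also have "\<dots> = T' (y(k := y k)) k" using xy by simp
      finally have e: "T' (y(k := x k)) k = T' (y(k := y k)) k" .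
      have "x k \<in> {-1..1}" "y k \<in> {-1..1}" using xy by (auto simp: cube_def)
      from inj_onD[OF strict_mono_on_imp_inj_on[OF T'_mono[OF xy(2), of k]] e this] show ?case .
    qed
    then show "x = y" by auto
  qed
  show "T' ` cube = cube" using T'_cube preimage by (force simp: image_iff)
qed

lemma triangular: "triangular T'"
  unfolding triangular_def by (auto intro!: T'_cong)

lemma increasing: "componentwise_increasing T'"
  unfolding componentwise_increasing_def using T'_mono by (auto intro: strict_mono_on_imp_mono_on)

lemma partial_T': "y \<in> cube \<Longrightarrow> partial k (\<lambda>y. T' y k) y = w k y / W k y"
proof -
  assume "y \<in> cube"
  then have "y k \<in> {-1..1}" by (simp add: cube_def)
  moreover have "at (y k) within {-1..1} \<noteq> bot" using \<open>y k \<in> {-1..1}\<close> by (simp add: trivial_limit_within islimpt_Icc)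
  ultimately show ?thesis
    using T'_deriv[of "y k" y k] unfolding partial_def has_real_derivative_iff_has_vector_derivative
    by (intro vector_derivative_within) auto
qed

lemma W_measurable: "W k \<in> borel_measurable mu"
proof -
  have "w k \<in> borel_measurable mu" unfolding w_def[abs_def] by (intro measurable_mu_continuous continuous_intros P_continuous)
  from measurable_compose[OF measurable_upd this] show ?thesis
    unfolding W_def[abs_def] by (intro mu1.borel_measurable_lebesgue_integral) (simp add: case_prod_unfold)
qed

lemma w_measurable: "w k \<in> borel_measurable mu"
  unfolding w_def[abs_def] by (intro measurable_mu_continuous continuous_intros P_continuous)

lemma T'_measurable: "T' \<in> mu \<rightarrow>\<^sub>M mu"
proof (rule measurable_mu_I)
  fix k
  have [measurable]: "(\<lambda>z. fst z k) \<in> borel_measurable (mu \<Otimes>\<^sub>M mu1)" "(\<lambda>z. snd z) \<in> borel_measurable (mu \<Otimes>\<^sub>M mu1)"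
    using measurable_compose[OF measurable_fst measurable_mu_component] measurable_compose[OF measurable_snd measurable_id_mu1] by auto
  have [measurable]: "(\<lambda>z. w k ((fst z)(k := snd z))) \<in> borel_measurable (mu \<Otimes>\<^sub>M mu1)"
    using measurable_compose[OF measurable_upd w_measurable, of k k] by (simp add: case_prod_unfold)
  have "(\<lambda>z. (if - 1 \<le> snd z \<and> snd z \<le> fst z k then 1 else 0) * w k ((fst z)(k := snd z))) \<in> borel_measurable (mu \<Otimes>\<^sub>M mu1)"
    by measurable
  moreover have "(if - 1 \<le> snd z \<and> snd z \<le> fst z k then 1 else 0) = (indicator {-1..fst z k} (snd z) :: real)" for z :: "(nat \<Rightarrow> real) \<times> real" by (simp add: indicator_def)
  ultimately have "(\<lambda>z. indicator {-1..fst z k} (snd z) * w k ((fst z)(k := snd z))) \<in> borel_measurable (mu \<Otimes>\<^sub>M mu1)" by (simp only:)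
  then have "(\<lambda>y. \<integral>t. indicator {-1..y k} t * w k (y(k := t)) \<partial>mu1) \<in> borel_measurable mu"
    by (intro mu1.borel_measurable_lebesgue_integral) (simp add: case_prod_unfold)
  moreover have "T' y k = -1 + 2 * ((\<integral>t. indicator {-1..y k} t * w k (y(k := t)) \<partial>mu1) / W k y)" for y
  proof -
    have "(LINT t:{-1..1}|mu1. (P k (y(k := t)) + 1)\<^sup>2) = W k y"
      unfolding W_def set_lebesgue_integral_def by (intro integral_mu1_cong) (simp add: w_def)
    then show ?thesis by (simp add: T'_def rational_component_def set_lebesgue_integral_def w_def)
  qed
  ultimately show "(\<lambda>y. T' y k) \<in> borel_measurable mu" using W_measurable by simp
qed (simp add: space_mu T'_cube)

end

text \<open>Points of \<open>mu_fin\<close> are undefined beyond coordinate k and need not lie in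
  the cube. Padding with 0 maps them measurably into it without changing h, and there h agrees with
  the measurable g.\<close>

lemma Linf_norm_le:
  assumes g: "g \<in> borel_measurable mu" "\<And>y. y \<in> cube \<Longrightarrow> \<bar>g y\<bar> \<le> B" and "\<And>y. h y = h (append_seq (Suc k) y (\<lambda>_. 0))"
    and hg: "\<And>y. y \<in> cube \<Longrightarrow> h y = g y"
  shows "Linf_norm (Suc k) h \<le> ennreal B"
proof -
  have z: "append_seq (Suc k) y (\<lambda>_. 0) \<in> cube" if "y \<in> space (mu_fin (Suc k))" for y
    using that by (auto simp: mu_fin_def space_PiM space_mu1 cube_def append_seq_def PiE_def Pi_def)
  have m: "(\<lambda>y. append_seq (Suc k) y (\<lambda>_. 0)) \<in> mu_fin (Suc k) \<rightarrow>\<^sub>M mu"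
  proof (rule measurable_mu_I[OF _ z])
    fix j
    show "(\<lambda>y. append_seq (Suc k) y (\<lambda>_. 0) j) \<in> borel_measurable (mu_fin (Suc k))"
    proof (cases "j < Suc k")
      case True
      then show ?thesis unfolding append_seq_def mu_fin_def
        using measurable_compose[OF measurable_component_singleton[of j "{..<Suc k}" "\<lambda>_. mu1"] measurable_id_mu1] by simp
    qed (simp add: append_seq_def)
  qed
  have e: "h y = g (append_seq (Suc k) y (\<lambda>_. 0))" if "y \<in> space (mu_fin (Suc k))" for y
    using assms(3)[of y] hg[OF z[OF that]] by simp
  have "h \<in> borel_measurable (mu_fin (Suc k))"
    using measurable_compose[OF m g(1)] by (subst measurable_cong[OF e]) auto
  then show ?thesis unfolding Linf_norm_def
    by (intro esssup_I AE_I2) (auto simp: e intro!: ennreal_leI g(2) z)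
qed

text \<open>On a probability space the q-th mean is at most the supremum, so one constant serves all
  q.\<close>

lemma ennreal_powr_nn_integral_le:
  assumes "prob_space N" "1 \<le> q" "\<And>z. z \<in> space N \<Longrightarrow> 0 \<le> g z \<and> g z \<le> B"
  shows "ennreal_powr (\<integral>\<^sup>+z. ennreal (g z powr q) \<partial>N) (1 / q) \<le> ennreal B"
proof -
  interpret N: prob_space N by fact
  obtain z0 where "z0 \<in> space N" using N.not_empty by auto
  then have B: "0 \<le> B" using assms(3) order_trans by blast
  have "(\<integral>\<^sup>+z. ennreal (g z powr q) \<partial>N) \<le> (\<integral>\<^sup>+z. ennreal (B powr q) \<partial>N)"
    using assms by (intro nn_integral_mono ennreal_leI powr_mono2) auto
  also have "\<dots> = ennreal (B powr q)" by (simp add: N.emeasure_space_1)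
  finally have I: "(\<integral>\<^sup>+z. ennreal (g z powr q) \<partial>N) \<le> ennreal (B powr q)" .
  define i where "i = enn2real (\<integral>\<^sup>+z. ennreal (g z powr q) \<partial>N)"
  have "i \<le> B powr q" using I by (simp add: i_def enn2real_leI)
  then have "i powr (1 / q) \<le> (B powr q) powr (1 / q)" using assms(2) by (intro powr_mono2) (auto simp: i_def)
  also have "\<dots> = B" using B assms(2) by (simp add: powr_powr)
  finally show ?thesis using I by (auto simp: ennreal_powr_def i_def top_unique intro: ennreal_leI)
qed

lemma wasserstein_le:
  fixes a b :: "'i \<Rightarrow> 'z::topological_space"
  assumes N: "prob_space N" and h: "(\<lambda>y. (a y, b y)) \<in> N \<rightarrow>\<^sub>M restrict_space borel (space A \<times> space A)"
    and fst: "fst \<in> restrict_space borel (space A \<times> space A) \<rightarrow>\<^sub>M A" and snd: "snd \<in> restrict_space borel (space A \<times> space A) \<rightarrow>\<^sub>M A"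
    and d: "(\<lambda>z. d (fst z) (snd z)) \<in> borel_measurable (restrict_space borel (space A \<times> space A))"
    and D: "\<And>y. y \<in> space N \<Longrightarrow> 0 \<le> d (a y) (b y) \<and> d (a y) (b y) \<le> D" and q: "1 \<le> q"
  shows "wasserstein d q (distr N A a) (distr N A b) \<le> ennreal D"
proof -
  let ?R = "restrict_space borel (space A \<times> space A)"
  define G where "G = distr N ?R (\<lambda>y. (a y, b y))"
  have "distr G (distr N A a) fst = distr G A fst" "distr G (distr N A b) snd = distr G A snd" by (rule distr_cong; simp)+
  moreover have "distr G A fst = distr N A a" "distr G A snd = distr N A b"
    unfolding G_def using distr_distr[OF fst h] distr_distr[OF snd h] by (simp_all add: comp_def)
  ultimately have "G \<in> couplings (distr N A a) (distr N A b)" by (simp add: couplings_def G_def)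
  then have "wasserstein d q (distr N A a) (distr N A b) \<le> ennreal_powr (\<integral>\<^sup>+z. ennreal (d (fst z) (snd z) powr q) \<partial>G) (1 / q)"
    unfolding wasserstein_def by (rule INF_lower)
  also have "(\<integral>\<^sup>+z. ennreal (d (fst z) (snd z) powr q) \<partial>G) = (\<integral>\<^sup>+y. ennreal (d (a y) (b y) powr q) \<partial>N)"
    unfolding G_def using d by (subst nn_integral_distr[OF h]) auto
  also have "ennreal_powr \<dots> (1 / q) \<le> ennreal D" using N q D by (rule ennreal_powr_nn_integral_le)
  finally show ?thesis .
qed

context kr_setting
begin

lemma rtrans_ends: assumes y: "y \<in> cube" shows "T.rtrans (y(k := -1)) k = -1" "T.rtrans (y(k := 1)) k = 1"
proof -
  have *: "T.rtrans (y(k := e)) k = e" if e: "e \<in> {-1, 1}" for e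
  proof -
    let ?y = "y(k := e)" and ?F = "\<lambda>x. Re (T.P.cdf k (complex_of_real \<circ> T.rtrans (y(k := e))) (of_real x))"
    have ye: "?y \<in> cube" using e by (intro upd_cube y) auto
    have t: "T.rtrans ?y \<in> cube" by (rule T.rtrans_cube[OF ye])
    have "?F (T.rtrans ?y k) = Re (T.R.cdf k (complex_of_real \<circ> ?y) (of_real (?y k)))" by (simp only: T.rtrans_cdf[OF ye])
    also have "\<dots> = ?F e" using e T.R.Re_cdf_props(3,4)[OF ye, of k] T.P.Re_cdf_props(3,4)[OF t, of k] by (elim insertE) (simp_all only: fun_upd_same, auto)
    finally have "?F (T.rtrans ?y k) = ?F e" .
    moreover have "T.rtrans ?y k \<in> {-1..1}" using t by (simp add: cube_def)
    ultimately show ?thesis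
      using strict_mono_on_imp_inj_on[OF T.P.Re_cdf_props(2)[OF t, of k]] e by (auto dest!: inj_onD)
  qed
  then show "T.rtrans (y(k := -1)) k = -1" "T.rtrans (y(k := 1)) k = 1" by simp_all
qed

text \<open>The transport fixes both ends of the interval, so its derivative integrates to the
  length 2. This is why the normalising factor W of a good approximation is close to 1
  (\<open>W_error\<close>).\<close>

lemma rratio_has_integral:
  assumes y: "y \<in> cube" shows "((\<lambda>t. T.rratio (y(k := t)) k) has_integral 2) {-1..1}"
proof -
  have "((\<lambda>t. T.rratio (y(k := t)) k) has_integral (T.rtrans (y(k := 1)) k - T.rtrans (y(k := -1)) k)) {-1..1}"
    by (intro fundamental_theorem_of_calculus T.rtrans_deriv[OF y, unfolded has_real_derivative_iff_has_vector_derivative]) auto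
  then show ?thesis by (simp add: rtrans_ends[OF y])
qed

lemma rratio_measurable: "(\<lambda>y. T.rratio y k) \<in> borel_measurable mu"
proof -
  have c: "conditional R.f (Suc k) \<in> borel_measurable mu" "conditional P.f (Suc k) \<in> borel_measurable mu"
    unfolding conditional_def using P.marginal_measurable R.marginal_measurable by (auto intro!: borel_measurable_divide)
  have "T.rratio y k = conditional R.f (Suc k) y / conditional P.f (Suc k) (T.rtrans y)" if "y \<in> space mu" for y
    using that T.rtrans_cube[of y] R.\<phi>_real[of y k] P.\<phi>_real[of "T.rtrans y" k] by (simp add: T.rratio_def space_mu)
  then show ?thesis
    by (subst measurable_cong, assumption) (intro borel_measurable_divide c measurable_compose[OF rtrans_measurable])
qed

lemma KR_deriv:
  assumes y: "y \<in> cube" and x: "x \<in> {-1..1}"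
  shows "((\<lambda>t. KR R.f P.f k (y(k := t))) has_real_derivative T.rratio (y(k := x)) k) (at x within {-1..1})"
  by (rule has_field_derivative_transform_within[OF T.rtrans_deriv[OF y x] zero_less_one x]) (simp add: KR_rtrans upd_cube[OF y])

lemma partial_KR: assumes y: "y \<in> cube" shows "partial k (KR R.f P.f k) y = T.rratio y k"
proof -
  have x: "y k \<in> {-1..1}" using y by (simp add: cube_def)
  then have "at (y k) within {-1..1} \<noteq> bot" by (simp add: trivial_limit_within islimpt_Icc)
  then show ?thesis
    using KR_deriv[OF y x, of k] unfolding partial_def has_real_derivative_iff_has_vector_derivative
    by (intro vector_derivative_within) auto
qed

end

section \<open>From the error of the root to the errors of maps and measures\<close>

locale kr_rational = kr_setting + rational_map P' \<Lambda> s for P' \<Lambda> s +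
  fixes \<eta> :: "nat \<Rightarrow> real" and r :: real
  assumes r: "1 \<le> r" and root_le: "\<And>k y. y \<in> cube \<Longrightarrow> sqrt (T.rratio y k) \<le> r" and P_le: "\<And>k y. y \<in> cube \<Longrightarrow> P' k y + 1 \<le> 2 * r"
    and P_error: "\<And>k y. y \<in> cube \<Longrightarrow> \<bar>sqrt (T.rratio y k) - (P' k y + 1)\<bar> \<le> \<eta> k" and \<eta>: "summable \<eta>"
begin

lemma zero_cube: "(\<lambda>_. 0) \<in> cube" by (simp add: cube_def)

lemma \<eta>_nonneg: "0 \<le> \<eta> k" using P_error[OF zero_cube, of k] by linarith

text \<open>\<open>3 * r\<close> bounds the sum of the two roots in the difference of their squares,
  \<open>1 + r\<^sup>2\<close> adds the effect of the normalisation, and \<open>s\<^sup>2\<close>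
  bounds the normalising factor from below.\<close>

definition c1 where "c1 = 3 * r * (1 + r\<^sup>2) / s\<^sup>2"

lemma c1: "0 < c1" using r s by (auto simp: c1_def intro!: divide_pos_pos mult_pos_pos add_pos_nonneg)

lemma rratio_pos: "y \<in> cube \<Longrightarrow> 0 \<le> T.rratio y k"
  using T.rratio(2)[of y k] T.R.m_pos T.R.K_pos by (auto intro: order_trans[of 0 "M / (2 * L) / (2 * L / M)"])

lemma rratio_le: "y \<in> cube \<Longrightarrow> T.rratio y k \<le> r\<^sup>2"
  using root_le[of y k] rratio_pos[of y k] by (metis real_sqrt_pow2 power_mono real_sqrt_ge_zero)

lemma w_error: assumes y: "y \<in> cube" shows "\<bar>T.rratio y k - w k y\<bar> \<le> 3 * r * \<eta> k"
proof -
  have "T.rratio y k - w k y = (sqrt (T.rratio y k))\<^sup>2 - (P' k y + 1)\<^sup>2" using rratio_pos[OF y] by (simp add: w_def)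
  also have "\<dots> = (sqrt (T.rratio y k) + (P' k y + 1)) * (sqrt (T.rratio y k) - (P' k y + 1))" by (simp add: power2_eq_square algebra_simps)
  also have "\<bar>\<dots>\<bar> \<le> 3 * r * \<eta> k"
    unfolding abs_mult using root_le[OF y, of k] P_le[OF y, of k] P_ge[OF y, of k] s P_error[OF y, of k] r rratio_pos[OF y, of k]
    by (intro mult_mono) auto
  finally show ?thesis .
qed

lemma W_error: assumes y: "y \<in> cube" shows "\<bar>1 - W k y\<bar> \<le> 3 * r * \<eta> k"
proof -
  have "(\<lambda>t. w k (y(k := t))) integrable_on {-1..1}" by (intro integrable_continuous_interval w_continuous)
  from integrable_integral[OF this] have "((\<lambda>t. w k (y(k := t))) has_integral 2 * W k y) {-1..1}" by (simp add: W_eq)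
  from has_integral_diff[OF rratio_has_integral[OF y, of k] this]
  have "norm (2 - 2 * W k y) \<le> 3 * r * \<eta> k * Sigma_Algebra.measure lborel {-1..1::real}"
    using \<eta>_nonneg r w_error[OF upd_cube[OF y]] by (intro has_integral_bound_real[where S = "{}"]) auto
  then show ?thesis by simp
qed

lemma deriv_error: assumes y: "y \<in> cube" shows "\<bar>T.rratio y k - w k y / W k y\<bar> \<le> c1 * \<eta> k"
proof -
  note W = W_pos[OF y, of k]
  define e where "e = 3 * r * \<eta> k"
  have e: "0 \<le> e" using r \<eta>_nonneg by (simp add: e_def)
  \<comment> \<open>Separates the error of the square from that of its normalisation, for both of
    which bounds are available.\<close>
  have eq: "T.rratio y k - w k y / W k y = ((T.rratio y k - w k y) - T.rratio y k * (1 - W k y)) / W k y"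
  proof -
    have "(T.rratio y k - w k y) - T.rratio y k * (1 - W k y) = T.rratio y k * W k y - w k y" by (simp add: right_diff_distrib)
    then show ?thesis using W by (simp only: diff_divide_distrib) simp
  qed
  have "\<bar>T.rratio y k - w k y / W k y\<bar> = \<bar>(T.rratio y k - w k y) - T.rratio y k * (1 - W k y)\<bar> / W k y"
    unfolding eq abs_divide abs_of_pos[OF W] ..
  also have "\<dots> \<le> (e + r\<^sup>2 * e) / W k y"
  proof (rule divide_right_mono)
    have "\<bar>T.rratio y k\<bar> \<le> r\<^sup>2" using rratio_le[OF y, of k] rratio_pos[OF y, of k] by linarith
    then have "\<bar>T.rratio y k * (1 - W k y)\<bar> \<le> r\<^sup>2 * e" unfolding abs_mult e_def
      by (rule mult_mono[OF _ W_error[OF y]]) simp_all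
    then show "\<bar>(T.rratio y k - w k y) - T.rratio y k * (1 - W k y)\<bar> \<le> e + r\<^sup>2 * e"
      using w_error[OF y, of k] abs_triangle_ineq4[of "T.rratio y k - w k y" "T.rratio y k * (1 - W k y)"]
      unfolding e_def[symmetric] by linarith
  qed (rule less_imp_le[OF W])
  also have "\<dots> \<le> (e + r\<^sup>2 * e) / s\<^sup>2"
  proof (rule divide_left_mono[OF W_ge[OF y]])
    show "0 \<le> e + r\<^sup>2 * e" using e by simp
    show "0 < W k y * s\<^sup>2" by (rule mult_pos_pos[OF W zero_less_power[OF s]])
  qed
  also have "\<dots> = c1 * \<eta> k"
    unfolding c1_def e_def times_divide_eq_left by (intro arg_cong2[where f = "(/)"] refl) (simp add: algebra_simps)
  finally show ?thesis .
qed

text \<open>Both maps fix the left end of the interval, so the error is the integral of the error of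
  the derivative over a length of at most 2.\<close>

lemma map_error: assumes y: "y \<in> cube" shows "\<bar>T.rtrans y k - T' y k\<bar> \<le> 2 * c1 * \<eta> k"
proof -
  have yk: "-1 \<le> y k" "y k \<le> 1" using y by (auto simp: cube_def)
  let ?g = "\<lambda>t. T.rtrans (y(k := t)) k - T' (y(k := t)) k"
  have "((\<lambda>t. T.rratio (y(k := t)) k - w k (y(k := t)) / W k (y(k := t))) has_integral ?g (y k) - ?g (-1)) {-1..y k}"
  proof (rule fundamental_theorem_of_calculus[OF yk(1)])
    fix t assume "t \<in> {-1..y k}"
    then have t: "t \<in> {-1..1}" using yk by auto
    have "W k (y(k := t)) = W k y" by (simp add: W_def)
    then have "(?g has_real_derivative T.rratio (y(k := t)) k - w k (y(k := t)) / W k (y(k := t))) (at t within {-1..1})"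
      using DERIV_diff[OF T.rtrans_deriv[OF y t] T'_deriv[OF t, of y k]] by simp
    then have "(?g has_real_derivative T.rratio (y(k := t)) k - w k (y(k := t)) / W k (y(k := t))) (at t within {-1..y k})"
      by (rule DERIV_subset) (use yk in auto)
    then show "(?g has_vector_derivative T.rratio (y(k := t)) k - w k (y(k := t)) / W k (y(k := t))) (at t within {-1..y k})"
      by (simp only: has_real_derivative_iff_has_vector_derivative)
  qed
  moreover have "?g (y k) - ?g (-1) = T.rtrans y k - T' y k" by (simp add: rtrans_ends[OF y] T'_ends[OF y])
  ultimately have "norm (T.rtrans y k - T' y k) \<le> c1 * \<eta> k * Sigma_Algebra.measure lborel {-1..y k}"
    using \<eta>_nonneg c1 yk deriv_error[OF upd_cube[OF y]] by (intro has_integral_bound_real[where S = "{}"]) auto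
  also have "\<dots> \<le> c1 * \<eta> k * 2" using \<eta>_nonneg c1 yk by (intro mult_left_mono) auto
  finally show ?thesis by simp
qed

lemma Linf_error: "Linf_norm (Suc k) (\<lambda>y. KR R.f P.f k y - rational_component (P' k) k y) \<le> ennreal (2 * c1 * \<eta> k)"
proof (rule Linf_norm_le[where g = "\<lambda>y. T.rtrans y k - T' y k"])
  show "(\<lambda>y. T.rtrans y k - T' y k) \<in> borel_measurable mu"
    by (intro borel_measurable_diff measurable_compose[OF rtrans_measurable measurable_mu_component] measurable_compose[OF T'_measurable measurable_mu_component])
  show "KR R.f P.f k y - rational_component (P' k) k y
      = KR R.f P.f k (append_seq (Suc k) y (\<lambda>_. 0)) - rational_component (P' k) k (append_seq (Suc k) y (\<lambda>_. 0))" for y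
    unfolding T'_def[symmetric] by (intro arg_cong2[where f = "(-)"] KR_cong T'_cong) (auto simp: append_seq_def)
qed (use map_error in \<open>auto simp: KR_rtrans T'_def\<close>)

lemma Linf_deriv_error:
  "Linf_norm (Suc k) (\<lambda>y. partial k (KR R.f P.f k) y - partial k (rational_component (P' k) k) y) \<le> ennreal (c1 * \<eta> k)"
proof (rule Linf_norm_le[where g = "\<lambda>y. T.rratio y k - w k y / W k y"])
  show "(\<lambda>y. T.rratio y k - w k y / W k y) \<in> borel_measurable mu"
    by (intro borel_measurable_diff borel_measurable_divide rratio_measurable w_measurable W_measurable)
  have e: "partial k g y = partial k g (append_seq (Suc k) y (\<lambda>_. 0))" if "\<And>y y'. (\<And>j. j \<le> k \<Longrightarrow> y j = y' j) \<Longrightarrow> g y = g y'" for g y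
  proof -
    have "g (y(k := t)) = g ((append_seq (Suc k) y (\<lambda>_. 0))(k := t))" for t by (rule that) (auto simp: append_seq_def)
    then show ?thesis by (simp add: partial_def append_seq_def)
  qed
  show "partial k (KR R.f P.f k) y - partial k (rational_component (P' k) k) y
      = partial k (KR R.f P.f k) (append_seq (Suc k) y (\<lambda>_. 0)) - partial k (rational_component (P' k) k) (append_seq (Suc k) y (\<lambda>_. 0))" for y
    by (intro arg_cong2[where f = "(-)"] e KR_cong T'_cong[unfolded T'_def]) auto
  show "partial k (KR R.f P.f k) y - partial k (rational_component (P' k) k) y = T.rratio y k - w k y / W k y" if "y \<in> cube" for y
    using partial_KR[OF that, of k] partial_T'[OF that, of k] by (simp add: T'_def)
qed (use deriv_error in auto)

definition \<eta>s where "\<eta>s = suminf \<eta>"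

lemma suminf_error: assumes "\<And>k. g k \<le> ennreal (c * \<eta> k)" "0 \<le> c" shows "(\<Sum>k. g k) \<le> ennreal (c * \<eta>s)"
proof -
  have "(\<Sum>k. g k) \<le> (\<Sum>k. ennreal (c * \<eta> k))" using assms by (intro suminf_le) auto
  also have "\<dots> = ennreal (\<Sum>k. c * \<eta> k)" using \<eta>_nonneg assms by (intro suminf_ennreal2 summable_mult \<eta>) auto
  also have "(\<Sum>k. c * \<eta> k) = c * \<eta>s" unfolding \<eta>s_def by (rule suminf_mult[OF \<eta>])
  finally show ?thesis .
qed

lemma \<eta>_summable_mult: assumes "\<And>j. 0 \<le> d j" "summable d"
  shows "summable (\<lambda>j. d j * \<eta> j)" "(\<Sum>j. d j * \<eta> j) \<le> suminf d * \<eta>s"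
proof -
  have d: "d j \<le> suminf d" for j using sum_le_suminf[OF assms(2), of "{j}"] assms(1) by simp
  show s: "summable (\<lambda>j. d j * \<eta> j)"
    by (rule summable_comparison_test'[OF summable_mult[OF \<eta>, of "suminf d"], of 0]) (use d assms \<eta>_nonneg in \<open>auto intro!: mult_right_mono\<close>)
  have "(\<Sum>j. d j * \<eta> j) \<le> (\<Sum>j. suminf d * \<eta> j)"
    using d \<eta>_nonneg by (intro suminf_le s summable_mult \<eta> mult_right_mono)
  then show "(\<Sum>j. d j * \<eta> j) \<le> suminf d * \<eta>s" by (simp add: suminf_mult[OF \<eta>] \<eta>s_def)
qed

lemma weighted_error:
  assumes d: "\<And>j. 0 \<le> d j" "summable d" and y: "y \<in> cube"
  shows "summable (\<lambda>j. d j * \<bar>T' y j - T.rtrans y j\<bar>)" "(\<Sum>j. d j * \<bar>T' y j - T.rtrans y j\<bar>) \<le> 2 * c1 * suminf d * \<eta>s"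
proof -
  note s = \<eta>_summable_mult[OF d]
  have le: "d j * \<bar>T' y j - T.rtrans y j\<bar> \<le> 2 * c1 * (d j * \<eta> j)" for j
    using mult_left_mono[OF map_error[OF y, of j] d(1)[of j]] by (simp add: abs_minus_commute mult_ac)
  show 1: "summable (\<lambda>j. d j * \<bar>T' y j - T.rtrans y j\<bar>)"
    by (rule summable_comparison_test'[OF summable_mult[OF s(1), of "2 * c1"], of 0]) (use le d in auto)
  have "(\<Sum>j. d j * \<bar>T' y j - T.rtrans y j\<bar>) \<le> (\<Sum>j. 2 * c1 * (d j * \<eta> j))"
    by (rule suminf_le[OF le 1 summable_mult[OF s(1)]])
  also have "\<dots> = 2 * c1 * (\<Sum>j. d j * \<eta> j)" by (rule suminf_mult[OF s(1)])
  also have "\<dots> \<le> 2 * c1 * (suminf d * \<eta>s)" using s(2) c1 by (intro mult_left_mono) auto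
  finally show "(\<Sum>j. d j * \<bar>T' y j - T.rtrans y j\<bar>) \<le> 2 * c1 * suminf d * \<eta>s" by (simp add: mult.assoc)
qed

abbreviation "\<rho> \<equiv> density mu (\<lambda>y. ennreal (R.f y))"
abbreviation "\<pi> \<equiv> density mu (\<lambda>y. ennreal (P.f y))"

lemma maps_measurable: "(\<lambda>y. (T' y, T.rtrans y)) \<in> \<rho> \<rightarrow>\<^sub>M restrict_space borel (cube \<times> cube)"
proof (rule measurable_restrict_space2)
  have "(\<lambda>y. (T' y, T.rtrans y)) \<in> mu \<rightarrow>\<^sub>M (borel \<Otimes>\<^sub>M borel)"
    by (intro measurable_Pair measurable_compose[OF T'_measurable measurable_id_mu_borel] measurable_compose[OF rtrans_measurable measurable_id_mu_borel])
  then show "(\<lambda>y. (T' y, T.rtrans y)) \<in> \<rho> \<rightarrow>\<^sub>M borel" by (simp add: borel_prod)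
qed (use T'_cube T.rtrans_cube in \<open>auto simp: space_mu\<close>)

lemma wasserstein_cube:
  assumes d: "\<And>j. 0 \<le> d j" "summable d" and q: "1 \<le> q"
  shows "wasserstein (weighted_dist d) q (distr \<rho> mu T') \<pi> \<le> ennreal (2 * c1 * suminf d * \<eta>s)"
  unfolding pushforward[symmetric]
proof (rule wasserstein_le[OF R.prob_space_density])
  have cont: "continuous_on (cube \<times> cube) (\<lambda>z. fst z j :: real)" "continuous_on (cube \<times> cube) (\<lambda>z. snd z j :: real)" for j :: nat
    by (rule continuous_on_compose2[OF continuous_on_product_coordinates[of j]]; force intro: continuous_intros)+
  note comp = cont[THEN borel_measurable_continuous_on_restrict]
  show "(\<lambda>y. (T' y, T.rtrans y)) \<in> \<rho> \<rightarrow>\<^sub>M restrict_space borel (space mu \<times> space mu)" using maps_measurable by (simp add: space_mu)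
  show "fst \<in> restrict_space borel (space mu \<times> space mu) \<rightarrow>\<^sub>M mu" "snd \<in> restrict_space borel (space mu \<times> space mu) \<rightarrow>\<^sub>M mu"
    using comp by (auto intro!: measurable_mu_I simp: space_mu space_restrict_space)
  show "(\<lambda>z. weighted_dist d (fst z) (snd z)) \<in> borel_measurable (restrict_space borel (space mu \<times> space mu))"
    unfolding weighted_dist_def space_mu using comp
    by (intro borel_measurable_suminf borel_measurable_times borel_measurable_const borel_measurable_abs borel_measurable_diff)
  show "0 \<le> weighted_dist d (T' y) (T.rtrans y) \<and> weighted_dist d (T' y) (T.rtrans y) \<le> 2 * c1 * suminf d * \<eta>s" if "y \<in> space \<rho>" for y
    using weighted_error[OF d, of y] that d by (auto simp: weighted_dist_def space_mu intro!: suminf_nonneg)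
qed (rule q)

lemma (in analytic_density) dist_expansion:
  assumes xy: "x \<in> cube" "y \<in> cube" and s: "summable (\<lambda>j. b j * \<bar>x j - y j\<bar>)"
  shows "dist (expansion \<psi> x) (expansion \<psi> y) \<le> (\<Sum>j. b j * \<bar>x j - y j\<bar>)"
proof -
  have "expansion \<psi> x - expansion \<psi> y = (\<Sum>j. x j *\<^sub>R \<psi> j - y j *\<^sub>R \<psi> j)"
    unfolding expansion_def using xy by (intro suminf_diff expansion_summable[of 0]) (auto simp: cube_def abs_le_iff)
  also have "\<dots> = (\<Sum>j. (x j - y j) *\<^sub>R \<psi> j)" by (simp add: scaleR_left_diff_distrib)
  finally have e: "expansion \<psi> x - expansion \<psi> y = (\<Sum>j. (x j - y j) *\<^sub>R \<psi> j)" .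
  have le: "norm ((x j - y j) *\<^sub>R \<psi> j) \<le> b j * \<bar>x j - y j\<bar>" for j
    using mult_right_mono[OF \<psi>_le[of j], of "\<bar>x j - y j\<bar>"] by (simp add: mult.commute)
  have n: "summable (\<lambda>j. norm ((x j - y j) *\<^sub>R \<psi> j))" by (rule summable_comparison_test'[OF s, of 0]) (use le in auto)
  show ?thesis unfolding dist_norm e
    by (rule order_trans[OF summable_norm[OF n] suminf_le[OF le n s]])
qed

lemma wasserstein_image:
  assumes q: "1 \<le> q"
  shows "wasserstein dist q (distr \<rho> borel (expansion \<psi>\<^sub>P \<circ> T')) (distr \<pi> borel (expansion \<psi>\<^sub>P)) \<le> ennreal (2 * c1 * suminf b * \<eta>s)"
proof -
  let ?\<Phi> = "expansion \<psi>\<^sub>P"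
  have \<Phi>m: "?\<Phi> \<in> borel_measurable mu" by (rule measurable_mu_continuous[OF P.expansion_continuous])
  have "distr \<pi> borel ?\<Phi> = distr \<rho> borel (?\<Phi> \<circ> T.rtrans)"
    unfolding pushforward[symmetric] using \<Phi>m rtrans_measurable by (intro distr_distr) simp_all
  moreover have "wasserstein dist q (distr \<rho> borel (?\<Phi> \<circ> T')) (distr \<rho> borel (?\<Phi> \<circ> T.rtrans)) \<le> ennreal (2 * c1 * suminf b * \<eta>s)"
  proof (rule wasserstein_le[OF R.prob_space_density])
    \<comment> \<open>Measurability for the Borel sets of the product of Y with itself comes from
      continuity on \<open>cube \<times> cube\<close>, since Y may be non-separable.\<close>
    have "continuous_on (cube \<times> cube) (\<lambda>z. (?\<Phi> (fst z), ?\<Phi> (snd z)))"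
      by (intro continuous_on_Pair continuous_on_compose2[OF P.expansion_continuous] continuous_intros) auto
    from measurable_compose[OF maps_measurable borel_measurable_continuous_on_restrict[OF this]]
    show "(\<lambda>y. ((?\<Phi> \<circ> T') y, (?\<Phi> \<circ> T.rtrans) y)) \<in> \<rho> \<rightarrow>\<^sub>M restrict_space borel (space borel \<times> space borel)" by simp

    show "0 \<le> dist ((?\<Phi> \<circ> T') y) ((?\<Phi> \<circ> T.rtrans) y) \<and> dist ((?\<Phi> \<circ> T') y) ((?\<Phi> \<circ> T.rtrans) y) \<le> 2 * c1 * suminf b * \<eta>s"
      if "y \<in> space \<rho>" for y
    proof -
      have y: "y \<in> cube" using that by (simp add: space_mu)
      note we = weighted_error[OF b_nonneg b_summable y]
      show ?thesis using P.dist_expansion[OF T'_cube[OF y] T.rtrans_cube[OF y] we(1)] we(2) by simp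
    qed
  qed (use q in \<open>auto intro!: measurable_restrict_space1 borel_measurable_continuous_onI continuous_intros\<close>)
  ultimately show ?thesis by simp
qed

end

section \<open>Convergence rates\<close>

text \<open>The exponent \<open>1 - 1 / p\<close> is negative, so the upper bound of order
  \<open>\<epsilon> powr (- p)\<close> on N becomes a lower bound of order
  \<open>\<epsilon> powr (1 - p)\<close> on the rate. For \<open>N = 0\<close> the right side is
  infinite.\<close>

lemma rate_bound_ge:
  assumes p: "0 < p" "p < 1" and \<epsilon>: "0 < \<epsilon>" and N: "N \<le> ennreal (c * \<epsilon> powr (- p))" and c: "0 \<le> c"
    and v: "v \<le> C1 * \<epsilon> powr (1 - p)" and C1: "0 \<le> C1" and C: "C1 * c powr (1 / p - 1) \<le> C"
  shows "ennreal v \<le> rate_bound C p N"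
proof (cases "N = 0")
  case False
  define n where "n = enn2real N"
  have "N < \<top>" using N by (rule order_le_less_trans) simp
  then have Nn: "N = ennreal n" by (simp add: n_def)
  have "n \<noteq> 0" using False Nn by (cases "n = 0") simp_all
  moreover have "0 \<le> n" by (simp add: n_def)
  ultimately have n: "0 < n" by simp
  have nc: "n \<le> c * \<epsilon> powr (- p)" using N c unfolding Nn by (subst (asm) ennreal_le_iff) auto
  have c0: "0 < c" using n nc c by (cases "c = 0") auto
  have "(c * \<epsilon> powr (- p)) powr (- (1 / p) + 1) = c powr (- (1 / p) + 1) * \<epsilon> powr (1 - p)"
  proof -
    have "- p * (- (1 / p) + 1) = 1 - p" using p by (simp add: ring_distribs)
    then show ?thesis using c0 \<epsilon> by (simp add: powr_mult powr_powr)
  qed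
  moreover have "c powr (1 / p - 1) * c powr (- (1 / p) + 1) = 1" using c0 by (simp flip: powr_add)
  ultimately have "\<epsilon> powr (1 - p) = c powr (1 / p - 1) * (c * \<epsilon> powr (- p)) powr (- (1 / p) + 1)"
    by (simp only: mult.assoc[symmetric] mult_1)
  also have "\<dots> \<le> c powr (1 / p - 1) * n powr (- (1 / p) + 1)"
    using n nc p by (intro mult_left_mono powr_mono2') simp_all
  finally have "C1 * \<epsilon> powr (1 - p) \<le> C1 * c powr (1 / p - 1) * n powr (- (1 / p) + 1)"
    using mult_left_mono[OF _ C1] by (simp add: mult.assoc)
  also have "\<dots> \<le> C * n powr (- (1 / p) + 1)" using C by (intro mult_right_mono) auto
  finally have "v \<le> C * n powr (- (1 / p) + 1)" using v by simp
  then show ?thesis using False by (simp add: rate_bound_def n_def ennreal_leI)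
qed (simp add: rate_bound_def)

locale kr_sparse = kr_setting b p M L \<psi>\<^sub>R S\<^sub>R F\<^sub>R \<psi>\<^sub>P S\<^sub>P F\<^sub>P
  for b p M L and \<psi>\<^sub>R :: "nat \<Rightarrow> 'x::banach" and S\<^sub>R F\<^sub>R and \<psi>\<^sub>P :: "nat \<Rightarrow> 'y::banach" and S\<^sub>P F\<^sub>P +
  assumes p: "0 < p" "p < 1" and b_p: "summable (\<lambda>j. b j powr p)"
begin

sublocale S: sparse b p T.\<delta>\<^sub>2
  using p b_p T.\<delta>\<^sub>2(1) by unfold_locales auto

text \<open>Square roots of the bounds \<open>m / K\<close> and \<open>K / m\<close> on
  \<open>rratio\<close>, with \<open>m = M / (2 * L)\<close> and
  \<open>K = 2 * L / M\<close>.\<close>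

definition r\<^sub>0 where "r\<^sub>0 = M / (2 * L)"
definition r\<^sub>1 where "r\<^sub>1 = 2 * L / M"

lemma r: "0 < r\<^sub>0" "r\<^sub>0 \<le> 1" "1 \<le> r\<^sub>1"
  using R.M by (auto simp: r\<^sub>0_def r\<^sub>1_def field_simps)

lemma root_bounds: assumes "y \<in> cube" shows "r\<^sub>0 \<le> sqrt (T.rratio y k)" "sqrt (T.rratio y k) \<le> r\<^sub>1"
proof -
  have "r\<^sub>0\<^sup>2 = M / (2 * L) / (2 * L / M)" "r\<^sub>1\<^sup>2 = 2 * L / M / (M / (2 * L))" by (simp_all add: r\<^sub>0_def r\<^sub>1_def power2_eq_square)
  then show "r\<^sub>0 \<le> sqrt (T.rratio y k)" "sqrt (T.rratio y k) \<le> r\<^sub>1"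
    using T.rratio(2,3)[OF assms, of k] r by (auto intro: real_le_rsqrt real_le_lsqrt)
qed

lemma root_const: "0 \<le> T.root_const"
  unfolding T.root_const_def using T.R.A_nonneg R.M R.L_pos T.gain_pos suminf_nonneg[OF b_summable b_nonneg] T.R.\<delta>_pos
  by (intro mult_nonneg_nonneg divide_nonneg_nonneg add_nonneg_nonneg) auto

lemma sparse_fun: "sparse_fun b p T.\<delta>\<^sub>2 k (\<lambda>z. T.root k z - 1) T.root_const"
proof unfold_locales
  show "curve_hol b (Suc k) T.\<delta>\<^sub>2 (\<lambda>z. T.root k z - 1)"
    by (intro curve_holI holomorphic_intros curve_holD[OF T.root_hol])
qed (use root_const T.root_one in auto)

lemma root_near_one: assumes y: "y \<in> cube" shows "\<bar>sqrt (T.rratio y k) - 1\<bar> \<le> T.root_const * b k"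
proof -
  have "near b (Suc k) T.\<delta>\<^sub>2 y (complex_of_real \<circ> y)" using T.\<delta>\<^sub>2 by (simp add: near_def)
  from T.root_one[OF y this] have "cmod (of_real (sqrt (T.rratio y k)) - 1) \<le> T.root_const * b k"
    by (simp add: T.root_real[OF y])
  moreover have "of_real (sqrt (T.rratio y k)) - 1 = complex_of_real (sqrt (T.rratio y k) - 1)" by simp
  ultimately show ?thesis by (simp only: norm_of_real)
qed

definition approximant :: "real \<Rightarrow> real \<Rightarrow> (nat \<Rightarrow> (nat \<Rightarrow> real) \<Rightarrow> real) \<Rightarrow> bool" where
  "approximant C1 \<epsilon> P' \<longleftrightarrow> (\<exists>\<eta>. kr_rational b p M L \<psi>\<^sub>R S\<^sub>R F\<^sub>R \<psi>\<^sub>P S\<^sub>P F\<^sub>P P' (Lambda (weight S.\<alpha> b) \<epsilon>) (r\<^sub>0 / 2) \<eta> r\<^sub>1 \<and> suminf \<eta> \<le> C1 * \<epsilon> powr (1 - p))"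

text \<open>For small \<epsilon> the truncated expansion is uniformly within
  \<open>r\<^sub>0 / 2\<close> of the root, so \<open>P' k y + 1\<close> stays positive. For large
  \<epsilon> this is not guaranteed, and the zero polynomial is used, whose error does not depend on
  \<epsilon>.\<close>

lemma approximant_exists:
  obtains C1 where "0 \<le> C1" "\<And>\<epsilon>. 0 < \<epsilon> \<Longrightarrow> \<exists>P'. approximant C1 \<epsilon> P'"
proof
  define A where "A = \<bar>sparse_fun.E b p T.\<delta>\<^sub>2 * T.root_const\<bar>"
  \<comment> \<open>Chosen so that the uniform error bound
    \<open>A * \<epsilon>0 powr (1 - p) * S.bpsum\<close> is below \<open>r\<^sub>0 / 2\<close>;
    adding 1 avoids a zero denominator.\<close>
  define \<epsilon>0 where "\<epsilon>0 = (r\<^sub>0 / 2 / (A * S.bpsum + 1)) powr (1 / (1 - p))"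
  have A: "0 \<le> A" by (simp add: A_def)
  have Ab: "0 < A * S.bpsum + 1" using A S.bpsum_nonneg by (simp add: add_nonneg_pos)
  have \<epsilon>0: "0 < \<epsilon>0" "\<epsilon>0 powr (1 - p) = r\<^sub>0 / 2 / (A * S.bpsum + 1)"
    using r Ab p by (auto simp: \<epsilon>0_def powr_powr)
  have sb: "0 \<le> suminf b" by (rule suminf_nonneg[OF b_summable b_nonneg])
  \<comment> \<open>The second summand serves the range beyond \<epsilon>0, where a constant error
    is at most a multiple of \<open>\<epsilon> powr (1 - p)\<close>.\<close>
  define C1 where "C1 = A * S.bpsum + T.root_const * suminf b / \<epsilon>0 powr (1 - p)"
  show "0 \<le> C1" using A S.bpsum_nonneg root_const sb by (simp add: C1_def)
  fix \<epsilon> :: real assume \<epsilon>: "0 < \<epsilon>"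
  have rat: "kr_rational b p M L \<psi>\<^sub>R S\<^sub>R F\<^sub>R \<psi>\<^sub>P S\<^sub>P F\<^sub>P P' (Lambda (weight S.\<alpha> b) \<epsilon>) (r\<^sub>0 / 2) \<eta> r\<^sub>1"
    if "\<And>k. P' k \<in> poly_space k (Lambda (weight S.\<alpha> b) \<epsilon> k)" "\<And>k y. y \<in> cube \<Longrightarrow> r\<^sub>0 / 2 \<le> P' k y + 1"
      "\<And>k y. y \<in> cube \<Longrightarrow> P' k y + 1 \<le> 2 * r\<^sub>1" "\<And>k y. y \<in> cube \<Longrightarrow> \<bar>sqrt (T.rratio y k) - (P' k y + 1)\<bar> \<le> \<eta> k" "summable \<eta>" for P' \<eta>
    using that r root_bounds by unfold_locales auto
  show "\<exists>P'. approximant C1 \<epsilon> P'"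
  proof (cases "\<epsilon> \<le> \<epsilon>0")
    case True
    define P' where "P' k = sparse_fun.approx b p T.\<delta>\<^sub>2 k (\<lambda>z. T.root k z - 1) \<epsilon>" for k
    define \<eta> where "\<eta> k = A * \<epsilon> powr (1 - p) * b k powr p" for k
    have small: "\<eta> k \<le> r\<^sub>0 / 2" for k
    proof -
      have bk: "b k powr p \<le> S.bpsum" unfolding S.bpsum_def using sum_le_suminf[OF b_p, of "{k}"] by simp
      have "\<eta> k \<le> A * (r\<^sub>0 / 2 / (A * S.bpsum + 1)) * S.bpsum"
        unfolding \<eta>_def \<epsilon>0(2)[symmetric] using True \<epsilon> p A bk by (intro mult_mono powr_mono2) auto
      also have "\<dots> = (r\<^sub>0 / 2) * (A * S.bpsum / (A * S.bpsum + 1))" by simp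
      also have "\<dots> \<le> (r\<^sub>0 / 2) * 1" using r Ab by (intro mult_left_mono) auto
      finally show ?thesis by simp
    qed
    have err: "\<bar>sqrt (T.rratio y k) - (P' k y + 1)\<bar> \<le> \<eta> k" if y: "y \<in> cube" for k y
    proof -
      interpret sf: sparse_fun b p T.\<delta>\<^sub>2 k "\<lambda>z. T.root k z - 1" T.root_const by (rule sparse_fun)
      have "\<bar>(sqrt (T.rratio y k) - 1) - P' k y\<bar> \<le> sf.E * T.root_const * \<epsilon> powr (1 - p) * b k powr p"
        using sf.approx_error[OF \<epsilon> y] by (simp add: P'_def T.root_real[OF y])
      also have "\<dots> \<le> \<eta> k" unfolding \<eta>_def A_def by (intro mult_right_mono) auto
      finally show ?thesis by (simp add: algebra_simps)
    qed
    have "kr_rational b p M L \<psi>\<^sub>R S\<^sub>R F\<^sub>R \<psi>\<^sub>P S\<^sub>P F\<^sub>P P' (Lambda (weight S.\<alpha> b) \<epsilon>) (r\<^sub>0 / 2) \<eta> r\<^sub>1"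
    proof (rule rat[OF _ _ _ err])
      show "P' k \<in> poly_space k (Lambda (weight S.\<alpha> b) \<epsilon> k)" for k
        unfolding P'_def by (rule sparse_fun.approx_poly[OF sparse_fun \<epsilon>])
      show "r\<^sub>0 / 2 \<le> P' k y + 1" "P' k y + 1 \<le> 2 * r\<^sub>1" if "y \<in> cube" for k y
        using err[OF that, of k] small[of k] root_bounds[OF that, of k] r by linarith+
      show "summable \<eta>" unfolding \<eta>_def by (intro summable_mult b_p)
    qed
    moreover have "suminf \<eta> \<le> C1 * \<epsilon> powr (1 - p)"
    proof -
      have "suminf \<eta> = A * \<epsilon> powr (1 - p) * S.bpsum" unfolding \<eta>_def S.bpsum_def by (rule suminf_mult[OF b_p])
      also have "\<dots> = (A * S.bpsum) * \<epsilon> powr (1 - p)" by simp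
      also have "\<dots> \<le> C1 * \<epsilon> powr (1 - p)" using root_const sb by (intro mult_right_mono) (auto simp: C1_def)
      finally show ?thesis .
    qed
    ultimately have "approximant C1 \<epsilon> P'" unfolding approximant_def by (intro exI conjI)
    then show ?thesis by blast
  next
    case False
    \<comment> \<open>The error of the zero polynomial is that of \<open>root - 1\<close>, already
      of order \<open>b k\<close>; the zero polynomial also belongs to the space of an empty index
      set.\<close>
    define \<eta> where "\<eta> k = T.root_const * b k" for k
    have "kr_rational b p M L \<psi>\<^sub>R S\<^sub>R F\<^sub>R \<psi>\<^sub>P S\<^sub>P F\<^sub>P (\<lambda>_ _. 0) (Lambda (weight S.\<alpha> b) \<epsilon>) (r\<^sub>0 / 2) \<eta> r\<^sub>1"
    proof (rule rat)
      show "(\<lambda>_. 0) \<in> poly_space k (Lambda (weight S.\<alpha> b) \<epsilon> k)" for k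
        by (auto simp: poly_space_def intro!: exI[of _ "{}"])
      show "summable \<eta>" unfolding \<eta>_def by (intro summable_mult b_summable)
    qed (use r root_near_one in \<open>auto simp: \<eta>_def\<close>)
    moreover have "suminf \<eta> \<le> C1 * \<epsilon> powr (1 - p)"
    proof -
      have "suminf \<eta> = T.root_const * suminf b" unfolding \<eta>_def by (rule suminf_mult[OF b_summable])
      also have "\<dots> = T.root_const * suminf b / \<epsilon>0 powr (1 - p) * \<epsilon>0 powr (1 - p)" using \<epsilon>0(1) by simp
      also have "\<dots> \<le> C1 * \<epsilon> powr (1 - p)"
        using False \<epsilon>0(1) p A S.bpsum_nonneg root_const sb by (intro mult_mono powr_mono2) (auto simp: C1_def)
      finally show ?thesis .
    qed
    ultimately have "approximant C1 \<epsilon> (\<lambda>_ _. 0)" unfolding approximant_def by (intro exI conjI)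
    then show ?thesis by blast
  qed
qed

end

theorem theorem6p4:
  fixes p M L :: real
    and \<psi>\<rho> :: "nat \<Rightarrow> 'x::banach" and O\<rho> :: "('x \<times> 'x) set" and F\<rho> :: "'x \<times> 'x \<Rightarrow> complex"
    and \<psi>\<pi> :: "nat \<Rightarrow> 'y::banach" and O\<pi> :: "('y \<times> 'y) set" and F\<pi> :: "'y \<times> 'y \<Rightarrow> complex"
    and f\<rho> f\<pi> :: "(nat \<Rightarrow> real) \<Rightarrow> real"
    and \<rho> \<pi> :: "(nat \<Rightarrow> real) measure"
    and T :: "nat \<Rightarrow> (nat \<Rightarrow> real) \<Rightarrow> real"
    and b c :: "nat \<Rightarrow> real"
    and \<Phi> :: "(nat \<Rightarrow> real) \<Rightarrow> 'y"
  assumes p: "0 < p" "p < 1"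
    and bounds: "0 < M" "M \<le> L"
    and dens_\<rho>: "density_assumption p M L \<psi>\<rho> O\<rho> F\<rho>"
    and dens_\<pi>: "density_assumption p M L \<psi>\<pi> O\<pi> F\<pi>"
    and f\<rho>: "f\<rho> = induced_density \<psi>\<rho> F\<rho>"
    and f\<pi>: "f\<pi> = induced_density \<psi>\<pi> F\<pi>"
    and \<rho>: "\<rho> = density mu (\<lambda>y. ennreal (f\<rho> y))"
    and \<pi>: "\<pi> = density mu (\<lambda>y. ennreal (f\<pi> y))"
    and T: "T = KR f\<rho> f\<pi>"
    and b: "b = (\<lambda>j. max (norm (\<psi>\<rho> j)) (norm (\<psi>\<pi> j)))"
    and c: "\<forall>j. 0 < c j" "summable c"
    and \<Phi>: "\<Phi> = expansion \<psi>\<pi>"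
  shows "\<exists>\<alpha>>0. \<exists>C>0. \<exists>P :: real \<Rightarrow> nat \<Rightarrow> (nat \<Rightarrow> real) \<Rightarrow> real.
    (\<forall>\<epsilon>>0. \<forall>k. P \<epsilon> k \<in> poly_space k (Lambda (weight \<alpha> b) \<epsilon> k)) \<and>
    (\<forall>\<epsilon>>0.
      let N = N_dim (weight \<alpha> b) \<epsilon>;
          T' = (\<lambda>k. rational_component (P \<epsilon> k) k);
          Tmap = (\<lambda>y k. T' k y)
      in
        bij_betw Tmap cube cube \<and> triangular Tmap \<and> componentwise_increasing Tmap \<and>
        N < \<infinity> \<and>
        (\<Sum>k. Linf_norm (Suc k) (\<lambda>y. T k y - T' k y)) \<le> rate_bound C p N \<and>
        (\<forall>k. \<forall>y\<in>cube. (\<lambda>t. T k (y(k := t))) differentiable_on {-1..1} \<and>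
                       (\<lambda>t. T' k (y(k := t))) differentiable_on {-1..1}) \<and>
        (\<Sum>k. Linf_norm (Suc k) (\<lambda>y. partial k (T k) y - partial k (T' k) y)) \<le> rate_bound C p N \<and>
        (\<forall>q\<ge>1.
          wasserstein (weighted_dist c) q (distr \<rho> mu Tmap) \<pi> \<le> rate_bound C p N \<and>
          wasserstein dist q (distr \<rho> borel (\<Phi> \<circ> Tmap)) (distr \<pi> borel \<Phi>) \<le> rate_bound C p N))"
    (is "\<exists>\<alpha>>0. \<exists>C>0. \<exists>P. (\<forall>\<epsilon>>0. \<forall>k. ?poly \<alpha> P \<epsilon> k) \<and> (\<forall>\<epsilon>>0. ?conclusion \<alpha> C P \<epsilon>)")
proof -
  have sp: "summable (\<lambda>j. norm (\<psi>\<rho> j) powr p)" "summable (\<lambda>j. norm (\<psi>\<pi> j) powr p)"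
    using dens_\<rho> dens_\<pi> by (simp_all add: density_assumption_def)
  have b0: "0 \<le> b j" for j by (simp add: b le_max_iff_disj)
  have b_p: "summable (\<lambda>j. b j powr p)"
  proof (rule summable_comparison_test'[OF summable_add[OF sp], of 0])
    show "norm (b n powr p) \<le> norm (\<psi>\<rho> n) powr p + norm (\<psi>\<pi> n) powr p" for n by (simp add: b max_def)
  qed
  have "summable b"
  proof (rule summable_comparison_test_ev[OF _ b_p])
    have "\<forall>\<^sub>F j in sequentially. b j powr p < 1" using summable_LIMSEQ_zero[OF b_p] by (rule order_tendstoD) simp
    then show "\<forall>\<^sub>F j in sequentially. norm (b j) \<le> b j powr p"
    proof eventually_elim
      case (elim j)
      have "b j \<le> 1" using elim b0[of j] p ge_one_powr_ge_zero[of "b j" p] by (cases "b j \<le> 1") auto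
      then have "b j powr 1 \<le> b j powr p" using b0[of j] p by (intro powr_mono') auto
      then show ?case using b0[of j] by simp
    qed
  qed
  then interpret A: kr_sparse b p M L \<psi>\<rho> O\<rho> F\<rho> \<psi>\<pi> O\<pi> F\<pi>
    using p bounds dens_\<rho> dens_\<pi> b_p by unfold_locales (auto simp: b le_max_iff_disj)
  note eqs = \<rho> \<pi> T f\<rho> f\<pi> \<Phi>
  obtain C1 where C1: "0 \<le> C1" and ex: "\<And>\<epsilon>. 0 < \<epsilon> \<Longrightarrow> \<exists>P'. A.approximant C1 \<epsilon> P'"
    using A.approximant_exists by blast
  define P where "P \<epsilon> = (SOME P'. A.approximant C1 \<epsilon> P')" for \<epsilon>
  have P: "A.approximant C1 \<epsilon> (P \<epsilon>)" if "0 < \<epsilon>" for \<epsilon>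
    unfolding P_def by (rule someI_ex[OF ex[OF that]])
  define c1 where "c1 = 3 * A.r\<^sub>1 * (1 + A.r\<^sub>1\<^sup>2) / (A.r\<^sub>0 / 2)\<^sup>2"
  \<comment> \<open>Exceeds each of the factors 1, 1/2, \<open>suminf c\<close> and
    \<open>suminf b\<close> with which \<open>rate\<close> is applied to the four estimates.\<close>
  define m where "m = 2 + suminf b + suminf c"
  define c2 where "c2 = A.S.Ncst * A.S.bpsum"
  \<comment> \<open>The summand 1 guarantees \<open>C > 0\<close> even when the other constants
    vanish.\<close>
  define C where "C = 2 * c1 * m * C1 * c2 powr (1 / p - 1) + 1"
  have c0: "0 \<le> c1" "0 \<le> c2" using A.r A.S.Ncst_pos A.S.bpsum_nonneg by (auto simp: c1_def c2_def)
  have c_nonneg: "0 \<le> c j" for j using c(1) by (simp add: less_imp_le)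
  have sums: "0 \<le> suminf b" "0 \<le> suminf c"
    using suminf_nonneg[OF A.b_summable A.b_nonneg] suminf_nonneg[OF c(2) c_nonneg] .
  have C: "0 < C" using c0 C1 sums by (auto simp: C_def m_def intro!: add_nonneg_pos)
  have main: "?conclusion A.S.\<alpha> C P \<epsilon>" if \<epsilon>: "0 < \<epsilon>" for \<epsilon>
  proof -
    obtain \<eta> where kr: "kr_rational b p M L \<psi>\<rho> O\<rho> F\<rho> \<psi>\<pi> O\<pi> F\<pi> (P \<epsilon>) (Lambda (weight A.S.\<alpha> b) \<epsilon>) (A.r\<^sub>0 / 2) \<eta> A.r\<^sub>1"
      and \<eta>: "suminf \<eta> \<le> C1 * \<epsilon> powr (1 - p)"
      using P[OF \<epsilon>] unfolding A.approximant_def by (elim exE conjE)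
    interpret K: kr_rational b p M L \<psi>\<rho> O\<rho> F\<rho> \<psi>\<pi> O\<pi> F\<pi> "P \<epsilon>" "Lambda (weight A.S.\<alpha> b) \<epsilon>" "A.r\<^sub>0 / 2" \<eta> A.r\<^sub>1 by (rule kr)
    define T' where "T' = (\<lambda>k. rational_component (P \<epsilon> k) k)"
    have T': "K.T' = (\<lambda>y k. T' k y)" by (simp add: K.T'_def T'_def fun_eq_iff)
    define N where "N = N_dim (weight A.S.\<alpha> b) \<epsilon>"
    have Nle: "N \<le> ennreal (c2 * \<epsilon> powr (- p))" using A.S.N_dim_le[OF \<epsilon>] by (simp add: N_def c2_def)
    have \<eta>0: "0 \<le> suminf \<eta>" using K.\<eta> K.\<eta>_nonneg by (intro suminf_nonneg)
    have rate: "x \<le> rate_bound C p N" if "x \<le> ennreal (2 * c1 * a * suminf \<eta>)" "0 \<le> a" "a \<le> m" for x a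
    proof -
      have "2 * c1 * a * suminf \<eta> \<le> 2 * c1 * m * suminf \<eta>" using that c0 \<eta>0 by (intro mult_right_mono mult_left_mono) auto
      also have "\<dots> \<le> 2 * c1 * m * (C1 * \<epsilon> powr (1 - p))" using \<eta> that c0 by (intro mult_left_mono) auto
      finally have "2 * c1 * a * suminf \<eta> \<le> 2 * c1 * m * C1 * \<epsilon> powr (1 - p)" by (simp add: mult.assoc)
      moreover have "0 \<le> 2 * c1 * m * C1" using c0 C1 that by auto
      moreover have "2 * c1 * m * C1 * c2 powr (1 / p - 1) \<le> C" by (simp add: C_def)
      ultimately have "ennreal (2 * c1 * a * suminf \<eta>) \<le> rate_bound C p N"
        by (rule rate_bound_ge[OF p \<epsilon> Nle c0(2)])
      with that(1) show ?thesis by (rule order_trans)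
    qed
    have kc: "K.c1 = c1" by (simp add: K.c1_def c1_def)
    have "(\<Sum>k. Linf_norm (Suc k) (\<lambda>y. T k y - T' k y)) \<le> rate_bound C p N"
      unfolding eqs T'_def using K.suminf_error[OF K.Linf_error] K.c1 sums by (intro rate[of _ 1]) (auto simp: kc K.\<eta>s_def m_def)
    moreover have "(\<Sum>k. Linf_norm (Suc k) (\<lambda>y. partial k (T k) y - partial k (T' k) y)) \<le> rate_bound C p N"
      unfolding eqs T'_def using K.suminf_error[OF K.Linf_deriv_error] K.c1 sums by (intro rate[of _ "1/2"]) (auto simp: kc K.\<eta>s_def m_def)
    moreover have "wasserstein (weighted_dist c) q (distr \<rho> mu (\<lambda>y k. T' k y)) \<pi> \<le> rate_bound C p N" if "1 \<le> q" for q
      unfolding eqs using K.wasserstein_cube[OF c_nonneg c(2) that] sums by (intro rate[of _ "suminf c"]) (auto simp: kc K.\<eta>s_def m_def T')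
    moreover have "wasserstein dist q (distr \<rho> borel (\<Phi> \<circ> (\<lambda>y k. T' k y))) (distr \<pi> borel \<Phi>) \<le> rate_bound C p N" if "1 \<le> q" for q
      unfolding eqs using K.wasserstein_image[OF that] sums by (intro rate[of _ "suminf b"]) (auto simp: kc K.\<eta>s_def m_def T')
    moreover have "N < \<infinity>" using Nle by (rule order_le_less_trans) simp
    moreover have "(\<lambda>t. T k (y(k := t))) differentiable_on {-1..1} \<and> (\<lambda>t. T' k (y(k := t))) differentiable_on {-1..1}"
      if "y \<in> cube" for k y
      using A.KR_deriv[OF that, of _ k] K.T'_deriv[of _ y k]
      unfolding eqs differentiable_on_def T' by (meson field_differentiable_imp_differentiable field_differentiable_def)
    ultimately show ?thesis
      using K.bij K.triangular K.increasing unfolding Let_def N_def[symmetric] T'_def[symmetric] T' by blast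
  qed
  show ?thesis
  proof (rule exI[of _ A.S.\<alpha>], intro conjI A.S.\<alpha>(1), rule exI[of _ C], intro conjI C, rule exI[of _ P], intro conjI allI impI main)
    show "P \<epsilon> k \<in> poly_space k (Lambda (weight A.S.\<alpha> b) \<epsilon> k)" if "0 < \<epsilon>" for \<epsilon> k
      using P[OF that] unfolding A.approximant_def by (elim exE conjE) (rule rational_map.poly[OF kr_rational.axioms(2)])
  qed
qed

end
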